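(* Let $d\in\{2,3\}$. If $d=2$, let $(\boldsymbol u_h^{m+1},\tilde p_h^{m+1},\kappa_{s,h}^{m+1},\tilde H_h^{m+1},\widetilde{\boldsymbol w}_h^{m+1},\varphi_{c,h}^{m+1})$ be the solution of the two-dimensional scheme (2D-a)--(2D-c) written out in the context; if $d=3$, let $(\boldsymbol u_h^{m+1},\tilde p_h^{m+1},\kappa_{s,h}^{m+1},\tilde H_h^{m+1},\widetilde{\boldsymbol w}_h^{m+1},\varphi_{c,h}^{m+1},\psi_{c,h}^{m+1})$ be the solution of the three-dimensional scheme (3D-a)--(3D-c) written out in the context. Let $\boldsymbol w_h^{m+1}$ be the bulk extension of $\widetilde{\boldsymbol w}_h^{m+1}$ and $\Omega_h^{m+1}=(\mathrm{id}+\tau\boldsymbol w_h^{m+1})(\Omega_h^m)$, as described in the context. Then: (i) (Volume conservation) $|\Omega_h^{m+1}|=|\Omega_h^m|$. (ii) (Total energy dissipation) Define the discrete total energy $$E_h^m:=\frac12\|\boldsymbol u_h^m\|_{L^2(\Omega_h^{m-1})}^2+\frac1{We}|\Gamma_{F,h}^m|-\frac{\cos\theta_Y}{We}|\Gamma_{s,h}^m|+g\int_{\Omega_h^m}z\,\mathrm dx .$$ Then for all $m\ge 0$, $$E_h^{m+1}-E_h^m\le-\frac12\|\boldsymbol u_h^{m+1}\circ\psi_h^m-\boldsymbol u_h^m\|_{\Omega_h^{m-1}}^2-\frac{2\tau}{Re}\|D(\boldsymbol u_h^{m+1})\|_{\Omega_h^m}^2-\tau\beta_s\|\mathbb P_s\boldsymbol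 u_h^{m+1}\|_{\Gamma_{s,h}^m}^2-\tau\beta_c\|\widetilde{\boldsymbol w}_h^{m+1}\cdot\boldsymbol\mu_{s,h}^m\|_{\Gamma_{c,h}^m}^2\le 0 .$$ Here $|\Omega_h^m|$ is the $d$-dimensional Lebesgue measure, $|\Gamma_{F,h}^m|$ and $|\Gamma_{s,h}^m|$ are $(d-1)$-dimensional Hausdorff measures, and $\|\cdot\|_{X}$ denotes the $L^2(X)$ norm.
   Context: **Parameters.** $Re,We>0$; $\beta_s,\beta_c\ge 0$; $g$ is the dimensionless gravitational acceleration; $\theta_Y$ is Young's equilibrium contact angle; $\tau>0$ is the time step, $t_m=m\tau$. $\boldsymbol e_z$ is the vertical unit vector and $z=\boldsymbol x\cdot\boldsymbol e_z$ the vertical coordinate. $D(\boldsymbol u)=\frac12(\nabla\boldsymbol u+(\nabla\boldsymbol u)^\top)$. **Domains.** $\Omega_h^m\subset\mathbb R^d$ is a polygonal ($d=2$) or polyhedral ($d=3$) domain with simplicial triangulation $\mathcal K_h^m$. Its boundary is $\Gamma_h^m=\Gamma_{F,h}^m\cup\Gamma_{s,h}^m$ (free surface and wetted solid boundary), with contact set $\Gamma_{c,h}^m=\Gamma_{F,h}^m\cap\Gamma_{s,h}^m$ (two points if $d=2$, a closed polygonal curve if $d=3$). The solid substrate is flat: $\Gamma_{s,h}^m$ lies in a fixed hyperplane with constant unit normal $\boldsymbol n_s$ (outward to the fluid); $\mathbb P_s=\mathbb I-\boldsymbol n_s\otimes\boldsymbol n_s$. $\boldsymbol n_{F,h}^m$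 is the elementwise constant unit outward normal on $\Gamma_{F,h}^m$. The mesh is updated by $\psi_h^{m+1}=\mathrm{id}+\tau\boldsymbol w_h^{m+1}$, $\Omega_h^{m+1}=\psi_h^{m+1}(\Omega_h^m)$, with $\mathcal K_h^{m+1}$, $\Gamma_{F,h}^{m+1}$, $\Gamma_{s,h}^{m+1}$, $\Gamma_{c,h}^{m+1}$ the images of the corresponding objects. The maps $\mathrm{id}+\vartheta\tau\boldsymbol w_h^{m+1}$, $\vartheta\in[0,1]$, are nondegenerate (injective, orientation preserving) and all triangulations are valid, shape-regular and quasi-uniform. Conventions: $\Omega_h^{-1}=\Omega_h^0$, $\psi_h^0=\mathrm{id}$, $\boldsymbol w_h^0=\mathbf 0$, and $\boldsymbol u_h^0$ is the interpolant of the initial velocity on $\Omega_h^0$. For $m\ge1$, $\boldsymbol u_h^m$ and $\boldsymbol w_h^m$ are defined on $\Omega_h^{m-1}$. **Spaces.** $\mathcal U_h^m$: continuous $\mathbb R^d$-valued piecewise quadratic functions on $\mathcal K_h^m$. $\mathcal Q_h^m$: continuous scalar piecewise linear functions. $\mathcal W_h^m$: continuous $\mathbb R^d$-valued piecewise linear functions. For a discrete boundary part $\Gamma$, $S_h(\Gamma)$ and $S_{h,2}(\Gamma)$ are the continuous scalar piecewise linear and piecewise quadratic functions on $\Gamma$; $S_h(\Gamma)^d$ is the vector version. (On points, $S_h$ is the space of functions on the set of points.) **Pairings.** $(\cdot,\cdot)_\Omega$ and $\langle\cdot,\cdot\rangle_\Gamma$ are $L^2$ inner products over $\Omega$ and $\Gamma$.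 $\langle f,g\rangle_\Gamma^h$ is the mass-lumped product: on each $k$-simplex $\sigma$ of $\Gamma$, the contribution is $\frac{|\sigma|}{k+1}\sum_{P\text{ vertex of }\sigma}(f\cdot g)(P)$ with one-sided limits taken from $\sigma$. For a set of points, $\int_\Gamma\cdot\,\mathrm ds$ and the lumped product are sums over the points. On $\Gamma_{s,h}^m$, $$\langle\lambda\boldsymbol n_s,\boldsymbol u\rangle_{\Gamma_{s,h}^m}^{s,h}=\sum_{\sigma}\frac{|\sigma|}{N_2}\sum_{P\in\mathcal N_2(\sigma)}\lambda(P)\,\boldsymbol n_s\cdot\boldsymbol u(P),$$ where $\sigma$ runs over the boundary simplices of $\Gamma_{s,h}^m$, $\mathcal N_2(\sigma)$ is the set of quadratic Lagrange nodes (vertices and edge midpoints) of $\sigma$, and $N_2=\dim\mathbb P_2(\sigma)$. The trilinear form is $b(\boldsymbol z;\boldsymbol u,\boldsymbol v)_\Omega=\frac12(\boldsymbol z\cdot\nabla\boldsymbol u,\boldsymbol v)_\Omega-\frac12(\boldsymbol z\cdot\nabla\boldsymbol v,\boldsymbol u)_\Omega$. $\nabla_\Gamma$ is the (elementwise) surface gradient. **Contact data.** $\theta_{c,h}^m=\arccos(\Pi_{[-1,1]}(c_{c,h}^m))$, where $\Pi_{[-1,1]}(r)=\min\{1,\max\{-1,r\}\}$ and $c_{c,h}^m=\mathcal I_{h,0}(\cos\theta_Y-We\,\beta_c\,\widetilde{\boldsymbol w}_h^m\cdot\boldsymbol\mu_s)$. Here $\mathcal I_{h,0}$ is elementwise midpoint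 interpolation into piecewise constants on $\Gamma_{c,h}^m$, and $\widetilde{\boldsymbol w}_h^m$ is the previous free-boundary mesh velocity, transported to $\Gamma_{c,h}^m$ ($\widetilde{\boldsymbol w}_h^0=\mathbf 0$). Thus $\theta_{c,h}^m$ is known data, constant on each element of $\Gamma_{c,h}^m$. For $d=2$: the substrate is horizontal, and $\boldsymbol\mu_s=\boldsymbol\mu_{s,h}^m$ equals $(-1,0)^\top$ at the left contact point and $(1,0)^\top$ at the right one. For $d=3$: with $s$ the arc length on $\Gamma_{c,h}^m$, oriented so that the result is outward, $\boldsymbol\mu_{s,h}^m=\partial_s(\mathrm{id}|_{\Gamma_{c,h}^m})\times\boldsymbol n_s$ is the unit outward conormal to $\Gamma_{s,h}^m$ (and $\boldsymbol\mu_s=\boldsymbol\mu_{s,h}^m$ in $c_{c,h}^m$). Moreover $$\boldsymbol\mu_{s,h}^{m+1/2}=\tfrac12\big[\partial_s(\mathrm{id}|_{\Gamma_{c,h}^m})+\partial_s(\mathrm{id}|_{\Gamma_{c,h}^m}+\tau\widetilde{\boldsymbol w}_h^{m+1}|_{\Gamma_{c,h}^m})\big]\times\boldsymbol n_s,$$ and $\boldsymbol\xi_{c,h}^m$ is the tangential direction on $\Gamma_{c,h}^m$. **Intermediate geometry.** For $\vartheta\in[0,1]$, on $\Gamma_{F,h}^m$: $\boldsymbol X(\vartheta)=\mathrm{id}+\tau\vartheta\widetilde{\boldsymbol w}_h^{m+1}$ and $z_h^m(\vartheta)=\boldsymbol X(\vartheta)\cdot\boldsymbol e_z$. For $d=2$,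 $\hat{\boldsymbol n}(\vartheta)=(\partial_s\boldsymbol X(\vartheta))^\perp=\boldsymbol n_{F,h}^m+\vartheta\tau(\partial_s\widetilde{\boldsymbol w}_h^{m+1})^\perp$, where $s$ is arc length on $\Gamma_{F,h}^m$ and $\perp$ is the $90^\circ$ rotation taking the unit tangent to $\boldsymbol n_{F,h}^m$. For $d=3$, $\hat{\boldsymbol n}(\vartheta)=\partial_{s_1}\boldsymbol X(\vartheta)\times\partial_{s_2}\boldsymbol X(\vartheta)$, where on each triangle $s_1,s_2$ are local surface parameters with $\hat{\boldsymbol n}(0)=\boldsymbol n_{F,h}^m$. Define $$\mathcal G(\widetilde{\boldsymbol w}_h^{m+1})=\int_0^1 z_h^m(\vartheta)\hat{\boldsymbol n}(\vartheta)\,\mathrm d\vartheta=\tfrac16z_h^m(0)\hat{\boldsymbol n}(0)+\tfrac23z_h^m(\tfrac12)\hat{\boldsymbol n}(\tfrac12)+\tfrac16z_h^m(1)\hat{\boldsymbol n}(1).$$ For $d=2$ write $\hat{\boldsymbol n}_{F,h}^{m+1/2}=\hat{\boldsymbol n}(\tfrac12)$. For $d=3$ write $\tilde{\boldsymbol n}_{F,h}^{m+1/2}=\int_0^1\hat{\boldsymbol n}(\vartheta)\,\mathrm d\vartheta=\frac16\hat{\boldsymbol n}(0)+\frac23\hat{\boldsymbol n}(\frac12)+\frac16\hat{\boldsymbol n}(1)$. **2D scheme.** Given $\boldsymbol u_h^m,\boldsymbol w_h^m,\Omega_h^m$, find $(\boldsymbol u_h^{m+1},\tilde p_h^{m+1},\kappa_{s,h}^{m+1},\tilde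 H_h^{m+1},\widetilde{\boldsymbol w}_h^{m+1},\varphi_{c,h}^{m+1})\in\mathcal U_h^m\times\mathcal Q_h^m\times S_{h,2}(\Gamma_{s,h}^m)\times S_h(\Gamma_{F,h}^m)\times S_h(\Gamma_{F,h}^m)^d\times S_h(\Gamma_{c,h}^m)$ such that for all $(\boldsymbol v,q,\lambda_s,\phi_F,\boldsymbol\eta,\phi_c)\in\mathcal U_h^m\times\mathcal Q_h^m\times S_{h,2}(\Gamma_{s,h}^m)\times S_h(\Gamma_{F,h}^m)\times S_h(\Gamma_{F,h}^m)^d\times S_h(\Gamma_{c,h}^m)$: (2D-a) $$\begin{aligned}&\tfrac1{2\tau}(\boldsymbol u_h^{m+1},\boldsymbol v)_{\Omega_h^m}+\tfrac1{2\tau}(\boldsymbol u_h^{m+1}\circ\psi_h^m,\boldsymbol v\circ\psi_h^m)_{\Omega_h^{m-1}}+b(\boldsymbol u_h^m-\boldsymbol w_h^m;\boldsymbol u_h^{m+1}\circ\psi_h^m,\boldsymbol v\circ\psi_h^m)_{\Omega_h^{m-1}}\\&+\big(\tfrac2{Re}D(\boldsymbol u_h^{m+1}),D(\boldsymbol v)\big)_{\Omega_h^m}-(\tilde p_h^{m+1},\nabla\cdot\boldsymbol v)_{\Omega_h^m}+(q,\nabla\cdot\boldsymbol u_h^{m+1})_{\Omega_h^m}+\langle\tilde H_h^{m+1}\boldsymbol n_{F,h}^m,\boldsymbol v\rangle_{\Gamma_{F,h}^m}\\&-\langle\kappa_{s,h}^{m+1}\boldsymbol n_s,\boldsymbol v\rangle_{\Gamma_{s,h}^m}^{s,h}+\langle\lambda_s\boldsymbol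 n_s,\boldsymbol u_h^{m+1}\rangle_{\Gamma_{s,h}^m}^{s,h}+\beta_s\langle\mathbb P_s\boldsymbol u_h^{m+1},\mathbb P_s\boldsymbol v\rangle_{\Gamma_{s,h}^m}+\langle\widetilde{\boldsymbol w}_h^{m+1}\cdot\boldsymbol n_s,\phi_c\rangle_{\Gamma_{c,h}^m}^h=\tfrac1\tau(\boldsymbol u_h^m,\boldsymbol v\circ\psi_h^m)_{\Omega_h^{m-1}},\end{aligned}$$ (2D-b) $$\begin{aligned}-\langle\tilde H_h^{m+1}\hat{\boldsymbol n}_{F,h}^{m+1/2},\boldsymbol\eta\rangle_{\Gamma_{F,h}^m}^h=&-\tfrac1{We}\langle\nabla_\Gamma(\mathrm{id}+\tau\widetilde{\boldsymbol w}_h^{m+1}),\nabla_\Gamma\boldsymbol\eta\rangle_{\Gamma_{F,h}^m}+\tfrac1{We}\langle\varphi_{c,h}^{m+1}\boldsymbol n_s,\boldsymbol\eta\rangle_{\Gamma_{c,h}^m}^h\\&+\tfrac1{We}\int_{\Gamma_{c,h}^m}\big[\cos\theta_Y\boldsymbol\mu_s-We\,\beta_c(\widetilde{\boldsymbol w}_h^{m+1}\cdot\boldsymbol\mu_s)\boldsymbol\mu_s+\sin\theta_{c,h}^m\boldsymbol n_s\big]\cdot\boldsymbol\eta\,\mathrm ds-g\langle\mathcal G(\widetilde{\boldsymbol w}_h^{m+1}),\boldsymbol\eta\rangle_{\Gamma_{F,h}^m},\end{aligned}$$ (2D-c) $\langle\widetilde{\boldsymbol w}_h^{m+1}\cdot\hat{\boldsymbol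 n}_{F,h}^{m+1/2},\phi_F\rangle_{\Gamma_{F,h}^m}^h=\langle\boldsymbol u_h^{m+1}\cdot\boldsymbol n_{F,h}^m,\phi_F\rangle_{\Gamma_{F,h}^m}$. **3D scheme.** Given $\boldsymbol u_h^m,\boldsymbol w_h^m,\psi_h^m,\Omega_h^m$ (with $d=3$), find $(\boldsymbol u_h^{m+1},\tilde p_h^{m+1},\kappa_{s,h}^{m+1},\tilde H_h^{m+1},\widetilde{\boldsymbol w}_h^{m+1},\varphi_{c,h}^{m+1},\psi_{c,h}^{m+1})\in\mathcal U_h^m\times\mathcal Q_h^m\times S_{h,2}(\Gamma_{s,h}^m)\times S_h(\Gamma_{F,h}^m)\times S_h(\Gamma_{F,h}^m)^d\times S_h(\Gamma_{c,h}^m)\times S_h(\Gamma_{c,h}^m)$ such that for all $(\boldsymbol v,q,\lambda_s,\phi_F,\boldsymbol\eta,\phi_c,\chi_c)\in\mathcal U_h^m\times\mathcal Q_h^m\times S_{h,2}(\Gamma_{s,h}^m)\times S_h(\Gamma_{F,h}^m)\times S_h(\Gamma_{F,h}^m)^d\times S_h(\Gamma_{c,h}^m)\times S_h(\Gamma_{c,h}^m)$: (3D-a) $$\begin{aligned}&\tfrac1{2\tau}(\boldsymbol u_h^{m+1},\boldsymbol v)_{\Omega_h^m}+\tfrac1{2\tau}(\boldsymbol u_h^{m+1}\circ\psi_h^m,\boldsymbol v\circ\psi_h^m)_{\Omega_h^{m-1}}+b(\boldsymbol u_h^m-\boldsymbol w_h^m;\boldsymbol u_h^{m+1}\circ\psi_h^m,\boldsymbol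 v\circ\psi_h^m)_{\Omega_h^{m-1}}\\&+\big(\tfrac2{Re}D(\boldsymbol u_h^{m+1}),D(\boldsymbol v)\big)_{\Omega_h^m}-(\tilde p_h^{m+1},\nabla\cdot\boldsymbol v)_{\Omega_h^m}+(q,\nabla\cdot\boldsymbol u_h^{m+1})_{\Omega_h^m}+\langle\tilde H_h^{m+1}\boldsymbol n_{F,h}^m,\boldsymbol v\rangle_{\Gamma_{F,h}^m}\\&-\langle\kappa_{s,h}^{m+1}\boldsymbol n_s,\boldsymbol v\rangle_{\Gamma_{s,h}^m}^{s,h}+\langle\lambda_s\boldsymbol n_s,\boldsymbol u_h^{m+1}\rangle_{\Gamma_{s,h}^m}^{s,h}+\beta_s\langle\mathbb P_s\boldsymbol u_h^{m+1},\mathbb P_s\boldsymbol v\rangle_{\Gamma_{s,h}^m}\\&+\tfrac1{We}\langle\widetilde{\boldsymbol w}_h^{m+1},\phi_c\boldsymbol n_s\rangle_{\Gamma_{c,h}^m}^h+\tfrac1{We}\langle\widetilde{\boldsymbol w}_h^{m+1},\chi_c\boldsymbol\xi_{c,h}^m\rangle_{\Gamma_{c,h}^m}^h=\tfrac1\tau(\boldsymbol u_h^m,\boldsymbol v\circ\psi_h^m)_{\Omega_h^{m-1}},\end{aligned}$$ (3D-b) $$\begin{aligned}-\langle\tilde H_h^{m+1}\tilde{\boldsymbol n}_{F,h}^{m+1/2},\boldsymbol\eta\rangle_{\Gamma_{F,h}^m}^h=&-\tfrac1{We}\langle\nabla_\Gamma(\mathrm{id}+\tau\widetilde{\boldsymbol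 w}_h^{m+1}),\nabla_\Gamma\boldsymbol\eta\rangle_{\Gamma_{F,h}^m}+\tfrac1{We}\langle\varphi_{c,h}^{m+1}\boldsymbol n_s,\boldsymbol\eta\rangle_{\Gamma_{c,h}^m}^h\\&+\tfrac1{We}\int_{\Gamma_{c,h}^m}\big[\cos\theta_Y\boldsymbol\mu_{s,h}^{m+1/2}-We\,\beta_c(\widetilde{\boldsymbol w}_h^{m+1}\cdot\boldsymbol\mu_{s,h}^m)\boldsymbol\mu_{s,h}^m+\sin\theta_{c,h}^m\boldsymbol n_s\big]\cdot\boldsymbol\eta\,\mathrm ds\\&+\tfrac1{We}\langle\psi_{c,h}^{m+1}\boldsymbol\xi_{c,h}^m,\boldsymbol\eta\rangle_{\Gamma_{c,h}^m}^h-g\langle\mathcal G(\widetilde{\boldsymbol w}_h^{m+1}),\boldsymbol\eta\rangle_{\Gamma_{F,h}^m},\end{aligned}$$ (3D-c) $\langle\widetilde{\boldsymbol w}_h^{m+1}\cdot\tilde{\boldsymbol n}_{F,h}^{m+1/2},\phi_F\rangle_{\Gamma_{F,h}^m}^h=\langle\boldsymbol u_h^{m+1}\cdot\boldsymbol n_{F,h}^m,\phi_F\rangle_{\Gamma_{F,h}^m}$. **Bulk mesh velocity.** Let $\mathring{\mathcal W}_h^m$ be the subspace of $\mathcal W_h^m$ of functions vanishing at the vertices of $\Gamma_{F,h}^m$. Given $\widetilde{\boldsymbol w}_h^{m+1}$, the bulk velocity $\boldsymbol w_h^{m+1}\in\mathcal W_h^m$ with $\boldsymbol w_h^{m+1}=\widetilde{\boldsymbol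 w}_h^{m+1}$ on $\Gamma_{F,h}^m$, together with $\varphi_{s,h}^{m+1}\in S_h(\Gamma_{s,h}^m)$, solves $$(D(\boldsymbol w_h^{m+1}),D(\boldsymbol\zeta))_{\Omega_h^m}+\langle\nabla_\Gamma\boldsymbol w_h^{m+1},\nabla_\Gamma\boldsymbol\zeta\rangle_{\Gamma_{s,h}^m}=\langle\varphi_{s,h}^{m+1}\boldsymbol n_s,\boldsymbol\zeta\rangle_{\Gamma_{s,h}^m}^h,\qquad\langle\boldsymbol w_h^{m+1}\cdot\boldsymbol n_s,\phi_s\rangle_{\Gamma_{s,h}^m}^h=0$$ for all $\boldsymbol\zeta\in\mathring{\mathcal W}_h^m$, $\phi_s\in S_h(\Gamma_{s,h}^m)$. *)

theory Defs
  imports "HOL-Analysis.Analysis"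
begin

section \<open>Hausdorff measure\<close>

text \<open>
  The constant of the Hausdorff measure is fixed by giving the unit cube of a coordinate
  \<open>k\<close>-plane measure one, so that it restricts to Lebesgue measure on \<open>k\<close>-planes.
  Boundedness is required because \<^const>\<open>diameter\<close> is unspecified on unbounded sets.
\<close>

definition hausdorff_pre :: "nat \<Rightarrow> real \<Rightarrow> 'a::euclidean_space set \<Rightarrow> ennreal" where
  "hausdorff_pre k \<delta> A =
     (INF C \<in> {C :: nat \<Rightarrow> 'a set. A \<subseteq> (\<Union>i. C i) \<and> (\<forall>i. bounded (C i) \<and> diameter (C i) \<le> \<delta>)}.
        \<Sum>i. if C i = {} then 0 else ennreal (diameter (C i) ^ k))"

definition hausdorff_outer :: "nat \<Rightarrow> 'a::euclidean_space set \<Rightarrow> ennreal" where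
  "hausdorff_outer k A = (SUP \<delta> \<in> {0<..}. hausdorff_pre k \<delta> A)"

definition coordinate_cube :: "nat \<Rightarrow> 'a::euclidean_space set" where
  "coordinate_cube k = cbox 0 (\<Sum>(SOME B. B \<subseteq> Basis \<and> card B = k))"

definition hausdorff :: "nat \<Rightarrow> 'a::euclidean_space measure" where
  "hausdorff k = measure_of UNIV (sets borel)
     (\<lambda>A. hausdorff_outer k A / hausdorff_outer k (coordinate_cube k :: 'a set))"


section \<open>Simplicial meshes\<close>

text \<open>
  A mesh consists of its (closed) cells and of the boundary facets forming the free surface and
  the wetted solid boundary.  The domain is represented by its closure.
\<close>

record 'a mesh =
  cells :: "'a set set"
  free_faces :: "'a set set"
  solid_faces :: "'a set set"

definition domain :: "('a, 'z) mesh_scheme \<Rightarrow> 'a set" where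
  "domain M = \<Union>(cells M)"

definition free_surface :: "('a, 'z) mesh_scheme \<Rightarrow> 'a set" where
  "free_surface M = \<Union>(free_faces M)"

definition solid_surface :: "('a, 'z) mesh_scheme \<Rightarrow> 'a set" where
  "solid_surface M = \<Union>(solid_faces M)"

definition contact_set :: "('a, 'z) mesh_scheme \<Rightarrow> 'a set" where
  "contact_set M = free_surface M \<inter> solid_surface M"

definition contact_edges :: "'a::euclidean_space mesh \<Rightarrow> 'a set set" where
  "contact_edges M =
     {e. \<exists>\<sigma>\<in>free_faces M. \<exists>\<rho>\<in>solid_faces M. e facet_of \<sigma> \<and> e facet_of \<rho>}"

definition boundary_faces :: "'a::euclidean_space set set \<Rightarrow> 'a set set" where
  "boundary_faces K = {\<sigma>. (\<exists>T\<in>K. \<sigma> facet_of T) \<and> \<sigma> \<subseteq> frontier (\<Union>K)}"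

definition map_mesh :: "('a \<Rightarrow> 'a) \<Rightarrow> 'a mesh \<Rightarrow> 'a mesh" where
  "map_mesh \<psi> M = \<lparr>cells = (`) \<psi> ` cells M, free_faces = (`) \<psi> ` free_faces M,
                   solid_faces = (`) \<psi> ` solid_faces M\<rparr>"

definition outward_normal :: "'a::euclidean_space set set \<Rightarrow> 'a set \<Rightarrow> 'a" where
  "outward_normal K \<sigma> = (THE n. norm n = 1 \<and> (\<forall>x\<in>\<sigma>. \<forall>y\<in>\<sigma>. n \<bullet> (y - x) = 0) \<and>
     (\<forall>T\<in>K. \<sigma> facet_of T \<longrightarrow> (\<forall>x\<in>\<sigma>. \<forall>y\<in>T. n \<bullet> (y - x) \<le> 0)))"

definition verts :: "'a::euclidean_space set \<Rightarrow> 'a set" where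
  "verts \<sigma> = {P. P extreme_point_of \<sigma>}"

text \<open>Quadratic Lagrange nodes; the choice \<open>P = Q\<close> yields the vertices.\<close>

definition nodes2 :: "'a::euclidean_space set \<Rightarrow> 'a set" where
  "nodes2 \<sigma> = {midpoint P Q | P Q. P \<in> verts \<sigma> \<and> Q \<in> verts \<sigma>}"

definition mesh_regular :: "real \<Rightarrow> 'a::euclidean_space mesh \<Rightarrow> bool" where
  "mesh_regular C M \<longleftrightarrow>
     (\<forall>T\<in>cells M. \<exists>x. cball x (diameter T / C) \<subseteq> T) \<and>
     (\<forall>T\<in>cells M. \<forall>T'\<in>cells M. diameter T \<le> C * diameter T')"


section \<open>Finite element spaces\<close>

definition P1_on :: "'a::euclidean_space set \<Rightarrow> ('a \<Rightarrow> real) \<Rightarrow> bool" where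
  "P1_on S f \<longleftrightarrow> (\<exists>c a. \<forall>x\<in>S. f x = c + a \<bullet> x)"

definition P2_on :: "'a::euclidean_space set \<Rightarrow> ('a \<Rightarrow> real) \<Rightarrow> bool" where
  "P2_on S f \<longleftrightarrow> (\<exists>c a A. linear A \<and> (\<forall>x\<in>S. f x = c + a \<bullet> x + x \<bullet> A x))"

text \<open>
  The collection \<open>F\<close> below is the set of cells for functions on the domain, and a set of
  boundary facets or contact edges for functions on a part of the boundary.
\<close>

definition S1 :: "'a::euclidean_space set set \<Rightarrow> ('a \<Rightarrow> real) set" where
  "S1 F = {f. continuous_on (\<Union>F) f \<and> (\<forall>\<sigma>\<in>F. P1_on \<sigma> f)}"

definition S2 :: "'a::euclidean_space set set \<Rightarrow> ('a \<Rightarrow> real) set" where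
  "S2 F = {f. continuous_on (\<Union>F) f \<and> (\<forall>\<sigma>\<in>F. P2_on \<sigma> f)}"

definition S1v :: "'a::euclidean_space set set \<Rightarrow> ('a \<Rightarrow> 'a) set" where
  "S1v F = {f. \<forall>b\<in>Basis. (\<lambda>x. f x \<bullet> b) \<in> S1 F}"

definition S2v :: "'a::euclidean_space set set \<Rightarrow> ('a \<Rightarrow> 'a) set" where
  "S2v F = {f. \<forall>b\<in>Basis. (\<lambda>x. f x \<bullet> b) \<in> S2 F}"

definition velocity_space :: "'a::euclidean_space mesh \<Rightarrow> ('a \<Rightarrow> 'a) set" where
  "velocity_space M = S2v (cells M)"

definition pressure_space :: "'a::euclidean_space mesh \<Rightarrow> ('a \<Rightarrow> real) set" where
  "pressure_space M = S1 (cells M)"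

definition mesh_velocity_space :: "'a::euclidean_space mesh \<Rightarrow> ('a \<Rightarrow> 'a) set" where
  "mesh_velocity_space M = S1v (cells M)"

definition mesh_velocity_space0 :: "'a::euclidean_space mesh \<Rightarrow> ('a \<Rightarrow> 'a) set" where
  "mesh_velocity_space0 M =
     {\<zeta> \<in> mesh_velocity_space M. \<forall>\<sigma>\<in>free_faces M. \<forall>P\<in>verts \<sigma>. \<zeta> P = 0}"


section \<open>Elementwise derivatives\<close>

text \<open>
  Discrete functions are only piecewise smooth, so each derivative is taken within one closed
  element.  On a full-dimensional cell it is unique at every point.  On a boundary element only
  its action on tangential directions is determined; \<^const>\<open>frechet_derivative\<close> then chooses
  some extension, and it is only used on tangential arguments.
\<close>

definition jac :: "(real^'n) set \<Rightarrow> (real^'n \<Rightarrow> real^'n) \<Rightarrow> real^'n \<Rightarrow> real^'n^'n" where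
  "jac T f x = matrix (frechet_derivative f (at x within T))"

definition strain :: "(real^'n) set \<Rightarrow> (real^'n \<Rightarrow> real^'n) \<Rightarrow> real^'n \<Rightarrow> real^'n^'n" where
  "strain T f x = (1/2) *\<^sub>R (jac T f x + transpose (jac T f x))"

definition divg :: "(real^'n) set \<Rightarrow> (real^'n \<Rightarrow> real^'n) \<Rightarrow> real^'n \<Rightarrow> real" where
  "divg T f x = trace (jac T f x)"

definition tproj :: "'a::real_inner \<Rightarrow> 'a \<Rightarrow> 'a" where
  "tproj n x = x - (x \<bullet> n) *\<^sub>R n"

definition sgrad :: "(real^'n) set \<Rightarrow> real^'n \<Rightarrow> (real^'n \<Rightarrow> real^'n) \<Rightarrow> real^'n \<Rightarrow> real^'n^'n" where
  "sgrad \<sigma> n f x = matrix (\<lambda>h. frechet_derivative f (at x within \<sigma>) (tproj n h))"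


section \<open>Pairings\<close>

definition l2 :: "'a::euclidean_space set \<Rightarrow> ('a \<Rightarrow> 'b::real_inner) \<Rightarrow> ('a \<Rightarrow> 'b) \<Rightarrow> real" where
  "l2 \<Omega> f g = (LINT x:\<Omega>|lborel. f x \<bullet> g x)"

definition cell_sum :: "'a::euclidean_space mesh \<Rightarrow> ('a set \<Rightarrow> 'a \<Rightarrow> real) \<Rightarrow> real" where
  "cell_sum M f = (\<Sum>T\<in>cells M. LINT x:T|lborel. f T x)"

definition strain_form :: "(real^'n) mesh \<Rightarrow> (real^'n \<Rightarrow> real^'n) \<Rightarrow> (real^'n \<Rightarrow> real^'n) \<Rightarrow> real" where
  "strain_form M u v = cell_sum M (\<lambda>T x. strain T u x \<bullet> strain T v x)"

definition div_form :: "(real^'n) mesh \<Rightarrow> (real^'n \<Rightarrow> real) \<Rightarrow> (real^'n \<Rightarrow> real^'n) \<Rightarrow> real" where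
  "div_form M q v = cell_sum M (\<lambda>T x. q x * divg T v x)"

definition conv_form :: "(real^'n) mesh \<Rightarrow> (real^'n \<Rightarrow> real^'n) \<Rightarrow> (real^'n \<Rightarrow> real^'n) \<Rightarrow>
    (real^'n \<Rightarrow> real^'n) \<Rightarrow> real" where
  "conv_form M z u v =
     1/2 * cell_sum M (\<lambda>T x. (jac T u x *v z x) \<bullet> v x) -
     1/2 * cell_sum M (\<lambda>T x. (jac T v x *v z x) \<bullet> u x)"

text \<open>
  In the next three definitions \<open>F\<close> is a set of \<open>k\<close>-simplices.  The integrand of the first two
  may depend on the simplex: on a shared vertex or edge it is the one-sided limit.
\<close>

definition surf_int :: "nat \<Rightarrow> 'a::euclidean_space set set \<Rightarrow> ('a set \<Rightarrow> 'a \<Rightarrow> real) \<Rightarrow> real" where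
  "surf_int k F f = (\<Sum>\<sigma>\<in>F. LINT x:\<sigma>|hausdorff k. f \<sigma> x)"

definition lump :: "nat \<Rightarrow> 'a::euclidean_space set set \<Rightarrow> ('a set \<Rightarrow> 'a \<Rightarrow> real) \<Rightarrow> real" where
  "lump k F f = (\<Sum>\<sigma>\<in>F. measure (hausdorff k) \<sigma> / real (k + 1) * (\<Sum>P\<in>verts \<sigma>. f \<sigma> P))"

text \<open>The binomial coefficient is the dimension of the quadratic polynomials on a \<open>k\<close>-simplex.\<close>

definition lump2 :: "nat \<Rightarrow> 'a::euclidean_space set set \<Rightarrow> ('a \<Rightarrow> real) \<Rightarrow> real" where
  "lump2 k F f =
     (\<Sum>\<sigma>\<in>F. measure (hausdorff k) \<sigma> / real ((k + 2) choose 2) * (\<Sum>P\<in>nodes2 \<sigma>. f P))"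


section \<open>Parameters and discrete evolutions\<close>

record 'a params =
  Rey :: real
  Web :: real
  beta_s :: real
  beta_c :: real
  grav :: real
  theta_Y :: real
  tau :: real
  nrm_s :: 'a
  e_vert :: 'a

text \<open>
  All fields are indexed by the time level.  The fields \<open>vel m\<close> and \<open>bulk_vel m\<close> live on the
  mesh of level \<open>m - 1\<close>, the remaining ones of level \<open>Suc m\<close> on (parts of) the mesh of level
  \<open>m\<close>.  Truncated subtraction on \<^typ>\<open>nat\<close> is used on purpose: for \<open>m = 0\<close> the mesh of level
  \<open>m - 1\<close> is the initial mesh, which is the convention for level \<open>-1\<close>.
\<close>

record 'a evolution =
  msh :: "nat \<Rightarrow> 'a mesh"
  vel :: "nat \<Rightarrow> 'a \<Rightarrow> 'a"
  pres :: "nat \<Rightarrow> 'a \<Rightarrow> real"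
  kappa_s :: "nat \<Rightarrow> 'a \<Rightarrow> real"
  curv :: "nat \<Rightarrow> 'a \<Rightarrow> real"
  free_vel :: "nat \<Rightarrow> 'a \<Rightarrow> 'a"
  phi_c :: "nat \<Rightarrow> 'a \<Rightarrow> real"
  bulk_vel :: "nat \<Rightarrow> 'a \<Rightarrow> 'a"

text \<open>In three dimensions there is a further multiplier on the contact line.\<close>

record 'a evolution3 = "'a evolution" +
  psi_c :: "nat \<Rightarrow> 'a \<Rightarrow> real"

definition params_ok :: "'a::euclidean_space params \<Rightarrow> bool" where
  "params_ok p \<longleftrightarrow> Rey p > 0 \<and> Web p > 0 \<and> beta_s p \<ge> 0 \<and> beta_c p \<ge> 0 \<and> tau p > 0 \<and>
     norm (nrm_s p) = 1 \<and> norm (e_vert p) = 1"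

text \<open>Since \<open>bulk_vel E 0 = 0\<close>, the map of level \<open>0\<close> is the identity.\<close>

definition psi :: "'a::euclidean_space params \<Rightarrow> ('a, 'z) evolution_scheme \<Rightarrow> nat \<Rightarrow> 'a \<Rightarrow> 'a" where
  "psi p E m x = x + tau p *\<^sub>R bulk_vel E m x"

definition valid_mesh :: "(real^'n) params \<Rightarrow> (real^'n) mesh \<Rightarrow> bool" where
  "valid_mesh p M \<longleftrightarrow>
     triangulation (cells M) \<and> cells M \<noteq> {} \<and>
     (\<forall>T\<in>cells M. int CARD('n) simplex T) \<and>
     connected (interior (domain M)) \<and>
     free_faces M \<union> solid_faces M = boundary_faces (cells M) \<and>
     free_faces M \<inter> solid_faces M = {} \<and>
     (\<forall>\<rho>\<in>solid_faces M. outward_normal (cells M) \<rho> = nrm_s p)"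

definition valid_mesh2 :: "(real^2) params \<Rightarrow> (real^2) mesh \<Rightarrow> bool" where
  "valid_mesh2 p M \<longleftrightarrow> valid_mesh p M \<and> card (contact_set M) = 2"

text \<open>
  The contact line is a closed polygonal curve made of edges of the mesh.  Each of its edges
  lies on the relative boundary of the wetted solid boundary, so that the outward conormal of
  the latter makes sense there.
\<close>

definition valid_mesh3 :: "(real^3) params \<Rightarrow> (real^3) mesh \<Rightarrow> bool" where
  "valid_mesh3 p M \<longleftrightarrow> valid_mesh p M \<and>
     contact_set M = \<Union>(contact_edges M) \<and>
     (\<exists>\<gamma>. simple_path \<gamma> \<and> pathfinish \<gamma> = pathstart \<gamma> \<and> path_image \<gamma> = contact_set M) \<and>
     (\<forall>e\<in>contact_edges M. \<exists>!\<rho>. \<rho> \<in> solid_faces M \<and> e facet_of \<rho>)"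

definition nondegenerate :: "(real^'n) params \<Rightarrow> (real^'n) mesh \<Rightarrow> (real^'n \<Rightarrow> real^'n) \<Rightarrow> bool" where
  "nondegenerate p M w \<longleftrightarrow> (\<forall>\<theta>\<in>{0..1}. inj_on (\<lambda>x. x + (\<theta> * tau p) *\<^sub>R w x) (domain M) \<and>
     (\<forall>T\<in>cells M. \<forall>x\<in>T. det (jac T (\<lambda>y. y + (\<theta> * tau p) *\<^sub>R w y) x) > 0))"

definition initial_ok :: "(real^'n \<Rightarrow> real^'n) \<Rightarrow> (real^'n, 'z) evolution_scheme \<Rightarrow> bool" where
  "initial_ok v0 E \<longleftrightarrow> bulk_vel E 0 = (\<lambda>x. 0) \<and> free_vel E 0 = (\<lambda>x. 0) \<and>
     vel E 0 \<in> velocity_space (msh E 0) \<and>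
     (\<forall>T\<in>cells (msh E 0). \<forall>P\<in>nodes2 T. vel E 0 P = v0 P)"

definition bulk_extension :: "(real^'n) params \<Rightarrow> (real^'n) mesh \<Rightarrow> (real^'n \<Rightarrow> real^'n) \<Rightarrow>
    (real^'n \<Rightarrow> real^'n) \<Rightarrow> bool" where
  "bulk_extension p M wt w \<longleftrightarrow>
     w \<in> mesh_velocity_space M \<and> (\<forall>x\<in>free_surface M. w x = wt x) \<and>
     (\<exists>\<phi>\<in>S1 (solid_faces M).
        (\<forall>\<zeta>\<in>mesh_velocity_space0 M.
           strain_form M w \<zeta> +
           surf_int (CARD('n) - 1) (solid_faces M)
             (\<lambda>\<rho> x. sgrad \<rho> (nrm_s p) w x \<bullet> sgrad \<rho> (nrm_s p) \<zeta> x)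
           = lump (CARD('n) - 1) (solid_faces M) (\<lambda>\<rho> x. (\<phi> x *\<^sub>R nrm_s p) \<bullet> \<zeta> x)) \<and>
        (\<forall>\<phi>s\<in>S1 (solid_faces M).
           lump (CARD('n) - 1) (solid_faces M) (\<lambda>\<rho> x. (w x \<bullet> nrm_s p) * \<phi>s x) = 0))"

definition mesh_motion :: "(real^'n) params \<Rightarrow> (real^'n, 'z) evolution_scheme \<Rightarrow> nat \<Rightarrow> bool" where
  "mesh_motion p E m \<longleftrightarrow>
     bulk_extension p (msh E m) (free_vel E (Suc m)) (bulk_vel E (Suc m)) \<and>
     nondegenerate p (msh E m) (bulk_vel E (Suc m)) \<and>
     msh E (Suc m) = map_mesh (psi p E (Suc m)) (msh E m)"

text \<open>The previous free boundary velocity, transported to the current free surface.\<close>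

definition transported_vel :: "'a::euclidean_space params \<Rightarrow> ('a, 'z) evolution_scheme \<Rightarrow> nat \<Rightarrow>
    'a \<Rightarrow> 'a" where
  "transported_vel p E m x = free_vel E m (inv_into (free_surface (msh E (m - 1))) (psi p E m) x)"


section \<open>Terms common to both schemes\<close>

definition face_nrm :: "'a::euclidean_space mesh \<Rightarrow> 'a set \<Rightarrow> 'a" where
  "face_nrm M \<sigma> = outward_normal (cells M) \<sigma>"

text \<open>Left-hand side of the momentum equation without the contact set terms.\<close>

definition momentum_lhs :: "(real^'n) params \<Rightarrow> (real^'n, 'z) evolution_scheme \<Rightarrow> nat \<Rightarrow>
    (real^'n \<Rightarrow> real^'n) \<Rightarrow> (real^'n \<Rightarrow> real) \<Rightarrow> (real^'n \<Rightarrow> real) \<Rightarrow> real" where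
  "momentum_lhs p E m v q ls =
    (let M = msh E m; M' = msh E (m - 1); u = vel E (Suc m); k = CARD('n) - 1 in
      1 / (2 * tau p) * l2 (domain M) u v
    + 1 / (2 * tau p) * l2 (domain M') (u \<circ> psi p E m) (v \<circ> psi p E m)
    + conv_form M' (\<lambda>x. vel E m x - bulk_vel E m x) (u \<circ> psi p E m) (v \<circ> psi p E m)
    + 2 / Rey p * strain_form M u v
    - div_form M (pres E (Suc m)) v
    + div_form M q u
    + surf_int k (free_faces M) (\<lambda>\<sigma> x. (curv E (Suc m) x *\<^sub>R face_nrm M \<sigma>) \<bullet> v x)
    - lump2 k (solid_faces M) (\<lambda>x. (kappa_s E (Suc m) x *\<^sub>R nrm_s p) \<bullet> v x)
    + lump2 k (solid_faces M) (\<lambda>x. (ls x *\<^sub>R nrm_s p) \<bullet> u x)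
    + beta_s p * surf_int k (solid_faces M) (\<lambda>\<rho> x. tproj (nrm_s p) (u x) \<bullet> tproj (nrm_s p) (v x)))"

definition momentum_rhs :: "(real^'n) params \<Rightarrow> (real^'n, 'z) evolution_scheme \<Rightarrow> nat \<Rightarrow>
    (real^'n \<Rightarrow> real^'n) \<Rightarrow> real" where
  "momentum_rhs p E m v = 1 / tau p * l2 (domain (msh E (m - 1))) (vel E m) (v \<circ> psi p E m)"

definition surface_stiffness :: "(real^'n) params \<Rightarrow> (real^'n) mesh \<Rightarrow> (real^'n \<Rightarrow> real^'n) \<Rightarrow>
    (real^'n \<Rightarrow> real^'n) \<Rightarrow> real" where
  "surface_stiffness p M wt \<eta> = surf_int (CARD('n) - 1) (free_faces M)
     (\<lambda>\<sigma> x. sgrad \<sigma> (face_nrm M \<sigma>) (\<lambda>y. y + tau p *\<^sub>R wt y) x \<bullet> sgrad \<sigma> (face_nrm M \<sigma>) \<eta> x)"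

definition interp_pos :: "'a::euclidean_space params \<Rightarrow> ('a \<Rightarrow> 'a) \<Rightarrow> real \<Rightarrow> 'a \<Rightarrow> 'a" where
  "interp_pos p wt \<theta> x = x + (tau p * \<theta>) *\<^sub>R wt x"

definition gravity_vec :: "'a::euclidean_space params \<Rightarrow> ('a \<Rightarrow> 'a) \<Rightarrow> (real \<Rightarrow> 'a \<Rightarrow> 'a) \<Rightarrow> 'a \<Rightarrow> 'a" where
  "gravity_vec p wt nhat x =
     integral {0..1} (\<lambda>\<theta>. (interp_pos p wt \<theta> x \<bullet> e_vert p) *\<^sub>R nhat \<theta> x)"

definition clip :: "real \<Rightarrow> real" where
  "clip r = min 1 (max (-1) r)"


section \<open>The two-dimensional scheme\<close>

definition mu2 :: "(real^2) mesh \<Rightarrow> real^2 \<Rightarrow> real^2" where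
  "mu2 M P = (if \<forall>Q\<in>contact_set M. P$1 \<le> Q$1 then vector [-1, 0] else vector [1, 0])"

definition theta2 :: "(real^2) params \<Rightarrow> (real^2) evolution \<Rightarrow> nat \<Rightarrow> real^2 \<Rightarrow> real" where
  "theta2 p E m P = arccos (clip (cos (theta_Y p)
     - Web p * beta_c p * (transported_vel p E m P \<bullet> mu2 (msh E m) P)))"

definition rot90 :: "real^2 \<Rightarrow> real^2" where
  "rot90 x = vector [- x$2, x$1]"

text \<open>
  With the unit tangent \<open>- rot90 n\<close>, the rotation taking the tangent to \<open>n\<close> is \<open>rot90\<close>.  The
  opposite tangent comes with the opposite rotation and gives the same vector.
\<close>

definition nhat2 :: "(real^2) params \<Rightarrow> (real^2) mesh \<Rightarrow> (real^2 \<Rightarrow> real^2) \<Rightarrow> (real^2) set \<Rightarrow>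
    real \<Rightarrow> real^2 \<Rightarrow> real^2" where
  "nhat2 p M wt \<sigma> \<theta> x =
     rot90 (frechet_derivative (interp_pos p wt \<theta>) (at x within \<sigma>) (- rot90 (face_nrm M \<sigma>)))"

definition scheme2 :: "(real^2) params \<Rightarrow> (real^2) evolution \<Rightarrow> nat \<Rightarrow> bool" where
  "scheme2 p E m \<longleftrightarrow>
    (let M = msh E m; wt = free_vel E (Suc m); H = curv E (Suc m); u = vel E (Suc m);
         ns = nrm_s p; nh = nhat2 p M wt; \<mu> = mu2 M
     in
      u \<in> velocity_space M \<and>
      pres E (Suc m) \<in> pressure_space M \<and>
      kappa_s E (Suc m) \<in> S2 (solid_faces M) \<and>
      H \<in> S1 (free_faces M) \<and>
      wt \<in> S1v (free_faces M) \<and>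
      (\<forall>v\<in>velocity_space M. \<forall>q\<in>pressure_space M. \<forall>ls\<in>S2 (solid_faces M). \<forall>\<phi>c :: real^2 \<Rightarrow> real.
         momentum_lhs p E m v q ls + (\<Sum>P\<in>contact_set M. (wt P \<bullet> ns) * \<phi>c P)
         = momentum_rhs p E m v) \<and>
      (\<forall>\<eta>\<in>S1v (free_faces M).
         - lump 1 (free_faces M) (\<lambda>\<sigma> x. (H x *\<^sub>R nh \<sigma> (1/2) x) \<bullet> \<eta> x)
         = - 1 / Web p * surface_stiffness p M wt \<eta>
           + 1 / Web p * (\<Sum>P\<in>contact_set M. (phi_c E (Suc m) P *\<^sub>R ns) \<bullet> \<eta> P)
           + 1 / Web p * (\<Sum>P\<in>contact_set M.
               (cos (theta_Y p) *\<^sub>R \<mu> P - (Web p * beta_c p * (wt P \<bullet> \<mu> P)) *\<^sub>R \<mu> P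
                + sin (theta2 p E m P) *\<^sub>R ns) \<bullet> \<eta> P)
           - grav p * surf_int 1 (free_faces M) (\<lambda>\<sigma> x. gravity_vec p wt (nh \<sigma>) x \<bullet> \<eta> x)) \<and>
      (\<forall>\<phi>F\<in>S1 (free_faces M).
         lump 1 (free_faces M) (\<lambda>\<sigma> x. (wt x \<bullet> nh \<sigma> (1/2) x) * \<phi>F x)
         = surf_int 1 (free_faces M) (\<lambda>\<sigma> x. (u x \<bullet> face_nrm M \<sigma>) * \<phi>F x)))"

text \<open>The substrate is horizontal.\<close>

definition solution2 :: "(real^2) params \<Rightarrow> (real^2 \<Rightarrow> real^2) \<Rightarrow> (real^2) evolution \<Rightarrow> nat \<Rightarrow> bool" where
  "solution2 p v0 E N \<longleftrightarrow>
     params_ok p \<and> e_vert p = vector [0, 1] \<and> nrm_s p \<in> {e_vert p, - e_vert p} \<and>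
     initial_ok v0 E \<and>
     (\<forall>m\<le>N. valid_mesh2 p (msh E m)) \<and>
     (\<exists>c. \<forall>m\<le>N. solid_surface (msh E m) \<subseteq> {x. x \<bullet> nrm_s p = c}) \<and>
     (\<exists>C>0. \<forall>m\<le>N. mesh_regular C (msh E m)) \<and>
     (\<forall>m<N. scheme2 p E m \<and> mesh_motion p E m)"

definition contact_norm_sq2 :: "(real^2) mesh \<Rightarrow> (real^2 \<Rightarrow> real^2) \<Rightarrow> real" where
  "contact_norm_sq2 M wt = (\<Sum>P\<in>contact_set M. (wt P \<bullet> mu2 M P)\<^sup>2)"


section \<open>The three-dimensional scheme\<close>

text \<open>
  The unit tangent of a contact edge, oriented so that its cross product with the normal of the
  substrate points out of the wetted solid boundary.
\<close>

definition tangent3 :: "(real^3) params \<Rightarrow> (real^3) mesh \<Rightarrow> (real^3) set \<Rightarrow> real^3" where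
  "tangent3 p M e = (THE t. norm t = 1 \<and> (\<forall>x\<in>e. \<forall>y\<in>e. \<exists>c. y - x = c *\<^sub>R t) \<and>
     (\<forall>\<rho>\<in>solid_faces M. e facet_of \<rho> \<longrightarrow>
        (\<forall>x\<in>e. \<forall>y\<in>\<rho>. cross3 t (nrm_s p) \<bullet> (y - x) \<le> 0)))"

definition mu3 :: "(real^3) params \<Rightarrow> (real^3) mesh \<Rightarrow> (real^3) set \<Rightarrow> real^3" where
  "mu3 p M e = cross3 (tangent3 p M e) (nrm_s p)"

definition mu3_half :: "(real^3) params \<Rightarrow> (real^3) mesh \<Rightarrow> (real^3 \<Rightarrow> real^3) \<Rightarrow> (real^3) set \<Rightarrow>
    real^3 \<Rightarrow> real^3" where
  "mu3_half p M wt e x = cross3 ((1/2) *\<^sub>R (tangent3 p M e +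
     frechet_derivative (\<lambda>y. y + tau p *\<^sub>R wt y) (at x within e) (tangent3 p M e))) (nrm_s p)"

text \<open>Elementwise constant: evaluated at the midpoint of the edge \<open>e\<close>.\<close>

definition theta3 :: "(real^3) params \<Rightarrow> (real^3) evolution3 \<Rightarrow> nat \<Rightarrow> (real^3) set \<Rightarrow> real" where
  "theta3 p E m e = arccos (clip (cos (theta_Y p)
     - Web p * beta_c p * (transported_vel p E m ((1/2) *\<^sub>R (\<Sum>P\<in>verts e. P)) \<bullet> mu3 p (msh E m) e)))"

text \<open>
  The cross product below depends on the pair \<open>(t1, t2)\<close> only through \<open>cross3 t1 t2\<close>, so every
  choice of the local parameters gives the same vector.
\<close>

definition nhat3 :: "(real^3) params \<Rightarrow> (real^3) mesh \<Rightarrow> (real^3 \<Rightarrow> real^3) \<Rightarrow> (real^3) set \<Rightarrow>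
    real \<Rightarrow> real^3 \<Rightarrow> real^3" where
  "nhat3 p M wt \<sigma> \<theta> x =
     (let D = frechet_derivative (interp_pos p wt \<theta>) (at x within \<sigma>);
          (t1, t2) = (SOME (t1, t2). norm t1 = 1 \<and> norm t2 = 1 \<and> t1 \<bullet> t2 = 0 \<and>
                        cross3 t1 t2 = face_nrm M \<sigma>)
      in cross3 (D t1) (D t2))"

definition ntilde3 :: "(real^3) params \<Rightarrow> (real^3) mesh \<Rightarrow> (real^3 \<Rightarrow> real^3) \<Rightarrow> (real^3) set \<Rightarrow>
    real^3 \<Rightarrow> real^3" where
  "ntilde3 p M wt \<sigma> x = integral {0..1} (\<lambda>\<theta>. nhat3 p M wt \<sigma> \<theta> x)"

definition scheme3 :: "(real^3) params \<Rightarrow> (real^3) evolution3 \<Rightarrow> nat \<Rightarrow> bool" where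
  "scheme3 p E m \<longleftrightarrow>
    (let M = msh E m; wt = free_vel E (Suc m); H = curv E (Suc m); u = vel E (Suc m);
         ns = nrm_s p; nt = ntilde3 p M wt; \<mu> = mu3 p M; \<xi> = tangent3 p M; CE = contact_edges M
     in
      u \<in> velocity_space M \<and>
      pres E (Suc m) \<in> pressure_space M \<and>
      kappa_s E (Suc m) \<in> S2 (solid_faces M) \<and>
      H \<in> S1 (free_faces M) \<and>
      wt \<in> S1v (free_faces M) \<and>
      phi_c E (Suc m) \<in> S1 CE \<and>
      psi_c E (Suc m) \<in> S1 CE \<and>
      (\<forall>v\<in>velocity_space M. \<forall>q\<in>pressure_space M. \<forall>ls\<in>S2 (solid_faces M).
       \<forall>\<phi>c\<in>S1 CE. \<forall>\<chi>\<^sub>c\<in>S1 CE.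
         momentum_lhs p E m v q ls
         + 1 / Web p * lump 1 CE (\<lambda>e x. wt x \<bullet> (\<phi>c x *\<^sub>R ns))
         + 1 / Web p * lump 1 CE (\<lambda>e x. wt x \<bullet> (\<chi>\<^sub>c x *\<^sub>R \<xi> e))
         = momentum_rhs p E m v) \<and>
      (\<forall>\<eta>\<in>S1v (free_faces M).
         - lump 2 (free_faces M) (\<lambda>\<sigma> x. (H x *\<^sub>R nt \<sigma> x) \<bullet> \<eta> x)
         = - 1 / Web p * surface_stiffness p M wt \<eta>
           + 1 / Web p * lump 1 CE (\<lambda>e x. (phi_c E (Suc m) x *\<^sub>R ns) \<bullet> \<eta> x)
           + 1 / Web p * surf_int 1 CE (\<lambda>e x.
               (cos (theta_Y p) *\<^sub>R mu3_half p M wt e x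
                - (Web p * beta_c p * (wt x \<bullet> \<mu> e)) *\<^sub>R \<mu> e
                + sin (theta3 p E m e) *\<^sub>R ns) \<bullet> \<eta> x)
           + 1 / Web p * lump 1 CE (\<lambda>e x. (psi_c E (Suc m) x *\<^sub>R \<xi> e) \<bullet> \<eta> x)
           - grav p * surf_int 2 (free_faces M)
               (\<lambda>\<sigma> x. gravity_vec p wt (nhat3 p M wt \<sigma>) x \<bullet> \<eta> x)) \<and>
      (\<forall>\<phi>F\<in>S1 (free_faces M).
         lump 2 (free_faces M) (\<lambda>\<sigma> x. (wt x \<bullet> nt \<sigma> x) * \<phi>F x)
         = surf_int 2 (free_faces M) (\<lambda>\<sigma> x. (u x \<bullet> face_nrm M \<sigma>) * \<phi>F x)))"

definition solution3 :: "(real^3) params \<Rightarrow> (real^3 \<Rightarrow> real^3) \<Rightarrow> (real^3) evolution3 \<Rightarrow> nat \<Rightarrow> bool" where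
  "solution3 p v0 E N \<longleftrightarrow>
     params_ok p \<and>
     initial_ok v0 E \<and>
     (\<forall>m\<le>N. valid_mesh3 p (msh E m)) \<and>
     (\<exists>c. \<forall>m\<le>N. solid_surface (msh E m) \<subseteq> {x. x \<bullet> nrm_s p = c}) \<and>
     (\<exists>C>0. \<forall>m\<le>N. mesh_regular C (msh E m)) \<and>
     (\<forall>m<N. scheme3 p E m \<and> mesh_motion p E m)"

definition contact_norm_sq3 :: "(real^3) params \<Rightarrow> (real^3) mesh \<Rightarrow> (real^3 \<Rightarrow> real^3) \<Rightarrow> real" where
  "contact_norm_sq3 p M wt = surf_int 1 (contact_edges M) (\<lambda>e x. (wt x \<bullet> mu3 p M e)\<^sup>2)"


section \<open>Energy\<close>

definition mesh_volume :: "(real^'n) mesh \<Rightarrow> real" where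
  "mesh_volume M = measure lborel (domain M)"

definition energy :: "(real^'n) params \<Rightarrow> (real^'n, 'z) evolution_scheme \<Rightarrow> nat \<Rightarrow> real" where
  "energy p E m =
     1/2 * (LINT x:domain (msh E (m - 1))|lborel. (norm (vel E m x))\<^sup>2)
     + 1 / Web p * measure (hausdorff (CARD('n) - 1)) (free_surface (msh E m))
     - cos (theta_Y p) / Web p * measure (hausdorff (CARD('n) - 1)) (solid_surface (msh E m))
     + grav p * (LINT x:domain (msh E m)|lborel. x \<bullet> e_vert p)"

text \<open>The dissipation of step \<open>m\<close>, except for the contact set term.\<close>

definition bulk_dissipation :: "(real^'n) params \<Rightarrow> (real^'n, 'z) evolution_scheme \<Rightarrow> nat \<Rightarrow> real" where
  "bulk_dissipation p E m =
     1/2 * (LINT x:domain (msh E (m - 1))|lborel. (norm (vel E (Suc m) (psi p E m x) - vel E m x))\<^sup>2)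
     + 2 * tau p / Rey p * strain_form (msh E m) (vel E (Suc m)) (vel E (Suc m))
     + tau p * beta_s p * surf_int (CARD('n) - 1) (solid_faces (msh E m))
         (\<lambda>\<rho> x. (norm (tproj (nrm_s p) (vel E (Suc m) x)))\<^sup>2)"

end

theory Submission
 imports Defs "HOL-Analysis.Analysis"
begin

text \<open>
Both schemes are tested with their own solution. In the momentum equation the convective form is
antisymmetric, polarization turns the time difference into a difference of kinetic energies plus
the square of the increment, and varying the other test functions shows that the velocity is
discretely divergence free and impermeable at the nodes of the substrate, so that pressure and
multipliers do no work. What is left is the work of the curvature on the free surface. The lumped
kinematic equation passes it on to the mesh velocity, and the curvature equation, tested with that
velocity, splits it into surface stiffness, contact terms and gravity. Each of these controls the
change of one part of the energy (\<open>energy_step\<close>).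

\<^item> Volume and potential energy are integrals of affine densities over the moving domain. On a cell
that moves linearly in time the derivative of such an integral is the flux through its facets, whose
scaled normals are the cofactor vectors of the motion. Integrated over time this is an identity in
which inner facets cancel (\<open>transport_complex\<close>), and a motion within the plane of the substrate
sweeps nothing. The averaged normals and the gravity vector of the schemes are exactly the remaining
time integrals (\<open>transport_free\<close>). For the volume, the divergence theorem for piecewise
quadratic fields shows that the swept amount is zero.

\<^item> The area of a parallelogram is at most half the sum of the squares of its sides, so the
stiffness term dominates the growth of the free surface (\<open>free_area_growth\<close>).

\<^item> The wetted area grows by exactly what the contact terms say. Its growth is a sum over the
boundaries of the wetted faces; the contributions of two adjacent faces cancel, and a parity argument
shows that a piece of boundary belonging to a single wetted face is on the contact set
(\<open>solid_length_growth\<close>, \<open>contact_line_growth\<close>).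

Since surface integrals refer to the Hausdorff measure, the first part identifies it on images of
affine maps, so that integrals of quadratic polynomials over segments and triangles become averages
over vertices and edge midpoints.
\<close>

section \<open>Hausdorff measure on Borel sets\<close>

definition covers :: "real \<Rightarrow> 'a::euclidean_space set \<Rightarrow> (nat \<Rightarrow> 'a set) set" where
 "covers \<delta> A = {C. A \<subseteq> (\<Union>i. C i) \<and> (\<forall>i. bounded (C i) \<and> diameter (C i) \<le> \<delta>)}"

definition weight :: "nat \<Rightarrow> 'a::euclidean_space set \<Rightarrow> ennreal" where
 "weight k C = (if C = {} then 0 else ennreal (diameter C ^ k))"

lemma hausdorff_pre_alt: "hausdorff_pre k \<delta> A = (INF C\<in>covers \<delta> A. \<Sum>i. weight k (C i))"
 unfolding hausdorff_pre_def covers_def weight_def ..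

lemma weight_empty [simp]: "weight k {} = 0"
 by (simp add: weight_def)

lemma weight_le_diameter: "weight k C \<le> ennreal (diameter C ^ k)"
 by (simp add: weight_def)

lemma hausdorff_pre_le:
 "C \<in> covers \<delta> A \<Longrightarrow> hausdorff_pre k \<delta> A \<le> (\<Sum>i. weight k (C i))"
 unfolding hausdorff_pre_alt by (rule INF_lower)

lemma hausdorff_pre_mono: "A \<subseteq> B \<Longrightarrow> hausdorff_pre k \<delta> A \<le> hausdorff_pre k \<delta> B"
 unfolding hausdorff_pre_alt by (rule INF_superset_mono) (auto simp: covers_def)

lemma hausdorff_pre_antimono: "\<delta> \<le> \<delta>' \<Longrightarrow> hausdorff_pre k \<delta>' A \<le> hausdorff_pre k \<delta> A"
 unfolding hausdorff_pre_alt by (rule INF_superset_mono) (auto simp: covers_def intro: order_trans)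

lemma hausdorff_pre_empty: "0 \<le> \<delta> \<Longrightarrow> hausdorff_pre k \<delta> {} = 0"
 using hausdorff_pre_le[of "\<lambda>_. {}" \<delta> "{}" k] by (auto simp: covers_def)

lemma hausdorff_pre_single:
 assumes "bounded C" "diameter C \<le> \<delta>" "0 \<le> \<delta>"
 shows "hausdorff_pre k \<delta> C \<le> weight k C"
proof -
 have "(\<Sum>i. weight k (if i = (0::nat) then C else {})) = (\<Sum>i\<in>{0::nat}. weight k (if i = 0 then C else {}))"
  by (rule suminf_finite) (auto split: if_splits)
 moreover have "(\<lambda>i. if i = 0 then C else {}) \<in> covers \<delta> C"
  using assms by (auto simp: covers_def)
 ultimately show ?thesis using hausdorff_pre_le[of "\<lambda>i. if i = 0 then C else {}" \<delta> C k] by simp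
qed

lemma hausdorff_pre_UN:
 fixes A :: "nat \<Rightarrow> 'a::euclidean_space set"
 shows "hausdorff_pre k \<delta> (\<Union>i. A i) \<le> (\<Sum>i. hausdorff_pre k \<delta> (A i))"
proof (cases "\<exists>i. hausdorff_pre k \<delta> (A i) = top")
 case True
 then obtain i where i: "hausdorff_pre k \<delta> (A i) = top" by blast
 have "hausdorff_pre k \<delta> (A i) \<le> (\<Sum>i. hausdorff_pre k \<delta> (A i))"
  using sum_le_suminf[of "\<lambda>i. hausdorff_pre k \<delta> (A i)" "{i}"] by simp
 then show ?thesis using i by (simp add: top_unique)
next
 case False
 show ?thesis
 proof (rule ennreal_le_epsilon)
  fix e :: real assume e: "0 < e"
  have "\<exists>C\<in>covers \<delta> (A i). (\<Sum>j. weight k (C j)) < hausdorff_pre k \<delta> (A i) + ennreal (e * (1/2)^Suc i)" for i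
  proof -
   have "hausdorff_pre k \<delta> (A i) < hausdorff_pre k \<delta> (A i) + ennreal (e * (1/2)^Suc i)"
    using False e by (cases "hausdorff_pre k \<delta> (A i)") (auto simp: ennreal_plus[symmetric] ennreal_less_iff simp del: ennreal_plus)
   then show ?thesis unfolding hausdorff_pre_alt by (simp add: INF_less_iff)
  qed
  then obtain C where C: "\<And>i. C i \<in> covers \<delta> (A i)"
   and Cs: "\<And>i. (\<Sum>j. weight k (C i j)) < hausdorff_pre k \<delta> (A i) + ennreal (e * (1/2)^Suc i)"
   by metis
  define D where "D n = (case prod_decode n of (i,j) \<Rightarrow> C i j)" for n
  have "D \<in> covers \<delta> (\<Union>i. A i)"
  proof -
   have "x \<in> (\<Union>n. D n)" if xA: "x \<in> A i" for x i
   proof -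
    have "A i \<subseteq> (\<Union>j. C i j)" using C[of i] by (simp add: covers_def)
    then obtain j where "x \<in> C i j" using xA by blast
    then have "x \<in> D (prod_encode (i,j))" by (simp add: D_def)
    then show ?thesis by blast
   qed
   then show ?thesis using C by (auto simp: covers_def D_def split: prod.splits)
  qed
  then have "hausdorff_pre k \<delta> (\<Union>i. A i) \<le> (\<Sum>n. weight k (D n))" by (rule hausdorff_pre_le)
  also have "\<dots> = (\<Sum>i. \<Sum>j. weight k (C i j))"
   using suminf_ennreal_2dimen[of "\<lambda>i. \<Sum>j. weight k (C i j)" "\<lambda>(i,j). weight k (C i j)"]
   by (simp add: D_def split_def)
  also have "\<dots> \<le> (\<Sum>i. hausdorff_pre k \<delta> (A i) + ennreal (e * (1/2)^Suc i))"
   by (intro suminf_le summableI less_imp_le Cs)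
  also have "\<dots> = (\<Sum>i. hausdorff_pre k \<delta> (A i)) + (\<Sum>i. ennreal (e * (1/2)^Suc i))"
   by (intro suminf_add[symmetric] summableI)
  also have "(\<Sum>i. ennreal (e * (1/2)^Suc i)) = ennreal e"
  proof (rule suminf_ennreal_eq)
   show "(\<lambda>i. e * (1/2)^Suc i) sums e"
    using sums_mult[OF power_half_series, of e] by simp
  qed (use e in auto)
  finally show "hausdorff_pre k \<delta> (\<Union>i. A i) \<le> (\<Sum>i. hausdorff_pre k \<delta> (A i)) + ennreal e" .
 qed
qed

lemma hausdorff_pre_le_outer: "0 < \<delta> \<Longrightarrow> hausdorff_pre k \<delta> A \<le> hausdorff_outer k A"
 unfolding hausdorff_outer_def by (rule SUP_upper) auto

lemma hausdorff_outer_least: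
 "(\<And>\<delta>. 0 < \<delta> \<Longrightarrow> hausdorff_pre k \<delta> A \<le> c) \<Longrightarrow> hausdorff_outer k A \<le> c"
 unfolding hausdorff_outer_def by (rule SUP_least) auto

lemma hausdorff_outer_mono: "A \<subseteq> B \<Longrightarrow> hausdorff_outer k A \<le> hausdorff_outer k B"
 by (rule hausdorff_outer_least) (meson hausdorff_pre_le_outer hausdorff_pre_mono order_trans)

lemma hausdorff_outer_empty: "hausdorff_outer k {} = 0"
 using hausdorff_outer_least[of k "{}" 0] by (simp add: hausdorff_pre_empty)

lemma hausdorff_outer_UN:
 fixes A :: "nat \<Rightarrow> 'a::euclidean_space set"
 shows "hausdorff_outer k (\<Union>i. A i) \<le> (\<Sum>i. hausdorff_outer k (A i))"
proof (rule hausdorff_outer_least)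
 fix \<delta> :: real assume "0 < \<delta>"
 then show "hausdorff_pre k \<delta> (\<Union>i. A i) \<le> (\<Sum>i. hausdorff_outer k (A i))"
  by (intro order_trans[OF hausdorff_pre_UN] suminf_le summableI hausdorff_pre_le_outer)
qed

lemma hausdorff_outer_space: "outer_measure_space UNIV (hausdorff_outer k)"
 by (auto simp: outer_measure_space_def positive_def increasing_def countably_subadditive_def
   hausdorff_outer_empty hausdorff_outer_mono hausdorff_outer_UN)

lemma hausdorff_outer_Un:
 "hausdorff_outer k (A \<union> B) \<le> hausdorff_outer k A + hausdorff_outer k B"
proof -
 have "hausdorff_outer k (\<Union>i. if i = 0 then A else if i = Suc 0 then B else {})
   \<le> (\<Sum>i. hausdorff_outer k (if i = 0 then A else if i = Suc 0 then B else {}))"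
  by (rule hausdorff_outer_UN)
 also have "(\<Union>i::nat. if i = 0 then A else if i = Suc 0 then B else {}) = A \<union> B"
  by (auto split: if_splits)
 also have "(\<Sum>i. hausdorff_outer k (if i = 0 then A else if i = Suc 0 then B else {}))
   = (\<Sum>i\<in>{0, Suc 0}. hausdorff_outer k (if i = 0 then A else if i = Suc 0 then B else {}))"
  by (rule suminf_finite) (auto simp: hausdorff_outer_empty)
 finally show ?thesis by simp
qed

text \<open>A set of diameter below the gap \<open>d\<close> meets at most one of the two sets, so a fine covering of the union splits.\<close>

lemma hausdorff_outer_separated:
 assumes d: "0 < d" and sep: "\<And>x y. x \<in> A \<Longrightarrow> y \<in> B \<Longrightarrow> d \<le> dist x y"
 shows "hausdorff_outer k A + hausdorff_outer k B \<le> hausdorff_outer k (A \<union> B)"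
proof -
 have *: "hausdorff_pre k \<delta> A + hausdorff_pre k \<delta> B \<le> hausdorff_outer k (A \<union> B)"
  if \<delta>: "0 < \<delta>" "\<delta> < d" for \<delta>
 proof -
  have "hausdorff_pre k \<delta> A + hausdorff_pre k \<delta> B \<le> (\<Sum>i. weight k (C i))"
   if C: "C \<in> covers \<delta> (A \<union> B)" for C
  proof -
   define CA where "CA i = (if C i \<inter> A = {} then {} else C i)" for i
   define CB where "CB i = (if C i \<inter> B = {} then {} else C i)" for i
   have disj: "C i \<inter> A = {} \<or> C i \<inter> B = {}" for i
   proof (rule ccontr)
    assume "\<not> ?thesis"
    then obtain x y where "x \<in> C i" "x \<in> A" "y \<in> C i" "y \<in> B" by blast
    then have "d \<le> dist x y" "dist x y \<le> diameter (C i)" "diameter (C i) \<le> \<delta>"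
     using sep C by (auto simp: covers_def intro!: diameter_bounded_bound)
    then show False using \<delta> by linarith
   qed
   have "CA \<in> covers \<delta> A"
    using C \<delta> by (auto simp: covers_def CA_def) blast
   moreover have "CB \<in> covers \<delta> B"
    using C \<delta> by (auto simp: covers_def CB_def) blast
   ultimately have "hausdorff_pre k \<delta> A + hausdorff_pre k \<delta> B
     \<le> (\<Sum>i. weight k (CA i)) + (\<Sum>i. weight k (CB i))"
    by (intro add_mono hausdorff_pre_le)
   also have "\<dots> = (\<Sum>i. weight k (CA i) + weight k (CB i))"
    by (intro suminf_add summableI)
   also have "\<dots> \<le> (\<Sum>i. weight k (C i))"
    using disj by (intro suminf_le summableI) (auto simp: CA_def CB_def)
   finally show ?thesis .
  qed
  then have "hausdorff_pre k \<delta> A + hausdorff_pre k \<delta> B \<le> hausdorff_pre k \<delta> (A \<union> B)"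
   unfolding hausdorff_pre_alt[of k \<delta> "A \<union> B"] by (rule INF_greatest)
  then show ?thesis using hausdorff_pre_le_outer[OF \<delta>(1)] order_trans by blast
 qed
 have dir: "hausdorff_outer k X = (SUP n. hausdorff_pre k (d / real (n + 2)) X)" for X :: "'a set"
 proof (rule antisym)
  show "(SUP n. hausdorff_pre k (d / real (n + 2)) X) \<le> hausdorff_outer k X"
   using d by (intro SUP_least hausdorff_pre_le_outer) auto
  show "hausdorff_outer k X \<le> (SUP n. hausdorff_pre k (d / real (n + 2)) X)"
  proof (rule hausdorff_outer_least)
   fix \<delta> :: real assume "0 < \<delta>"
   then obtain n where "d / \<delta> < real n" using reals_Archimedean2 by blast
   then have "d < real n * \<delta>" using \<open>0 < \<delta>\<close> by (simp add: field_simps)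
   also have "\<dots> \<le> real (n + 2) * \<delta>" using \<open>0 < \<delta>\<close> by (intro mult_right_mono) auto
   finally have "d / real (n + 2) \<le> \<delta>" by (simp add: field_simps)
   then have "hausdorff_pre k \<delta> X \<le> hausdorff_pre k (d / real (n + 2)) X"
    by (rule hausdorff_pre_antimono)
   then show "hausdorff_pre k \<delta> X \<le> (SUP n. hausdorff_pre k (d / real (n + 2)) X)"
    by (rule SUP_upper2[rotated]) simp
  qed
 qed
 have inc: "incseq (\<lambda>n. hausdorff_pre k (d / real (n + 2)) X)" for X :: "'a set"
  using d by (intro monoI hausdorff_pre_antimono) (auto intro!: divide_left_mono)
 have "hausdorff_outer k A + hausdorff_outer k B
   = (SUP n. hausdorff_pre k (d / real (n + 2)) A + hausdorff_pre k (d / real (n + 2)) B)"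
  unfolding dir by (rule ennreal_SUP_add[symmetric, OF inc inc])
 also have "\<dots> \<le> hausdorff_outer k (A \<union> B)"
  using d by (intro SUP_least *) (auto simp: field_simps intro: add_pos_nonneg)
 finally show ?thesis .
qed

text \<open>Every second shell is separated from the others; this bounds the series of their outer measures.\<close>

lemma hausdorff_outer_shells:
 fixes S :: "nat \<Rightarrow> 'a::euclidean_space set"
 assumes sub: "\<And>n. S n \<subseteq> X" and sep: "\<And>n. \<exists>d>0. \<forall>m\<ge>n+2. \<forall>x\<in>S n. \<forall>y\<in>S m. d \<le> dist x y"
 shows "(\<Sum>n. hausdorff_outer k (S (2 * n + r))) \<le> hausdorff_outer k X"
proof -
 have fin: "(\<Sum>n<N. hausdorff_outer k (S (2 * n + r))) \<le> hausdorff_outer k (\<Union>n<N. S (2 * n + r))" for N r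
 proof (induction N arbitrary: r)
  case (Suc N)
  obtain d where d: "d > 0" "\<And>m x y. m \<ge> r + 2 \<Longrightarrow> x \<in> S r \<Longrightarrow> y \<in> S m \<Longrightarrow> d \<le> dist x y"
   using sep[of r] by blast
  have "(\<Sum>n<Suc N. hausdorff_outer k (S (2 * n + r)))
    = hausdorff_outer k (S r) + (\<Sum>n<N. hausdorff_outer k (S (2 * n + (r + 2))))"
   by (simp add: sum.lessThan_Suc_shift del: sum.lessThan_Suc)
  also have "\<dots> \<le> hausdorff_outer k (S r) + hausdorff_outer k (\<Union>n<N. S (2 * n + (r + 2)))"
   by (intro add_left_mono Suc)
  also have "\<dots> \<le> hausdorff_outer k (S r \<union> (\<Union>n<N. S (2 * n + (r + 2))))"
  proof (rule hausdorff_outer_separated[OF d(1)])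
   fix x y assume x: "x \<in> S r" and "y \<in> (\<Union>n<N. S (2 * n + (r + 2)))"
   then obtain n where y: "y \<in> S (2 * n + (r + 2))" by blast
   show "d \<le> dist x y" by (rule d(2)[OF _ x y]) simp
  qed
  also have "\<dots> \<le> hausdorff_outer k (\<Union>n<Suc N. S (2 * n + r))"
  proof (rule hausdorff_outer_mono, safe)
   fix x assume "x \<in> S r" then show "x \<in> (\<Union>n<Suc N. S (2 * n + r))"
    by (intro UN_I[of 0]) auto
  next
   fix x n assume "n < N" "x \<in> S (2 * n + (r + 2))"
   then show "x \<in> (\<Union>n<Suc N. S (2 * n + r))"
    by (intro UN_I[of "Suc n"]) auto
  qed
  finally show ?case .
 qed (simp add: hausdorff_outer_empty)
 show ?thesis
  unfolding suminf_eq_SUP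
  using fin sub by (intro SUP_least order_trans[OF fin] hausdorff_outer_mono) auto
qed

text \<open>Caratheodory's criterion: the part of \<open>X\<close> outside \<open>F\<close> is exhausted by points at distance at least
\<open>1 / (n + 1)\<close> from \<open>F\<close>, and what is left consists of shells whose outer measures are summable.\<close>

lemma closed_in_lambda_system:
 fixes F :: "'a::euclidean_space set"
 assumes F: "closed F"
 shows "F \<in> lambda_system UNIV UNIV (hausdorff_outer k)"
proof -
 let ?H = "hausdorff_outer k"
 have "?H (F \<inter> X) + ?H (X - F) \<le> ?H X" for X
 proof (cases "F = {} \<or> ?H X = top")
  case True
  then show ?thesis by (auto simp: hausdorff_outer_empty)
 next
  case False
  then have ne: "F \<noteq> {}" and fin: "?H X < top" by (auto simp: less_top)
  define A where "A n = {x\<in>X. infdist x F \<ge> 1 / real (Suc n)}" for n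
  define S where "S n = {x\<in>X. 1 / real (Suc (Suc n)) \<le> infdist x F \<and> infdist x F < 1 / real (Suc n)}" for n
  have sep: "\<exists>d>0. \<forall>m\<ge>n+2. \<forall>x\<in>S n. \<forall>y\<in>S m. d \<le> dist x y" for n
  proof (intro exI conjI allI ballI impI)
   show "0 < 1 / real (Suc (Suc n)) - 1 / real (Suc (Suc (Suc n)))"
    by (intro diff_gt_0_iff_gt[THEN iffD2] divide_strict_left_mono) auto
   fix m x y assume m: "n + 2 \<le> m" and x: "x \<in> S n" and y: "y \<in> S m"
   have "infdist y F < 1 / real (Suc m)" using y by (simp add: S_def)
   also have "\<dots> \<le> 1 / real (Suc (Suc (Suc n)))" using m by (intro divide_left_mono) auto
   finally have "infdist y F \<le> 1 / real (Suc (Suc (Suc n)))" by simp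
   moreover have "1 / real (Suc (Suc n)) \<le> infdist x F" using x by (simp add: S_def)
   moreover have "infdist x F \<le> infdist y F + dist x y" by (rule infdist_triangle)
   ultimately show "1 / real (Suc (Suc n)) - 1 / real (Suc (Suc (Suc n))) \<le> dist x y" by linarith
  qed
  have sums: "(\<Sum>n. ?H (S (2 * n + r))) \<le> ?H X" for r
   by (rule hausdorff_outer_shells[OF _ sep]) (auto simp: S_def)
  have tot: "(\<Sum>n. ?H (S n)) < top"
  proof -
   have "(\<Sum>n<2 * N. ?H (S n)) = (\<Sum>n<N. ?H (S (2 * n + 0))) + (\<Sum>n<N. ?H (S (2 * n + 1)))" for N
    by (induction N) (auto simp: algebra_simps)
   also have "\<dots> N \<le> ?H X + ?H X" for N
    by (intro add_mono order_trans[OF sum_le_suminf sums] summableI) auto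
   finally have *: "(\<Sum>n<2 * N. ?H (S n)) \<le> ?H X + ?H X" for N .
   have "(\<Sum>n. ?H (S n)) \<le> ?H X + ?H X"
    unfolding suminf_eq_SUP
   proof (rule SUP_least)
    fix N
    have "(\<Sum>n<N. ?H (S n)) \<le> (\<Sum>n<2 * N. ?H (S n))" by (rule sum_mono2) auto
    then show "(\<Sum>n<N. ?H (S n)) \<le> ?H X + ?H X" using * order_trans by blast
   qed
   also have "\<dots> < top" using fin by simp
   finally show ?thesis .
  qed
  have main: "?H (F \<inter> X) + ?H (X - F) \<le> ?H X + (\<Sum>i. ?H (S (i + n)))" for n
  proof -
   have "X - F \<subseteq> A n \<union> (\<Union>i. S (i + n))"
   proof
    fix x assume x: "x \<in> X - F"
    then have pos: "infdist x F > 0"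
     using in_closed_iff_infdist_zero[OF F ne] infdist_nonneg[of x F] by (simp add: less_le)
    then obtain N where N: "1 / real (Suc N) < infdist x F"
     using nat_approx_posE by (metis)
    define M where "M = (LEAST N. 1 / real (Suc N) \<le> infdist x F)"
    have M1: "1 / real (Suc M) \<le> infdist x F"
     unfolding M_def using N by (intro LeastI[of "\<lambda>N. 1 / real (Suc N) \<le> infdist x F" N]) simp
    have M2: "infdist x F < 1 / real (Suc j)" if "j < M" for j
     using not_less_Least[of j "\<lambda>N. 1 / real (Suc N) \<le> infdist x F"] that by (simp add: M_def)
    show "x \<in> A n \<union> (\<Union>i. S (i + n))"
    proof (cases "M \<le> n")
     case True
     then have "1 / real (Suc n) \<le> 1 / real (Suc M)" by (intro divide_left_mono) auto
     then show ?thesis using M1 x by (auto simp: A_def)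
    next
     case False
     then have "x \<in> S (M - 1)" using M1 M2[of "M - 1"] x by (auto simp: S_def)
     moreover have "M - 1 = (M - 1 - n) + n" using False by simp
     ultimately show ?thesis by (metis UN_I UNIV_I UnI2)
    qed
   qed
   then have "?H (X - F) \<le> ?H (A n) + ?H (\<Union>i. S (i + n))"
    by (meson hausdorff_outer_Un hausdorff_outer_mono order_trans)
   also have "\<dots> \<le> ?H (A n) + (\<Sum>i. ?H (S (i + n)))"
    by (intro add_left_mono hausdorff_outer_UN)
   finally have "?H (F \<inter> X) + ?H (X - F) \<le> (?H (F \<inter> X) + ?H (A n)) + (\<Sum>i. ?H (S (i + n)))"
    by (simp add: add.assoc add_left_mono)
   also have "?H (F \<inter> X) + ?H (A n) \<le> ?H ((F \<inter> X) \<union> A n)"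
   proof (rule hausdorff_outer_separated)
    show "0 < 1 / real (Suc n)" by simp
    fix x y assume "x \<in> F \<inter> X" "y \<in> A n"
    then show "1 / real (Suc n) \<le> dist x y"
     using infdist_le[of x F y] by (simp add: A_def dist_commute)
   qed
   also have "\<dots> \<le> ?H X" by (rule hausdorff_outer_mono) (auto simp: A_def)
   finally show ?thesis by (simp add: add_right_mono)
  qed
  have "(\<lambda>n. \<Sum>i. ?H (S (i + n))) \<longlonglongrightarrow> 0"
  proof -
   have "(\<Sum>i. ?H (S i)) = ennreal (\<Sum>i. enn2real (?H (S i))) \<and> summable (\<lambda>i. enn2real (?H (S i))) \<and>
     (\<forall>i. ?H (S i) = ennreal (enn2real (?H (S i))))"
   proof -
    have lt: "?H (S i) < top" for i
     using sum_le_suminf[of "\<lambda>i. ?H (S i)" "{i}"] tot by (auto simp: le_less_trans)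
    then have eq: "?H (S i) = ennreal (enn2real (?H (S i)))" for i by simp
    have "(\<Sum>i. ennreal (enn2real (?H (S i)))) \<noteq> top" using tot eq by simp
    then have "summable (\<lambda>i. enn2real (?H (S i)))"
     by (intro summable_suminf_not_top) auto
    then show ?thesis using eq suminf_ennreal2[of "\<lambda>i. enn2real (?H (S i))"] by auto
   qed
   then have sm: "summable (\<lambda>i. enn2real (?H (S i)))" and eq: "\<And>i. ?H (S i) = ennreal (enn2real (?H (S i)))"
    by auto
   have "(\<Sum>i. ?H (S (i + n))) = ennreal (\<Sum>i. enn2real (?H (S (i + n))))" for n
    by (subst eq, rule suminf_ennreal2) (auto intro: summable_ignore_initial_segment[OF sm])
   moreover have "(\<lambda>n. ennreal (\<Sum>i. enn2real (?H (S (i + n))))) \<longlonglongrightarrow> ennreal 0"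
    by (intro tendsto_ennrealI suminf_exist_split2 sm)
   ultimately show ?thesis by simp
  qed
  then have "(\<lambda>n. ?H X + (\<Sum>i. ?H (S (i + n)))) \<longlonglongrightarrow> ?H X + 0"
   by (intro tendsto_add tendsto_const)
  then have "(\<lambda>n. ?H X + (\<Sum>i. ?H (S (i + n)))) \<longlonglongrightarrow> ?H X" by simp
  then show ?thesis by (rule LIMSEQ_le_const) (use main in auto)
 qed
 moreover have "?H X \<le> ?H (F \<inter> X) + ?H (X - F)" for X
  using hausdorff_outer_Un[of k "F \<inter> X" "X - F"] by (metis Int_Diff_Un Int_commute)
 ultimately show ?thesis
  by (auto simp: lambda_system_def Int_commute Compl_eq_Diff_UNIV[symmetric] Diff_eq intro: antisym)
qed

text \<open>Borel sets lie in the Caratheodory algebra, so the prescribed values do form a measure.\<close>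

lemma emeasure_hausdorff:
 fixes A :: "'a::euclidean_space set"
 assumes "A \<in> sets borel"
 shows "emeasure (hausdorff k) A
  = hausdorff_outer k A / hausdorff_outer k (coordinate_cube k :: 'a set)"
proof -
 let ?H = "hausdorff_outer k :: 'a set \<Rightarrow> ennreal"
 let ?L = "lambda_system UNIV UNIV ?H"
 interpret sigma_algebra UNIV "UNIV :: 'a set set" by (metis Pow_UNIV sigma_algebra_Pow)
 have ms: "measure_space UNIV ?L ?H"
  by (rule caratheodory_lemma[OF hausdorff_outer_space])
 then have L: "sigma_algebra UNIV ?L" and ca: "countably_additive ?L ?H" by (auto simp: measure_space_def)
 have "sets (borel :: 'a measure) = sigma_sets UNIV {S. closed S}"
  unfolding borel_eq_closed by simp
 also have "\<dots> \<subseteq> ?L"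
  by (rule sigma_algebra.sigma_sets_subset[OF L]) (auto intro: closed_in_lambda_system)
 finally have sub: "sets (borel :: 'a measure) \<subseteq> ?L" .
 show ?thesis
  unfolding hausdorff_def
 proof (rule emeasure_measure_of_sigma)
  show "sigma_algebra UNIV (sets (borel :: 'a measure))"
   using sets.sigma_algebra_axioms[of "borel :: 'a measure"] by simp
  show "positive (sets borel) (\<lambda>A. ?H A / ?H (coordinate_cube k))"
   by (simp add: positive_def hausdorff_outer_empty)
  show "countably_additive (sets borel) (\<lambda>A. ?H A / ?H (coordinate_cube k))"
  proof (rule countably_additiveI)
   fix A :: "nat \<Rightarrow> 'a set" assume "range A \<subseteq> sets borel" "disjoint_family A" "(\<Union>i. A i) \<in> sets borel"
   then have "(\<Sum>i. ?H (A i)) = ?H (\<Union>i. A i)"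
    using ca sub unfolding countably_additive_def by blast
   then show "(\<Sum>i. ?H (A i) / ?H (coordinate_cube k)) = ?H (\<Union>i. A i) / ?H (coordinate_cube k)"
    by (simp add: divide_ennreal_def)
  qed
 qed fact
qed

lemma sets_hausdorff [simp, measurable_cong]: "sets (hausdorff k) = sets borel"
 unfolding hausdorff_def by (metis sets.sets_measure_of_eq space_borel)

lemma space_hausdorff [simp]: "space (hausdorff k) = UNIV"
 unfolding hausdorff_def by (simp add: space_measure_of_conv)

lemma hausdorff_outer_lipschitz_le:
 fixes f :: "'a::euclidean_space \<Rightarrow> 'b::euclidean_space"
 assumes L: "0 < L" and lip: "\<And>x y. x \<in> A \<Longrightarrow> y \<in> A \<Longrightarrow> dist (f x) (f y) \<le> L * dist x y"
 shows "hausdorff_outer k (f ` A) \<le> ennreal (L ^ k) * hausdorff_outer k A"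
proof (rule hausdorff_outer_least)
 fix \<delta> :: real assume \<delta>: "0 < \<delta>"
 have *: "hausdorff_pre k \<delta> (f ` A) \<le> ennreal (L ^ k) * (\<Sum>i. weight k (C i))" if C: "C \<in> covers (\<delta> / L) A" for C
 proof -
  have bd: "bounded (C i)" "diameter (C i) \<le> \<delta> / L" for i using C by (auto simp: covers_def)
  have dm: "dist (f x) (f y) \<le> L * diameter (C i)" if "x \<in> C i \<inter> A" "y \<in> C i \<inter> A" for x y i
  proof -
   have "dist (f x) (f y) \<le> L * dist x y" using lip that by auto
   also have "\<dots> \<le> L * diameter (C i)"
    using that bd L by (intro mult_left_mono diameter_bounded_bound) auto
   finally show ?thesis .
  qed
  have d2: "diameter (f ` (C i \<inter> A)) \<le> L * diameter (C i)" for i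
   using dm[of _ i] L diameter_ge_0[OF bd(1)[of i]] by (intro diameter_le) (auto simp: dist_norm)
  have bf: "bounded (f ` (C i \<inter> A))" for i
  proof (cases "C i \<inter> A = {}")
   case False
   then obtain a where "a \<in> C i \<inter> A" by blast
   then show ?thesis unfolding bounded_def using dm[of a i] by blast
  qed simp
  have "(\<lambda>i. f ` (C i \<inter> A)) \<in> covers \<delta> (f ` A)"
  proof -
   have "diameter (f ` (C i \<inter> A)) \<le> \<delta>" for i
    using d2[of i] bd(2)[of i] L by (simp add: field_simps)
   moreover have "f ` A \<subseteq> (\<Union>i. f ` (C i \<inter> A))" using C by (fastforce simp: covers_def)
   ultimately show ?thesis using bf by (auto simp: covers_def)
  qed
  then have "hausdorff_pre k \<delta> (f ` A) \<le> (\<Sum>i. weight k (f ` (C i \<inter> A)))" by (rule hausdorff_pre_le)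
  also have "\<dots> \<le> (\<Sum>i. ennreal (L ^ k) * weight k (C i))"
  proof (intro suminf_le summableI)
   fix i
   have "ennreal (diameter (f ` (C i \<inter> A)) ^ k) \<le> ennreal ((L * diameter (C i)) ^ k)"
    by (intro ennreal_leI power_mono d2 diameter_ge_0 bf)
   also have "\<dots> = ennreal (L ^ k) * ennreal (diameter (C i) ^ k)"
    using L diameter_ge_0[OF bd(1)[of i]] by (simp add: power_mult_distrib ennreal_mult)
   finally show "weight k (f ` (C i \<inter> A)) \<le> ennreal (L ^ k) * weight k (C i)"
    by (auto simp: weight_def)
  qed
  also have "\<dots> = ennreal (L ^ k) * (\<Sum>i. weight k (C i))" by simp
  finally show ?thesis .
 qed
 have inv: "ennreal (1 / L ^ k) * ennreal (L ^ k) = 1"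
  using L by (simp add: ennreal_mult[symmetric])
 have "ennreal (1 / L ^ k) * hausdorff_pre k \<delta> (f ` A) \<le> hausdorff_pre k (\<delta> / L) A"
  unfolding hausdorff_pre_alt[of k "\<delta> / L"]
 proof (rule INF_greatest)
  fix C assume "C \<in> covers (\<delta> / L) A"
  from mult_left_mono[OF *[OF this], of "ennreal (1 / L ^ k)"]
  have "ennreal (1 / L ^ k) * hausdorff_pre k \<delta> (f ` A)
    \<le> (ennreal (1 / L ^ k) * ennreal (L ^ k)) * (\<Sum>i. weight k (C i))"
   by (simp only: mult.assoc zero_le)
  then show "ennreal (1 / L ^ k) * hausdorff_pre k \<delta> (f ` A) \<le> (\<Sum>i. weight k (C i))"
   unfolding inv by simp
 qed
 from mult_left_mono[OF this, of "ennreal (L ^ k)"]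
 have "(ennreal (1 / L ^ k) * ennreal (L ^ k)) * hausdorff_pre k \<delta> (f ` A)
   \<le> ennreal (L ^ k) * hausdorff_pre k (\<delta> / L) A"
  by (simp only: mult.assoc mult.left_commute zero_le)
 then have "hausdorff_pre k \<delta> (f ` A) \<le> ennreal (L ^ k) * hausdorff_pre k (\<delta> / L) A"
  unfolding inv by simp
 also have "\<dots> \<le> ennreal (L ^ k) * hausdorff_outer k A"
  using \<delta> L by (intro mult_left_mono hausdorff_pre_le_outer) auto
 finally show "hausdorff_pre k \<delta> (f ` A) \<le> ennreal (L ^ k) * hausdorff_outer k A" .
qed

lemma hausdorff_outer_isometry:
 fixes f :: "'a::euclidean_space \<Rightarrow> 'b::euclidean_space"
 assumes iso: "\<And>x y. x \<in> A \<Longrightarrow> y \<in> A \<Longrightarrow> dist (f x) (f y) = dist x y"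
 shows "hausdorff_outer k (f ` A) = hausdorff_outer k A"
proof (rule antisym)
 show "hausdorff_outer k (f ` A) \<le> hausdorff_outer k A"
  using hausdorff_outer_lipschitz_le[of 1 A f k] iso by simp
 have inj: "inj_on f A" using iso by (intro inj_onI) (metis dist_eq_0_iff)
 have "dist (inv_into A f x) (inv_into A f y) \<le> 1 * dist x y" if "x \<in> f ` A" "y \<in> f ` A" for x y
  using that iso inj by (auto simp: inv_into_f_f)
 from hausdorff_outer_lipschitz_le[of 1, OF _ this, where A="f ` A"]
 have "hausdorff_outer k (inv_into A f ` f ` A) \<le> hausdorff_outer k (f ` A)"
  by simp
 then show "hausdorff_outer k A \<le> hausdorff_outer k (f ` A)"
  using inj by simp
qed

text \<open>A grid of width \<open>1 / N\<close> covers the cube; the number of its boxes balances their weights.\<close>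

lemma hausdorff_outer_unit_cube_finite:
 "hausdorff_outer DIM('b) (cbox 0 One :: 'b::euclidean_space set) < top"
proof -
 let ?k = "DIM('b)"
 let ?Q = "cbox 0 One :: 'b set"
 have *: "hausdorff_pre ?k \<delta> ?Q \<le> ennreal ((2 * real ?k) ^ ?k)" if \<delta>: "0 < \<delta>" for \<delta>
 proof -
  obtain N where N: "real ?k / \<delta> < real N" using reals_Archimedean2 by blast
  moreover have "0 < real ?k / \<delta>" using \<delta> by simp
  ultimately have N0: "0 < real N" by linarith
  have kN: "real ?k / real N \<le> \<delta>" using N N0 \<delta> by (simp add: field_simps)
  define I where "I = PiE (Basis :: 'b set) (\<lambda>_. {0..N})"
  define Q where "Q f = cbox (\<Sum>b\<in>Basis. (real (f b) / real N) *\<^sub>R b) (\<Sum>b\<in>Basis. ((real (f b) + 1) / real N) *\<^sub>R b)"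
   for f :: "'b \<Rightarrow> nat"
  have finI: "finite I" unfolding I_def by (intro finite_PiE) auto
  have cardI: "card I = (N + 1) ^ ?k" unfolding I_def by (simp add: card_PiE)
  have mem: "x \<in> Q f \<longleftrightarrow> (\<forall>b\<in>Basis. real (f b) / real N \<le> x \<bullet> b \<and> x \<bullet> b \<le> (real (f b) + 1) / real N)" for x f
   by (auto simp: Q_def mem_box)
  have diam: "diameter (Q f) \<le> real ?k / real N" for f
  proof (rule diameter_le)
   fix x y assume xy: "x \<in> Q f" "y \<in> Q f"
   have "norm (x - y) \<le> (\<Sum>b\<in>Basis. \<bar>(x - y) \<bullet> b\<bar>)" by (rule norm_le_l1)
   also have "\<dots> \<le> (\<Sum>b\<in>(Basis :: 'b set). 1 / real N)"
   proof (rule sum_mono)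
    fix b :: 'b assume "b \<in> Basis"
    then have "real (f b) / real N \<le> x \<bullet> b" "x \<bullet> b \<le> real (f b) / real N + 1 / real N"
     "real (f b) / real N \<le> y \<bullet> b" "y \<bullet> b \<le> real (f b) / real N + 1 / real N"
     using xy by (auto simp: mem add_divide_distrib)
    then show "\<bar>(x - y) \<bullet> b\<bar> \<le> 1 / real N" by (simp add: inner_diff_left abs_le_iff)
   qed
   finally show "norm (x - y) \<le> real ?k / real N" by simp
  qed (use N0 in auto)
  obtain e where e: "bij_betw e {..<card I} I"
   using ex_bij_betw_nat_finite[OF finI] atLeast0LessThan by metis
  define C where "C i = (if i < card I then Q (e i) else {})" for i
  have "C \<in> covers \<delta> ?Q"
  proof -
   have "\<exists>i. x \<in> C i" if x: "x \<in> ?Q" for x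
   proof -
    define f where "f = restrict (\<lambda>b. nat \<lfloor>(x \<bullet> b) * real N\<rfloor>) Basis"
    have x01: "0 \<le> x \<bullet> b" "x \<bullet> b \<le> 1" if "b \<in> Basis" for b using x that by (auto simp: mem_box)
    have fb: "real (f b) = of_int \<lfloor>(x \<bullet> b) * real N\<rfloor>" if "b \<in> Basis" for b
     using x01[OF that] that by (simp add: f_def)
    have fI: "f \<in> I"
     unfolding I_def
    proof (rule PiE_I)
     fix b :: 'b assume b: "b \<in> Basis"
     have "real (f b) \<le> (x \<bullet> b) * real N" using fb[OF b] by linarith
     also have "\<dots> \<le> 1 * real N" using x01[OF b] by (intro mult_right_mono) auto
     finally show "f b \<in> {0..N}" by simp
    qed (simp add: f_def)
    have "x \<in> Q f"
     unfolding mem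
    proof (intro ballI conjI)
     fix b :: 'b assume b: "b \<in> Basis"
     show "real (f b) / real N \<le> x \<bullet> b" using fb[OF b] N0 by (simp add: field_simps)
     have "(x \<bullet> b) * real N \<le> real (f b) + 1" using fb[OF b] by linarith
     then show "x \<bullet> b \<le> (real (f b) + 1) / real N" using N0 by (simp add: field_simps)
    qed
    have "f \<in> e ` {..<card I}" using e fI by (simp add: bij_betw_def)
    then obtain i where "i < card I" "e i = f" by blast
    then show ?thesis using \<open>x \<in> Q f\<close> by (intro exI[of _ i]) (simp add: C_def)
   qed
   moreover have "bounded (C i)" "diameter (C i) \<le> \<delta>" for i
    using order_trans[OF diam kN] \<delta> by (auto simp: C_def Q_def)
   ultimately show ?thesis by (auto simp: covers_def)
  qed
  then have "hausdorff_pre ?k \<delta> ?Q \<le> (\<Sum>i. weight ?k (C i))" by (rule hausdorff_pre_le)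
  also have "\<dots> = (\<Sum>i<card I. weight ?k (C i))"
   by (rule suminf_finite) (auto simp: C_def)
  also have "\<dots> \<le> (\<Sum>i<card I. ennreal ((real ?k / real N) ^ ?k))"
  proof (rule sum_mono)
   fix i assume "i \<in> {..<card I}"
   then have "C i = Q (e i)" by (simp add: C_def)
   then have "weight ?k (C i) \<le> ennreal (diameter (Q (e i)) ^ ?k)" by (simp add: weight_le_diameter)
   also have "\<dots> \<le> ennreal ((real ?k / real N) ^ ?k)"
    by (intro ennreal_leI power_mono diam diameter_ge_0) (simp add: Q_def)
   finally show "weight ?k (C i) \<le> ennreal ((real ?k / real N) ^ ?k)" .
  qed
  also have "\<dots> = ennreal (real (card I) * (real ?k / real N) ^ ?k)"
   using N0 by (simp add: ennreal_mult ennreal_of_nat_eq_real_of_nat)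
  also have "\<dots> \<le> ennreal ((2 * real ?k) ^ ?k)"
  proof (rule ennreal_leI)
   have "real (card I) * (real ?k / real N) ^ ?k = ((real N + 1) * (real ?k / real N)) ^ ?k"
    by (simp only: cardI of_nat_power of_nat_add of_nat_1 power_mult_distrib)
   also have "\<dots> \<le> (2 * real N * (real ?k / real N)) ^ ?k"
    using N0 by (intro power_mono mult_right_mono) auto
   also have "2 * real N * (real ?k / real N) = 2 * real ?k" using N0 by simp
   finally show "real (card I) * (real ?k / real N) ^ ?k \<le> (2 * real ?k) ^ ?k" .
  qed
  finally show ?thesis .
 qed
 have "hausdorff_outer ?k ?Q \<le> ennreal ((2 * real ?k) ^ ?k)" by (rule hausdorff_outer_least) (rule *)
 then show ?thesis using ennreal_less_top le_less_trans by blast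
qed

text \<open>A set of diameter \<open>d\<close> lies in a cube of side \<open>2 * d\<close>, so Lebesgue measure bounds the weights of a covering from below.\<close>

lemma hausdorff_outer_unit_cube_pos:
 "hausdorff_outer DIM('b) (cbox 0 One :: 'b::euclidean_space set) > 0"
proof -
 let ?k = "DIM('b)"
 have "ennreal (1 / 2 ^ ?k) \<le> hausdorff_pre ?k 1 (cbox 0 One :: 'b set)"
  unfolding hausdorff_pre_alt
 proof (rule INF_greatest)
  fix C :: "nat \<Rightarrow> 'b set" assume C: "C \<in> covers 1 (cbox 0 One)"
  have bd: "bounded (C i)" for i using C by (auto simp: covers_def)
  have "\<exists>x. C i \<subseteq> cbox (x - diameter (C i) *\<^sub>R One) (x + diameter (C i) *\<^sub>R One)" for i
  proof (cases "C i = {}")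
   case False
   then obtain x where x: "x \<in> C i" by blast
   have "\<bar>(y - x) \<bullet> b\<bar> \<le> diameter (C i)" if "y \<in> C i" "b \<in> Basis" for y b
   proof -
    have "\<bar>(y - x) \<bullet> b\<bar> \<le> norm (y - x)" using that by (intro Basis_le_norm)
    also have "\<dots> \<le> diameter (C i)" using diameter_bounded_bound[OF bd \<open>y \<in> C i\<close> x] by (simp add: dist_norm)
    finally show ?thesis .
   qed
   then have "C i \<subseteq> cbox (x - diameter (C i) *\<^sub>R One) (x + diameter (C i) *\<^sub>R One)"
    by (auto simp: mem_box inner_diff_left inner_add_left abs_le_iff algebra_simps)
   then show ?thesis ..
  qed simp
  then obtain x where x: "\<And>i. C i \<subseteq> cbox (x i - diameter (C i) *\<^sub>R One) (x i + diameter (C i) *\<^sub>R One)"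
   by metis
  define D where "D i = (if C i = {} then {} else cbox (x i - diameter (C i) *\<^sub>R One) (x i + diameter (C i) *\<^sub>R One))" for i
  have D: "C i \<subseteq> D i" "D i \<in> sets lborel" for i using x by (auto simp: D_def)
  have "1 = emeasure lborel (cbox 0 One :: 'b set)" by (simp add: emeasure_lborel_cbox_eq)
  also have "\<dots> \<le> emeasure lborel (\<Union>i. D i)"
   using C D by (intro emeasure_mono) (fastforce simp: covers_def)+
  also have "\<dots> \<le> (\<Sum>i. emeasure lborel (D i))"
   using D by (intro emeasure_subadditive_countably) auto
  also have "\<dots> = (\<Sum>i. 2 ^ ?k * weight ?k (C i))"
  proof (intro suminf_cong)
   fix i
   have "emeasure lborel (cbox (x i - diameter (C i) *\<^sub>R One) (x i + diameter (C i) *\<^sub>R One)) =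
     ennreal ((2 * diameter (C i)) ^ ?k)"
    using diameter_ge_0[OF bd[of i]] by (simp add: emeasure_lborel_cbox_eq inner_diff_left inner_add_left)
   also have "\<dots> = 2 ^ ?k * ennreal (diameter (C i) ^ ?k)"
    using diameter_ge_0[OF bd[of i]] by (simp add: power_mult_distrib ennreal_mult ennreal_power[symmetric])
   finally show "emeasure lborel (D i) = 2 ^ ?k * weight ?k (C i)" by (simp add: D_def weight_def)
  qed
  also have "\<dots> = 2 ^ ?k * (\<Sum>i. weight ?k (C i))" by simp
  finally have "1 \<le> 2 ^ ?k * (\<Sum>i. weight ?k (C i))" .
  then have "ennreal (1 / 2 ^ ?k) * 1 \<le> ennreal (1 / 2 ^ ?k) * (2 ^ ?k * (\<Sum>i. weight ?k (C i)))"
   by (rule mult_left_mono) simp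
  also have "ennreal (1 / 2 ^ ?k) * (2 ^ ?k * (\<Sum>i. weight ?k (C i))) = (ennreal (1 / 2 ^ ?k) * ennreal (2 ^ ?k)) * (\<Sum>i. weight ?k (C i))"
   by (simp add: mult.assoc ennreal_power[symmetric])
  also have "ennreal (1 / 2 ^ ?k) * ennreal (2 ^ ?k) = 1"
   by (simp add: ennreal_mult[symmetric])
  finally show "ennreal (1 / 2 ^ ?k) \<le> (\<Sum>i. weight ?k (C i))" by simp
 qed
 also have "\<dots> \<le> hausdorff_outer ?k (cbox 0 One :: 'b set)" by (rule hausdorff_pre_le_outer) simp
 finally show ?thesis by (rule less_le_trans[rotated]) simp
qed

lemma hausdorff_outer_coordinate_cube:
 assumes "DIM('b) \<le> DIM('a)"
 shows "hausdorff_outer k (coordinate_cube DIM('b) :: 'a::euclidean_space set)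
  = hausdorff_outer k (cbox 0 One :: 'b::euclidean_space set)"
proof -
 define B where "B = (SOME B :: 'a set. B \<subseteq> Basis \<and> card B = DIM('b))"
 have "\<exists>B :: 'a set. B \<subseteq> Basis \<and> card B = DIM('b)"
  using obtain_subset_with_card_n[OF assms] by metis
 then have B: "B \<subseteq> Basis" "card B = DIM('b)" unfolding B_def by (metis (mono_tags, lifting) someI_ex)+
 have finB: "finite B" using B(1) finite_Basis by (rule finite_subset)
 obtain h where h: "bij_betw h (Basis :: 'b set) B"
  using finite_same_card_bij[OF finite_Basis finB] B(2) by auto
 define F where "F y = (\<Sum>b\<in>Basis. (y \<bullet> b) *\<^sub>R h b)" for y :: 'b
 have hB: "h b \<in> Basis" if "b \<in> Basis" for b using h B that by (auto simp: bij_betw_def)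
 have Fh: "F y \<bullet> h b = y \<bullet> b" if b: "b \<in> Basis" for y b
 proof -
  have "F y \<bullet> h b = (\<Sum>c\<in>Basis. (y \<bullet> c) * (h c \<bullet> h b))" by (simp add: F_def inner_sum_left)
  also have "\<dots> = (\<Sum>c\<in>Basis. if c = b then y \<bullet> c else 0)"
  proof (intro sum.cong refl)
   fix c :: 'b assume c: "c \<in> Basis"
   have "h c \<bullet> h b = (if c = b then 1 else 0)"
    using inner_Basis[OF hB[OF c] hB[OF b]] h b c by (auto simp: bij_betw_def inj_on_def)
   then show "(y \<bullet> c) * (h c \<bullet> h b) = (if c = b then y \<bullet> c else 0)" by simp
  qed
  finally show ?thesis using b by simp
 qed
 have Fo: "F y \<bullet> i = 0" if "i \<in> Basis - B" for y i
  using that h hB by (auto simp: F_def inner_sum_left inner_Basis bij_betw_def intro!: sum.neutral)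
 have nrm: "norm (F y) = norm y" for y
 proof -
  have "(norm (F y))\<^sup>2 = (\<Sum>i\<in>Basis. (F y \<bullet> i)\<^sup>2)" 
   unfolding power2_norm_eq_inner by (subst euclidean_inner) (simp add: power2_eq_square)
  also have "\<dots> = (\<Sum>i\<in>B. (F y \<bullet> i)\<^sup>2)"
   using B Fo by (intro sum.mono_neutral_right) auto
  also have "\<dots> = (\<Sum>b\<in>Basis. (F y \<bullet> h b)\<^sup>2)" by (rule sum.reindex_bij_betw[OF h, symmetric])
  also have "\<dots> = (norm y)\<^sup>2" 
   unfolding power2_norm_eq_inner by (subst euclidean_inner) (simp add: Fh power2_eq_square)
  finally show ?thesis by simp
 qed
 have lin: "F x - F y = F (x - y)" for x y
  by (simp add: F_def sum_subtractf inner_diff_left scaleR_left_diff_distrib)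
 have "F ` cbox 0 One = cbox 0 (\<Sum>B)"
 proof (intro equalityI subsetI)
  fix z assume "z \<in> F ` cbox 0 One"
  then obtain y where y: "z = F y" "y \<in> cbox 0 One" by blast
  show "z \<in> cbox 0 (\<Sum>B)"
   unfolding mem_box
  proof (intro ballI conjI)
   fix i :: 'a assume i: "i \<in> Basis"
   have sB: "\<Sum>B \<bullet> i = (if i \<in> B then 1 else 0)"
    using i B finB by (auto simp: inner_sum_left inner_Basis subset_iff sum.delta' cong: sum.cong)
   have "0 \<le> z \<bullet> i \<and> z \<bullet> i \<le> \<Sum>B \<bullet> i"
   proof (cases "i \<in> B")
    case True
    then obtain b where "b \<in> Basis" "i = h b" using h by (auto simp: bij_betw_def)
    then show ?thesis using True sB y Fh by (simp add: mem_box)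
   next
    case False
    then show ?thesis using sB y i Fo by simp
   qed
   then show "0 \<bullet> i \<le> z \<bullet> i" "z \<bullet> i \<le> \<Sum>B \<bullet> i" by auto
  qed
 next
  fix z assume z: "z \<in> cbox 0 (\<Sum>B)"
  define y where "y = (\<Sum>b\<in>Basis. (z \<bullet> h b) *\<^sub>R b)"
  have sB: "\<Sum>B \<bullet> i = (if i \<in> B then 1 else 0)" if "i \<in> Basis" for i
   using that B finB by (auto simp: inner_sum_left inner_Basis subset_iff sum.delta' cong: sum.cong)
  have yb: "y \<bullet> b = z \<bullet> h b" if "b \<in> Basis" for b using that by (simp add: y_def)
  have hBB: "h b \<in> B" if "b \<in> Basis" for b using h that by (auto simp: bij_betw_def)
  have "0 \<le> z \<bullet> h b \<and> z \<bullet> h b \<le> 1" if "b \<in> Basis" for b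
   using z hB[OF that] sB[OF hB[OF that]] hBB[OF that] by (auto simp: mem_box)
  then have "y \<in> cbox 0 One" by (auto simp: mem_box yb)
  moreover have "F y = z"
  proof (rule euclidean_eqI)
   fix i :: 'a assume i: "i \<in> Basis"
   show "F y \<bullet> i = z \<bullet> i"
   proof (cases "i \<in> B")
    case True
    then obtain b where "b \<in> Basis" "i = h b" using h by (auto simp: bij_betw_def)
    then show ?thesis using Fh yb by simp
   next
    case False
    then show ?thesis using Fo[of i y] z i sB[OF i] by (auto simp: mem_box dest!: bspec[OF _ i])
   qed
  qed
  ultimately show "z \<in> F ` cbox 0 One" by blast
 qed
 then have "coordinate_cube DIM('b) = F ` cbox 0 One" by (simp add: coordinate_cube_def B_def)
 then show ?thesis
  using hausdorff_outer_isometry[of "cbox 0 One" F k] by (simp add: dist_norm lin nrm)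
qed

text \<open>Both sides are the double integral of \<open>indicator A x * indicator B (x + y)\<close>, by translation in one variable and then in the other.\<close>

lemma emeasure_translation_invariant_unique:
 fixes M :: "'b::euclidean_space measure"
 assumes M: "sets M = sets borel" "sigma_finite_measure M"
  and inv: "\<And>v. distr M borel ((+) v) = M"
  and A: "A \<in> sets borel" and B: "B \<in> sets borel"
 shows "emeasure M A * emeasure lborel B = emeasure lborel A * emeasure M B"
proof -
 interpret M: sigma_finite_measure M by fact
 interpret P: pair_sigma_finite M lborel ..
 note [measurable_cong] = M(1)
 note [measurable] = A B
 have lb: "(\<integral>\<^sup>+y. indicator B (x + y) \<partial>lborel) = (\<integral>\<^sup>+y. indicator B y \<partial>lborel)" for x :: 'b
  by (subst (2) lborel_distr_plus[of x, symmetric], subst nn_integral_distr) auto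
 have tM: "(\<integral>\<^sup>+x. f (y + x) \<partial>M) = (\<integral>\<^sup>+x. f x \<partial>M)" if [measurable]: "f \<in> borel_measurable borel" for f and y :: 'b
  by (subst (2) inv[of y, symmetric], subst nn_integral_distr) auto
 have refl: "(\<integral>\<^sup>+y. indicator A (x - y) \<partial>lborel) = emeasure lborel A" for x :: 'b
 proof -
  have "distr lborel borel (\<lambda>y. x - y) = (lborel :: 'b measure)"
   using lborel_affine[of "-1" x] by (simp add: density_1)
  then have "emeasure lborel A = (\<integral>\<^sup>+y. indicator A y \<partial>distr lborel borel (\<lambda>y. x - y))"
   by (simp)
  also have "\<dots> = (\<integral>\<^sup>+y. indicator A (x - y) \<partial>lborel)"
   by (rule nn_integral_distr) measurable
  finally show ?thesis by simp
 qed
 have "emeasure M A * emeasure lborel B = (\<integral>\<^sup>+x. indicator A x * (\<integral>\<^sup>+y. indicator B y \<partial>lborel) \<partial>M)"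
  using A B by (simp add: nn_integral_multc nn_integral_indicator M(1))
 also have "\<dots> = (\<integral>\<^sup>+x. indicator A x * (\<integral>\<^sup>+y. indicator B (x + y) \<partial>lborel) \<partial>M)"
  by (simp only: lb)
 also have "\<dots> = (\<integral>\<^sup>+x. (\<integral>\<^sup>+y. indicator A x * indicator B (x + y) \<partial>lborel) \<partial>M)"
  by (simp add: nn_integral_cmult)
 also have "\<dots> = (\<integral>\<^sup>+y. (\<integral>\<^sup>+x. indicator A x * indicator B (x + y) \<partial>M) \<partial>lborel)"
  by (rule P.Fubini'[symmetric]) measurable
 also have "\<dots> = (\<integral>\<^sup>+y. (\<integral>\<^sup>+x. indicator A (x - y) * indicator B x \<partial>M) \<partial>lborel)"
 proof (rule nn_integral_cong)
  fix y :: 'b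
  show "(\<integral>\<^sup>+x. indicator A x * indicator B (x + y) \<partial>M) = (\<integral>\<^sup>+x. indicator A (x - y) * indicator B x \<partial>M)"
   using tM[of "\<lambda>x. indicator A (x - y) * indicator B x" y] by (simp add: add.commute)
 qed
 also have "\<dots> = (\<integral>\<^sup>+x. (\<integral>\<^sup>+y. indicator A (x - y) * indicator B x \<partial>lborel) \<partial>M)"
  by (rule P.Fubini') measurable
 also have "\<dots> = (\<integral>\<^sup>+x. emeasure lborel A * indicator B x \<partial>M)"
  by (simp add: nn_integral_multc refl)
 also have "\<dots> = emeasure lborel A * emeasure M B"
  using B by (simp add: nn_integral_cmult M(1))
 finally show ?thesis .
qed

section \<open>Affine images\<close>

text \<open>The factor by which a linear map scales measure, read off from the unit cube.\<close>

definition jacobian :: "('b::euclidean_space \<Rightarrow> 'a::euclidean_space) \<Rightarrow> real" where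
 "jacobian F = measure (hausdorff DIM('b)) (F ` cbox 0 One)"

lemma emeasure_hausdorff_isometry:
 fixes f :: "'a::euclidean_space \<Rightarrow> 'a"
 assumes "A \<in> sets borel" "f ` A \<in> sets borel"
  and "\<And>x y. x \<in> A \<Longrightarrow> y \<in> A \<Longrightarrow> dist (f x) (f y) = dist x y"
 shows "emeasure (hausdorff k) (f ` A) = emeasure (hausdorff k) A"
 using assms by (simp add: emeasure_hausdorff hausdorff_outer_isometry)

context
 fixes F :: "'b::euclidean_space \<Rightarrow> 'a::euclidean_space" and p :: 'a
 assumes lin: "linear F" and inj: "inj F"
begin

lemma linear_left_inverse:
 obtains G where "linear G" "\<And>y. G (F y) = y"
 using linear_injective_left_inverse[OF lin inj] by (metis comp_apply id_apply)

lemma affine_image_borel: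
 assumes [measurable]: "A \<in> sets borel"
 shows "(\<lambda>y. p + F y) ` A \<in> sets borel"
proof -
 obtain G where G: "linear G" "\<And>y. G (F y) = y" by (rule linear_left_inverse) blast
 have [measurable]: "F \<in> borel_measurable borel" "G \<in> borel_measurable borel"
  using lin G(1) by (auto intro!: borel_measurable_continuous_onI linear_continuous_on simp: linear_conv_bounded_linear)
 have "(\<lambda>y. p + F y) ` A = {x\<in>space borel. p + F (G (x - p)) = x \<and> G (x - p) \<in> A}"
  using G(2) by (force simp: image_iff)
 also have "\<dots> \<in> sets borel" by measurable
 finally show ?thesis .
qed

lemma dim_le: "DIM('b) \<le> DIM('a)"
 by (metis dim_UNIV dim_image_eq dim_subset_UNIV inj lin inj_on_subset subset_UNIV)

lemma hausdorff_coordinate_cube: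
 shows "0 < hausdorff_outer DIM('b) (coordinate_cube DIM('b) :: 'a set)"
  and "hausdorff_outer DIM('b) (coordinate_cube DIM('b) :: 'a set) < top"
 using hausdorff_outer_coordinate_cube[OF dim_le, of "DIM('b)"] hausdorff_outer_unit_cube_pos[where 'b='b]
  hausdorff_outer_unit_cube_finite[where 'b='b] by simp_all

lemma emeasure_affine_image_cbox_finite:
 "emeasure (hausdorff DIM('b)) ((\<lambda>y. p + F y) ` cbox (- (r *\<^sub>R One)) (r *\<^sub>R One)) < top"
proof -
 let ?s = "2 * \<bar>r\<bar> + 1"
 define h where "h y = p + F (?s *\<^sub>R y - r *\<^sub>R One)" for y
 obtain B where B: "0 < B" "\<And>x. norm (F x) \<le> B * norm x"
  using linear_bounded_pos[OF lin] by blast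
 have "(\<lambda>y. p + F y) ` cbox (- (r *\<^sub>R One)) (r *\<^sub>R One) \<subseteq> h ` cbox 0 One"
 proof safe
  fix y :: 'b assume y: "y \<in> cbox (- (r *\<^sub>R One)) (r *\<^sub>R One)"
  have "0 \<le> (y \<bullet> b + r) / ?s \<and> (y \<bullet> b + r) / ?s \<le> 1" if "b \<in> Basis" for b
  proof -
   have "- r \<le> y \<bullet> b" "y \<bullet> b \<le> r" using y that by (auto simp: mem_box)
   then show ?thesis by (intro conjI divide_nonneg_pos, auto simp: divide_le_eq_1)
  qed
  then have "(1 / ?s) *\<^sub>R (y + r *\<^sub>R One) \<in> cbox 0 One"
   by (simp add: mem_box inner_add_left)
  moreover have "p + F y = h ((1 / ?s) *\<^sub>R (y + r *\<^sub>R One))" 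
  proof -
   have "?s \<noteq> 0" by linarith
   then show ?thesis by (simp add: h_def)
  qed
  ultimately show "p + F y \<in> h ` cbox 0 One" by blast
 qed
 then have "hausdorff_outer DIM('b) ((\<lambda>y. p + F y) ` cbox (- (r *\<^sub>R One)) (r *\<^sub>R One))
   \<le> hausdorff_outer DIM('b) (h ` cbox 0 One)"
  by (rule hausdorff_outer_mono)
 also have "\<dots> \<le> ennreal ((B * ?s) ^ DIM('b)) * hausdorff_outer DIM('b) (cbox 0 One :: 'b set)"
 proof (rule hausdorff_outer_lipschitz_le)
  fix x y :: 'b
  have "dist (h x) (h y) = norm (F (?s *\<^sub>R (x - y)))"
   using lin by (simp add: h_def dist_norm linear_diff[symmetric] algebra_simps)
  also have "\<dots> \<le> B * norm (?s *\<^sub>R (x - y))" by (rule B(2))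
  also have "\<dots> = B * ?s * dist x y" by (simp add: dist_norm)
  finally show "dist (h x) (h y) \<le> B * ?s * dist x y" .
 qed (use B in auto)
 also have "\<dots> < top"
  using hausdorff_outer_unit_cube_finite[where 'b='b] by (simp add: ennreal_mult_less_top)
 finally have "hausdorff_outer DIM('b) ((\<lambda>y. p + F y) ` cbox (- (r *\<^sub>R One)) (r *\<^sub>R One)) < top" .
 then show ?thesis
  using hausdorff_coordinate_cube
  by (auto simp: emeasure_hausdorff affine_image_borel divide_ennreal_def ennreal_mult_less_top
    less_top[symmetric] ennreal_inverse_eq_top_iff ennreal_mult_eq_top_iff)
qed

text \<open>Pulled back along the affine map, Hausdorff measure is translation invariant and hence a multiple of Lebesgue measure.\<close>

lemma emeasure_affine_image_mult:
 assumes A: "A \<in> sets borel"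
 shows "emeasure (hausdorff DIM('b)) ((\<lambda>y. p + F y) ` A)
  = emeasure lborel A * emeasure (hausdorff DIM('b)) ((\<lambda>y. p + F y) ` cbox 0 One)"
proof -
 let ?H = "hausdorff DIM('b) :: 'a measure"
 let ?F = "\<lambda>y. p + F y"
 obtain G where G: "linear G" "\<And>y. G (F y) = y" by (rule linear_left_inverse) blast
 have Gm [measurable]: "(\<lambda>x. G (x - p)) \<in> borel_measurable borel"
  using G(1) by (intro borel_measurable_continuous_onI continuous_intros
    linear_continuous_on_compose[where f="\<lambda>x. x - p"])
 have R: "range ?F \<in> sets borel" by (rule affine_image_borel) simp
 define M where "M = distr (restrict_space ?H (range ?F)) borel (\<lambda>x. G (x - p))"
 have emM: "emeasure M A = emeasure ?H (?F ` A)" if A: "A \<in> sets borel" for A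
 proof -
  have "emeasure M A = emeasure (restrict_space ?H (range ?F)) ((\<lambda>x. G (x - p)) -` A \<inter> range ?F)"
   unfolding M_def using A
   by (subst emeasure_distr) (auto intro!: measurable_restrict_space1 simp: space_restrict_space)
  also have "(\<lambda>x. G (x - p)) -` A \<inter> range ?F = ?F ` A"
   using G(2) by auto
  also have "emeasure (restrict_space ?H (range ?F)) (?F ` A) = emeasure ?H (?F ` A)"
   using R by (intro emeasure_restrict_space) auto
  finally show ?thesis .
 qed
 have setsM: "sets M = sets borel" by (simp add: M_def)
 have inv: "distr M borel ((+) v) = M" for v
 proof (rule measure_eqI)
  fix A assume "A \<in> sets (distr M borel ((+) v))"
  then have A [measurable]: "A \<in> sets borel" by simp
  have "(+) v \<in> measurable borel borel" by measurable
  from measurable_sets[OF this A] have V: "(+) v -` A \<in> sets borel" by simp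
  have FV: "(+) (F v) ` ?F ` ((+) v -` A) = ?F ` A"
  proof (intro equalityI subsetI)
   fix x assume "x \<in> (+) (F v) ` ?F ` ((+) v -` A)"
   then obtain y where "v + y \<in> A" "x = p + F (v + y)" using lin by (auto simp: linear_add)
   then show "x \<in> ?F ` A" by blast
  next
   fix x assume "x \<in> ?F ` A"
   then obtain y where y: "y \<in> A" "x = p + F y" by blast
   then have "x = F v + (p + F (y - v))" using lin by (simp add: linear_diff)
   moreover have "y - v \<in> (+) v -` A" using y by simp
   ultimately show "x \<in> (+) (F v) ` ?F ` ((+) v -` A)" by blast
  qed
  have "emeasure (distr M borel ((+) v)) A = emeasure M ((+) v -` A)"
   using A by (subst emeasure_distr) (auto simp: M_def cong: measurable_cong_sets)
  also have "\<dots> = emeasure ?H (?F ` ((+) v -` A))" by (rule emM[OF V])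
  also have "\<dots> = emeasure ?H ((+) (F v) ` ?F ` ((+) v -` A))"
  proof (rule emeasure_hausdorff_isometry[symmetric])
   show "?F ` ((+) v -` A) \<in> sets borel" by (rule affine_image_borel[OF V])
   show "(+) (F v) ` ?F ` ((+) v -` A) \<in> sets borel" using affine_image_borel[OF A] FV by simp
  qed (simp add: dist_norm)
  also note FV
  also have "emeasure ?H (?F ` A) = emeasure M A" by (rule emM[OF A, symmetric])
  finally show "emeasure (distr M borel ((+) v)) A = emeasure M A" .
 qed (simp add: setsM)
 have "sigma_finite_measure M"
 proof
  show "\<exists>Q. countable Q \<and> Q \<subseteq> sets M \<and> \<Union>Q = space M \<and> (\<forall>a\<in>Q. emeasure M a \<noteq> \<infinity>)"
  proof (intro exI conjI ballI)
   show "countable (range (\<lambda>n::nat. cbox (- (real n *\<^sub>R One)) (real n *\<^sub>R One) :: 'b set))" by simp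
   show "range (\<lambda>n::nat. cbox (- (real n *\<^sub>R One)) (real n *\<^sub>R One) :: 'b set) \<subseteq> sets M"
    by (auto simp: setsM)
   show "\<Union>(range (\<lambda>n::nat. cbox (- (real n *\<^sub>R One)) (real n *\<^sub>R One) :: 'b set)) = space M"
   proof -
    have "\<exists>n::nat. x \<in> cbox (- (real n *\<^sub>R One)) (real n *\<^sub>R One)" for x :: 'b
    proof -
     obtain n :: nat where n: "norm x \<le> real n" using real_arch_simple by blast
     have "\<bar>x \<bullet> b\<bar> \<le> real n" if "b \<in> Basis" for b using Basis_le_norm[OF that, of x] n by linarith
     then have "- real n \<le> x \<bullet> b \<and> x \<bullet> b \<le> real n" if "b \<in> Basis" for b
      using that by (simp add: abs_le_iff minus_le_iff)
     then show ?thesis by (intro exI[of _ n]) (simp add: mem_box)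
    qed
    then show ?thesis by (auto simp: M_def)
   qed
   fix a assume "a \<in> range (\<lambda>n::nat. cbox (- (real n *\<^sub>R One)) (real n *\<^sub>R One) :: 'b set)"
   then show "emeasure M a \<noteq> \<infinity>"
    using emeasure_affine_image_cbox_finite by (auto simp: emM less_top)
  qed
 qed
 from emeasure_translation_invariant_unique[OF setsM this inv A, of "cbox 0 One"]
 show ?thesis using A by (simp add: emM emeasure_lborel_cbox_eq)
qed

end

lemma emeasure_affine_image:
 fixes F :: "'b::euclidean_space \<Rightarrow> 'a::euclidean_space"
 assumes lin: "linear F" and inj: "inj F" and A: "A \<in> sets borel"
 shows "emeasure (hausdorff DIM('b)) ((\<lambda>y. p + F y) ` A) = ennreal (jacobian F) * emeasure lborel A"
proof -
 let ?H = "hausdorff DIM('b) :: 'a measure"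
 have b: "F ` cbox 0 One \<in> sets borel" using affine_image_borel[OF lin inj, of "cbox 0 One" 0] by simp
 have b': "(+) p ` F ` cbox 0 One \<in> sets borel" using affine_image_borel[OF lin inj, of "cbox 0 One" p] by (simp add: image_image)
 have "F ` cbox 0 One \<subseteq> (\<lambda>y. 0 + F y) ` cbox (- (1 *\<^sub>R One)) (1 *\<^sub>R One)"
  by (force simp: mem_box intro!: imageI)
 then have "emeasure ?H (F ` cbox 0 One) \<le> emeasure ?H ((\<lambda>y. 0 + F y) ` cbox (- (1 *\<^sub>R One)) (1 *\<^sub>R One))"
  using affine_image_borel[OF lin inj, of "cbox (- (1 *\<^sub>R One)) (1 *\<^sub>R One)" 0] by (intro emeasure_mono) auto
 also have "\<dots> < top" by (rule emeasure_affine_image_cbox_finite[OF lin inj])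
 finally have fin: "emeasure ?H (F ` cbox 0 One) < top" .
 have "emeasure ?H ((\<lambda>y. p + F y) ` cbox 0 One) = emeasure ?H (F ` cbox 0 One)"
  using emeasure_hausdorff_isometry[OF b b', of "DIM('b)"] by (simp add: dist_norm image_image)
 then show ?thesis
  using emeasure_affine_image_mult[OF lin inj A, of p] fin
  by (simp add: jacobian_def emeasure_eq_ennreal_measure mult.commute)
qed

lemma jacobian_pos:
 fixes F :: "'b::euclidean_space \<Rightarrow> 'a::euclidean_space"
 assumes lin: "linear F" and inj: "inj F"
 shows "0 < jacobian F"
proof -
 let ?H = "hausdorff DIM('b) :: 'a measure"
 obtain G where G: "linear G" "\<And>y. G (F y) = y" by (rule linear_left_inverse[OF lin inj]) blast
 obtain B where B: "0 < B" "\<And>x. norm (G x) \<le> B * norm x"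
  using linear_bounded_pos[OF G(1)] by blast
 have "cbox 0 One = G ` F ` cbox 0 One" using G(2) by (simp add: image_image)
 then have "hausdorff_outer DIM('b) (cbox 0 One :: 'b set) = hausdorff_outer DIM('b) (G ` F ` cbox 0 One)"
  by simp
 also have "\<dots> \<le> ennreal (B ^ DIM('b)) * hausdorff_outer DIM('b) (F ` cbox 0 One)"
  by (rule hausdorff_outer_lipschitz_le[OF B(1)]) (use B G(1) in \<open>auto simp: dist_norm linear_diff[symmetric]\<close>)
 finally have "0 < hausdorff_outer DIM('b) (F ` cbox 0 One)"
  using hausdorff_outer_unit_cube_pos[where 'b='b] by (auto simp: zero_less_iff_neq_zero)
 then have "emeasure ?H (F ` cbox 0 One) \<noteq> 0"
  using affine_image_borel[OF lin inj, of "cbox 0 One" 0] hausdorff_coordinate_cube[OF lin inj]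
  by (auto simp: emeasure_hausdorff divide_ennreal_def)
 moreover have "emeasure ?H (F ` cbox 0 One) = ennreal (jacobian F)"
  using emeasure_affine_image[OF lin inj, of "cbox 0 One" 0] by (simp add: emeasure_lborel_cbox_eq)
 ultimately show ?thesis by (simp add: ennreal_eq_0_iff)
qed

lemma jacobian_isometry:
 fixes F :: "'b::euclidean_space \<Rightarrow> 'a::euclidean_space"
 assumes lin: "linear F" and iso: "\<And>y. norm (F y) = norm y"
 shows "jacobian F = 1"
proof -
 have inj: "inj F" using iso by (metis linear_injective_0[OF lin] norm_eq_zero)
 have "hausdorff_outer DIM('b) (F ` cbox 0 One) = hausdorff_outer DIM('b) (cbox 0 One :: 'b set)"
  by (rule hausdorff_outer_isometry) (use lin iso in \<open>auto simp: dist_norm linear_diff[symmetric]\<close>)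
 also have "\<dots> = hausdorff_outer DIM('b) (coordinate_cube DIM('b) :: 'a set)"
  by (rule hausdorff_outer_coordinate_cube[OF dim_le[OF lin inj], symmetric])
 finally have "emeasure (hausdorff DIM('b)) (F ` cbox 0 One) = 1"
  using affine_image_borel[OF lin inj, of "cbox 0 One" 0] hausdorff_coordinate_cube[OF lin inj]
  by (simp add: emeasure_hausdorff ennreal_divide_self)
 then show ?thesis by (simp add: jacobian_def measure_def)
qed

lemma measure_affine_image:
 fixes F :: "'b::euclidean_space \<Rightarrow> 'a::euclidean_space"
 assumes lin: "linear F" and inj: "inj F" and A: "A \<in> sets borel"
 shows "measure (hausdorff DIM('b)) ((\<lambda>y. p + F y) ` A) = jacobian F * measure lborel A"
 using emeasure_affine_image[OF assms, of p] jacobian_pos[OF lin inj]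
 by (simp add: measure_def enn2real_mult)

lemma integral_affine_image:
 fixes F :: "'b::euclidean_space \<Rightarrow> 'a::euclidean_space" and g :: "'a \<Rightarrow> real"
 assumes lin: "linear F" and inj: "inj F" and A: "A \<in> sets borel"
  and g: "(\<lambda>y. indicator A y *\<^sub>R g (p + F y)) \<in> borel_measurable borel"
 shows "(LINT x:(\<lambda>y. p + F y) ` A|hausdorff DIM('b). g x) = jacobian F * (LINT y:A|lborel. g (p + F y))"
proof -
 let ?H = "hausdorff DIM('b) :: 'a measure"
 let ?F = "\<lambda>y. p + F y"
 let ?h = "\<lambda>y. indicator A y *\<^sub>R g (p + F y)"
 obtain G where G: "linear G" "\<And>y. G (F y) = y" by (rule linear_left_inverse[OF lin inj]) blast
 have Gm [measurable]: "(\<lambda>x. G (x - p)) \<in> borel_measurable borel"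
  using G(1) by (intro borel_measurable_continuous_onI continuous_intros
    linear_continuous_on_compose[where f="\<lambda>x. x - p"])
 have R: "range ?F \<in> sets borel" using affine_image_borel[OF lin inj, of UNIV] by simp
 have M: "distr (restrict_space ?H (range ?F)) borel (\<lambda>x. G (x - p)) = density lborel (\<lambda>_. ennreal (jacobian F))"
  (is "?M = _")
 proof (rule measure_eqI)
  fix A assume "A \<in> sets (distr (restrict_space ?H (range ?F)) borel (\<lambda>x. G (x - p)))"
  then have A: "A \<in> sets borel" by simp
  have "emeasure ?M A = emeasure (restrict_space ?H (range ?F)) ((\<lambda>x. G (x - p)) -` A \<inter> range ?F)"
   using A by (subst emeasure_distr) (auto intro!: measurable_restrict_space1 simp: space_restrict_space)
  also have "(\<lambda>x. G (x - p)) -` A \<inter> range ?F = ?F ` A" using G(2) by auto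
  also have "emeasure (restrict_space ?H (range ?F)) (?F ` A) = emeasure ?H (?F ` A)"
   using R by (intro emeasure_restrict_space) auto
  finally show "emeasure ?M A = emeasure (density lborel (\<lambda>_. ennreal (jacobian F))) A"
   using emeasure_affine_image[OF lin inj A, of p] A by (simp add: emeasure_density nn_integral_cmult)
 qed simp
 have "(LINT x:?F ` A|?H. g x) = (LINT x|?H. indicator (range ?F) x *\<^sub>R ?h (G (x - p)))"
  unfolding set_lebesgue_integral_def
 proof (rule Bochner_Integration.integral_cong[OF refl])
  fix x
  show "indicator (?F ` A) x *\<^sub>R g x = indicator (range ?F) x *\<^sub>R ?h (G (x - p))"
  proof (cases "x \<in> range ?F")
   case True
   then obtain y where y: "x = ?F y" by blast
   then have "x \<in> ?F ` A \<longleftrightarrow> y \<in> A" by (auto dest!: injD[OF inj])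
   then show ?thesis using y G(2) by (auto simp: indicator_def)
  next
   case False
   then have "x \<notin> ?F ` A" by blast
   then show ?thesis using False by simp
  qed
 qed
 also have "\<dots> = (LINT x|restrict_space ?H (range ?F). ?h (G (x - p)))"
  using R by (subst integral_restrict_space) auto
 also have "\<dots> = (LINT y|?M. ?h y)"
  by (rule integral_distr[symmetric]) (use g in \<open>auto intro!: measurable_restrict_space1\<close>)
 also have "\<dots> = (LINT y|lborel. jacobian F *\<^sub>R ?h y)"
  unfolding M using g jacobian_pos[OF lin inj] by (intro integral_density) auto
 also have "\<dots> = jacobian F * (LINT y:A|lborel. g (p + F y))"
  by (simp add: set_lebesgue_integral_def)
 finally show ?thesis .
qed

subsection \<open>Lengths and areas\<close>

lemma jacobian_real:
 fixes d :: "'a::euclidean_space"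
 assumes "d \<noteq> 0"
 shows "jacobian (\<lambda>t::real. t *\<^sub>R d) = norm d"
proof -
 let ?u = "d /\<^sub>R norm d"
 have lin: "linear (\<lambda>t::real. t *\<^sub>R v)" for v :: 'a by (rule linear_scaleR_left)
 have nu: "norm ?u = 1" using assms by simp
 have inj: "inj (\<lambda>t::real. t *\<^sub>R ?u)" using nu by (auto simp: inj_def)
 have "(\<lambda>t. t *\<^sub>R d) ` cbox 0 (1::real) = (\<lambda>y. 0 + y *\<^sub>R ?u) ` {0..norm d}"
 proof (intro equalityI subsetI)
  fix x assume "x \<in> (\<lambda>t. t *\<^sub>R d) ` cbox 0 (1::real)"
  then obtain t where "0 \<le> t" "t \<le> 1" "x = t *\<^sub>R d" by auto
  then have "x = 0 + (t * norm d) *\<^sub>R ?u" "t * norm d \<in> {0..norm d}"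
   using assms by (auto simp: mult_left_le_one_le)
  then show "x \<in> (\<lambda>y. 0 + y *\<^sub>R ?u) ` {0..norm d}" by blast
 next
  fix x assume "x \<in> (\<lambda>y. 0 + y *\<^sub>R ?u) ` {0..norm d}"
  then obtain t where "0 \<le> t" "t \<le> norm d" "x = t *\<^sub>R ?u" by auto
  then have "x = (t / norm d) *\<^sub>R d" "t / norm d \<in> cbox 0 1"
   using assms by (auto simp: field_simps)
  then show "x \<in> (\<lambda>t. t *\<^sub>R d) ` cbox 0 (1::real)" by blast
 qed
 then have "jacobian (\<lambda>t::real. t *\<^sub>R d) = measure (hausdorff DIM(real)) ((\<lambda>y. 0 + y *\<^sub>R ?u) ` {0..norm d})"
  by (simp add: jacobian_def)
 also have "\<dots> = jacobian (\<lambda>t::real. t *\<^sub>R ?u) * norm d"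
  using measure_affine_image[OF lin inj, of "{0..norm d}" 0] by simp
 also have "jacobian (\<lambda>t::real. t *\<^sub>R ?u) = 1"
  by (rule jacobian_isometry[OF lin]) (subst norm_scaleR, subst nu, simp)
 finally show ?thesis by simp
qed

text \<open>The square of the area of a parallelogram.\<close>

definition gram :: "'a::real_inner \<Rightarrow> 'a \<Rightarrow> real" where
 "gram a b = (a \<bullet> a) * (b \<bullet> b) - (a \<bullet> b)\<^sup>2"

lemma gram_pos:
 assumes "\<And>s t. s *\<^sub>R a + t *\<^sub>R b = 0 \<Longrightarrow> s = 0 \<and> t = 0"
 shows "0 < gram a b"
proof -
 have a: "a \<noteq> 0" using assms[of 1 0] by auto
 let ?c = "b - ((b \<bullet> a) / (a \<bullet> a)) *\<^sub>R a"
 have "?c \<noteq> 0" using assms[of "- ((b \<bullet> a) / (a \<bullet> a))" 1] by (auto simp: algebra_simps)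
 then have "0 < (a \<bullet> a) * (?c \<bullet> ?c)" using a by simp
 also have "\<dots> = gram a b"
  using a by (simp add: gram_def inner_diff_left inner_diff_right inner_commute[of b a] field_simps power2_eq_square)
 finally show ?thesis .
qed

text \<open>By orthogonalization the map is an isometry after a triangular map of the plane, whose determinant is explicit.\<close>

lemma jacobian_real2:
 fixes a b :: "'a::euclidean_space"
 assumes ind: "\<And>s t. s *\<^sub>R a + t *\<^sub>R b = 0 \<Longrightarrow> s = 0 \<and> t = 0"
 shows "jacobian (\<lambda>x::real^2. x $ 1 *\<^sub>R a + x $ 2 *\<^sub>R b) = sqrt (gram a b)"
proof -
 have a: "a \<noteq> 0" using ind[of 1 0] by auto
 define c where "c = b - ((b \<bullet> a) / (a \<bullet> a)) *\<^sub>R a"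
 have c: "c \<noteq> 0" using ind[of "- ((b \<bullet> a) / (a \<bullet> a))" 1] by (auto simp: c_def algebra_simps)
 have ac: "a \<bullet> c = 0" using a by (simp add: c_def inner_diff_right inner_commute)
 define e f where "e = a /\<^sub>R norm a" and "f = c /\<^sub>R norm c"
 have ef: "e \<bullet> e = 1" "f \<bullet> f = 1" "e \<bullet> f = 0"
  using a c ac by (simp_all add: e_def f_def dot_square_norm power2_eq_square)
 define E where "E x = x $ 1 *\<^sub>R e + x $ 2 *\<^sub>R f" for x :: "real^2"
 define L where "L x = (vector [x $ 1 * norm a + x $ 2 * (b \<bullet> e), x $ 2 * norm c] :: real^2)" for x :: "real^2"
 have lE: "linear E" unfolding E_def by (intro linearI) (auto simp: algebra_simps)
 have lL: "linear L" unfolding L_def by (intro linearI) (auto simp: vec_eq_iff forall_2 algebra_simps)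
 have isoE: "norm (E y) = norm y" for y
  by (simp add: E_def norm_eq_sqrt_inner inner_add_left inner_add_right ef inner_commute[of f e]
    inner_vec_def sum_2)
 have injE: "inj E" using isoE by (metis linear_injective_0[OF lE] norm_eq_zero)
 have bE: "b = (b \<bullet> e) *\<^sub>R e + norm c *\<^sub>R f"
 proof -
  have "(b \<bullet> e) *\<^sub>R e = ((b \<bullet> a) / (a \<bullet> a)) *\<^sub>R a"
   by (simp add: e_def dot_square_norm power2_eq_square divide_inverse mult_ac)
  moreover have "norm c *\<^sub>R f = c" using c by (simp add: f_def)
  ultimately show ?thesis by (simp add: c_def)
 qed
 have aE: "a = norm a *\<^sub>R e" using a by (simp add: e_def)
 have comp: "x $ 1 *\<^sub>R a + x $ 2 *\<^sub>R b = E (L x)" for x :: "real^2"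
 proof -
  have "x $ 1 *\<^sub>R a + x $ 2 *\<^sub>R b = x $ 1 *\<^sub>R (norm a *\<^sub>R e) + x $ 2 *\<^sub>R ((b \<bullet> e) *\<^sub>R e + norm c *\<^sub>R f)"
   using aE bE by metis
  then show ?thesis by (simp add: E_def L_def algebra_simps)
 qed
 have detL: "det (matrix L) = norm a * norm c"
  by (simp add: det_2 matrix_def L_def axis_def)
 have bL: "L ` cbox 0 One \<in> sets borel" "compact (L ` cbox 0 One)"
  using lL by (auto intro!: compact_imp_closed borel_closed compact_continuous_image linear_continuous_on
    simp: linear_conv_bounded_linear)
 have "measure lborel (L ` cbox 0 One) = measure lebesgue (L ` cbox 0 One)"
  using bL by (simp add: measure_completion)
 also have "\<dots> = \<bar>det (matrix L)\<bar> * measure lebesgue (cbox 0 (One :: real^2))"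
  by (rule measure_linear_image[OF lL]) simp
 finally have mL: "measure lborel (L ` cbox 0 One) = norm a * norm c"
  using detL by (simp add: measure_lborel_cbox_eq)
 have "jacobian (\<lambda>x::real^2. x $ 1 *\<^sub>R a + x $ 2 *\<^sub>R b) = measure (hausdorff DIM(real^2)) ((\<lambda>y. 0 + E y) ` L ` cbox 0 One)"
  by (simp add: jacobian_def comp image_image)
 also have "\<dots> = norm a * norm c"
  using measure_affine_image[OF lE injE bL(1), of 0] jacobian_isometry[OF lE isoE] mL by simp
 also have "\<dots> = sqrt (gram a b)"
 proof -
  have "(norm a * norm c)\<^sup>2 = (a \<bullet> a) * (c \<bullet> c)" by (simp add: power_mult_distrib dot_square_norm)
  also have "\<dots> = gram a b"
   using a by (simp add: c_def gram_def inner_diff_left inner_diff_right inner_commute[of b a] field_simps power2_eq_square)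
  finally show ?thesis by (metis norm_ge_zero mult_nonneg_nonneg real_sqrt_abs abs_of_nonneg)
 qed
 finally show ?thesis .
qed

subsection \<open>Quadrature\<close>

text \<open>The mean of a quadratic polynomial over a simplex. In barycentric coordinates the polynomial is a
quadratic form whose coefficients are \<open>2 * g mid - g P / 2 - g Q / 2\<close>, and the mean of a product of
two coordinates is proportional to \<open>2\<close> or \<open>1\<close> according to whether they agree.\<close>

definition quad_avg :: "'a::real_vector set \<Rightarrow> ('a \<Rightarrow> real) \<Rightarrow> real" where
 "quad_avg V g = (\<Sum>P\<in>V. \<Sum>Q\<in>V. (if P = Q then 2 else 1) *
   (2 * g ((1/2) *\<^sub>R (P + Q)) - g P / 2 - g Q / 2)) / (real (card V) * (real (card V) + 1))"

lemma quad_avg_two: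
 "a \<noteq> b \<Longrightarrow> quad_avg {a, b} g = (g a + 4 * g ((1/2) *\<^sub>R (a + b)) + g b) / 6"
 by (simp add: quad_avg_def scaleR_2[symmetric] add.commute[of b a])

lemma quad_avg_three:
 assumes "a \<noteq> b" "a \<noteq> c" "b \<noteq> c"
 shows "quad_avg {a, b, c} g = (g ((1/2) *\<^sub>R (a + b)) + g ((1/2) *\<^sub>R (a + c)) + g ((1/2) *\<^sub>R (b + c))) / 3"
 using assms by (simp add: quad_avg_def scaleR_2[symmetric] add.commute[of b a] add.commute[of c a] add.commute[of c b])

lemma integral_quadratic_interval:
 fixes c0 c1 c2 l :: real
 assumes "0 \<le> l"
 shows "(LINT t:{0..l}|lborel. c0 + c1 * t + c2 * t\<^sup>2) = c0 * l + c1 * l\<^sup>2 / 2 + c2 * l ^ 3 / 3"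
proof -
 have "((\<lambda>t. c0 + c1 * t + c2 * t\<^sup>2) has_integral
   (c0 * l + c1 * l\<^sup>2 / 2 + c2 * l ^ 3 / 3) - (c0 * 0 + c1 * 0\<^sup>2 / 2 + c2 * 0 ^ 3 / 3)) {0..l}"
  by (rule fundamental_theorem_of_calculus[OF assms])
   (auto simp: has_real_derivative_iff_has_vector_derivative[symmetric] field_simps power2_eq_square
    intro!: derivative_eq_intros)
 moreover have "set_integrable lborel {0..l} (\<lambda>t. c0 + c1 * t + c2 * t\<^sup>2)"
  unfolding set_integrable_def by (rule borel_integrable_compact) (auto intro!: continuous_intros)
 ultimately show ?thesis
  by (simp add: set_borel_integral_eq_integral(2) integral_unique)
qed

lemma integral_cubic_interval:
 fixes c0 c1 c2 c3 :: real
 shows "(LINT t:{0..1}|lborel. c0 + c1 * t + c2 * t\<^sup>2 + c3 * t ^ 3) = c0 + c1 / 2 + c2 / 3 + c3 / 4"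
proof -
 have "((\<lambda>t. c0 + c1 * t + c2 * t\<^sup>2 + c3 * t ^ 3) has_integral
   (c0 * 1 + c1 * 1\<^sup>2 / 2 + c2 * 1 ^ 3 / 3 + c3 * 1 ^ 4 / 4) - (c0 * 0 + c1 * 0\<^sup>2 / 2 + c2 * 0 ^ 3 / 3 + c3 * 0 ^ 4 / 4)) {0..1}"
  by (rule fundamental_theorem_of_calculus)
   (auto simp: has_real_derivative_iff_has_vector_derivative[symmetric] field_simps power2_eq_square power3_eq_cube
    intro!: derivative_eq_intros)
 moreover have "set_integrable lborel {0..1} (\<lambda>t. c0 + c1 * t + c2 * t\<^sup>2 + c3 * t ^ 3)"
  unfolding set_integrable_def by (rule borel_integrable_compact) (auto intro!: continuous_intros)
 ultimately show ?thesis
  by (simp add: set_borel_integral_eq_integral(2) integral_unique)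
qed

definition unit_triangle :: "(real \<times> real) set" where
 "unit_triangle = {(x, y). 0 \<le> x \<and> 0 \<le> y \<and> x + y \<le> 1}"

lemma compact_unit_triangle: "compact unit_triangle"
proof -
 have "closed unit_triangle"
  unfolding unit_triangle_def case_prod_unfold by (intro closed_Collect_conj closed_Collect_le continuous_intros)
 moreover have "unit_triangle \<subseteq> {0..1} \<times> {0..1}" by (auto simp: unit_triangle_def)
 then have "bounded unit_triangle" by (rule bounded_subset[rotated]) (simp add: bounded_Times)
 ultimately show ?thesis by (simp add: compact_eq_bounded_closed)
qed

lemma integral_quadratic_unit_triangle:
 "(LINT z:unit_triangle|lborel. c0 + c1 * fst z + c2 * snd z + c3 * (fst z)\<^sup>2 + c4 * (fst z * snd z) + c5 * (snd z)\<^sup>2)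
  = c0 / 2 + c1 / 6 + c2 / 6 + c3 / 12 + c4 / 24 + c5 / 12"
proof -
 let ?q = "\<lambda>z::real \<times> real. c0 + c1 * fst z + c2 * snd z + c3 * (fst z)\<^sup>2 + c4 * (fst z * snd z) + c5 * (snd z)\<^sup>2"
 let ?f = "\<lambda>z. indicator unit_triangle z *\<^sub>R ?q z"
 have int: "integrable lborel ?f"
  by (rule borel_integrable_compact[OF compact_unit_triangle]) (intro continuous_intros)
 have "(LINT z:unit_triangle|lborel. ?q z) = (\<integral>x. (\<integral>y. ?f (x, y) \<partial>lborel) \<partial>lborel)"
  unfolding set_lebesgue_integral_def
  using lborel_pair.integral_fst'[of ?f] int by (simp only: lborel_prod)
 also have "\<dots> = (LINT x:{0..1}|lborel. (c0 + c2 / 2 + c5 / 3) + (c1 - c0 - c2 + c4 / 2 - c5) * x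
   + (c3 - c1 + c2 / 2 - c4 + c5) * x\<^sup>2 + (c4 / 2 - c3 - c5 / 3) * x ^ 3)"
  unfolding set_lebesgue_integral_def
 proof (rule Bochner_Integration.integral_cong[OF refl])
  fix x :: real
  show "(\<integral>y. ?f (x, y) \<partial>lborel) = indicator {0..1} x *\<^sub>R ((c0 + c2 / 2 + c5 / 3) + (c1 - c0 - c2 + c4 / 2 - c5) * x
   + (c3 - c1 + c2 / 2 - c4 + c5) * x\<^sup>2 + (c4 / 2 - c3 - c5 / 3) * x ^ 3)"
  proof (cases "x \<in> {0..1}")
   case True
   have "(\<integral>y. ?f (x, y) \<partial>lborel) = (LINT y:{0..1 - x}|lborel. (c0 + c1 * x + c3 * x\<^sup>2) + (c2 + c4 * x) * y + c5 * y\<^sup>2)"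
    unfolding set_lebesgue_integral_def
    by (intro Bochner_Integration.integral_cong refl)
     (use True in \<open>auto simp: indicator_def unit_triangle_def algebra_simps\<close>)
   also have "\<dots> = (c0 + c1 * x + c3 * x\<^sup>2) * (1 - x) + (c2 + c4 * x) * (1 - x)\<^sup>2 / 2 + c5 * (1 - x) ^ 3 / 3"
    using True by (intro integral_quadratic_interval) simp
   finally show ?thesis
    using True by (simp add: field_simps power2_eq_square power3_eq_cube)
  next
   case False
   then have "(\<lambda>y. ?f (x, y)) = (\<lambda>_. 0)" by (auto simp: indicator_def unit_triangle_def)
   then have "(\<integral>y. ?f (x, y) \<partial>lborel) = 0" by (simp only: Bochner_Integration.integral_zero)
   moreover have "indicator {0..1} x = (0::real)" using False by simp
   ultimately show ?thesis by (simp only: scaleR_zero_left)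
  qed
 qed
 also have "\<dots> = c0 / 2 + c1 / 6 + c2 / 6 + c3 / 12 + c4 / 24 + c5 / 12"
  unfolding integral_cubic_interval by (simp add: field_simps)
 finally show ?thesis .
qed

lemma measure_unit_triangle: "measure lborel unit_triangle = 1 / 2"
proof -
 have "measure lborel unit_triangle = (LINT z:unit_triangle|lborel. (1::real))"
  using compact_imp_closed[OF compact_unit_triangle] by (simp add: set_lebesgue_integral_def)
 also have "\<dots> = 1 / 2"
  using integral_quadratic_unit_triangle[of 1 0 0 0 0 0] by simp
 finally show ?thesis .
qed

lemma segment_affine_image:
 fixes a b :: "'a::real_vector"
 shows "closed_segment a b = (\<lambda>t. a + t *\<^sub>R (b - a)) ` {0..1::real}"
 unfolding closed_segment_image_interval by (intro image_cong) (auto simp: algebra_simps)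

lemma triangle_affine_image:
 fixes a b c :: "'a::real_vector"
 shows "convex hull {a, b, c} = (\<lambda>z. a + (fst z *\<^sub>R (b - a) + snd z *\<^sub>R (c - a))) ` unit_triangle"
 unfolding convex_hull_3_alt unit_triangle_def by (auto simp: image_iff) (metis add.assoc)+

lemma hausdorff_segment:
 fixes a b :: "'a::euclidean_space"
 assumes "a \<noteq> b"
 shows "measure (hausdorff 1) (closed_segment a b) = dist a b"
  and "P2_on (closed_segment a b) g \<Longrightarrow>
   (LINT x:closed_segment a b|hausdorff 1. g x) = measure (hausdorff 1) (closed_segment a b) * quad_avg {a, b} g"
proof -
 let ?d = "b - a"
 have lin: "linear (\<lambda>t::real. t *\<^sub>R ?d)" by (rule linear_scaleR_left)
 have inj: "inj (\<lambda>t::real. t *\<^sub>R ?d)" using assms by (auto simp: inj_def)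
 have J: "jacobian (\<lambda>t::real. t *\<^sub>R ?d) = dist a b"
  using jacobian_real[of ?d] assms by (simp add: dist_norm norm_minus_commute)
 show m: "measure (hausdorff 1) (closed_segment a b) = dist a b"
  using measure_affine_image[OF lin inj, of "{0..1}" a] J by (simp add: segment_affine_image)
 assume "P2_on (closed_segment a b) g"
 then obtain c l A where A: "linear A" and g: "\<And>x. x \<in> closed_segment a b \<Longrightarrow> g x = c + l \<bullet> x + x \<bullet> A x"
  by (auto simp: P2_on_def)
 have gt: "g (a + t *\<^sub>R ?d) = (c + l \<bullet> a + a \<bullet> A a) + (l \<bullet> ?d + a \<bullet> A ?d + ?d \<bullet> A a) * t + (?d \<bullet> A ?d) * t\<^sup>2"
  if "t \<in> {0..1}" for t
 proof -
  have "a + t *\<^sub>R ?d \<in> closed_segment a b" using that unfolding segment_affine_image by blast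
  then have "g (a + t *\<^sub>R ?d) = c + l \<bullet> (a + t *\<^sub>R ?d) + (a + t *\<^sub>R ?d) \<bullet> A (a + t *\<^sub>R ?d)" by (rule g)
  then show ?thesis
   by (simp only: linear_add[OF A] linear_scale[OF A] inner_add_left inner_add_right inner_scaleR_left inner_scaleR_right)
    (simp add: algebra_simps power2_eq_square)
 qed
 have "(LINT x:(\<lambda>t. a + t *\<^sub>R ?d) ` {0..1}|hausdorff DIM(real). g x) = dist a b * (LINT t:{0..1}|lborel. g (a + t *\<^sub>R ?d))"
  unfolding J[symmetric]
 proof (rule integral_affine_image[OF lin inj])
  have "continuous_on {0..1} (\<lambda>t. g (a + t *\<^sub>R ?d))"
   by (subst continuous_on_cong[OF refl gt]) (auto intro!: continuous_intros)
  then show "(\<lambda>t. indicator {0..1} t *\<^sub>R g (a + t *\<^sub>R ?d)) \<in> borel_measurable borel"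
   by (intro borel_measurable_continuous_on_indicator) auto
 qed simp
 also have "(LINT t:{0..1}|lborel. g (a + t *\<^sub>R ?d)) = (LINT t:{0..1}|lborel. (c + l \<bullet> a + a \<bullet> A a) + (l \<bullet> ?d + a \<bullet> A ?d + ?d \<bullet> A a) * t + (?d \<bullet> A ?d) * t\<^sup>2)"
  using gt by (intro set_lebesgue_integral_cong) auto
 also have "\<dots> = (c + l \<bullet> a + a \<bullet> A a) + (l \<bullet> ?d + a \<bullet> A ?d + ?d \<bullet> A a) / 2 + (?d \<bullet> A ?d) / 3"
  using integral_quadratic_interval[of 1] by simp
 also have "\<dots> = quad_avg {a, b} g"
 proof -
  have mid: "(1/2) *\<^sub>R (a + b) = a + (1/2) *\<^sub>R ?d"
   by (simp add: algebra_simps flip: scaleR_add_left)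
  have "g a = g (a + 0 *\<^sub>R ?d)" "g b = g (a + 1 *\<^sub>R ?d)" by simp_all
  then show ?thesis
   using gt[of 0] gt[of 1] gt[of "1/2"] unfolding quad_avg_two[OF assms] mid
   by (simp add: power2_eq_square field_simps)
 qed
 finally show "(LINT x:closed_segment a b|hausdorff 1. g x) = measure (hausdorff 1) (closed_segment a b) * quad_avg {a, b} g"
  unfolding m unfolding segment_affine_image[of a b] by simp
qed

lemma hausdorff_triangle:
 fixes a b c :: "'a::euclidean_space"
 assumes ind: "\<And>s t. s *\<^sub>R (b - a) + t *\<^sub>R (c - a) = 0 \<Longrightarrow> s = 0 \<and> t = 0"
 shows "measure (hausdorff 2) (convex hull {a, b, c}) = sqrt (gram (b - a) (c - a)) / 2"
  and "P2_on (convex hull {a, b, c}) g \<Longrightarrow> (LINT x:convex hull {a, b, c}|hausdorff 2. g x)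
   = measure (hausdorff 2) (convex hull {a, b, c}) * quad_avg {a, b, c} g"
proof -
 let ?u = "b - a" and ?v = "c - a"
 let ?F = "\<lambda>x::real^2. x $ 1 *\<^sub>R ?u + x $ 2 *\<^sub>R ?v"
 have lF: "linear ?F" by (intro linearI) (auto simp: algebra_simps)
 have iF: "inj ?F"
  unfolding linear_injective_0[OF lF] using ind by (auto simp: vec_eq_iff forall_2)
 define T where "T = (convex hull (insert 0 Basis) :: (real^2) set)"
 have T: "compact T" unfolding T_def by (intro finite_imp_compact_convex_hull) simp
 have B2: "(Basis :: (real^2) set) = {axis 1 1, axis 2 1}"
  by (auto simp: Basis_vec_def UNIV_2)
 have "(\<lambda>y. a + ?F y) ` T = convex hull ((\<lambda>y. a + ?F y) ` insert 0 Basis)"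
 proof -
  have "(\<lambda>y. a + ?F y) ` T = (+) a ` ?F ` T" by (simp add: image_image)
  also have "\<dots> = convex hull ((+) a ` ?F ` insert 0 Basis)"
   unfolding T_def convex_hull_linear_image[OF lF, symmetric] convex_hull_translation ..
  finally show ?thesis by (simp only: image_image)
 qed
 also have "\<dots> = convex hull {a, b, c}"
  by (simp add: B2 axis_def)
 finally have FT: "convex hull {a, b, c} = (\<lambda>y. a + ?F y) ` T" by simp
 show m: "measure (hausdorff 2) (convex hull {a, b, c}) = sqrt (gram (b - a) (c - a)) / 2"
  using measure_affine_image[OF lF iF, of T a] jacobian_real2[of "b - a" "c - a", OF ind] content_std_simplex[where 'a="real^2"]
   compact_imp_closed[OF T] by (simp add: FT T_def[symmetric])
 assume "P2_on (convex hull {a, b, c}) g"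
 then obtain k l A where A: "linear A" and g: "\<And>x. x \<in> convex hull {a, b, c} \<Longrightarrow> g x = k + l \<bullet> x + x \<bullet> A x"
  by (auto simp: P2_on_def)
 let ?G = "\<lambda>z::real \<times> real. fst z *\<^sub>R ?u + snd z *\<^sub>R ?v"
 have lG: "linear ?G" by (intro linearI) (auto simp: algebra_simps)
 have iG: "inj ?G" unfolding linear_injective_0[OF lG] using ind by (auto simp: prod_eq_iff)
 have GT: "convex hull {a, b, c} = (\<lambda>z. a + ?G z) ` unit_triangle" by (rule triangle_affine_image)
 have mem: "a + ?G z \<in> convex hull {a, b, c}" if "z \<in> unit_triangle" for z using that GT by blast
 have gz: "g (a + ?G z) = (k + l \<bullet> a + a \<bullet> A a) + (l \<bullet> ?u + a \<bullet> A ?u + ?u \<bullet> A a) * fst z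
   + (l \<bullet> ?v + a \<bullet> A ?v + ?v \<bullet> A a) * snd z
   + (?u \<bullet> A ?u) * (fst z)\<^sup>2 + (?u \<bullet> A ?v + ?v \<bullet> A ?u) * (fst z * snd z) + (?v \<bullet> A ?v) * (snd z)\<^sup>2"
  if z: "z \<in> unit_triangle" for z
  unfolding g[OF mem[OF z]]
  by (simp only: linear_add[OF A] linear_scale[OF A] inner_add_left inner_add_right inner_scaleR_left inner_scaleR_right)
   (simp add: algebra_simps power2_eq_square)
 have mG: "measure (hausdorff 2) (convex hull {a, b, c}) = jacobian ?G / 2"
  using measure_affine_image[OF lG iG, of unit_triangle a] measure_unit_triangle
   compact_imp_closed[OF compact_unit_triangle] unfolding GT by (simp add: numeral_2_eq_2)
 have "(LINT x:(\<lambda>z. a + ?G z) ` unit_triangle|hausdorff DIM(real \<times> real). g x)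
   = jacobian ?G * (LINT z:unit_triangle|lborel. g (a + ?G z))"
 proof (rule integral_affine_image[OF lG iG])
  have "continuous_on unit_triangle (\<lambda>z. g (a + ?G z))"
   by (subst continuous_on_cong[OF refl gz]) (auto intro!: continuous_intros)
  then show "(\<lambda>z. indicator unit_triangle z *\<^sub>R g (a + ?G z)) \<in> borel_measurable borel"
   using compact_imp_closed[OF compact_unit_triangle] by (intro borel_measurable_continuous_on_indicator) auto
 qed (use compact_imp_closed[OF compact_unit_triangle] in simp)
 also have "(LINT z:unit_triangle|lborel. g (a + ?G z)) = (LINT z:unit_triangle|lborel. (k + l \<bullet> a + a \<bullet> A a) + (l \<bullet> ?u + a \<bullet> A ?u + ?u \<bullet> A a) * fst z
   + (l \<bullet> ?v + a \<bullet> A ?v + ?v \<bullet> A a) * snd z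
   + (?u \<bullet> A ?u) * (fst z)\<^sup>2 + (?u \<bullet> A ?v + ?v \<bullet> A ?u) * (fst z * snd z) + (?v \<bullet> A ?v) * (snd z)\<^sup>2)"
  using gz compact_imp_closed[OF compact_unit_triangle] by (intro set_lebesgue_integral_cong) auto
 also have "\<dots> = quad_avg {a, b, c} g / 2"
 proof -
  have ne: "a \<noteq> b" "a \<noteq> c" "b \<noteq> c"
   using ind[of 1 0] ind[of 0 1] ind[of 1 "-1"] by auto
  have nodes: "(1/2) *\<^sub>R (a + b) = a + ?G (1/2, 0)" "(1/2) *\<^sub>R (a + c) = a + ?G (0, 1/2)"
   "(1/2) *\<^sub>R (b + c) = a + ?G (1/2, 1/2)"
   by (simp_all add: algebra_simps flip: scaleR_add_left)
  have "(1/2, 0) \<in> unit_triangle" "(0, 1/2) \<in> unit_triangle" "(1/2, 1/2) \<in> unit_triangle"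
   by (auto simp: unit_triangle_def)
  from this[THEN gz] show ?thesis
   unfolding quad_avg_three[OF ne] nodes integral_quadratic_unit_triangle
   by (simp add: power2_eq_square field_simps)
 qed
 finally show "(LINT x:convex hull {a, b, c}|hausdorff 2. g x)
   = measure (hausdorff 2) (convex hull {a, b, c}) * quad_avg {a, b, c} g"
  unfolding mG unfolding GT by (simp add: numeral_2_eq_2)
qed

section \<open>Barycentric coordinates\<close>

abbreviation facet :: "'a::euclidean_space set \<Rightarrow> 'a \<Rightarrow> 'a set" where
 "facet V P \<equiv> convex hull (V - {P})"

abbreviation cell :: "'a::euclidean_space set \<Rightarrow> bool" where
 "cell T \<equiv> int DIM('a) simplex T"

lemma simplexD:
 fixes T :: "'a::euclidean_space set"
 assumes "int k simplex T"
 shows "\<not> affine_dependent (verts T)" "card (verts T) = Suc k" "finite (verts T)"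
  "convex hull (verts T) = T"
proof -
 obtain C where C: "\<not> affine_dependent C" "int (card C) = int k + 1" "T = convex hull C"
  using assms by (auto simp: simplex_def)
 then have "verts T = C" by (auto simp: verts_def extreme_point_of_convex_hull_affine_independent)
 then show "\<not> affine_dependent (verts T)" "card (verts T) = Suc k" "finite (verts T)"
  "convex hull (verts T) = T" using C aff_independent_finite by auto
qed

lemma verts_convex_hull: "\<not> affine_dependent V \<Longrightarrow> verts (convex hull V) = V"
 by (auto simp: verts_def extreme_point_of_convex_hull_affine_independent)

definition barycentric :: "'a::euclidean_space set \<Rightarrow> ('a \<Rightarrow> 'a \<Rightarrow> real) \<Rightarrow> bool" where
 "barycentric V L \<longleftrightarrow> (\<forall>P\<in>V. \<exists>c g. \<forall>x. L P x = c + g \<bullet> x) \<and>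
   (\<forall>P\<in>V. \<forall>Q\<in>V. L P Q = (if P = Q then 1 else 0)) \<and>
   (\<forall>x. (\<Sum>P\<in>V. L P x) = 1) \<and> (\<forall>x. (\<Sum>P\<in>V. L P x *\<^sub>R P) = x)"

lemma barycentric_exists:
 fixes V :: "'a::euclidean_space set"
 assumes ind: "\<not> affine_dependent V" and card: "card V = Suc DIM('a)"
 shows "\<exists>L. barycentric V L"
proof -
 have finV: "finite V" using ind by (rule aff_independent_finite)
 have "V \<noteq> {}" using card by auto
 then obtain P0 where P0: "P0 \<in> V" by blast
 let ?W = "V - {P0}"
 let ?B = "(\<lambda>x. x - P0) ` ?W"
 have ins: "insert P0 ?W = V" using P0 by blast
 have indB: "independent ?B"
  using ind affine_dependent_iff_dependent2[OF P0] by (simp add: image_def)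
 have inj: "inj_on (\<lambda>x. x - P0) ?W" by (simp add: inj_on_def)
 have cB: "card ?B = DIM('a)" using card P0 finV by (simp add: card_image[OF inj])
 have span: "span ?B = UNIV"
  using card_eq_dim[of ?B UNIV] indB cB finV by (auto simp: dim_UNIV)
 have "\<exists>f. linear f \<and> (\<forall>Q\<in>?W. f (Q - P0) = (if P = Q then 1 else 0 :: real))" for P
 proof -
  obtain f where "linear f" "\<forall>x\<in>?B. f x = (if P = x + P0 then 1 else 0 :: real)"
   using linear_independent_extend[OF indB, of "\<lambda>x. if P = x + P0 then 1 else 0 :: real"] by blast
  then show ?thesis by auto
 qed
 then obtain f where f: "\<And>P. linear (f P)"
  and fQ: "\<And>P Q. Q \<in> ?W \<Longrightarrow> f P (Q - P0) = (if P = Q then 1 else 0 :: real)" by metis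
 have frep: "f P x = (\<Sum>b\<in>Basis. f P b *\<^sub>R b) \<bullet> x" for P x
 proof -
  have "f P x = f P (\<Sum>b\<in>Basis. (x \<bullet> b) *\<^sub>R b)" by (simp add: euclidean_representation)
  also have "\<dots> = (\<Sum>b\<in>Basis. (x \<bullet> b) * f P b)"
   using f[of P] by (simp add: linear_sum linear_scale)
  also have "\<dots> = (\<Sum>b\<in>Basis. f P b *\<^sub>R b) \<bullet> x" by (simp add: inner_sum_left) (simp add: inner_commute mult.commute)
  finally show ?thesis .
 qed
 have rep: "(\<Sum>P\<in>?W. f P x *\<^sub>R (P - P0)) = x" for x
 proof -
  have "x \<in> span ?B" by (simp add: span)
  then show ?thesis
  proof (induction rule: span_induct_alt)
   case base
   then show ?case using f by (simp add: linear_0)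
  next
   case (step c y z)
   then obtain Q where Q: "Q \<in> ?W" "y = Q - P0" by blast
   have "(\<Sum>P\<in>?W. f P y *\<^sub>R (P - P0)) = (\<Sum>P\<in>?W. if P = Q then Q - P0 else 0)"
    using Q by (intro sum.cong) (auto simp: fQ)
   also have "\<dots> = y" using Q finV by simp
   finally have "(\<Sum>P\<in>?W. f P y *\<^sub>R (P - P0)) = y" .
   moreover have "(\<Sum>P\<in>?W. f P (c *\<^sub>R y + z) *\<^sub>R (P - P0))
     = c *\<^sub>R (\<Sum>P\<in>?W. f P y *\<^sub>R (P - P0)) + (\<Sum>P\<in>?W. f P z *\<^sub>R (P - P0))"
    using f by (simp add: linear_add linear_scale scaleR_add_left sum.distrib scaleR_sum_right)
   ultimately show ?case using step by simp
  qed
 qed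
 define L where "L P x = (if P = P0 then 1 - (\<Sum>Q\<in>?W. f Q (x - P0)) else f P (x - P0))" for P x
 have sW: "(\<Sum>P\<in>V. h P) = h P0 + (\<Sum>P\<in>?W. h P)" for h :: "'a \<Rightarrow> 'c::comm_monoid_add"
  using sum.remove[OF finV P0] .
 have "barycentric V L"
  unfolding barycentric_def
 proof (intro conjI ballI allI)
  fix P assume "P \<in> V"
  define G where "G P = (\<Sum>b\<in>Basis. f P b *\<^sub>R b)" for P
  have fG: "f P x = G P \<bullet> x" for P x unfolding G_def by (rule frep)
  show "\<exists>c g. \<forall>x. L P x = c + g \<bullet> x"
  proof (cases "P = P0")
   case True
   have "\<forall>x. L P x = (1 + (\<Sum>Q\<in>?W. G Q) \<bullet> P0) + (- (\<Sum>Q\<in>?W. G Q)) \<bullet> x"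
    using True by (simp add: L_def fG inner_diff_right inner_sum_left sum_subtractf)
   then show ?thesis by blast
  next
   case False
   then have "\<forall>x. L P x = - (G P \<bullet> P0) + G P \<bullet> x" by (simp add: L_def fG inner_diff_right)
   then show ?thesis by blast
  qed
  fix Q assume Q: "Q \<in> V"
  have "(\<Sum>R\<in>?W. f R (Q - P0)) = (if Q = P0 then 0 else 1)"
  proof (cases "Q = P0")
   case True then show ?thesis using f by (simp add: linear_0)
  next
   case False
   then have "(\<Sum>R\<in>?W. f R (Q - P0)) = (\<Sum>R\<in>?W. if R = Q then 1 else 0)"
    using Q by (intro sum.cong) (auto simp: fQ)
   then show ?thesis using False Q finV by simp
  qed
  then show "L P Q = (if P = Q then 1 else 0)"
   using Q fQ[of Q P] f[of P] by (auto simp: L_def linear_0)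
 next
  fix x
  have LW: "(\<Sum>P\<in>?W. L P x) = (\<Sum>P\<in>?W. f P (x - P0))" "(\<Sum>P\<in>?W. L P x *\<^sub>R P) = (\<Sum>P\<in>?W. f P (x - P0) *\<^sub>R P)"
   by (auto simp: L_def intro!: sum.cong)
  show "(\<Sum>P\<in>V. L P x) = 1" unfolding sW LW by (simp add: L_def)
  have "(\<Sum>P\<in>V. L P x *\<^sub>R P) = P0 + (\<Sum>P\<in>?W. f P (x - P0) *\<^sub>R (P - P0))"
   unfolding sW LW by (simp add: L_def algebra_simps sum_subtractf scaleR_sum_left)
  then show "(\<Sum>P\<in>V. L P x *\<^sub>R P) = x" unfolding rep by simp
 qed
 then show ?thesis by blast
qed

definition bary :: "'a::euclidean_space set \<Rightarrow> 'a \<Rightarrow> 'a \<Rightarrow> real" where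
 "bary V = (SOME L. barycentric V L)"

definition bgrad :: "'a::euclidean_space set \<Rightarrow> 'a \<Rightarrow> 'a" where
 "bgrad V P = (SOME g. \<exists>c. \<forall>x. bary V P x = c + g \<bullet> x)"

definition full :: "'a::euclidean_space set \<Rightarrow> bool" where
 "full V \<longleftrightarrow> \<not> affine_dependent V \<and> card V = Suc DIM('a)"

lemma full_verts: "cell (T :: 'a::euclidean_space set) \<Longrightarrow> full (verts T)"
 using simplexD(1,2)[of "DIM('a)" T] by (simp add: full_def)

lemma full_finite: "full V \<Longrightarrow> finite V"
 by (simp add: full_def aff_independent_finite)

context
 fixes V :: "'a::euclidean_space set"
 assumes V: "full V"
begin

lemma barycentric_bary: "barycentric V (bary V)"
proof -
 have "\<exists>L. barycentric V L" using barycentric_exists V unfolding full_def by blast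
 then show ?thesis unfolding bary_def by (rule someI_ex)
qed

lemma bary_vertex: "P \<in> V \<Longrightarrow> Q \<in> V \<Longrightarrow> bary V P Q = (if P = Q then 1 else 0)"
 and bary_sum: "(\<Sum>P\<in>V. bary V P x) = 1"
 and bary_rep: "(\<Sum>P\<in>V. bary V P x *\<^sub>R P) = x"
proof -
 note L = barycentric_bary[unfolded barycentric_def]
 show "P \<in> V \<Longrightarrow> Q \<in> V \<Longrightarrow> bary V P Q = (if P = Q then 1 else 0)" using L by blast
 show "(\<Sum>P\<in>V. bary V P x) = 1" "(\<Sum>P\<in>V. bary V P x *\<^sub>R P) = x" using L by blast+
qed

lemma bary_diff: "P \<in> V \<Longrightarrow> bary V P y - bary V P x = bgrad V P \<bullet> (y - x)"
proof -
 assume "P \<in> V"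
 then have "\<exists>g c. \<forall>x. bary V P x = c + g \<bullet> x"
  using barycentric_bary unfolding barycentric_def by blast
 from someI_ex[OF this] have "\<exists>c. \<forall>x. bary V P x = c + bgrad V P \<bullet> x"
  unfolding bgrad_def .
 then obtain c where "\<forall>x. bary V P x = c + bgrad V P \<bullet> x" by blast
 then have "bary V P y = c + bgrad V P \<bullet> y" "bary V P x = c + bgrad V P \<bullet> x" by blast+
 then show ?thesis by (simp only: inner_diff_right)
qed

lemma bary_affine: "P \<in> V \<Longrightarrow> bary V P y = bary V P x + bgrad V P \<bullet> (y - x)"
 using bary_diff[of P y x] by simp

lemma continuous_bary: "P \<in> V \<Longrightarrow> continuous_on S (bary V P)"
proof -
 assume "P \<in> V"
 then have eq: "bary V P = (\<lambda>y. bary V P 0 + bgrad V P \<bullet> (y - 0))" using bary_affine[of P _ 0] by blast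
 show ?thesis by (subst eq) (intro continuous_intros)
qed

lemma bary_combination:
 assumes P: "P \<in> V" and W: "W \<subseteq> V" and u: "(\<Sum>Q\<in>W. u Q) = 1"
 shows "bary V P (\<Sum>Q\<in>W. u Q *\<^sub>R Q) = (if P \<in> W then u P else 0)"
proof -
 have finW: "finite W" using finite_subset[OF W full_finite[OF V]] .
 have "bary V P (\<Sum>Q\<in>W. u Q *\<^sub>R Q) = bary V P 0 + (\<Sum>Q\<in>W. u Q * (bgrad V P \<bullet> Q))"
  using bary_affine[OF P, of "\<Sum>Q\<in>W. u Q *\<^sub>R Q" 0] by (simp add: inner_sum_right)
 also have "\<dots> = (\<Sum>Q\<in>W. u Q * (bary V P 0 + bgrad V P \<bullet> Q))"
  by (simp add: distrib_left sum.distrib sum_distrib_right[symmetric] u)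
 also have "\<dots> = (\<Sum>Q\<in>W. u Q * bary V P Q)"
 proof -
  have "bary V P 0 + bgrad V P \<bullet> Q = bary V P Q" for Q
   using bary_affine[OF P, of Q 0] by (simp only: diff_zero)
  then show ?thesis by simp
 qed
 also have "\<dots> = (\<Sum>Q\<in>W. if Q = P then u Q else 0)"
  using W P by (intro sum.cong refl) (auto simp: bary_vertex subset_iff)
 finally show ?thesis using finW by simp
qed

lemma convex_hull_bary:
 assumes W: "W \<subseteq> V"
 shows "convex hull W = {x. (\<forall>P\<in>V. 0 \<le> bary V P x) \<and> (\<forall>P\<in>V - W. bary V P x = 0)}"
proof -
 have finV: "finite V" and finW: "finite W" using finite_subset[OF W full_finite[OF V]] full_finite[OF V] by auto
 show ?thesis
 proof (intro equalityI subsetI CollectI conjI ballI)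
  fix x P assume x: "x \<in> convex hull W"
  then obtain u where u: "\<forall>Q\<in>W. 0 \<le> u Q" "sum u W = 1" "x = (\<Sum>Q\<in>W. u Q *\<^sub>R Q)"
   by (auto simp: convex_hull_finite[OF finW])
  then show "0 \<le> bary V P x" if "P \<in> V" using bary_combination[OF that W, of u] by auto
  show "bary V P x = 0" if "P \<in> V - W" using u that bary_combination[OF _ W, of P u] by auto
 next
  fix x assume x: "x \<in> {x. (\<forall>P\<in>V. 0 \<le> bary V P x) \<and> (\<forall>P\<in>V - W. bary V P x = 0)}"
  have s: "(\<Sum>P\<in>V. h P) = (\<Sum>P\<in>W. h P)" if "\<And>P. P \<in> V - W \<Longrightarrow> h P = 0" for h :: "'a \<Rightarrow> 'c::comm_monoid_add"
   using finV W that by (intro sum.mono_neutral_right) auto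
  have "(\<Sum>P\<in>W. bary V P x) = 1" using s[of "\<lambda>P. bary V P x"] x bary_sum[of x] by auto
  moreover have "(\<Sum>P\<in>W. bary V P x *\<^sub>R P) = x" using s[of "\<lambda>P. bary V P x *\<^sub>R P"] x bary_rep[of x] by auto
  moreover have "\<forall>P\<in>W. 0 \<le> bary V P x" using x W by blast
  ultimately show "x \<in> convex hull W" unfolding convex_hull_finite[OF finW] mem_Collect_eq
   by (intro exI[of _ "\<lambda>P. bary V P x"]) auto
 qed
qed

lemma interior_bary:
 assumes "\<forall>P\<in>V. 0 < bary V P x"
 shows "x \<in> interior (convex hull V)"
proof -
 let ?U = "{y. \<forall>P\<in>V. 0 < bary V P y}"
 have "?U = (\<Inter>P\<in>V. {y. 0 < bary V P y})" by auto
 also have "open \<dots>"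
  using full_finite[OF V] continuous_bary by (intro open_INT ballI open_Collect_less continuous_on_const) auto
 finally have "open ?U" .
 moreover have "?U \<subseteq> convex hull V" by (auto simp: convex_hull_bary[OF subset_refl] less_imp_le)
 ultimately show ?thesis using assms interiorI[of ?U x "convex hull V"] by simp
qed

lemma card_facet: "P \<in> V \<Longrightarrow> card (V - {P}) = DIM('a)"
 using V full_finite[OF V] by (simp add: full_def)

lemma facet_vertex_nonempty:
 assumes "P \<in> V" shows "\<exists>Q. Q \<in> V - {P}"
proof -
 have "card (V - {P}) \<noteq> 0" unfolding card_facet[OF assms] by simp
 then have "V - {P} \<noteq> {}" by (metis card.empty)
 then show ?thesis by blast
qed

lemma bgrad_nonzero:
 assumes P: "P \<in> V" shows "bgrad V P \<noteq> 0"
proof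
 assume g: "bgrad V P = 0"
 obtain Q where Q: "Q \<in> V - {P}" using facet_vertex_nonempty[OF P] by blast
 then show False using bary_affine[OF P, of P Q] P g by (auto simp: bary_vertex)
qed

lemma card_full_ge2: "2 \<le> card V"
 using V by (simp add: full_def)

lemma facet_convex_hull: "\<sigma> facet_of (convex hull V) \<longleftrightarrow> (\<exists>P\<in>V. \<sigma> = facet V P)"
 using V card_full_ge2 facet_of_convex_hull_affine_independent_alt[of V \<sigma>] by (auto simp: full_def)

lemma affine_independent_sub: "W \<subseteq> V \<Longrightarrow> \<not> affine_dependent W"
 using V affine_dependent_subset[of W V] by (auto simp: full_def)

lemma verts_sub: "W \<subseteq> V \<Longrightarrow> verts (convex hull W) = W"
 using affine_independent_sub by (simp add: verts_convex_hull)

lemma normal_parallel_bgrad: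
 assumes P: "P \<in> V" and Q: "Q \<in> V - {P}"
  and n: "\<And>R S. R \<in> V - {P} \<Longrightarrow> S \<in> V - {P} \<Longrightarrow> n \<bullet> (S - R) = 0"
 shows "n = (n \<bullet> (P - Q)) *\<^sub>R bgrad V P"
proof -
 have finV: "finite V" by (rule full_finite[OF V])
 have *: "n \<bullet> (x - Q) = (n \<bullet> (P - Q)) * bary V P x" for x
 proof -
  have "x - Q = (\<Sum>R\<in>V. bary V R x *\<^sub>R (R - Q))"
   using bary_rep[of x] bary_sum[of x]
   by (simp add: scaleR_diff_right sum_subtractf scaleR_sum_left[symmetric])
  then have "n \<bullet> (x - Q) = (\<Sum>R\<in>V. bary V R x * (n \<bullet> (R - Q)))"
   by (metis (no_types, lifting) inner_scaleR_right inner_sum_right sum.cong)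
  also have "\<dots> = (\<Sum>R\<in>V. if R = P then bary V P x * (n \<bullet> (P - Q)) else 0)"
   using n[OF Q] by (intro sum.cong) auto
  also have "\<dots> = (n \<bullet> (P - Q)) * bary V P x" using finV P by simp
  finally show ?thesis .
 qed
 have "n \<bullet> v = ((n \<bullet> (P - Q)) *\<^sub>R bgrad V P) \<bullet> v" for v
  using *[of "Q + v"] bary_affine[OF P, of "Q + v" Q] Q P by (simp add: bary_vertex)
 then show ?thesis by (metis vector_eq_rdot)
qed

text \<open>The barycentric coordinate of \<open>P\<close> vanishes on the facet opposite to \<open>P\<close> and increases into the simplex.\<close>

lemma outward_normal_bgrad:
 assumes P: "P \<in> V"
 shows "outward_normal {convex hull V} (facet V P) = - (bgrad V P /\<^sub>R norm (bgrad V P))"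
 unfolding outward_normal_def
proof (rule the_equality)
 let ?g = "bgrad V P" and ?\<sigma> = "facet V P" and ?T = "convex hull V"
 have g0: "?g \<noteq> 0" by (rule bgrad_nonzero[OF P])
 have mem\<sigma>: "bary V P x = 0" if "x \<in> ?\<sigma>" for x
  using that P convex_hull_bary[of "V - {P}"] by auto
 have memT: "0 \<le> bary V P x" if "x \<in> ?T" for x
  using that P convex_hull_bary[of V] by auto
 have fac: "?\<sigma> facet_of ?T" using facet_convex_hull P by blast
 show "norm (- (?g /\<^sub>R norm ?g)) = 1 \<and>
  (\<forall>x\<in>?\<sigma>. \<forall>y\<in>?\<sigma>. - (?g /\<^sub>R norm ?g) \<bullet> (y - x) = 0) \<and>
  (\<forall>T\<in>{?T}. ?\<sigma> facet_of T \<longrightarrow> (\<forall>x\<in>?\<sigma>. \<forall>y\<in>T. - (?g /\<^sub>R norm ?g) \<bullet> (y - x) \<le> 0))"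
  using g0 by (auto simp: bary_diff[OF P, symmetric] mem\<sigma> memT)
 fix n assume n: "norm n = 1 \<and> (\<forall>x\<in>?\<sigma>. \<forall>y\<in>?\<sigma>. n \<bullet> (y - x) = 0) \<and>
  (\<forall>T\<in>{?T}. ?\<sigma> facet_of T \<longrightarrow> (\<forall>x\<in>?\<sigma>. \<forall>y\<in>T. n \<bullet> (y - x) \<le> 0))"
 obtain Q where Q: "Q \<in> V - {P}" using facet_vertex_nonempty[OF P] by blast
 define a where "a = n \<bullet> (P - Q)"
 have "n = a *\<^sub>R ?g"
  unfolding a_def using n by (intro normal_parallel_bgrad[OF P Q]) (auto simp: hull_inc)
 moreover have "a \<le> 0" using n fac Q P by (auto simp: a_def hull_inc)
 moreover have "\<bar>a\<bar> * norm ?g = 1" using n calculation(1) by (metis norm_scaleR)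
 ultimately have "a = - 1 / norm ?g" using g0 by (simp add: field_simps)
 then show "n = - (?g /\<^sub>R norm ?g)" using \<open>n = a *\<^sub>R ?g\<close> by (simp add: divide_inverse)
qed

end

abbreviation outn :: "'a::euclidean_space set \<Rightarrow> 'a set \<Rightarrow> 'a" where
 "outn T \<sigma> \<equiv> outward_normal {T} \<sigma>"

definition centroid :: "'a::euclidean_space set \<Rightarrow> 'a" where
 "centroid W = (\<Sum>P\<in>W. (1 / real (card W)) *\<^sub>R P)"

lemma facet_of_cellE:
 assumes "cell T" "\<sigma> facet_of T"
 obtains P where "P \<in> verts T" "\<sigma> = facet (verts T) P" "verts \<sigma> = verts T - {P}"
  "outn T \<sigma> = - (bgrad (verts T) P /\<^sub>R norm (bgrad (verts T) P))"
proof -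
 note V = full_verts[OF assms(1)] and T = simplexD(4)[OF assms(1)]
 obtain P where P: "P \<in> verts T" "\<sigma> = facet (verts T) P"
  using facet_convex_hull[OF V] assms(2) unfolding T by blast
 show ?thesis
 proof (rule that[OF P])
  show "verts \<sigma> = verts T - {P}" unfolding P(2) by (rule verts_sub[OF V]) auto
  show "outn T \<sigma> = - (bgrad (verts T) P /\<^sub>R norm (bgrad (verts T) P))"
   using outward_normal_bgrad[OF V P(1)] unfolding T P(2) .
 qed
qed

lemma outn_props:
 assumes "cell T" "\<sigma> facet_of T"
 shows "norm (outn T \<sigma>) = 1"
  and "x \<in> \<sigma> \<Longrightarrow> y \<in> \<sigma> \<Longrightarrow> outn T \<sigma> \<bullet> (y - x) = 0"
  and "x \<in> \<sigma> \<Longrightarrow> y \<in> T \<Longrightarrow> outn T \<sigma> \<bullet> (y - x) \<le> 0"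
proof -
 note V = full_verts[OF assms(1)] and T = simplexD(4)[OF assms(1)]
 obtain P where P: "P \<in> verts T" "\<sigma> = facet (verts T) P"
  "outn T \<sigma> = - (bgrad (verts T) P /\<^sub>R norm (bgrad (verts T) P))"
  using facet_of_cellE[OF assms] by metis
 let ?g = "bgrad (verts T) P"
 have g0: "?g \<noteq> 0" by (rule bgrad_nonzero[OF V P(1)])
 show "norm (outn T \<sigma>) = 1" using g0 by (simp add: P(3))
 have s: "bary (verts T) P x = 0" if "x \<in> \<sigma>" for x
  using that P(1) unfolding P(2) convex_hull_bary[OF V Diff_subset] by blast
 have t: "0 \<le> bary (verts T) P x" if "x \<in> T" for x
 proof -
  have "x \<in> convex hull (verts T)" using that T by simp
  then show ?thesis using P(1) unfolding convex_hull_bary[OF V subset_refl] by blast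
 qed
 show "x \<in> \<sigma> \<Longrightarrow> y \<in> \<sigma> \<Longrightarrow> outn T \<sigma> \<bullet> (y - x) = 0"
  using bary_diff[OF V P(1), of y x] by (simp add: s P(3))
 show "x \<in> \<sigma> \<Longrightarrow> y \<in> T \<Longrightarrow> outn T \<sigma> \<bullet> (y - x) \<le> 0"
  using bary_diff[OF V P(1), of y x] t[of y] by (simp add: s P(3))
qed

lemma bary_centroid:
 assumes V: "full V" and W: "W \<subseteq> V" "W \<noteq> {}" and Q: "Q \<in> V"
 shows "bary V Q (centroid W) = (if Q \<in> W then 1 / real (card W) else 0)"
proof -
 have "finite W" using finite_subset[OF W(1) full_finite[OF V]] .
 then have "(\<Sum>P\<in>W. 1 / real (card W)) = 1" using W(2) by simp
 from bary_combination[OF V Q W(1) this] show ?thesis by (simp add: centroid_def)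
qed

text \<open>Near a relative interior point of a facet the simplex is a half space.\<close>

lemma facet_near:
 assumes V: "full V" and P: "P \<in> V" and x0: "bary V P x = 0"
  and xQ: "\<And>Q. Q \<in> V - {P} \<Longrightarrow> 0 < bary V Q x"
 obtains e where "0 < e"
  "\<And>y. dist x y < e \<Longrightarrow> 0 \<le> bgrad V P \<bullet> (y - x) \<Longrightarrow> y \<in> convex hull V"
  "\<And>y. dist x y < e \<Longrightarrow> 0 < bgrad V P \<bullet> (y - x) \<Longrightarrow> y \<in> interior (convex hull V)"
proof -
 let ?U = "{y. \<forall>Q\<in>V - {P}. 0 < bary V Q y}"
 have "?U = (\<Inter>Q\<in>V - {P}. {y. 0 < bary V Q y})" by auto
 also have "open \<dots>"
  using full_finite[OF V] continuous_bary[OF V]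
  by (intro open_INT ballI open_Collect_less continuous_on_const) auto
 finally have "open ?U" .
 moreover have "x \<in> ?U" using xQ by blast
 ultimately obtain e where e: "0 < e" "ball x e \<subseteq> ?U" using open_contains_ball by blast
 have pos: "0 < bary V Q y" if "dist x y < e" "Q \<in> V - {P}" for y Q
  using e(2) that by (auto simp: subset_iff)
 have bP: "bary V P y = bgrad V P \<bullet> (y - x)" for y using bary_diff[OF V P, of y x] x0 by simp
 show ?thesis
 proof (rule that[OF e(1)])
  fix y assume y: "dist x y < e"
  show "y \<in> convex hull V" if "0 \<le> bgrad V P \<bullet> (y - x)"
   unfolding convex_hull_bary[OF V subset_refl] using pos[OF y] that bP[of y] by (force simp: less_imp_le)
  show "y \<in> interior (convex hull V)" if "0 < bgrad V P \<bullet> (y - x)"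
   by (rule interior_bary[OF V]) (use pos[OF y] that bP[of y] in force)
 qed
qed

lemma facet_centroid_near:
 assumes T: "cell T" and \<sigma>: "\<sigma> facet_of T"
 obtains e where "0 < e"
  "\<And>y. dist (centroid (verts \<sigma>)) y < e \<Longrightarrow> outn T \<sigma> \<bullet> (y - centroid (verts \<sigma>)) \<le> 0 \<Longrightarrow> y \<in> T"
  "\<And>y. dist (centroid (verts \<sigma>)) y < e \<Longrightarrow> outn T \<sigma> \<bullet> (y - centroid (verts \<sigma>)) < 0 \<Longrightarrow> y \<in> interior T"
  "centroid (verts \<sigma>) \<in> \<sigma>"
proof -
 note V = full_verts[OF T] and TV = simplexD(4)[OF T]
 obtain P where P: "P \<in> verts T" "\<sigma> = facet (verts T) P" "verts \<sigma> = verts T - {P}"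
  "outn T \<sigma> = - (bgrad (verts T) P /\<^sub>R norm (bgrad (verts T) P))"
  using facet_of_cellE[OF T \<sigma>] by metis
 let ?V = "verts T" and ?c = "centroid (verts \<sigma>)"
 have ne: "?V - {P} \<noteq> {}" using facet_vertex_nonempty[OF V P(1)] by blast
 have card0: "0 < card (?V - {P})" using ne full_finite[OF V] by (simp add: card_gt_0_iff)
 have b: "bary ?V Q ?c = (if Q \<in> ?V - {P} then 1 / real (card (?V - {P})) else 0)" if "Q \<in> ?V" for Q
  unfolding P(3) by (rule bary_centroid[OF V Diff_subset ne that])
 have "?c \<in> facet ?V P" unfolding convex_hull_bary[OF V Diff_subset] mem_Collect_eq
  using b P(1) by simp
 then have c\<sigma>: "?c \<in> \<sigma>" by (simp only: P(2)[symmetric])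
 have g0: "0 < norm (bgrad ?V P)" using bgrad_nonzero[OF V P(1)] by simp
 have sgn: "outn T \<sigma> \<bullet> v = - (bgrad ?V P \<bullet> v) / norm (bgrad ?V P)" for v
  by (simp add: P(4) divide_inverse mult.commute)
 obtain e where e: "0 < e"
  "\<And>y. dist ?c y < e \<Longrightarrow> 0 \<le> bgrad ?V P \<bullet> (y - ?c) \<Longrightarrow> y \<in> convex hull ?V"
  "\<And>y. dist ?c y < e \<Longrightarrow> 0 < bgrad ?V P \<bullet> (y - ?c) \<Longrightarrow> y \<in> interior (convex hull ?V)"
  by (rule facet_near[OF V P(1), of ?c]) (use b P(1) card0 in auto)
 show ?thesis
 proof (rule that[OF e(1) _ _ c\<sigma>])
  fix y assume y: "dist ?c y < e"
  show "y \<in> T" if "outn T \<sigma> \<bullet> (y - ?c) \<le> 0"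
   using e(2)[OF y] that g0 unfolding sgn TV by (simp add: divide_le_0_iff zero_le_divide_iff)
  show "y \<in> interior T" if "outn T \<sigma> \<bullet> (y - ?c) < 0"
   using e(3)[OF y] that g0 unfolding sgn TV by (simp add: divide_less_0_iff zero_less_divide_iff)
 qed
qed

lemma cell_interior_nonempty:
 fixes T :: "'a::euclidean_space set"
 assumes "cell T" shows "interior T \<noteq> {}"
proof -
 note V = full_verts[OF assms] and TV = simplexD(4)[OF assms]
 have card: "card (verts T) = Suc DIM('a)" using V by (simp add: full_def)
 then have ne: "verts T \<noteq> {}" by auto
 have "centroid (verts T) \<in> interior (convex hull (verts T))"
  by (rule interior_bary[OF V]) (use bary_centroid[OF V subset_refl ne] card in auto)
 then show ?thesis unfolding TV by blast
qed

section \<open>Boundary facets of a triangulation\<close>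

locale cell_complex =
 fixes K :: "'a::euclidean_space set set"
 assumes tri: "triangulation K" and cells: "\<And>T. T \<in> K \<Longrightarrow> cell T"
begin

lemma finite_K: "finite K"
 using tri by (simp add: triangulation_def)

lemma closed_cell: "T \<in> K \<Longrightarrow> closed T"
 using cells closed_simplex by blast

lemma Int_face_of:
 assumes "T \<in> K" "T' \<in> K"
 shows "T \<inter> T' face_of T" "T \<inter> T' face_of T'"
 using tri assms unfolding triangulation_def by (blast, metis Int_commute)

lemma cell_interior_unique:
 assumes T: "T \<in> K" and T': "T' \<in> K" and x: "x \<in> interior T" "x \<in> T'"
 shows "T = T'"
proof -
 have "x \<in> rel_interior T" using x(1) interior_subset_rel_interior by blast
 then have 1: "T \<inter> T' = T"
  using face_of_disjoint_rel_interior[of "T \<inter> T'" T] Int_face_of(1)[OF T T'] x interior_subset by blast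
 show ?thesis
 proof (rule ccontr)
  assume "T \<noteq> T'"
  then have "T \<inter> rel_interior T' = {}"
   using face_of_disjoint_rel_interior[of T T'] Int_face_of(2)[OF T T'] 1 by simp
  moreover have "interior T \<subseteq> interior T'" using 1 by (metis inf.cobounded2 interior_mono)
  ultimately show False
   using cell_interior_nonempty[OF cells[OF T]] interior_subset_rel_interior[of T'] interior_subset[of T] by blast
 qed
qed

text \<open>Two cells on the same side of a common facet would overlap near its centroid.\<close>

lemma outn_opposite:
 assumes T: "T \<in> K" "\<sigma> facet_of T" and T': "T' \<in> K" "\<sigma> facet_of T'" and ne: "T \<noteq> T'"
 shows "outn T' \<sigma> = - outn T \<sigma>"
proof -
 let ?n = "outn T \<sigma>" and ?n' = "outn T' \<sigma>" and ?c = "centroid (verts \<sigma>)"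
 have V: "full (verts T)" using cells[OF T(1)] by (rule full_verts)
 obtain P where P: "P \<in> verts T" "\<sigma> = facet (verts T) P"
  "?n = - (bgrad (verts T) P /\<^sub>R norm (bgrad (verts T) P))"
  using facet_of_cellE[OF cells[OF T(1)] T(2)] by metis
 obtain Q where Q: "Q \<in> verts T - {P}" using facet_vertex_nonempty[OF V P(1)] by blast
 let ?g = "bgrad (verts T) P"
 have g0: "?g \<noteq> 0" by (rule bgrad_nonzero[OF V P(1)])
 have in\<sigma>: "R \<in> \<sigma>" if "R \<in> verts T - {P}" for R using that P(2) by (simp add: hull_inc)
 have "?n' = (?n' \<bullet> (P - Q)) *\<^sub>R ?g"
  by (rule normal_parallel_bgrad[OF V P(1) Q]) (rule outn_props(2)[OF cells[OF T'(1)] T'(2)]; rule in\<sigma>)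
 also have "?g = (- norm ?g) *\<^sub>R ?n" using g0 by (simp add: P(3))
 finally obtain a where a: "?n' = a *\<^sub>R ?n" by (metis scaleR_scaleR)
 have "\<bar>a\<bar> = 1"
  using outn_props(1)[OF cells[OF T'(1)] T'(2)] outn_props(1)[OF cells[OF T(1)] T(2)] unfolding a by simp
 then consider "a = 1" | "a = -1" by linarith
 then show ?thesis
 proof cases
  case 1
  obtain e where e: "0 < e" "\<And>y. dist ?c y < e \<Longrightarrow> ?n \<bullet> (y - ?c) < 0 \<Longrightarrow> y \<in> interior T"
   using facet_centroid_near[OF cells[OF T(1)] T(2)] by metis
  obtain e' where e': "0 < e'" "\<And>y. dist ?c y < e' \<Longrightarrow> ?n' \<bullet> (y - ?c) \<le> 0 \<Longrightarrow> y \<in> T'"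
   using facet_centroid_near[OF cells[OF T'(1)] T'(2)] by metis
  let ?y = "?c - (min e e' / 2) *\<^sub>R ?n"
  have nn: "?n \<bullet> ?n = 1" using outn_props(1)[OF cells[OF T(1)] T(2)] by (simp add: dot_square_norm)
  have "dist ?c ?y = min e e' / 2" using outn_props(1)[OF cells[OF T(1)] T(2)] e e' by (simp add: dist_norm)
  moreover have "?n \<bullet> (?y - ?c) < 0" using e e' nn by simp
  ultimately have "?y \<in> interior T" "?y \<in> T'" using e e' a 1 by auto
  then show ?thesis using cell_interior_unique[OF T(1) T'(1)] ne by blast
 next
  case 2
  then show ?thesis using a by simp
 qed
qed

lemma at_most_two_cells:
 assumes "T1 \<in> K" "T2 \<in> K" "T3 \<in> K" "\<sigma> facet_of T1" "\<sigma> facet_of T2" "\<sigma> facet_of T3"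
  and "T1 \<noteq> T2" "T1 \<noteq> T3"
 shows "T2 = T3"
proof (rule ccontr)
 assume ne: "T2 \<noteq> T3"
 have "outn T2 \<sigma> = - outn T1 \<sigma>" "outn T3 \<sigma> = - outn T1 \<sigma>" "outn T3 \<sigma> = - outn T2 \<sigma>"
  using outn_opposite[OF assms(1,4) assms(2,5) assms(7)] outn_opposite[OF assms(1,4) assms(3,6) assms(8)]
   outn_opposite[OF assms(2,5) assms(3,6) ne] by this
 then have "outn T1 \<sigma> = - outn T1 \<sigma>" by simp
 then have "2 *\<^sub>R outn T1 \<sigma> = 0" unfolding scaleR_2 by (metis add.right_inverse)
 then show False using outn_props(1)[OF cells[OF assms(1)] assms(4)] by simp
qed

lemma frontier_facet_unique:
 assumes T: "T \<in> K" "\<sigma> facet_of T" and T': "T' \<in> K" "\<sigma> facet_of T'" and fr: "\<sigma> \<subseteq> frontier (\<Union>K)"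
 shows "T = T'"
proof (rule ccontr)
 assume ne: "T \<noteq> T'"
 let ?c = "centroid (verts \<sigma>)"
 obtain e where e: "0 < e" "\<And>y. dist ?c y < e \<Longrightarrow> outn T \<sigma> \<bullet> (y - ?c) \<le> 0 \<Longrightarrow> y \<in> T" "?c \<in> \<sigma>"
  using facet_centroid_near[OF cells[OF T(1)] T(2)] by metis
 obtain e' where e': "0 < e'" "\<And>y. dist ?c y < e' \<Longrightarrow> outn T' \<sigma> \<bullet> (y - ?c) \<le> 0 \<Longrightarrow> y \<in> T'"
  using facet_centroid_near[OF cells[OF T'(1)] T'(2)] by metis
 have "ball ?c (min e e') \<subseteq> \<Union>K"
 proof
  fix y assume y: "y \<in> ball ?c (min e e')"
  show "y \<in> \<Union>K"
  proof (cases "outn T \<sigma> \<bullet> (y - ?c) \<le> 0")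
   case True
   then have "y \<in> T" using e(2)[of y] y by simp
   then show ?thesis using T by blast
  next
   case False
   then have "y \<in> T'" using e'(2)[of y] y outn_opposite[OF T T' ne] by simp
   then show ?thesis using T' by blast
  qed
 qed
 moreover have "?c \<in> ball ?c (min e e')" using e e' by simp
 ultimately have "?c \<in> interior (\<Union>K)" using open_ball by (meson interiorI)
 then show False using e(3) fr by (auto simp: frontier_def)
qed

text \<open>Otherwise a relative interior point of the facet is interior to the domain, and just across the
facet there is another cell. It meets the first one in a face containing that point, which must be
the facet itself.\<close>

lemma unique_facet_frontier:
 assumes T: "T \<in> K" "\<sigma> facet_of T" and uniq: "\<And>T'. T' \<in> K \<Longrightarrow> \<sigma> facet_of T' \<Longrightarrow> T' = T"
 shows "\<sigma> \<subseteq> frontier (\<Union>K)"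
proof (rule ccontr)
 assume "\<not> ?thesis"
 then obtain y where y: "y \<in> \<sigma>" "y \<notin> frontier (\<Union>K)" by blast
 note V = full_verts[OF cells[OF T(1)]] and TV = simplexD(4)[OF cells[OF T(1)]]
 let ?V = "verts T"
 obtain P where P: "P \<in> ?V" "\<sigma> = facet ?V P" "verts \<sigma> = ?V - {P}"
  using facet_of_cellE[OF cells[OF T(1)] T(2)] by metis
 let ?n = "outn T \<sigma>"
 have n1: "norm ?n = 1" by (rule outn_props(1)[OF cells[OF T(1)] T(2)])
 have ne: "?V - {P} \<noteq> {}" using facet_vertex_nonempty[OF V P(1)] by blast
 have card0: "0 < card (?V - {P})" using ne full_finite[OF V] by (simp add: card_gt_0_iff)
 have "y \<in> \<Union>K" using y(1) T facet_of_imp_subset by blast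
 then have yi: "y \<in> interior (\<Union>K)" using y(2) closure_subset[of "\<Union>K"] by (auto simp: frontier_def)
 then obtain r where r: "0 < r" "ball y r \<subseteq> interior (\<Union>K)" using open_contains_ball open_interior by blast
 let ?c = "centroid (?V - {P})"
 \<comment> \<open>Moving from \<open>y\<close> slightly towards the centroid gives a relative interior point of the facet.\<close>
 define e where "e = min 1 (r / (2 * (norm (?c - y) + 1)))"
 have e: "0 < e" "e \<le> 1" "e * norm (?c - y) < r"
 proof -
  have pos: "0 < 2 * (norm (?c - y) + 1)" by (smt (verit) norm_ge_zero)
  show "0 < e" "e \<le> 1" using r pos by (auto simp: e_def)
  have "e * norm (?c - y) \<le> (r / (2 * (norm (?c - y) + 1))) * norm (?c - y)"
   by (intro mult_right_mono) (auto simp: e_def)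
  also have "\<dots> < r" using r(1) pos by (simp add: field_simps)
    (smt (verit) mult_nonneg_nonneg norm_ge_zero)
  finally show "e * norm (?c - y) < r" .
 qed
 let ?x = "y + e *\<^sub>R (?c - y)"
 have xi: "?x \<in> interior (\<Union>K)" using r(2) e by (auto simp: dist_norm subset_iff)
 have bx: "bary ?V Q ?x = (1 - e) * bary ?V Q y + e * bary ?V Q ?c" if "Q \<in> ?V" for Q
 proof -
  have 1: "bary ?V Q ?x = bary ?V Q y + e * (bgrad ?V Q \<bullet> (?c - y))"
   using bary_affine[OF V that, of ?x y] by (simp only: add_diff_cancel_left' inner_scaleR_right)
  show ?thesis unfolding 1 bary_diff[OF V that, of ?c y, symmetric] by (simp add: algebra_simps)
 qed
 have by0: "bary ?V P y = 0" "\<And>Q. Q \<in> ?V \<Longrightarrow> 0 \<le> bary ?V Q y"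
  using y(1) P(1) unfolding P(2) convex_hull_bary[OF V Diff_subset] by auto
 have bc: "bary ?V Q ?c = (if Q \<in> ?V - {P} then 1 / real (card (?V - {P})) else 0)" if "Q \<in> ?V" for Q
  by (rule bary_centroid[OF V Diff_subset ne that])
 have bxP: "bary ?V P ?x = 0" using bx[OF P(1)] by0 bc[OF P(1)] by simp
 have bxQ: "0 < bary ?V Q ?x" if "Q \<in> ?V - {P}" for Q
  using bx[of Q] by0(2)[of Q] bc[of Q] that e card0 by (auto intro!: add_nonneg_pos)
 have x\<sigma>: "?x \<in> \<sigma>" unfolding P(2) convex_hull_bary[OF V Diff_subset] using bxP bxQ
  by (auto simp: less_imp_le) (metis DiffI bxP bxQ less_eq_real_def singletonD)
 have cl: "closed (\<Union>{S\<in>K. ?x \<notin> S})" using finite_K closed_cell by (intro closed_Union) auto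
 have "?x \<in> - \<Union>{S\<in>K. ?x \<notin> S} \<inter> interior (\<Union>K)" using xi by auto
 moreover have "open (- \<Union>{S\<in>K. ?x \<notin> S} \<inter> interior (\<Union>K))" using cl by auto
 ultimately obtain d where d: "0 < d" "ball ?x d \<subseteq> - \<Union>{S\<in>K. ?x \<notin> S} \<inter> interior (\<Union>K)"
  using open_contains_ball by blast
 let ?z = "?x + (d / 2) *\<^sub>R ?n"
 have "?z \<in> ball ?x d" using d(1) n1 by (simp add: dist_norm)
 then have z: "?z \<in> - \<Union>{S\<in>K. ?x \<notin> S} \<inter> interior (\<Union>K)" using d(2) by blast
 then obtain T' where T': "T' \<in> K" "?z \<in> T'" using interior_subset by blast
 then have xT': "?x \<in> T'" using z by blast
 have "?n \<bullet> (?z - ?x) > 0" using d(1) n1 by (simp add: dot_square_norm)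
 then have zT: "?z \<notin> T" using outn_props(3)[OF cells[OF T(1)] T(2) x\<sigma>, of ?z] by auto
 then have neT: "T' \<noteq> T" using T'(2) by blast
 have xT: "?x \<in> T" using x\<sigma> T(2) facet_of_imp_subset by blast
 have face: "T \<inter> T' face_of convex hull ?V" using Int_face_of(1)[OF T(1) T'(1)] TV by simp
 then obtain W where W: "W \<subseteq> ?V" "T \<inter> T' = convex hull W"
  using face_of_convex_hull_affine_independent[of ?V] V unfolding full_def by blast
 have "Q \<in> W" if "Q \<in> ?V - {P}" for Q
 proof (rule ccontr)
  assume "Q \<notin> W"
  then have "bary ?V Q ?x = 0"
   using xT xT' W that unfolding convex_hull_bary[OF V W(1)] set_eq_iff by blast
  then show False using bxQ[OF that] by simp
 qed
 then consider "W = ?V" | "W = ?V - {P}" using W(1) by blast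
 then show False
 proof cases
  case 1
  then have "T \<subseteq> T'" using W(2) TV by blast
  then show False
   using cell_interior_unique[OF T(1) T'(1)] cell_interior_nonempty[OF cells[OF T(1)]] interior_subset neT by blast
 next
  case 2
  note V' = full_verts[OF cells[OF T'(1)]] and TV' = simplexD(4)[OF cells[OF T'(1)]]
  have \<sigma>eq: "\<sigma> = T \<inter> T'" using W(2) 2 P(2) by simp
  have "\<sigma> face_of convex hull (verts T')" using Int_face_of(2)[OF T(1) T'(1)] TV' \<sigma>eq by simp
  then obtain W' where W': "W' \<subseteq> verts T'" "\<sigma> = convex hull W'"
   using face_of_convex_hull_affine_independent[of "verts T'"] V' unfolding full_def by blast
  have "W' = ?V - {P}" using verts_sub[OF V' W'(1)] P(3) W'(2) by simp
  then have "card W' = DIM('a)" using card_facet[OF V P(1)] by simp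
  then have "card (verts T' - W') = 1"
   using W'(1) V' full_finite[OF V'] by (simp add: card_Diff_subset finite_subset full_def)
  then obtain P' where "verts T' - W' = {P'}" using card_1_singletonE by blast
  then have "P' \<in> verts T'" "W' = verts T' - {P'}" using W'(1) by blast+
  then have "\<sigma> facet_of T'" using facet_convex_hull[OF V'] W'(2) TV' by auto
  then show False using uniq[OF T'(1)] neT by blast
 qed
qed

lemma boundary_faces_iff:
 "\<sigma> \<in> boundary_faces K \<longleftrightarrow> (\<exists>!T. T \<in> K \<and> \<sigma> facet_of T)"
proof
 assume "\<sigma> \<in> boundary_faces K"
 then obtain T where T: "T \<in> K" "\<sigma> facet_of T" and fr: "\<sigma> \<subseteq> frontier (\<Union>K)"
  by (auto simp: boundary_faces_def)
 show "\<exists>!T. T \<in> K \<and> \<sigma> facet_of T"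
 proof (rule ex1I[of _ T])
  fix T' assume "T' \<in> K \<and> \<sigma> facet_of T'"
  then show "T' = T" using frontier_facet_unique[OF T _ _ fr, of T'] by simp
 qed (simp add: T)
next
 assume ex: "\<exists>!T. T \<in> K \<and> \<sigma> facet_of T"
 then obtain T where T: "T \<in> K" "\<sigma> facet_of T" by blast
 have "T' = T" if "T' \<in> K" "\<sigma> facet_of T'" for T'
  using ex1_implies_ex[OF ex] ex T that by (metis (full_types))
 then have "\<sigma> \<subseteq> frontier (\<Union>K)" by (rule unique_facet_frontier[OF T])
 then show "\<sigma> \<in> boundary_faces K" using T unfolding boundary_faces_def by blast
qed

definition cell_of :: "'a set \<Rightarrow> 'a set" where
 "cell_of \<sigma> = (THE T. T \<in> K \<and> \<sigma> facet_of T)"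

lemma cell_of:
 assumes "\<sigma> \<in> boundary_faces K"
 shows "cell_of \<sigma> \<in> K" "\<sigma> facet_of cell_of \<sigma>"
  and "\<And>T. T \<in> K \<Longrightarrow> \<sigma> facet_of T \<Longrightarrow> T = cell_of \<sigma>"
proof -
 have ex: "\<exists>!T. T \<in> K \<and> \<sigma> facet_of T" using assms boundary_faces_iff by blast
 have "cell_of \<sigma> \<in> K \<and> \<sigma> facet_of cell_of \<sigma>" unfolding cell_of_def by (rule theI'[OF ex])
 then show 1: "cell_of \<sigma> \<in> K" "\<sigma> facet_of cell_of \<sigma>" by auto
 fix T assume "T \<in> K" "\<sigma> facet_of T"
 then show "T = cell_of \<sigma>" unfolding cell_of_def by (intro the1_equality[OF ex, symmetric]) simp
qed

lemma outward_normal_boundary: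
 assumes "\<sigma> \<in> boundary_faces K"
 shows "outward_normal K \<sigma> = outn (cell_of \<sigma>) \<sigma>"
proof -
 have "(\<forall>T\<in>K. \<sigma> facet_of T \<longrightarrow> Q T) \<longleftrightarrow> Q (cell_of \<sigma>)" for Q
 proof
  assume "\<forall>T\<in>K. \<sigma> facet_of T \<longrightarrow> Q T"
  then show "Q (cell_of \<sigma>)" using cell_of(1,2)[OF assms] by simp
 next
  assume Q: "Q (cell_of \<sigma>)"
  show "\<forall>T\<in>K. \<sigma> facet_of T \<longrightarrow> Q T"
  proof (intro ballI impI)
   fix T assume "T \<in> K" "\<sigma> facet_of T"
   then have "T = cell_of \<sigma>" by (rule cell_of(3)[OF assms])
   then show "Q T" using Q by simp
  qed
 qed
 then show ?thesis unfolding outward_normal_def using cell_of(2)[OF assms] by simp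
qed

lemma finite_facets: "T \<in> K \<Longrightarrow> finite {\<sigma>. \<sigma> facet_of T}"
proof -
 assume T: "T \<in> K"
 note V = full_verts[OF cells[OF T]] and TV = simplexD(4)[OF cells[OF T]]
 have "{\<sigma>. \<sigma> facet_of T} = (\<lambda>P. facet (verts T) P) ` verts T"
  using facet_convex_hull[OF V] unfolding TV by blast
 then show ?thesis using full_finite[OF V] by simp
qed

definition all_facets :: "'a set set" where
 "all_facets = (\<Union>T\<in>K. {\<sigma>. \<sigma> facet_of T})"

lemma finite_all_facets: "finite all_facets"
 unfolding all_facets_def using finite_K finite_facets by blast

lemma boundary_subset_all_facets: "boundary_faces K \<subseteq> all_facets"
 by (auto simp: boundary_faces_def all_facets_def)

lemma cells_of_facet:
 assumes "\<sigma> \<in> all_facets"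
 shows "(\<sigma> \<in> boundary_faces K \<and> {T\<in>K. \<sigma> facet_of T} = {cell_of \<sigma>}) \<or>
  (\<sigma> \<notin> boundary_faces K \<and> (\<exists>T T'. T \<noteq> T' \<and> {T\<in>K. \<sigma> facet_of T} = {T, T'}))"
proof (cases "\<sigma> \<in> boundary_faces K")
 case True
 have "{T\<in>K. \<sigma> facet_of T} = {cell_of \<sigma>}"
 proof (intro equalityI subsetI)
  fix T assume "T \<in> {T\<in>K. \<sigma> facet_of T}"
  then have "T = cell_of \<sigma>" by (intro cell_of(3)[OF True]) auto
  then show "T \<in> {cell_of \<sigma>}" by simp
 qed (use cell_of(1,2)[OF True] in auto)
 then show ?thesis using True by simp
next
 case False
 obtain T where T: "T \<in> K" "\<sigma> facet_of T" using assms by (auto simp: all_facets_def)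
 then obtain T' where T': "T' \<in> K" "\<sigma> facet_of T'" "T \<noteq> T'"
  using False boundary_faces_iff[of \<sigma>] by blast
 have "{T\<in>K. \<sigma> facet_of T} = {T, T'}"
  using T T' at_most_two_cells[OF T(1) T'(1) _ T(2) T'(2)] by blast
 then show ?thesis using False T'(3) by blast
qed

lemma sum_facets:
 fixes \<Psi> :: "'a set \<Rightarrow> 'a set \<Rightarrow> 'c::comm_monoid_add"
 shows "(\<Sum>T\<in>K. \<Sum>\<sigma> | \<sigma> facet_of T. \<Psi> T \<sigma>) = (\<Sum>\<sigma>\<in>all_facets. \<Sum>T | T \<in> K \<and> \<sigma> facet_of T. \<Psi> T \<sigma>)"
proof -
 have "{\<sigma>. \<sigma> facet_of T} = {\<sigma>\<in>all_facets. \<sigma> facet_of T}" if "T \<in> K" for T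
  using that by (auto simp: all_facets_def)
 then have "(\<Sum>T\<in>K. \<Sum>\<sigma> | \<sigma> facet_of T. \<Psi> T \<sigma>) = (\<Sum>T\<in>K. \<Sum>\<sigma> | \<sigma> \<in> all_facets \<and> \<sigma> facet_of T. \<Psi> T \<sigma>)"
  by simp
 also have "\<dots> = (\<Sum>\<sigma>\<in>all_facets. \<Sum>T | T \<in> K \<and> \<sigma> facet_of T. \<Psi> T \<sigma>)"
  by (rule sum.swap_restrict[OF finite_K finite_all_facets])
 finally show ?thesis .
qed

text \<open>An inner facet has exactly two cells, whose contributions cancel.\<close>

lemma sum_facets_boundary:
 fixes \<Psi> :: "'a set \<Rightarrow> 'a set \<Rightarrow> real"
 assumes anti: "\<And>T T' \<sigma>. T \<in> K \<Longrightarrow> T' \<in> K \<Longrightarrow> \<sigma> facet_of T \<Longrightarrow> \<sigma> facet_of T' \<Longrightarrow> T \<noteq> T' \<Longrightarrow> \<Psi> T' \<sigma> = - \<Psi> T \<sigma>"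
 shows "(\<Sum>T\<in>K. \<Sum>\<sigma> | \<sigma> facet_of T. \<Psi> T \<sigma>) = (\<Sum>\<sigma>\<in>boundary_faces K. \<Psi> (cell_of \<sigma>) \<sigma>)"
proof -
 have "(\<Sum>T | T \<in> K \<and> \<sigma> facet_of T. \<Psi> T \<sigma>) = (if \<sigma> \<in> boundary_faces K then \<Psi> (cell_of \<sigma>) \<sigma> else 0)"
  if "\<sigma> \<in> all_facets" for \<sigma>
  using cells_of_facet[OF that]
 proof (elim disjE conjE exE)
  assume b: "\<sigma> \<in> boundary_faces K" "{T \<in> K. \<sigma> facet_of T} = {cell_of \<sigma>}"
  show ?thesis unfolding b(2) using b(1) by simp
 next
  fix T T' assume b: "\<sigma> \<notin> boundary_faces K" "T \<noteq> T'" "{T \<in> K. \<sigma> facet_of T} = {T, T'}"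
  then have "\<Psi> T' \<sigma> = - \<Psi> T \<sigma>" by (intro anti) blast+
  then show ?thesis unfolding b(3) using b(1,2) by simp
 qed
 then have "(\<Sum>T\<in>K. \<Sum>\<sigma> | \<sigma> facet_of T. \<Psi> T \<sigma>) = (\<Sum>\<sigma>\<in>all_facets. if \<sigma> \<in> boundary_faces K then \<Psi> (cell_of \<sigma>) \<sigma> else 0)"
  unfolding sum_facets by (rule sum.cong[OF refl])
 also have "\<dots> = (\<Sum>\<sigma>\<in>boundary_faces K. \<Psi> (cell_of \<sigma>) \<sigma>)"
  using finite_all_facets boundary_subset_all_facets
  by (simp add: sum.inter_restrict[symmetric] Int_absorb1)
 finally show ?thesis .
qed

lemma facets_of_cell_at_ridge:
 assumes T: "T \<in> K" and d: "2 \<le> DIM('a)"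
 shows "even (card {\<sigma>. \<sigma> facet_of T \<and> E facet_of \<sigma>})"
proof (cases "{\<sigma>. \<sigma> facet_of T \<and> E facet_of \<sigma>} = {}")
 case False
 let ?V = "verts T"
 note V = full_verts[OF cells[OF T]] and TV = simplexD(4)[OF cells[OF T]]
 have fac: "\<sigma> facet_of T \<longleftrightarrow> (\<exists>P\<in>?V. \<sigma> = facet ?V P)" for \<sigma>
  using facet_convex_hull[OF V] unfolding TV by blast
 have sub: "E facet_of (facet ?V P) \<longleftrightarrow> (\<exists>Q\<in>?V - {P}. E = convex hull (?V - {P} - {Q}))"
  if "P \<in> ?V" for P
  using facet_of_convex_hull_affine_independent_alt[of "?V - {P}" E] affine_independent_sub[OF V Diff_subset]
   card_facet[OF V that] d by auto
 from False obtain \<sigma> where \<sigma>: "\<sigma> facet_of T" "E facet_of \<sigma>" by auto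
 from \<sigma>(1) obtain P where P: "P \<in> ?V" "\<sigma> = facet ?V P" unfolding fac by auto
 from \<sigma>(2) obtain Q where Q: "Q \<in> ?V - {P}" "E = convex hull (?V - {P} - {Q})"
  unfolding P(2) sub[OF P(1)] by auto
 note PQ = P(1) Q
 have vE: "verts E = ?V - {P, Q}" unfolding PQ(3) by (subst verts_sub[OF V]) auto
 have "{\<sigma>. \<sigma> facet_of T \<and> E facet_of \<sigma>} = {facet ?V P, facet ?V Q}"
 proof (intro equalityI subsetI)
  fix \<sigma> assume "\<sigma> \<in> {\<sigma>. \<sigma> facet_of T \<and> E facet_of \<sigma>}"
  then have \<sigma>: "\<sigma> facet_of T" "E facet_of \<sigma>" by auto
  from \<sigma>(1) obtain R where R0: "R \<in> ?V" "\<sigma> = convex hull (?V - {R})" unfolding fac by auto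
  from \<sigma>(2) obtain S where S: "S \<in> ?V - {R}" "E = convex hull (?V - {R} - {S})"
   unfolding R0(2) sub[OF R0(1)] by auto
  note R = R0 S
  have "verts E = ?V - {R} - {S}" unfolding R(4) by (subst verts_sub[OF V]) auto
  then have "?V - {P, Q} = ?V - {R} - {S}" using vE by simp
  then have "R = P \<or> R = Q" using R(1) by blast
  then show "\<sigma> \<in> {facet ?V P, facet ?V Q}" using R(2) by blast
 next
  fix \<sigma> assume "\<sigma> \<in> {facet ?V P, facet ?V Q}"
  moreover have "E facet_of (facet ?V P)" unfolding sub[OF PQ(1)] using PQ by auto
  moreover have "?V - {P} - {Q} = ?V - {Q} - {P}" by blast
  then have "E facet_of (facet ?V Q)" using sub[of Q] PQ by auto
  moreover have "facet ?V P facet_of T" "facet ?V Q facet_of T"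
   unfolding fac using PQ by auto
  ultimately show "\<sigma> \<in> {\<sigma>. \<sigma> facet_of T \<and> E facet_of \<sigma>}" by auto
 qed
 moreover have "facet ?V P \<noteq> facet ?V Q"
 proof
  assume "facet ?V P = facet ?V Q"
  then have "verts (facet ?V P) = verts (facet ?V Q)" by simp
  then have "?V - {P} = ?V - {Q}" unfolding verts_sub[OF V Diff_subset] .
  then show False using PQ by blast
 qed
 ultimately show ?thesis by simp
next
 case True
 show ?thesis unfolding True by simp
qed

text \<open>Pairs of a cell and a facet of it through \<open>E\<close> are counted twice: each cell has no or two such
facets, and each inner facet has two cells.\<close>

lemma even_boundary_faces_at_ridge:
 assumes d: "2 \<le> DIM('a)"
 shows "even (card {\<sigma>\<in>boundary_faces K. E facet_of \<sigma>})"
proof -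
 let ?\<Psi> = "\<lambda>\<sigma>. if E facet_of \<sigma> then 1 else 0 :: nat"
 have "(\<Sum>\<sigma> | \<sigma> facet_of T. ?\<Psi> \<sigma>) = card {\<sigma>. \<sigma> facet_of T \<and> E facet_of \<sigma>}" if "T \<in> K" for T
  using finite_facets[OF that] by (simp add: sum.If_cases Int_def)
 then have "even (\<Sum>T\<in>K. \<Sum>\<sigma> | \<sigma> facet_of T. ?\<Psi> \<sigma>)"
  using facets_of_cell_at_ridge[OF _ d] by (simp add: dvd_sum)
 then have "even (\<Sum>\<sigma>\<in>all_facets. card {T\<in>K. \<sigma> facet_of T} * ?\<Psi> \<sigma>)"
  unfolding sum_facets by simp
 also have "(\<Sum>\<sigma>\<in>all_facets. card {T\<in>K. \<sigma> facet_of T} * ?\<Psi> \<sigma>)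
  = (\<Sum>\<sigma>\<in>all_facets. (if \<sigma> \<in> boundary_faces K then ?\<Psi> \<sigma> else 0) + (if \<sigma> \<in> boundary_faces K then 0 else 2 * ?\<Psi> \<sigma>))"
 proof (rule sum.cong[OF refl])
  fix \<sigma> assume "\<sigma> \<in> all_facets"
  from cells_of_facet[OF this]
  show "card {T\<in>K. \<sigma> facet_of T} * ?\<Psi> \<sigma>
   = (if \<sigma> \<in> boundary_faces K then ?\<Psi> \<sigma> else 0) + (if \<sigma> \<in> boundary_faces K then 0 else 2 * ?\<Psi> \<sigma>)"
  proof (elim disjE conjE exE)
   assume b: "\<sigma> \<in> boundary_faces K" "{T \<in> K. \<sigma> facet_of T} = {cell_of \<sigma>}"
   show ?thesis unfolding b(2) using b(1) by simp
  next
   fix T T' assume b: "\<sigma> \<notin> boundary_faces K" "T \<noteq> T'" "{T \<in> K. \<sigma> facet_of T} = {T, T'}"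
   show ?thesis unfolding b(3) using b(1,2) by simp
  qed
 qed
 also have "\<dots> = (\<Sum>\<sigma>\<in>all_facets. if \<sigma> \<in> boundary_faces K then ?\<Psi> \<sigma> else 0)
   + (\<Sum>\<sigma>\<in>all_facets. if \<sigma> \<in> boundary_faces K then 0 else 2 * ?\<Psi> \<sigma>)" by (rule sum.distrib)
 finally have 1: "even ((\<Sum>\<sigma>\<in>all_facets. if \<sigma> \<in> boundary_faces K then ?\<Psi> \<sigma> else 0)
   + (\<Sum>\<sigma>\<in>all_facets. if \<sigma> \<in> boundary_faces K then 0 else 2 * ?\<Psi> \<sigma>))" .
 have 2: "even (\<Sum>\<sigma>\<in>all_facets. if \<sigma> \<in> boundary_faces K then 0 else 2 * ?\<Psi> \<sigma>)"
  by (rule dvd_sum) auto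
 have 3: "(\<Sum>\<sigma>\<in>all_facets. if \<sigma> \<in> boundary_faces K then ?\<Psi> \<sigma> else 0) = (\<Sum>\<sigma>\<in>boundary_faces K. ?\<Psi> \<sigma>)"
  using finite_all_facets boundary_subset_all_facets by (simp add: sum.inter_restrict[symmetric] Int_absorb1)
 have 4: "(\<Sum>\<sigma>\<in>boundary_faces K. ?\<Psi> \<sigma>) = card {\<sigma>\<in>boundary_faces K. E facet_of \<sigma>}"
  using finite_subset[OF boundary_subset_all_facets finite_all_facets] by (simp add: sum.If_cases Int_def)
 show ?thesis using 1 2 unfolding 3 4 even_add by simp
qed

lemma boundary_faces_Int:
 assumes "\<sigma> \<in> boundary_faces K" "\<rho> \<in> boundary_faces K"
 shows "\<sigma> \<inter> \<rho> face_of \<sigma>" "\<sigma> \<inter> \<rho> face_of \<rho>"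
proof -
 have "\<sigma> face_of cell_of \<sigma>" "\<rho> face_of cell_of \<rho>"
  using cell_of(2)[OF assms(1)] cell_of(2)[OF assms(2)] facet_of_imp_face_of by blast+
 from face_of_Int_subface[OF Int_face_of[OF cell_of(1)[OF assms(1)] cell_of(1)[OF assms(2)]] this]
 show "\<sigma> \<inter> \<rho> face_of \<sigma>" "\<sigma> \<inter> \<rho> face_of \<rho>" by auto
qed

lemma boundary_face_simplex:
 assumes "\<sigma> \<in> boundary_faces K"
 shows "\<not> affine_dependent (verts \<sigma>)" "card (verts \<sigma>) = DIM('a)" "convex hull (verts \<sigma>) = \<sigma>"
  "finite (verts \<sigma>)" "compact \<sigma>"
proof -
 let ?T = "cell_of \<sigma>"
 have T: "cell ?T" and V: "full (verts ?T)" using cells[OF cell_of(1)[OF assms]] full_verts by blast+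
 obtain P where P: "P \<in> verts ?T" "\<sigma> = facet (verts ?T) P" "verts \<sigma> = verts ?T - {P}"
  using facet_of_cellE[OF T cell_of(2)[OF assms]] by metis
 show 1: "\<not> affine_dependent (verts \<sigma>)" unfolding P(3) by (rule affine_independent_sub[OF V Diff_subset])
 show "card (verts \<sigma>) = DIM('a)" unfolding P(3) by (rule card_facet[OF V P(1)])
 show 2: "convex hull (verts \<sigma>) = \<sigma>" using P by simp
 show 3: "finite (verts \<sigma>)" using 1 by (rule aff_independent_finite)
 show "compact \<sigma>" using finite_imp_compact_convex_hull[OF 3] unfolding 2 .
qed

end

section \<open>Integration over simplices\<close>

lemma affine_independent3:
 fixes a b c :: "'a::euclidean_space"
 assumes ind: "\<not> affine_dependent {a, b, c}" and ne: "a \<noteq> b" "a \<noteq> c" "b \<noteq> c"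
  and 0: "s *\<^sub>R (b - a) + t *\<^sub>R (c - a) = 0"
 shows "s = 0 \<and> t = 0"
proof (rule ccontr)
 assume st: "\<not> (s = 0 \<and> t = 0)"
 define U where "U x = (if x = a then - s - t else if x = b then s else t)" for x
 have "sum U {a, b, c} = 0" using ne by (simp add: U_def)
 moreover have "(\<Sum>v\<in>{a, b, c}. U v *\<^sub>R v) = 0" using ne 0 by (simp add: U_def algebra_simps)
 moreover have "\<exists>v\<in>{a, b, c}. U v \<noteq> 0" using st ne by (auto simp: U_def)
 ultimately have "affine_dependent {a, b, c}" unfolding affine_dependent_explicit_finite[OF finite.insertI[OF finite.insertI[OF finite.insertI[OF finite.emptyI]]]] by blast
 then show False using ind by simp
qed

lemma hausdorff_simplex:
 fixes V :: "'a::euclidean_space set"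
 assumes ind: "\<not> affine_dependent V" and card: "card V = Suc k" and k: "k = 1 \<or> k = 2"
 shows "0 < measure (hausdorff k) (convex hull V)"
  and "P2_on (convex hull V) g \<Longrightarrow>
   (LINT x:convex hull V|hausdorff k. g x) = measure (hausdorff k) (convex hull V) * quad_avg V g"
proof -
 have "0 < measure (hausdorff k) (convex hull V) \<and> (P2_on (convex hull V) g \<longrightarrow>
   (LINT x:convex hull V|hausdorff k. g x) = measure (hausdorff k) (convex hull V) * quad_avg V g)"
  using k
 proof
  assume k: "k = 1"
  then have "card V = 2" using card by simp
  then obtain a b where ab: "V = {a, b}" "a \<noteq> b" by (auto simp: card_2_iff)
  show ?thesis using hausdorff_segment[OF ab(2)] ab by (simp add: k segment_convex_hull)
 next
  assume k: "k = 2"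
  then have "card V = 3" using card by simp
  then obtain a b c where abc: "V = {a, b, c}" "a \<noteq> b" "a \<noteq> c" "b \<noteq> c" by (auto simp: card_3_iff)
  have ind': "s = 0 \<and> t = 0" if "s *\<^sub>R (b - a) + t *\<^sub>R (c - a) = 0" for s t
   using affine_independent3[OF _ abc(2,3,4) that] ind abc(1) by simp
  have "0 < sqrt (gram (b - a) (c - a)) / 2" using gram_pos[of "b - a" "c - a", OF ind'] by simp
  then have "0 < measure (hausdorff 2) (convex hull {a, b, c})"
   using hausdorff_triangle(1)[of b a c, OF ind'] by linarith
  then show ?thesis using hausdorff_triangle(2)[of b a c, OF ind'] unfolding k abc(1) by blast
 qed
 then show "0 < measure (hausdorff k) (convex hull V)" "P2_on (convex hull V) g \<Longrightarrow>
   (LINT x:convex hull V|hausdorff k. g x) = measure (hausdorff k) (convex hull V) * quad_avg V g" by auto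
qed

lemma emeasure_finite_of_measure_pos: "0 < measure M A \<Longrightarrow> emeasure M A < top"
 by (metis less_numeral_extra(3) measure_def enn2real_top top.not_eq_extremum)

lemma hausdorff_full_dim: "hausdorff DIM('a) = (lborel :: 'a::euclidean_space measure)"
proof (rule measure_eqI)
 fix A :: "'a set" assume "A \<in> sets (hausdorff DIM('a))"
 then have A: "A \<in> sets borel" by simp
 have lin: "linear (\<lambda>x::'a. x)" by (rule linear_ident)
 have "emeasure (hausdorff DIM('a)) ((\<lambda>y. 0 + y) ` A) = ennreal (jacobian (\<lambda>x::'a. x)) * emeasure lborel A"
  by (rule emeasure_affine_image[OF lin _ A]) simp
 also have "jacobian (\<lambda>x::'a. x) = 1" by (rule jacobian_isometry[OF lin]) simp
 finally show "emeasure (hausdorff DIM('a)) A = emeasure lborel A" by simp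
qed simp

subsection \<open>Cells\<close>

lemma compact_full: "full V \<Longrightarrow> compact (convex hull V)"
 using full_finite finite_imp_compact_convex_hull by blast

lemma measure_full_pos:
 assumes V: "full V" shows "0 < measure lborel (convex hull V)"
proof -
 have card: "card V = Suc DIM('a)" using V by (simp add: full_def)
 then have ne: "V \<noteq> {}" by auto
 have "centroid V \<in> interior (convex hull V)"
  by (rule interior_bary[OF V]) (use bary_centroid[OF V subset_refl ne] card in auto)
 then have ni: "interior (convex hull V) \<noteq> {}" by blast
 have "\<not> negligible (convex hull V)"
  using negligible_convex_interior[OF convex_convex_hull, of V] ni by simp
 then have "measure lebesgue (convex hull V) \<noteq> 0"
  using compact_full[OF V] negligible_iff_measure0 lmeasurable_compact by blast
 moreover have "measure lebesgue (convex hull V) = measure lborel (convex hull V)"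
  using compact_imp_closed[OF compact_full[OF V]] by (simp add: measure_completion)
 ultimately show ?thesis by (simp add: zero_less_measure_iff)
qed

lemma set_integrable_compact_lborel:
 fixes f :: "'a::euclidean_space \<Rightarrow> real"
 assumes "compact S" "continuous_on S f"
 shows "set_integrable lborel S f"
 unfolding set_integrable_def by (rule borel_integrable_compact[OF assms])

lemma set_integral_sum:
 fixes f :: "'i \<Rightarrow> 'a \<Rightarrow> real"
 assumes "\<And>i. i \<in> I \<Longrightarrow> set_integrable M A (f i)"
 shows "(LINT x:A|M. (\<Sum>i\<in>I. f i x)) = (\<Sum>i\<in>I. LINT x:A|M. f i x)"
 using assms unfolding set_lebesgue_integral_def set_integrable_def scaleR_sum_right
 by (rule Bochner_Integration.integral_sum)

text \<open>Exchanging two vertices is a measure preserving affine map of the simplex.\<close>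

lemma integral_bary_eq:
 assumes V: "full V" and P: "P \<in> V" and Q: "Q \<in> V"
 shows "(LINT x:convex hull V|lborel. bary V P x) = (LINT x:convex hull V|lborel. bary V Q x)"
proof (cases "P = Q")
 case False
 let ?T = "convex hull V"
 define F where "F x = x + ((bgrad V P - bgrad V Q) \<bullet> x) *\<^sub>R (Q - P)" for x
 define p where "p = (bary V P 0 - bary V Q 0) *\<^sub>R (Q - P)"
 have lin: "linear F" unfolding F_def by (intro linearI) (auto simp: algebra_simps inner_add_right)
 have L: "p + F x = x + (bary V P x - bary V Q x) *\<^sub>R (Q - P)" for x
  using bary_affine[OF V P, of x 0] bary_affine[OF V Q, of x 0]
  by (simp add: p_def F_def inner_diff_left algebra_simps)
 have bL: "bary V R (p + F x) = bary V R x + (bary V P x - bary V Q x) * ((if R = Q then 1 else 0) - (if R = P then 1 else 0))"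
  if R: "R \<in> V" for R x
 proof -
  have "bary V R (p + F x) = bary V R x + (bary V P x - bary V Q x) * (bgrad V R \<bullet> (Q - P))"
   unfolding L using bary_affine[OF V R, of "x + (bary V P x - bary V Q x) *\<^sub>R (Q - P)" x] by simp
  also have "bgrad V R \<bullet> (Q - P) = bary V R Q - bary V R P" by (rule bary_diff[OF V R, symmetric])
  finally show ?thesis using R P Q by (simp add: bary_vertex[OF V])
 qed
 have LL: "p + F (p + F x) = x" for x
 proof -
  have P': "bary V P (p + F x) = bary V Q x" and Q': "bary V Q (p + F x) = bary V P x"
   using bL[OF P, of x] bL[OF Q, of x] False by simp_all
  show ?thesis unfolding L[of "p + F x"] P' Q' unfolding L[of x] by (simp add: algebra_simps)
 qed
 have inj: "inj F"
 proof (rule injI)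
  fix x y assume F: "F x = F y"
  have "x = p + F (p + F x)" by (rule LL[symmetric])
  also have "\<dots> = p + F (p + F y)" unfolding F ..
  also have "\<dots> = y" by (rule LL)
  finally show "x = y" .
 qed
 have img: "(\<lambda>x. p + F x) ` ?T = ?T"
 proof -
  have sub: "p + F x \<in> ?T" if x: "x \<in> ?T" for x
  proof -
   have pos: "0 \<le> bary V R x" if "R \<in> V" for R
    using x that unfolding convex_hull_bary[OF V subset_refl] by blast
   have "0 \<le> bary V R (p + F x)" if R: "R \<in> V" for R
    using pos[OF R] pos[OF P] pos[OF Q] False unfolding bL[OF R] by simp
   then show ?thesis unfolding convex_hull_bary[OF V subset_refl] by blast
  qed
  show ?thesis
  proof (intro equalityI subsetI)
   fix x assume x: "x \<in> ?T"
   have "x = p + F (p + F x)" using LL by simp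
   then show "x \<in> (\<lambda>x. p + F x) ` ?T" using sub[OF x] by (rule image_eqI)
  qed (use sub in auto)
 qed
 have T: "?T \<in> sets borel" using compact_imp_closed[OF compact_full[OF V]] by simp
 have "measure (hausdorff DIM('a)) ((\<lambda>x. p + F x) ` ?T) = jacobian F * measure lborel ?T"
  by (rule measure_affine_image[OF lin inj T])
 then have J: "jacobian F = 1" using measure_full_pos[OF V] by (simp add: img hausdorff_full_dim)
 have "(LINT x:(\<lambda>x. p + F x) ` ?T|hausdorff DIM('a). bary V P x) = jacobian F * (LINT x:?T|lborel. bary V P (p + F x))"
 proof (rule integral_affine_image[OF lin inj T])
  have "continuous_on ?T (\<lambda>x. bary V P (p + F x))"
   unfolding bL[OF P] by (intro continuous_intros continuous_bary[OF V] P Q)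
  then show "(\<lambda>x. indicator ?T x *\<^sub>R bary V P (p + F x)) \<in> borel_measurable borel"
   by (rule borel_measurable_continuous_on_indicator[OF T])
 qed
 then show ?thesis using False by (simp add: img J hausdorff_full_dim bL[OF P])
qed simp

lemma integral_bary:
 fixes V :: "'a::euclidean_space set"
 assumes V: "full V" and P: "P \<in> V"
 shows "(LINT x:convex hull V|lborel. bary V P x) = measure lborel (convex hull V) / real (Suc DIM('a))"
proof -
 let ?T = "convex hull V"
 have "(\<Sum>Q\<in>V. LINT x:?T|lborel. bary V Q x) = (LINT x:?T|lborel. (\<Sum>Q\<in>V. bary V Q x))"
  using full_finite[OF V] set_integrable_compact_lborel[OF compact_full[OF V] continuous_bary[OF V]]
  by (intro set_integral_sum[symmetric]) auto
 also have "\<dots> = measure lborel ?T"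
  using compact_imp_closed[OF compact_full[OF V]] by (simp add: bary_sum[OF V] set_lebesgue_integral_def)
 finally have "(\<Sum>Q\<in>V. LINT x:?T|lborel. bary V P x) = measure lborel ?T"
  using integral_bary_eq[OF V P] by simp
 then show ?thesis using V by (simp add: full_def field_simps)
qed

lemma integral_affine_full:
 fixes V :: "'a::euclidean_space set"
 assumes V: "full V"
 shows "(LINT x:convex hull V|lborel. c + a \<bullet> x)
  = measure lborel (convex hull V) * (\<Sum>P\<in>V. c + a \<bullet> P) / real (Suc DIM('a))"
proof -
 let ?T = "convex hull V"
 have eq: "c + a \<bullet> x = (\<Sum>P\<in>V. (c + a \<bullet> P) * bary V P x)" for x
 proof -
  have "(\<Sum>P\<in>V. (c + a \<bullet> P) * bary V P x) = c * (\<Sum>P\<in>V. bary V P x) + a \<bullet> (\<Sum>P\<in>V. bary V P x *\<^sub>R P)"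
   by (simp add: inner_sum_right sum_distrib_left sum.distrib[symmetric] algebra_simps)
  then show ?thesis by (simp only: bary_sum[OF V] bary_rep[OF V] mult_1_right)
 qed
 have "(LINT x:?T|lborel. c + a \<bullet> x) = (\<Sum>P\<in>V. LINT x:?T|lborel. (c + a \<bullet> P) * bary V P x)"
 proof -
  have "(LINT x:?T|lborel. c + a \<bullet> x) = (LINT x:?T|lborel. \<Sum>P\<in>V. (c + a \<bullet> P) * bary V P x)"
   by (rule arg_cong[where f="set_lebesgue_integral lborel ?T"], rule ext, rule eq)
  also have "\<dots> = (\<Sum>P\<in>V. LINT x:?T|lborel. (c + a \<bullet> P) * bary V P x)"
   by (intro set_integral_sum set_integrable_compact_lborel compact_full[OF V] continuous_on_mult
     continuous_on_const continuous_bary[OF V])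
  finally show ?thesis .
 qed
 also have "\<dots> = (\<Sum>P\<in>V. (c + a \<bullet> P) * (measure lborel ?T / real (Suc DIM('a))))"
  by (intro sum.cong refl) (simp add: integral_bary[OF V])
 also have "\<dots> = measure lborel ?T * (\<Sum>P\<in>V. c + a \<bullet> P) / real (Suc DIM('a))"
  by (simp only: sum_distrib_right[symmetric]) (simp add: mult.commute)
 finally show ?thesis .
qed

lemma bgrad_inner:
 assumes "full V" "P \<in> V" shows "bgrad V P \<bullet> h = bary V P h - bary V P 0"
 using bary_diff[OF assms, of h 0] by simp

lemma sum_bgrad:
 assumes V: "full V" shows "(\<Sum>P\<in>V. bgrad V P) = 0"
proof -
 have "(\<Sum>P\<in>V. bgrad V P) \<bullet> h = 0" for h
 proof -
  have "(\<Sum>P\<in>V. bgrad V P) \<bullet> h = (\<Sum>P\<in>V. bary V P h - bary V P 0)"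
   unfolding inner_sum_left by (rule sum.cong[OF refl]) (rule bgrad_inner[OF V])
  then show ?thesis by (simp only: sum_subtractf bary_sum[OF V] diff_self)
 qed
 from this[of "\<Sum>P\<in>V. bgrad V P"] show ?thesis by simp
qed

lemma sum_bgrad_vertex:
 assumes V: "full V" shows "(\<Sum>P\<in>V. (bgrad V P \<bullet> h) *\<^sub>R P) = h"
proof -
 have "(\<Sum>P\<in>V. (bgrad V P \<bullet> h) *\<^sub>R P) = (\<Sum>P\<in>V. (bary V P h - bary V P 0) *\<^sub>R P)"
  by (rule sum.cong[OF refl]) (simp only: bgrad_inner[OF V])
 then show ?thesis by (simp only: scaleR_diff_left sum_subtractf bary_rep[OF V] diff_zero)
qed

subsection \<open>Overlaps\<close>

lemma hausdorff_outer_singleton: "0 < k \<Longrightarrow> hausdorff_outer k {a} = 0"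
proof -
 assume k: "0 < k"
 have "hausdorff_outer k {a} \<le> 0"
 proof (rule hausdorff_outer_least)
  fix \<delta> :: real assume "0 < \<delta>"
  then have "hausdorff_pre k \<delta> {a} \<le> weight k {a}" by (intro hausdorff_pre_single) auto
  then show "hausdorff_pre k \<delta> {a} \<le> 0" using k by (simp add: weight_def zero_power)
 qed
 then show ?thesis by simp
qed

lemma hausdorff_outer_two_segment:
 fixes a b :: "'a::euclidean_space"
 shows "hausdorff_outer 2 (closed_segment a b) = 0"
proof -
 define S where "S = cbox (0, 0) (1::real, 0::real)"
 define f where "f z = a + fst z *\<^sub>R (b - a)" for z :: "real \<times> real"
 have "emeasure (hausdorff DIM(real \<times> real)) S = emeasure lborel S" by (simp only: hausdorff_full_dim)
 also have "emeasure lborel S = 0"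
 proof -
  have "prod ((\<bullet>) (1::real, 0::real)) Basis = 0"
   by (rule prod_zero) (auto simp: Basis_prod_def intro!: bexI[of _ "(0, 1)"])
  then show ?thesis unfolding S_def emeasure_lborel_cbox_eq by (simp del: prod_zero_iff)
 qed
 finally have "hausdorff_outer DIM(real \<times> real) S / hausdorff_outer DIM(real \<times> real) (coordinate_cube DIM(real \<times> real) :: (real \<times> real) set) = 0"
  by (subst (asm) emeasure_hausdorff) (auto simp: S_def)
 moreover have "hausdorff_outer DIM(real \<times> real) (coordinate_cube DIM(real \<times> real) :: (real \<times> real) set) < top"
  by (rule hausdorff_coordinate_cube(2)[OF linear_ident]) simp
 ultimately have S0: "hausdorff_outer 2 S = 0" by (auto simp: divide_ennreal_def numeral_2_eq_2)
 have "closed_segment a b \<subseteq> f ` S"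
 proof
  fix x assume "x \<in> closed_segment a b"
  then obtain t where "t \<in> {0..1}" "x = a + t *\<^sub>R (b - a)" unfolding segment_affine_image by auto
  then have "x = f (t, 0)" "(t, 0) \<in> S" by (auto simp: f_def S_def cbox_Pair_eq)
  then show "x \<in> f ` S" by blast
 qed
 then have "hausdorff_outer 2 (closed_segment a b) \<le> hausdorff_outer 2 (f ` S)" by (rule hausdorff_outer_mono)
 also have "\<dots> \<le> ennreal ((norm (b - a) + 1) ^ 2) * hausdorff_outer 2 S"
 proof (rule hausdorff_outer_lipschitz_le)
  show "0 < norm (b - a) + 1" by (rule add_nonneg_pos) auto
  fix x y :: "real \<times> real"
  have "dist (f x) (f y) = norm (b - a) * dist (fst x) (fst y)"
   by (simp add: f_def dist_norm scaleR_diff_left[symmetric] mult.commute)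
  also have "\<dots> \<le> (norm (b - a) + 1) * dist x y"
   by (intro mult_mono dist_fst_le) auto
  finally show "dist (f x) (f y) \<le> (norm (b - a) + 1) * dist x y" .
 qed
 finally show ?thesis using S0 by simp
qed

lemma hausdorff_null_low_dim:
 fixes V :: "'a::euclidean_space set"
 assumes V: "finite V" "card V \<le> k" and k: "k = 1 \<or> k = 2"
 shows "emeasure (hausdorff k) (convex hull V) = 0"
proof -
 have "hausdorff_outer k (convex hull V) = 0"
 proof -
  consider "card V = 0" | "card V = 1" | "card V = 2" "k = 2" using V k by linarith
  then show ?thesis
  proof cases
   case 1 then show ?thesis using V(1) by (simp add: hausdorff_outer_empty)
  next
   case 2
   then obtain a where "V = {a}" using card_1_singletonE by blast
   then show ?thesis using hausdorff_outer_singleton[of k a] k by auto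
  next
   case 3
   then obtain a b where "V = {a, b}" by (auto simp: card_2_iff)
   then show ?thesis using hausdorff_outer_two_segment[of a b] 3 by (simp add: segment_convex_hull)
  qed
 qed
 moreover have "convex hull V \<in> sets borel"
  using finite_imp_compact_convex_hull[OF V(1)] compact_imp_closed borel_closed by blast
 ultimately show ?thesis by (simp add: emeasure_hausdorff)
qed

context cell_complex
begin

lemma boundary_face_subset_eq:
 assumes \<sigma>: "\<sigma> \<in> boundary_faces K" and \<rho>: "\<rho> \<in> boundary_faces K" and sub: "\<sigma> \<subseteq> \<rho>"
 shows "\<sigma> = \<rho>"
proof -
 note s = boundary_face_simplex[OF \<sigma>] and r = boundary_face_simplex[OF \<rho>]
 have "\<sigma> face_of convex hull (verts \<rho>)" using boundary_faces_Int(2)[OF \<sigma> \<rho>] sub r(3) by (simp add: Int_absorb2)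
 then obtain c where c: "c \<subseteq> verts \<rho>" "\<sigma> = convex hull c"
  using face_of_convex_hull_affine_independent[OF r(1)] by auto
 have "\<not> affine_dependent c" using affine_dependent_subset[OF _ c(1)] r(1) by blast
 then have "verts \<sigma> = c" unfolding c(2) by (rule verts_convex_hull)
 then have "c = verts \<rho>" using c(1) s(2) r(2) r(4) card_subset_eq[of "verts \<rho>" c] by simp
 then show ?thesis using c(2) r(3) by simp
qed

lemma hausdorff_boundary_face:
 assumes \<sigma>: "\<sigma> \<in> boundary_faces K" and k: "DIM('a) = Suc k" "k = 1 \<or> k = 2"
 shows "0 < measure (hausdorff k) \<sigma>" "emeasure (hausdorff k) \<sigma> < top"
  and "P2_on \<sigma> g \<Longrightarrow> (LINT x:\<sigma>|hausdorff k. g x) = measure (hausdorff k) \<sigma> * quad_avg (verts \<sigma>) g"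
proof -
 note s = boundary_face_simplex[OF \<sigma>]
 have card: "card (verts \<sigma>) = Suc k" using s(2) k(1) by simp
 show p: "0 < measure (hausdorff k) \<sigma>" using hausdorff_simplex(1)[OF s(1) card k(2)] unfolding s(3) .
 then show "emeasure (hausdorff k) \<sigma> < top" by (rule emeasure_finite_of_measure_pos)
 show "P2_on \<sigma> g \<Longrightarrow> (LINT x:\<sigma>|hausdorff k. g x) = measure (hausdorff k) \<sigma> * quad_avg (verts \<sigma>) g"
  using hausdorff_simplex(2)[OF s(1) card k(2), of g] unfolding s(3) .
qed

lemma measure_Union_boundary_faces:
 assumes F: "F \<subseteq> boundary_faces K" and k: "DIM('a) = Suc k" "k = 1 \<or> k = 2"
 shows "measure (hausdorff k) (\<Union>F) = (\<Sum>\<sigma>\<in>F. measure (hausdorff k) \<sigma>)"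
proof (rule measure_Union_AE)
 show "finite F" using finite_subset[OF F] finite_subset[OF boundary_subset_all_facets finite_all_facets] by blast
 show "S \<in> fmeasurable (hausdorff k)" if "S \<in> F" for S
  using that F boundary_face_simplex(5)[of S] hausdorff_boundary_face(2)[OF _ k, of S]
  by (intro fmeasurableI) (auto intro!: borel_closed compact_imp_closed)
 show "pairwise (\<lambda>S T. AE x in hausdorff k. x \<notin> S \<or> x \<notin> T) F"
 proof (rule pairwiseI)
  fix \<sigma> \<rho> assume "\<sigma> \<in> F" "\<rho> \<in> F" and ne: "\<sigma> \<noteq> \<rho>"
  then have \<sigma>: "\<sigma> \<in> boundary_faces K" and \<rho>: "\<rho> \<in> boundary_faces K" using F by auto
  note s = boundary_face_simplex[OF \<sigma>]
  have "\<sigma> \<inter> \<rho> face_of convex hull (verts \<sigma>)" using boundary_faces_Int(1)[OF \<sigma> \<rho>] s(3) by simp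
  then obtain c where c: "c \<subseteq> verts \<sigma>" "\<sigma> \<inter> \<rho> = convex hull c"
   using face_of_convex_hull_affine_independent[OF s(1)] by auto
  have "c \<noteq> verts \<sigma>"
  proof
   assume "c = verts \<sigma>"
   then have "\<sigma> \<subseteq> \<rho>" using c(2) s(3) by auto
   then show False using boundary_face_subset_eq[OF \<sigma> \<rho>] ne by blast
  qed
  then have "c \<subset> verts \<sigma>" using c(1) by blast
  then have "card c < card (verts \<sigma>)" by (rule psubset_card_mono[OF s(4)])
  then have "card c \<le> k" using s(2) k(1) by simp
  then have "emeasure (hausdorff k) (\<sigma> \<inter> \<rho>) = 0"
   unfolding c(2) by (intro hausdorff_null_low_dim[OF _ _ k(2)] finite_subset[OF c(1) s(4)])
  moreover have "\<sigma> \<inter> \<rho> \<in> sets borel"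
   using s(5) boundary_face_simplex(5)[OF \<rho>] by (intro sets.Int borel_closed compact_imp_closed)
  ultimately have "\<sigma> \<inter> \<rho> \<in> null_sets (hausdorff k)" by (simp add: null_sets_def)
  from AE_not_in[OF this] show "AE x in hausdorff k. x \<notin> \<sigma> \<or> x \<notin> \<rho>" by eventually_elim auto
 qed
qed

lemma cells_overlap_null:
 assumes T: "T \<in> K" "T' \<in> K" "T \<noteq> T'"
 shows "T \<inter> T' \<in> null_sets lborel"
proof -
 have "interior (T \<inter> T') = {}"
  using cell_interior_unique[OF T(1,2)] T(3) interior_subset[of T'] by (auto simp: interior_Int)
 moreover have "convex (T \<inter> T')" using simplexD(4)[OF cells[OF T(1)]] simplexD(4)[OF cells[OF T(2)]] convex_convex_hull
  by (metis convex_Int)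
 ultimately have "negligible (T \<inter> T')" using negligible_convex_interior by blast
 moreover have "T \<inter> T' \<in> sets lborel" using T closed_cell by (auto intro: borel_closed)
 ultimately show ?thesis
  by (simp add: negligible_iff_null_sets null_sets_completion_iff)
qed

lemma compact_cell: "T \<in> K \<Longrightarrow> compact T"
 using cells compact_simplex by blast

lemma AE_indicator_cells: "AE x in lborel. indicator (\<Union>K) x = (\<Sum>T\<in>K. indicator T x :: real)"
proof -
 have "AE x in lborel. \<forall>p\<in>{(T, T'). T \<in> K \<and> T' \<in> K \<and> T \<noteq> T'}. x \<notin> fst p \<inter> snd p"
 proof (rule AE_finite_allI)
  show "finite {(T, T'). T \<in> K \<and> T' \<in> K \<and> T \<noteq> T'}"
   by (rule finite_subset[of _ "K \<times> K"]) (use finite_K in auto)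
 qed (auto intro!: AE_not_in cells_overlap_null simp del: Int_iff)
 then show ?thesis
 proof eventually_elim
  case (elim x)
  show ?case
  proof (cases "x \<in> \<Union>K")
   case True
   then obtain T where T: "T \<in> K" "x \<in> T" by blast
   have "(\<Sum>S\<in>K. indicator S x :: real) = (\<Sum>S\<in>{T}. indicator S x)"
    by (rule sum.mono_neutral_right) (use finite_K T elim in \<open>auto simp: indicator_def\<close>)
   then show ?thesis using T True by simp
  next
   case False
   then have "indicator S x = (0::real)" if "S \<in> K" for S using that by auto
   then show ?thesis using False by simp
  qed
 qed
qed

lemma integral_cells:
 fixes f :: "'a \<Rightarrow> real"
 assumes f: "continuous_on (\<Union>K) f"
 shows "(LINT x:\<Union>K|lborel. f x) = (\<Sum>T\<in>K. LINT x:T|lborel. f x)"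
proof -
 have comp: "compact (\<Union>K)" using finite_K compact_cell by (intro compact_Union) auto
 have int: "set_integrable lborel T f" if "T \<in> K" for T
  using that by (intro set_integrable_compact_lborel[OF compact_cell continuous_on_subset[OF f]]) auto
 have int': "set_integrable lborel (\<Union>K) f" by (rule set_integrable_compact_lborel[OF comp f])
 have "(LINT x:\<Union>K|lborel. f x) = (\<integral>x. (\<Sum>T\<in>K. indicator T x *\<^sub>R f x) \<partial>lborel)"
  unfolding set_lebesgue_integral_def
 proof (rule integral_cong_AE)
  show "(\<lambda>x. indicator (\<Union>K) x *\<^sub>R f x) \<in> borel_measurable lborel"
   using int' unfolding set_integrable_def by (rule borel_measurable_integrable)
  show "(\<lambda>x. \<Sum>T\<in>K. indicator T x *\<^sub>R f x) \<in> borel_measurable lborel"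
   using int unfolding set_integrable_def by (intro borel_measurable_sum borel_measurable_integrable)
  show "AE x in lborel. indicator (\<Union>K) x *\<^sub>R f x = (\<Sum>T\<in>K. indicator T x *\<^sub>R f x)"
   using AE_indicator_cells by eventually_elim (simp only: scaleR_sum_left)
 qed
 also have "\<dots> = (\<Sum>T\<in>K. LINT x:T|lborel. f x)"
  unfolding set_lebesgue_integral_def using int unfolding set_integrable_def
  by (intro Bochner_Integration.integral_sum)
 finally show ?thesis .
qed

end

subsection \<open>Facet areas\<close>

text \<open>Area is base times height over the dimension, and the height of a vertex is the inverse norm of the gradient of its barycentric coordinate.\<close>

lemma facet_measure_2:
 fixes V :: "(real^2) set"
 assumes V: "full V" and P: "P \<in> V"
 shows "measure (hausdorff 1) (facet V P) = 2 * measure lborel (convex hull V) * norm (bgrad V P)"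
proof -
 have "card (V - {P}) = 2" using card_facet[OF V P] by simp
 then obtain A B where AB: "V - {P} = {A, B}" "A \<noteq> B" by (auto simp: card_2_iff)
 then have VP: "V = {P, A, B}" "A \<in> V" "B \<in> V" "A \<noteq> P" "B \<noteq> P" using P by blast+
 let ?g = "bgrad V P"
 define e d where "e = B - A" and "d = A - P"
 have ge: "?g \<bullet> e = 0" using bary_diff[OF V P, of B A] VP(2-) P by (simp add: bary_vertex[OF V] e_def)
 have gd: "?g \<bullet> d = -1" using bary_diff[OF V P, of A P] VP(2-) P by (simp add: bary_vertex[OF V] d_def)
 define D where "D = d $ 1 * e $ 2 - d $ 2 * e $ 1"
 have c1: "?g $ 1 * e $ 1 + ?g $ 2 * e $ 2 = 0" and c2: "?g $ 1 * d $ 1 + ?g $ 2 * d $ 2 = -1"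
  using ge gd by (simp_all add: inner_vec_def sum_2)
 have g1: "D * ?g $ 1 = - e $ 2" using c1 c2 unfolding D_def by algebra
 have g2: "D * ?g $ 2 = e $ 1" using c1 c2 unfolding D_def by algebra
 have "measure lborel (convex hull V) = \<bar>D\<bar> / 2"
  unfolding VP(1) content_triangle by (simp add: D_def d_def e_def abs_if algebra_simps)
 moreover have "measure (hausdorff 1) (facet V P) = norm e"
  using hausdorff_segment(1)[OF AB(2)] unfolding AB(1) segment_convex_hull[symmetric]
  by (simp add: e_def dist_norm norm_minus_commute)
 moreover have "norm e = \<bar>D\<bar> * norm ?g"
 proof -
  have "(norm e)\<^sup>2 = (D * ?g $ 1)\<^sup>2 + (D * ?g $ 2)\<^sup>2"
   unfolding g1 g2 power2_norm_eq_inner inner_vec_def sum_2 by (simp add: power2_eq_square)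
  also have "\<dots> = (\<bar>D\<bar> * norm ?g)\<^sup>2"
   unfolding power_mult_distrib power2_norm_eq_inner inner_vec_def sum_2
   by (simp add: power2_eq_square algebra_simps)
  finally show ?thesis by (simp add: power2_eq_iff_nonneg)
 qed
 ultimately show ?thesis by simp
qed

lemma gram_cross3: "gram a b = (norm (cross3 a b))\<^sup>2"
 using norm_cross_dot[of a b] by (simp add: gram_def power2_norm_eq_inner[symmetric] power_mult_distrib)

lemma measure_tetrahedron:
 fixes P A B C :: "real^3"
 assumes "card {P, A, B, C} = 4"
 shows "measure lborel (convex hull {P, A, B, C}) = \<bar>(A - P) \<bullet> cross3 (B - A) (C - A)\<bar> / 6"
proof -
 define f where "f j = (if j = 1 then A else if j = 2 then B else C)" for j :: 3
 have ne: "P \<noteq> A" "P \<noteq> B" "P \<noteq> C" "A \<noteq> B" "A \<noteq> C" "B \<noteq> C"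
  using assms by (auto simp: card_insert_if split: if_splits)
 have bij: "bij_betw f UNIV ({P, A, B, C} - {P})"
 proof -
  have "inj f" unfolding inj_on_def using ne by (simp add: f_def forall_3)
  moreover have "f ` UNIV = {A, B, C}"
  proof -
   have "f 1 = A" "f 2 = B" "f 3 = C" by (simp_all add: f_def)
   then show ?thesis unfolding UNIV_3 by (simp only: image_insert image_empty)
  qed
  moreover have "{P, A, B, C} - {P} = {A, B, C}" using ne by auto
  ultimately show ?thesis by (simp add: bij_betw_def)
 qed
 have "measure lborel (convex hull {P, A, B, C}) = \<bar>det (\<chi> i. \<chi> j. f j $ i - P $ i)\<bar> / fact CARD(3)"
  by (rule content_simplex[OF _ _ _ bij]) (use assms in auto)
 also have "det (\<chi> i. \<chi> j. f j $ i - P $ i) = (A - P) \<bullet> cross3 (B - A) (C - A)"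
  by (simp add: det_3 f_def cross3_def inner_vec_def sum_3 algebra_simps)
 finally show ?thesis by (simp add: fact_numeral)
qed

lemma measure_triangle_cross3:
 fixes A B C :: "real^3"
 assumes "\<not> affine_dependent {A, B, C}" "A \<noteq> B" "A \<noteq> C" "B \<noteq> C"
 shows "measure (hausdorff 2) (convex hull {A, B, C}) = norm (cross3 (B - A) (C - A)) / 2"
 using hausdorff_triangle(1)[of B A C, OF affine_independent3[OF assms]] by (simp add: gram_cross3)

lemma facet_measure_3:
 fixes V :: "(real^3) set"
 assumes V: "full V" and P: "P \<in> V"
 shows "measure (hausdorff 2) (facet V P) = 3 * measure lborel (convex hull V) * norm (bgrad V P)"
proof -
 have "card (V - {P}) = 3" using card_facet[OF V P] by simp
 then obtain A B C where ABC: "V - {P} = {A, B, C}" "A \<noteq> B" "A \<noteq> C" "B \<noteq> C" by (auto simp: card_3_iff)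
 then have VP: "V = {P, A, B, C}" "A \<in> V" "B \<in> V" "C \<in> V" "A \<noteq> P" "B \<noteq> P" "C \<noteq> P" using P by blast+
 let ?g = "bgrad V P"
 define u v d where "u = B - A" and "v = C - A" and "d = A - P"
 define w where "w = cross3 u v"
 have gu: "?g \<bullet> u = 0" using bary_diff[OF V P, of B A] VP(2-) P by (simp add: bary_vertex[OF V] u_def)
 have gv: "?g \<bullet> v = 0" using bary_diff[OF V P, of C A] VP(2-) P by (simp add: bary_vertex[OF V] v_def)
 have gd: "?g \<bullet> d = -1" using bary_diff[OF V P, of A P] VP(2-) P by (simp add: bary_vertex[OF V] d_def)
 have ind: "\<not> affine_dependent {A, B, C}" using affine_independent_sub[OF V Diff_subset, of "{P}"] unfolding ABC(1) .
 have card4: "card {P, A, B, C} = 4" using V unfolding VP(1) by (simp add: full_def)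
 have mT: "measure lborel (convex hull V) = \<bar>d \<bullet> w\<bar> / 6"
  unfolding VP(1) measure_tetrahedron[OF card4] by (simp add: d_def w_def u_def v_def)
 have mS: "measure (hausdorff 2) (facet V P) = norm w / 2"
  unfolding ABC(1) measure_triangle_cross3[OF ind ABC(2-4)] by (simp add: w_def u_def v_def)
 have wg: "w = - ((d \<bullet> w) *\<^sub>R ?g)"
 proof -
  have c: "?g $ 1 * u $ 1 + ?g $ 2 * u $ 2 + ?g $ 3 * u $ 3 = 0" "?g $ 1 * v $ 1 + ?g $ 2 * v $ 2 + ?g $ 3 * v $ 3 = 0"
   "?g $ 1 * d $ 1 + ?g $ 2 * d $ 2 + ?g $ 3 * d $ 3 = -1"
   using gu gv gd by (simp_all add: inner_vec_def sum_3)
  have "w $ i = - ((d \<bullet> w) * ?g $ i)" for i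
  proof -
   have "w $ 1 = - ((d $ 1 * w $ 1 + d $ 2 * w $ 2 + d $ 3 * w $ 3) * ?g $ 1)"
    "w $ 2 = - ((d $ 1 * w $ 1 + d $ 2 * w $ 2 + d $ 3 * w $ 3) * ?g $ 2)"
    "w $ 3 = - ((d $ 1 * w $ 1 + d $ 2 * w $ 2 + d $ 3 * w $ 3) * ?g $ 3)"
    using c unfolding w_def cross3_def by (simp_all) algebra+
   then show ?thesis using exhaust_3[of i] by (auto simp: inner_vec_def sum_3)
  qed
  then show ?thesis by (simp add: vec_eq_iff)
 qed
 have nw: "norm w = \<bar>d \<bullet> w\<bar> * norm ?g" by (subst wg) simp
 show ?thesis unfolding mT mS nw by simp
qed

section \<open>Finite element functions\<close>

lemma P1_on_subset: "P1_on S f \<Longrightarrow> T \<subseteq> S \<Longrightarrow> P1_on T f"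
 unfolding P1_on_def by (meson subsetD)

lemma P2_on_subset: "P2_on S f \<Longrightarrow> T \<subseteq> S \<Longrightarrow> P2_on T f"
 unfolding P2_on_def by (meson subsetD)

lemma P1_onI: "(\<And>x. x \<in> S \<Longrightarrow> f x = c + a \<bullet> x) \<Longrightarrow> P1_on S f"
 unfolding P1_on_def by blast

lemma P2_onI: "linear A \<Longrightarrow> (\<And>x. x \<in> S \<Longrightarrow> f x = c + a \<bullet> x + x \<bullet> A x) \<Longrightarrow> P2_on S f"
 unfolding P2_on_def by blast

lemma P1_on_const: "P1_on S (\<lambda>x. c)"
 by (rule P1_onI[of _ _ c 0]) simp

lemma P1_on_add:
 assumes "P1_on S f" "P1_on S g" shows "P1_on S (\<lambda>x. f x + g x)"
proof -
 obtain c a c' a' where "\<forall>x\<in>S. f x = c + a \<bullet> x" "\<forall>x\<in>S. g x = c' + a' \<bullet> x"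
  using assms unfolding P1_on_def by blast
 then show ?thesis by (intro P1_onI[of _ _ "c + c'" "a + a'"]) (simp add: inner_add_left)
qed

lemma P1_on_cmult:
 assumes "P1_on S f" shows "P1_on S (\<lambda>x. r * f x)"
proof -
 obtain c a where "\<forall>x\<in>S. f x = c + a \<bullet> x" using assms unfolding P1_on_def by blast
 then show ?thesis by (intro P1_onI[of _ _ "r * c" "r *\<^sub>R a"]) (simp add: distrib_left)
qed

lemma P1_on_sum:
 assumes "\<And>i. i \<in> I \<Longrightarrow> P1_on S (f i)" shows "P1_on S (\<lambda>x. \<Sum>i\<in>I. f i x)"
 using assms by (induction I rule: infinite_finite_induct) (auto intro: P1_on_const P1_on_add)

lemma P2_on_add:
 assumes "P2_on S f" "P2_on S g" shows "P2_on S (\<lambda>x. f x + g x)"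
proof -
 obtain c a A where f: "linear A" "\<forall>x\<in>S. f x = c + a \<bullet> x + x \<bullet> A x" using assms(1) unfolding P2_on_def by blast
 obtain c' a' A' where g: "linear A'" "\<forall>x\<in>S. g x = c' + a' \<bullet> x + x \<bullet> A' x" using assms(2) unfolding P2_on_def by blast
 show ?thesis
  by (rule P2_onI[of "\<lambda>x. A x + A' x" _ _ "c + c'" "a + a'"])
   (use f g in \<open>auto simp: inner_add_left inner_add_right intro: linear_compose_add\<close>)
qed

lemma P2_on_cmult:
 assumes "P2_on S f" shows "P2_on S (\<lambda>x. r * f x)"
proof -
 obtain c a A where f: "linear A" "\<forall>x\<in>S. f x = c + a \<bullet> x + x \<bullet> A x" using assms unfolding P2_on_def by blast
 show ?thesis
  by (rule P2_onI[of "\<lambda>x. r *\<^sub>R A x" _ _ "r * c" "r *\<^sub>R a"])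
   (use f in \<open>auto simp: algebra_simps intro: linear_compose_scale_right\<close>)
qed

lemma P2_on_mult:
 assumes "P1_on S f" "P1_on S g" shows "P2_on S (\<lambda>x. f x * g x)"
proof -
 obtain c a c' a' where fg: "\<forall>x\<in>S. f x = c + a \<bullet> x" "\<forall>x\<in>S. g x = c' + a' \<bullet> x"
  using assms unfolding P1_on_def by blast
 show ?thesis
 proof (rule P2_onI[of "\<lambda>x. (a' \<bullet> x) *\<^sub>R a" _ _ "c * c'" "c *\<^sub>R a' + c' *\<^sub>R a"])
  show "linear (\<lambda>x. (a' \<bullet> x) *\<^sub>R a)" by (intro linearI) (auto simp: algebra_simps inner_add_right)
  fix x assume "x \<in> S"
  then show "f x * g x = c * c' + (c *\<^sub>R a' + c' *\<^sub>R a) \<bullet> x + x \<bullet> ((a' \<bullet> x) *\<^sub>R a)"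
   using fg by (simp add: inner_add_left inner_commute[of x a] algebra_simps)
 qed
qed

lemma P2_on_P1: "P1_on S f \<Longrightarrow> P2_on S f"
 using P2_on_mult[OF P1_on_const[of S 1]] by simp

lemma P2_on_sum:
 assumes "\<And>i. i \<in> I \<Longrightarrow> P2_on S (f i)" shows "P2_on S (\<lambda>x. \<Sum>i\<in>I. f i x)"
 using assms by (induction I rule: infinite_finite_induct) (auto intro: P2_on_P1[OF P1_on_const] P2_on_add)

subsection \<open>Node averages\<close>

lemma quad_avg_cong:
 assumes "\<And>x. x \<in> convex hull W \<Longrightarrow> f x = g x"
 shows "quad_avg W f = quad_avg W g"
proof -
 have "(1/2) *\<^sub>R (P + Q) \<in> convex hull W" if "P \<in> W" "Q \<in> W" for P Q
 proof -
  have "(1/2) *\<^sub>R P + (1/2) *\<^sub>R Q \<in> convex hull W"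
   by (rule convexD[OF convex_convex_hull]) (use that in \<open>auto intro: hull_inc\<close>)
  then show ?thesis by (simp add: scaleR_add_right)
 qed
 then show ?thesis unfolding quad_avg_def using assms by (auto simp: hull_inc intro!: sum.cong arg_cong2[where f="(/)"])
qed

lemma quad_avg_add: "quad_avg W (\<lambda>x. f x + g x) = quad_avg W f + quad_avg W g"
 unfolding quad_avg_def add_divide_distrib[symmetric] sum.distrib[symmetric]
 by (intro arg_cong2[where f="(/)"] sum.cong refl) (simp add: field_simps)

lemma quad_avg_cmult: "quad_avg W (\<lambda>x. r * f x) = r * quad_avg W f"
proof -
 have "(\<Sum>P\<in>W. \<Sum>Q\<in>W. (if P = Q then 2 else 1) * (2 * (r * f ((1/2) *\<^sub>R (P + Q))) - r * f P / 2 - r * f Q / 2))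
  = r * (\<Sum>P\<in>W. \<Sum>Q\<in>W. (if P = Q then 2 else 1) * (2 * f ((1/2) *\<^sub>R (P + Q)) - f P / 2 - f Q / 2))"
  unfolding sum_distrib_left by (intro sum.cong refl) (simp add: algebra_simps)
 then show ?thesis unfolding quad_avg_def by simp
qed

lemma quad_avg_zero: "quad_avg W (\<lambda>x. 0) = 0"
 by (simp add: quad_avg_def)

lemma quad_avg_sum: "quad_avg W (\<lambda>x. \<Sum>i\<in>I. f i x) = (\<Sum>i\<in>I. quad_avg W (f i))"
 by (induction I rule: infinite_finite_induct) (auto simp: quad_avg_zero quad_avg_add)

lemma sum_with_diagonal:
 fixes h :: "'a \<Rightarrow> 'a \<Rightarrow> real"
 assumes "finite W"
 shows "(\<Sum>P\<in>W. \<Sum>Q\<in>W. (if P = Q then 2 else 1) * h P Q) = (\<Sum>P\<in>W. \<Sum>Q\<in>W. h P Q) + (\<Sum>P\<in>W. h P P)"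
proof -
 have "(\<Sum>Q\<in>W. (if P = Q then 2 else 1) * h P Q) = (\<Sum>Q\<in>W. h P Q) + h P P" if "P \<in> W" for P
 proof -
  have "(\<Sum>Q\<in>W. (if P = Q then 2 else 1) * h P Q) = (\<Sum>Q\<in>W. h P Q + (if P = Q then h P Q else 0))"
   by (intro sum.cong) auto
  also have "\<dots> = (\<Sum>Q\<in>W. h P Q) + h P P" using assms that by (simp add: sum.distrib)
  finally show ?thesis .
 qed
 then show ?thesis by (simp add: sum.distrib)
qed

lemma quad_avg_product:
 assumes W: "finite W" "W \<noteq> {}"
  and f: "\<And>P Q. P \<in> W \<Longrightarrow> Q \<in> W \<Longrightarrow> f ((1/2) *\<^sub>R (P + Q)) = (f P + f Q) / 2"
  and g: "\<And>P Q. P \<in> W \<Longrightarrow> Q \<in> W \<Longrightarrow> g ((1/2) *\<^sub>R (P + Q)) = (g P + g Q) / 2"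
 shows "quad_avg W (\<lambda>x. f x * g x)
  = ((\<Sum>P\<in>W. f P) * (\<Sum>P\<in>W. g P) + (\<Sum>P\<in>W. f P * g P)) / (real (card W) * (real (card W) + 1))"
proof -
 have "(\<Sum>P\<in>W. \<Sum>Q\<in>W. (if P = Q then 2 else 1) *
   (2 * (f ((1/2) *\<^sub>R (P + Q)) * g ((1/2) *\<^sub>R (P + Q))) - f P * g P / 2 - f Q * g Q / 2))
  = (\<Sum>P\<in>W. \<Sum>Q\<in>W. (if P = Q then 2 else 1) * ((f P * g Q + f Q * g P) / 2))"
  by (intro sum.cong refl) (simp only: f g, simp add: field_simps)
 also have "\<dots> = (\<Sum>P\<in>W. \<Sum>Q\<in>W. (f P * g Q + f Q * g P) / 2) + (\<Sum>P\<in>W. (f P * g P + f P * g P) / 2)"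
  by (rule sum_with_diagonal[OF W(1)])
 also have "(\<Sum>P\<in>W. \<Sum>Q\<in>W. (f P * g Q + f Q * g P) / 2) = (\<Sum>P\<in>W. f P) * (\<Sum>P\<in>W. g P)"
  unfolding sum_divide_distrib[symmetric] sum.distrib sum_distrib_left[symmetric] sum_distrib_right[symmetric]
  by simp
 also have "(\<Sum>P\<in>W. (f P * g P + f P * g P) / 2) = (\<Sum>P\<in>W. f P * g P)" by simp
 finally show ?thesis unfolding quad_avg_def by simp
qed

lemma quad_avg_affine:
 assumes W: "finite W" "W \<noteq> {}"
  and g: "\<And>P Q. P \<in> W \<Longrightarrow> Q \<in> W \<Longrightarrow> g ((1/2) *\<^sub>R (P + Q)) = (g P + g Q) / 2"
 shows "quad_avg W g = (\<Sum>P\<in>W. g P) / real (card W)"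
proof -
 have c: "0 < real (card W)" using W by (simp add: card_gt_0_iff)
 have "quad_avg W (\<lambda>x. 1 * g x) = (real (card W) * (\<Sum>P\<in>W. g P) + (\<Sum>P\<in>W. g P)) / (real (card W) * (real (card W) + 1))"
  by (subst quad_avg_product[OF W _ g]) auto
 also have "\<dots> = ((\<Sum>P\<in>W. g P) * (real (card W) + 1)) / (real (card W) * (real (card W) + 1))"
  by (simp add: algebra_simps)
 also have "\<dots> = (\<Sum>P\<in>W. g P) / real (card W)"
  by (rule nonzero_mult_divide_mult_cancel_right) simp
 finally show ?thesis by simp
qed

lemma P1_on_midpoint:
 assumes "P1_on (convex hull W) g" "P \<in> W" "Q \<in> W"
 shows "g ((1/2) *\<^sub>R (P + Q)) = (g P + g Q) / 2"
proof -
 obtain c a where g: "\<And>x. x \<in> convex hull W \<Longrightarrow> g x = c + a \<bullet> x" using assms unfolding P1_on_def by blast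
 have "(1/2) *\<^sub>R P + (1/2) *\<^sub>R Q \<in> convex hull W"
  by (rule convexD[OF convex_convex_hull]) (use assms in \<open>auto intro: hull_inc\<close>)
 then have m: "(1/2) *\<^sub>R (P + Q) \<in> convex hull W" by (simp add: scaleR_add_right)
 show ?thesis using g[OF m] g[OF hull_inc[OF assms(2)]] g[OF hull_inc[OF assms(3)]]
  by (simp add: inner_add_right field_simps)
qed

lemma quad_avg_P1:
 assumes "finite W" "W \<noteq> {}" "P1_on (convex hull W) g"
 shows "quad_avg W g = (\<Sum>P\<in>W. g P) / real (card W)"
 by (rule quad_avg_affine[OF assms(1,2)]) (rule P1_on_midpoint[OF assms(3)])

lemma quad_avg_quadratic:
 fixes W :: "'a::euclidean_space set"
 assumes W: "finite W" "W \<noteq> {}" and A: "linear A"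
 shows "quad_avg W (\<lambda>x. c + a \<bullet> x + x \<bullet> A x) = c + (a \<bullet> \<Sum>W) / real (card W)
  + (\<Sum>W \<bullet> A (\<Sum>W) + (\<Sum>P\<in>W. P \<bullet> A P)) / (real (card W) * (real (card W) + 1))"
proof -
 have c0: "0 < real (card W)" using W by (simp add: card_gt_0_iff)
 have "quad_avg W (\<lambda>x. c + a \<bullet> x) = (\<Sum>P\<in>W. c + a \<bullet> P) / real (card W)"
  by (rule quad_avg_P1[OF W]) (rule P1_onI[of _ _ c a], simp)
 also have "\<dots> = c + (a \<bullet> \<Sum>W) / real (card W)"
  using c0 by (simp add: sum.distrib inner_sum_right add_divide_distrib)
 finally have 1: "quad_avg W (\<lambda>x. c + a \<bullet> x) = c + (a \<bullet> \<Sum>W) / real (card W)" .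
 have "(\<Sum>P\<in>W. \<Sum>Q\<in>W. (if P = Q then 2 else 1) *
   (2 * (((1/2) *\<^sub>R (P + Q)) \<bullet> A ((1/2) *\<^sub>R (P + Q))) - P \<bullet> A P / 2 - Q \<bullet> A Q / 2))
  = (\<Sum>P\<in>W. \<Sum>Q\<in>W. (if P = Q then 2 else 1) * ((P \<bullet> A Q + Q \<bullet> A P) / 2))"
  by (intro sum.cong refl) (simp add: linear_add[OF A] linear_scale[OF A] inner_add_left inner_add_right field_simps)
 also have "\<dots> = (\<Sum>P\<in>W. \<Sum>Q\<in>W. (P \<bullet> A Q + Q \<bullet> A P) / 2) + (\<Sum>P\<in>W. (P \<bullet> A P + P \<bullet> A P) / 2)"
  by (rule sum_with_diagonal[OF W(1)])
 also have "(\<Sum>P\<in>W. \<Sum>Q\<in>W. (P \<bullet> A Q + Q \<bullet> A P) / 2) = \<Sum>W \<bullet> A (\<Sum>W)"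
 proof -
  have "(\<Sum>P\<in>W. \<Sum>Q\<in>W. P \<bullet> A Q) = \<Sum>W \<bullet> A (\<Sum>W)"
   by (simp add: linear_sum[OF A] inner_sum_left inner_sum_right) (rule sum.swap)
  moreover have "(\<Sum>P\<in>W. \<Sum>Q\<in>W. Q \<bullet> A P) = (\<Sum>P\<in>W. \<Sum>Q\<in>W. P \<bullet> A Q)" by (rule sum.swap)
  ultimately show ?thesis by (simp only: sum_divide_distrib[symmetric] sum.distrib) simp
 qed
 finally have 2: "quad_avg W (\<lambda>x. x \<bullet> A x) = (\<Sum>W \<bullet> A (\<Sum>W) + (\<Sum>P\<in>W. P \<bullet> A P)) / (real (card W) * (real (card W) + 1))"
  unfolding quad_avg_def by simp
 show ?thesis using quad_avg_add[of W "\<lambda>x. c + a \<bullet> x" "\<lambda>x. x \<bullet> A x"] unfolding 1 2 .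
qed

subsection \<open>Derivatives within an element\<close>

text \<open>Within a convex set the derivative is determined on the span of the set, even if the set has empty interior.\<close>

lemma frechet_derivative_within_convex:
 fixes f :: "'a::euclidean_space \<Rightarrow> 'b::euclidean_space"
 assumes S: "convex S" "x \<in> S" and f: "(f has_derivative A) (at x within S)"
  and h: "h \<in> span ((\<lambda>y. y - x) ` S)"
 shows "frechet_derivative f (at x within S) h = A h"
proof -
 let ?D = "frechet_derivative f (at x within S)"
 have D: "(f has_derivative ?D) (at x within S)"
  using f frechet_derivative_works differentiable_def by blast
 have "?D (y - x) = A (y - x)" if y: "y \<in> S" for y
 proof -
  define \<gamma> where "\<gamma> t = x + t *\<^sub>R (y - x)" for t :: real
  have \<gamma>S: "\<gamma> ` {0..1} \<subseteq> S"
  proof safe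
   fix t :: real assume "t \<in> {0..1}"
   then have "(1 - t) *\<^sub>R x + t *\<^sub>R y \<in> S" using S y by (intro convexD) auto
   then show "\<gamma> t \<in> S" by (simp add: \<gamma>_def algebra_simps)
  qed
  have \<gamma>': "(\<gamma> has_derivative (\<lambda>t. t *\<^sub>R (y - x))) (at 0 within {0..1})"
   unfolding \<gamma>_def by (auto intro!: derivative_eq_intros)
  have vd: "((f \<circ> \<gamma>) has_vector_derivative B (y - x)) (at 0 within {0..1})"
   if B: "(f has_derivative B) (at x within S)" for B
  proof -
   have "(f has_derivative B) (at (\<gamma> 0) within \<gamma> ` {0..1})"
    using has_derivative_subset[OF B \<gamma>S] by (simp add: \<gamma>_def)
   from diff_chain_within[OF \<gamma>' this]
   have "((f \<circ> \<gamma>) has_derivative (B \<circ> (\<lambda>t. t *\<^sub>R (y - x)))) (at 0 within {0..1})" .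
   then show ?thesis
    using has_derivative_linear[OF B] by (simp add: has_vector_derivative_def o_def linear_scale)
  qed
  have "at (0::real) within {0..1} \<noteq> bot" by (simp add: trivial_limit_within islimpt_Icc)
  then show ?thesis using vector_derivative_unique_within vd[OF D] vd[OF f] by blast
 qed
 then show ?thesis
  using linear_eq_on_span[OF has_derivative_linear[OF D] has_derivative_linear[OF f], of "(\<lambda>y. y - x) ` S" h] h by auto
qed

lemma span_full:
 assumes V: "full V"
 shows "h \<in> span ((\<lambda>y. y - x) ` (convex hull V))"
proof -
 have "h = (\<Sum>P\<in>V. (bgrad V P \<bullet> h) *\<^sub>R P) - (\<Sum>P\<in>V. bgrad V P \<bullet> h) *\<^sub>R x"
  using sum_bgrad_vertex[OF V, of h] sum_bgrad[OF V] by (simp add: inner_sum_left[symmetric])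
 also have "\<dots> = (\<Sum>P\<in>V. (bgrad V P \<bullet> h) *\<^sub>R (P - x))"
  by (simp add: scaleR_diff_right sum_subtractf scaleR_sum_left)
 also have "\<dots> \<in> span ((\<lambda>y. y - x) ` (convex hull V))"
  by (intro span_sum span_scale span_base imageI hull_inc)
 finally show ?thesis .
qed

lemma span_facet:
 assumes V: "full V" and P: "P \<in> V" and h: "bgrad V P \<bullet> h = 0"
 shows "h \<in> span ((\<lambda>y. y - x) ` (facet V P))"
proof -
 note fin = full_finite[OF V]
 have "h = (\<Sum>Q\<in>V. (bgrad V Q \<bullet> h) *\<^sub>R Q) - (\<Sum>Q\<in>V. bgrad V Q \<bullet> h) *\<^sub>R x"
  using sum_bgrad_vertex[OF V, of h] sum_bgrad[OF V] by (simp add: inner_sum_left[symmetric])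
 also have "\<dots> = (\<Sum>Q\<in>V. (bgrad V Q \<bullet> h) *\<^sub>R (Q - x))"
  by (simp add: scaleR_diff_right sum_subtractf scaleR_sum_left)
 also have "\<dots> = (\<Sum>Q\<in>V - {P}. (bgrad V Q \<bullet> h) *\<^sub>R (Q - x))"
  using h by (simp add: sum.remove[OF fin P])
 also have "\<dots> \<in> span ((\<lambda>y. y - x) ` (facet V P))"
  by (intro span_sum span_scale span_base imageI hull_inc)
 finally show ?thesis .
qed

subsection \<open>The divergence theorem on a simplex\<close>

text \<open>For a quadratic polynomial both sides can be written in terms of its values at sums of vertices;
they agree because the barycentric gradients sum to zero and reproduce every vector.\<close>

lemma divergence_simplex_scalar:
 fixes V :: "'a::euclidean_space set"
 assumes V: "full V" and A: "linear A"
 shows "(LINT x:convex hull V|lborel. a \<bullet> h + (h \<bullet> A x + x \<bullet> A h))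
  = (\<Sum>P\<in>V. - (real DIM('a) * measure lborel (convex hull V) * (bgrad V P \<bullet> h))
    * quad_avg (V - {P}) (\<lambda>x. c + a \<bullet> x + x \<bullet> A x))"
proof -
 let ?n = "real DIM('a)" and ?m = "measure lborel (convex hull V)" and ?S = "\<Sum>V"
 note fin = full_finite[OF V]
 have n0: "0 < ?n" by simp
 have card: "card V = Suc DIM('a)" using V by (simp add: full_def)
 have sym: "v \<bullet> A x + x \<bullet> A v = (adjoint A v + A v) \<bullet> x" for v x
  unfolding inner_add_left inner_commute[of "adjoint A v"] adjoint_works[OF A] by (simp add: inner_commute)
 have "(LINT x:convex hull V|lborel. a \<bullet> h + (h \<bullet> A x + x \<bullet> A h)) = (LINT x:convex hull V|lborel. a \<bullet> h + (adjoint A h + A h) \<bullet> x)"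
  unfolding sym ..
 also have "\<dots> = ?m * (\<Sum>P\<in>V. a \<bullet> h + (adjoint A h + A h) \<bullet> P) / real (Suc DIM('a))"
  by (rule integral_affine_full[OF V])
 also have "(\<Sum>P\<in>V. a \<bullet> h + (adjoint A h + A h) \<bullet> P) = (?n + 1) * (a \<bullet> h) + (h \<bullet> A ?S + ?S \<bullet> A h)"
  unfolding sym using card by (simp add: sum.distrib inner_sum_right)
 finally have L: "(LINT x:convex hull V|lborel. a \<bullet> h + (h \<bullet> A x + x \<bullet> A h))
  = ?m * (a \<bullet> h) + ?m * (h \<bullet> A ?S + ?S \<bullet> A h) / (?n + 1)"
  by (simp add: field_simps)
 define C where "C = c + (a \<bullet> ?S) / ?n + (?S \<bullet> A ?S + (\<Sum>P\<in>V. P \<bullet> A P)) / (?n * (?n + 1))"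
 have Q: "quad_avg (V - {P}) (\<lambda>x. c + a \<bullet> x + x \<bullet> A x)
  = C - (a \<bullet> P) / ?n - (P \<bullet> A ?S + ?S \<bullet> A P) / (?n * (?n + 1))" if P: "P \<in> V" for P
 proof -
  have ne: "V - {P} \<noteq> {}" using facet_vertex_nonempty[OF V P] by blast
  have S: "\<Sum>(V - {P}) = ?S - P" using sum.remove[OF fin P, of "\<lambda>x. x"] by simp
  have S2: "(\<Sum>Q\<in>V - {P}. Q \<bullet> A Q) = (\<Sum>Q\<in>V. Q \<bullet> A Q) - P \<bullet> A P"
   using sum.remove[OF fin P, of "\<lambda>Q. Q \<bullet> A Q"] by simp
  have "quad_avg (V - {P}) (\<lambda>x. c + a \<bullet> x + x \<bullet> A x)
   = c + (a \<bullet> (?S - P)) / ?n + ((?S - P) \<bullet> A (?S - P) + ((\<Sum>Q\<in>V. Q \<bullet> A Q) - P \<bullet> A P)) / (?n * (?n + 1))"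
   using quad_avg_quadratic[OF finite_Diff[OF fin] ne A, of c a] unfolding S S2 card_facet[OF V P] .
  also have "\<dots> = C - (a \<bullet> P) / ?n - (P \<bullet> A ?S + ?S \<bullet> A P) / (?n * (?n + 1))"
   unfolding C_def linear_diff[OF A] inner_diff_left inner_diff_right add_divide_distrib diff_divide_distrib by simp
  finally show ?thesis .
 qed
 have s0: "(\<Sum>P\<in>V. bgrad V P \<bullet> h) = 0" using sum_bgrad[OF V] by (simp add: inner_sum_left[symmetric])
 have s1: "(\<Sum>P\<in>V. (bgrad V P \<bullet> h) * (v \<bullet> P)) = v \<bullet> h" for v
  using sum_bgrad_vertex[OF V, of h] by (metis (no_types, lifting) inner_scaleR_right inner_sum_right sum.cong)
 have s2: "(\<Sum>P\<in>V. (bgrad V P \<bullet> h) * (P \<bullet> A ?S + ?S \<bullet> A P)) = h \<bullet> A ?S + ?S \<bullet> A h"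
 proof -
  have eq: "P \<bullet> A ?S + ?S \<bullet> A P = (adjoint A ?S + A ?S) \<bullet> P" for P
   using sym[of ?S P] by simp
  have "(\<Sum>P\<in>V. (bgrad V P \<bullet> h) * (P \<bullet> A ?S + ?S \<bullet> A P)) = (adjoint A ?S + A ?S) \<bullet> h"
   unfolding eq by (rule s1)
  also have "\<dots> = h \<bullet> A ?S + ?S \<bullet> A h" unfolding eq ..
  finally show ?thesis .
 qed
 have "(\<Sum>P\<in>V. - (?n * ?m * (bgrad V P \<bullet> h)) * quad_avg (V - {P}) (\<lambda>x. c + a \<bullet> x + x \<bullet> A x))
  = (\<Sum>P\<in>V. (- (?n * ?m) * C) * (bgrad V P \<bullet> h) + ?m * ((bgrad V P \<bullet> h) * (a \<bullet> P))
    + (?m / (?n + 1)) * ((bgrad V P \<bullet> h) * (P \<bullet> A ?S + ?S \<bullet> A P)))"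
 proof (intro sum.cong refl)
  have *: "- (n * m * g) * (D - \<alpha> / n - \<beta> / (n * (n + 1))) = (- (n * m) * D) * g + m * (g * \<alpha>) + (m / (n + 1)) * (g * \<beta>)"
   if "0 < n" for n m g D \<alpha> \<beta> :: real
  proof -
   have "n * (\<beta> / (n * (n + 1))) = \<beta> / (n + 1)" "n * (\<alpha> / n) = \<alpha>" using that by simp_all
   then have "n * (D - \<alpha> / n - \<beta> / (n * (n + 1))) = n * D - \<alpha> - \<beta> / (n + 1)"
    by (simp only: right_diff_distrib)
   moreover have "- (n * m * g) * X = - (m * g) * (n * X)" for X by simp
   moreover have "(m / (n + 1)) * (g * \<beta>) = m * g * (\<beta> / (n + 1))" by simp
   moreover have "- (m * g) * (n * D - \<alpha> - b) = (- (n * m) * D) * g + m * (g * \<alpha>) + m * g * b" for b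
    by (simp add: algebra_simps)
   ultimately show ?thesis by (simp only:)
  qed
  fix P assume P: "P \<in> V"
  show "- (?n * ?m * (bgrad V P \<bullet> h)) * quad_avg (V - {P}) (\<lambda>x. c + a \<bullet> x + x \<bullet> A x)
   = (- (?n * ?m) * C) * (bgrad V P \<bullet> h) + ?m * ((bgrad V P \<bullet> h) * (a \<bullet> P))
    + (?m / (?n + 1)) * ((bgrad V P \<bullet> h) * (P \<bullet> A ?S + ?S \<bullet> A P))"
   unfolding Q[OF P] by (rule *[OF n0])
 qed
 also have "\<dots> = ?m * (a \<bullet> h) + (?m / (?n + 1)) * (h \<bullet> A ?S + ?S \<bullet> A h)"
  by (simp only: sum.distrib sum_distrib_left[symmetric] s0 s1 s2)
 finally show ?thesis unfolding L by simp
qed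

lemma sum_facets_of_cell:
 assumes "cell T"
 shows "(\<Sum>\<sigma> | \<sigma> facet_of T. \<Psi> \<sigma>) = (\<Sum>P\<in>verts T. \<Psi> (facet (verts T) P))"
proof -
 note V = full_verts[OF assms] and TV = simplexD(4)[OF assms]
 have inj: "inj_on (\<lambda>P. facet (verts T) P) (verts T)"
 proof (rule inj_onI)
  fix P Q assume P: "P \<in> verts T" "Q \<in> verts T" "facet (verts T) P = facet (verts T) Q"
  then have "verts (facet (verts T) P) = verts (facet (verts T) Q)" by simp
  then have "verts T - {P} = verts T - {Q}" unfolding verts_sub[OF V Diff_subset] .
  then show "P = Q" using P by blast
 qed
 have "{\<sigma>. \<sigma> facet_of T} = (\<lambda>P. facet (verts T) P) ` verts T"
  using facet_convex_hull[OF V] unfolding TV by auto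
 then show ?thesis by (simp only: sum.reindex[OF inj] o_def)
qed

lemma cell_facetD:
 assumes T: "cell T" and P: "P \<in> verts T"
 shows "facet (verts T) P facet_of T" "verts (facet (verts T) P) = verts T - {P}"
  "\<not> affine_dependent (verts T - {P})" "verts T - {P} \<noteq> {}" "finite (verts T - {P})"
  "outn T (facet (verts T) P) = - (bgrad (verts T) P /\<^sub>R norm (bgrad (verts T) P))"
proof -
 note V = full_verts[OF T] and TV = simplexD(4)[OF T]
 show "facet (verts T) P facet_of T" using facet_convex_hull[OF V] P unfolding TV by auto
 show "verts (facet (verts T) P) = verts T - {P}" by (rule verts_sub[OF V Diff_subset])
 show "\<not> affine_dependent (verts T - {P})" by (rule affine_independent_sub[OF V Diff_subset])
 show "verts T - {P} \<noteq> {}" using facet_vertex_nonempty[OF V P] by blast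
 show "finite (verts T - {P})" using full_finite[OF V] by simp
 show "outn T (facet (verts T) P) = - (bgrad (verts T) P /\<^sub>R norm (bgrad (verts T) P))"
  using outward_normal_bgrad[OF V P] unfolding TV .
qed

lemma divg_quadratic:
 fixes u :: "real^'n \<Rightarrow> real^'n"
 assumes T: "cell T" and x: "x \<in> T" and A: "\<And>i. linear (A i)"
  and u: "\<And>i y. y \<in> T \<Longrightarrow> u y $ i = c i + a i \<bullet> y + y \<bullet> A i y"
 shows "divg T u x = (\<Sum>i\<in>UNIV. a i \<bullet> axis i 1 + (axis i 1 \<bullet> A i x + x \<bullet> A i (axis i 1)))"
proof -
 note V = full_verts[OF T] and TV = simplexD(4)[OF T]
 define D where "D h = (\<chi> i. a i \<bullet> h + (x \<bullet> A i h + h \<bullet> A i x))" for h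
 have "((\<lambda>y. \<chi> i. c i + a i \<bullet> y + y \<bullet> A i y) has_derivative D) (at x within T)"
 proof (subst has_derivative_componentwise_within, intro ballI)
  fix b :: "real^'n" assume "b \<in> Basis"
  then obtain i where b: "b = axis i 1" by (auto simp: Basis_vec_def)
  have A': "(A i has_derivative A i) (at x within T)"
   using A[of i] by (simp add: linear_imp_has_derivative)
  have "((\<lambda>y. c i + a i \<bullet> y + y \<bullet> A i y) has_derivative (\<lambda>h. a i \<bullet> h + (x \<bullet> A i h + h \<bullet> A i x))) (at x within T)"
   by (rule derivative_eq_intros A' refl | simp)+
  then show "((\<lambda>y. (\<chi> i. c i + a i \<bullet> y + y \<bullet> A i y) \<bullet> b) has_derivative (\<lambda>y. D y \<bullet> b)) (at x within T)"
   by (simp add: b inner_axis D_def)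
 qed
 then have "(u has_derivative D) (at x within T)"
  by (rule has_derivative_transform[OF x, rotated]) (simp add: vec_eq_iff u)
 from frechet_derivative_within_convex[OF _ x this] span_full[OF V, of _ x]
 have "frechet_derivative u (at x within T) = D"
  using convex_convex_hull[of "verts T"] unfolding TV by blast
 then show ?thesis by (simp add: divg_def trace_def jac_def matrix_def D_def ac_simps)
qed

section \<open>Divergence theorem on a triangulation\<close>

text \<open>The planar and the spatial case share the vector \<open>cof D n\<close>, the normal of the image under \<open>D\<close> of a
face with unit normal \<open>n\<close>, scaled by the area of the image. Its main property is \<open>cof_det\<close>, which
says that it is the cofactor matrix of \<open>D\<close> applied to \<open>n\<close>.\<close>

locale face_geometry =
 fixes cof :: "(real^'n \<Rightarrow> real^'n) \<Rightarrow> real^'n \<Rightarrow> real^'n" and k :: nat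
 assumes card_n: "CARD('n) = Suc k" and k12: "k = 1 \<or> k = 2"
  and facet_measure: "\<And>V P. full (V :: (real^'n) set) \<Longrightarrow> P \<in> V \<Longrightarrow>
   measure (hausdorff k) (facet V P) = real CARD('n) * measure lborel (convex hull V) * norm (bgrad V P)"
  and cof_tangent: "\<And>D D' n. norm n = 1 \<Longrightarrow> linear D \<Longrightarrow> linear D' \<Longrightarrow> (\<And>h. n \<bullet> h = 0 \<Longrightarrow> D h = D' h) \<Longrightarrow> cof D n = cof D' n"
  and cof_minus: "\<And>D n. norm n = 1 \<Longrightarrow> linear D \<Longrightarrow> cof D (- n) = - cof D n"
  and cof_det: "\<And>D n h. norm n = 1 \<Longrightarrow> linear D \<Longrightarrow> cof D n \<bullet> D h = det (matrix D) * (n \<bullet> h)"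
  and cof_continuous: "\<And>B n r. norm n = 1 \<Longrightarrow> linear B \<Longrightarrow> continuous_on {0..1} (\<lambda>\<theta>. cof (\<lambda>h. h + (r * \<theta>) *\<^sub>R B h) n)"
  and jacobian_det: "\<And>M. linear (M :: real^'n \<Rightarrow> real^'n) \<Longrightarrow> jacobian M = \<bar>det (matrix M)\<bar>"
  and det_derivative: "\<And>C. linear C \<Longrightarrow> ((\<lambda>t. det (matrix (\<lambda>h :: real^'n. h + t *\<^sub>R C h))) has_real_derivative trace (matrix C)) (at 0)"
begin

lemma dim_n: "DIM(real^'n) = Suc k"
 using card_n by simp

lemma facet_quadrature:
 fixes T :: "(real^'n) set"
 assumes T: "cell T" and P: "P \<in> verts T" and g: "P2_on (facet (verts T) P) g"
 shows "(LINT x:facet (verts T) P|hausdorff k. g x)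
  = real CARD('n) * measure lborel T * norm (bgrad (verts T) P) * quad_avg (verts T - {P}) g"
proof -
 note V = full_verts[OF T] and TV = simplexD(4)[OF T]
 have card: "card (verts T - {P}) = Suc k" using card_facet[OF V P] dim_n by simp
 show ?thesis
  using hausdorff_simplex(2)[OF cell_facetD(3)[OF T P] card k12 g] facet_measure[OF V P] TV by simp
qed

lemma divergence_cell:
 fixes T :: "(real^'n) set"
 assumes T: "cell T" and u: "\<And>i. P2_on T (\<lambda>x. u x $ i)"
 shows "(LINT x:T|lborel. divg T u x) = (\<Sum>\<sigma> | \<sigma> facet_of T. LINT x:\<sigma>|hausdorff k. u x \<bullet> outn T \<sigma>)"
proof -
 note V = full_verts[OF T] and TV = simplexD(4)[OF T]
 let ?V = "verts T" and ?n = "real CARD('n)"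
 have "\<exists>c a A. linear A \<and> (\<forall>x\<in>T. u x $ i = c + a \<bullet> x + x \<bullet> A x)" for i
  using u[of i] unfolding P2_on_def .
 then obtain c a A where A: "\<And>i. linear (A i)" and ui: "\<And>i x. x \<in> T \<Longrightarrow> u x $ i = c i + a i \<bullet> x + x \<bullet> A i x"
  by metis
 have Tb: "compact T" using compact_full[OF V] unfolding TV .
 have int: "set_integrable lborel T (\<lambda>x. a i \<bullet> axis i 1 + (axis i 1 \<bullet> A i x + x \<bullet> A i (axis i 1)))" for i
 proof (rule set_integrable_compact_lborel[OF Tb])
  have "continuous_on T (A i)" using A[of i] by (simp add: linear_continuous_on linear_conv_bounded_linear)
  then show "continuous_on T (\<lambda>x. a i \<bullet> axis i 1 + (axis i 1 \<bullet> A i x + x \<bullet> A i (axis i 1)))"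
   by (intro continuous_intros)
 qed
 have "(LINT x:T|lborel. divg T u x) = (LINT x:T|lborel. \<Sum>i\<in>UNIV. a i \<bullet> axis i 1 + (axis i 1 \<bullet> A i x + x \<bullet> A i (axis i 1)))"
  using compact_imp_closed[OF Tb] by (intro set_lebesgue_integral_cong) (auto intro!: divg_quadratic[OF T _ A ui])
 also have "\<dots> = (\<Sum>i\<in>UNIV. LINT x:T|lborel. a i \<bullet> axis i 1 + (axis i 1 \<bullet> A i x + x \<bullet> A i (axis i 1)))"
  by (rule set_integral_sum[OF int])
 also have "\<dots> = (\<Sum>i\<in>UNIV. \<Sum>P\<in>?V. - (?n * measure lborel T * (bgrad ?V P $ i)) * quad_avg (?V - {P}) (\<lambda>x. u x $ i))"
 proof (rule sum.cong[OF refl])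
  fix i :: 'n
  have "quad_avg (?V - {P}) (\<lambda>x. c i + a i \<bullet> x + x \<bullet> A i x) = quad_avg (?V - {P}) (\<lambda>x. u x $ i)" for P
  proof (rule quad_avg_cong)
   fix x assume "x \<in> facet ?V P"
   then have "x \<in> T" using hull_mono[of "?V - {P}" ?V convex] TV by auto
   then show "c i + a i \<bullet> x + x \<bullet> A i x = u x $ i" by (rule ui[symmetric])
  qed
  then show "(LINT x:T|lborel. a i \<bullet> axis i 1 + (axis i 1 \<bullet> A i x + x \<bullet> A i (axis i 1)))
    = (\<Sum>P\<in>?V. - (?n * measure lborel T * (bgrad ?V P $ i)) * quad_avg (?V - {P}) (\<lambda>x. u x $ i))"
   using divergence_simplex_scalar[OF V A, of "a i" "axis i 1" i "c i"] unfolding TV by (simp add: inner_axis)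
 qed
 also have "\<dots> = (\<Sum>P\<in>?V. \<Sum>i\<in>UNIV. - (?n * measure lborel T * (bgrad ?V P $ i)) * quad_avg (?V - {P}) (\<lambda>x. u x $ i))"
  by (rule sum.swap)
 also have "\<dots> = (\<Sum>P\<in>?V. LINT x:facet ?V P|hausdorff k. u x \<bullet> outn T (facet ?V P))"
 proof (rule sum.cong[OF refl])
  fix P assume P: "P \<in> ?V"
  let ?\<sigma> = "facet ?V P" and ?g = "bgrad ?V P"
  have g0: "norm ?g \<noteq> 0" using bgrad_nonzero[OF V P] by simp
  have sub: "?\<sigma> \<subseteq> T" using facet_of_imp_subset[OF cell_facetD(1)[OF T P]] .
  have ex: "u x \<bullet> outn T ?\<sigma> = (\<Sum>i\<in>UNIV. (- (?g $ i) / norm ?g) * (u x $ i))" for x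
   unfolding cell_facetD(6)[OF T P] by (simp add: inner_vec_def divide_inverse mult_ac sum_negf sum_distrib_left)
  have p2: "P2_on ?\<sigma> (\<lambda>x. u x \<bullet> outn T ?\<sigma>)"
   unfolding ex by (intro P2_on_sum P2_on_cmult P2_on_subset[OF u sub])
  have "(LINT x:?\<sigma>|hausdorff k. u x \<bullet> outn T ?\<sigma>) = ?n * measure lborel T * norm ?g * quad_avg (?V - {P}) (\<lambda>x. u x \<bullet> outn T ?\<sigma>)"
   by (rule facet_quadrature[OF T P p2])
  also have "quad_avg (?V - {P}) (\<lambda>x. u x \<bullet> outn T ?\<sigma>) = (\<Sum>i\<in>UNIV. (- (?g $ i) / norm ?g) * quad_avg (?V - {P}) (\<lambda>x. u x $ i))"
   unfolding ex quad_avg_sum quad_avg_cmult ..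
  also have "?n * measure lborel T * norm ?g * \<dots> = (\<Sum>i\<in>UNIV. - (?n * measure lborel T * (?g $ i)) * quad_avg (?V - {P}) (\<lambda>x. u x $ i))"
   unfolding sum_distrib_left by (intro sum.cong refl) (use g0 in simp)
  finally show "(\<Sum>i\<in>UNIV. - (?n * measure lborel T * (?g $ i)) * quad_avg (?V - {P}) (\<lambda>x. u x $ i))
   = (LINT x:?\<sigma>|hausdorff k. u x \<bullet> outn T ?\<sigma>)" ..
 qed
 also have "\<dots> = (\<Sum>\<sigma> | \<sigma> facet_of T. LINT x:\<sigma>|hausdorff k. u x \<bullet> outn T \<sigma>)"
  by (rule sum_facets_of_cell[OF T, symmetric])
 finally show ?thesis .
qed

theorem divergence_complex:
 fixes K :: "(real^'n) set set"
 assumes K: "cell_complex K" and u: "\<And>T i. T \<in> K \<Longrightarrow> P2_on T (\<lambda>x. u x $ i)"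
 shows "(\<Sum>T\<in>K. LINT x:T|lborel. divg T u x)
  = (\<Sum>\<sigma>\<in>boundary_faces K. LINT x:\<sigma>|hausdorff k. u x \<bullet> outward_normal K \<sigma>)"
proof -
 interpret cell_complex K by fact
 have "(\<Sum>T\<in>K. LINT x:T|lborel. divg T u x) = (\<Sum>T\<in>K. \<Sum>\<sigma> | \<sigma> facet_of T. LINT x:\<sigma>|hausdorff k. u x \<bullet> outn T \<sigma>)"
  by (intro sum.cong refl divergence_cell cells u)
 also have "\<dots> = (\<Sum>\<sigma>\<in>boundary_faces K. LINT x:\<sigma>|hausdorff k. u x \<bullet> outn (cell_of \<sigma>) \<sigma>)"
 proof (rule sum_facets_boundary)
  fix T T' \<sigma> assume *: "T \<in> K" "T' \<in> K" "\<sigma> facet_of T" "\<sigma> facet_of T'" "T \<noteq> T'"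
  have eq: "outn T' \<sigma> = - outn T \<sigma>" by (rule outn_opposite[OF *(1,3) *(2,4) *(5)])
  show "(LINT x:\<sigma>|hausdorff k. u x \<bullet> outn T' \<sigma>) = - (LINT x:\<sigma>|hausdorff k. u x \<bullet> outn T \<sigma>)"
   unfolding eq by (simp add: set_lebesgue_integral_def)
 qed
 also have "\<dots> = (\<Sum>\<sigma>\<in>boundary_faces K. LINT x:\<sigma>|hausdorff k. u x \<bullet> outward_normal K \<sigma>)"
  by (simp add: outward_normal_boundary)
 finally show ?thesis .
qed

section \<open>Transport of affine densities\<close>

text \<open>The derivative of the determinant along a linear motion (Jacobi's formula).\<close>

lemma det_motion_derivative:
 fixes B :: "real^'n \<Rightarrow> real^'n"
 assumes B: "linear B" and M: "\<And>h. M h = h + (r * s) *\<^sub>R B h" and d: "det (matrix M) \<noteq> 0"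
  and G: "linear G" "\<And>v. M (G v) = v"
 shows "((\<lambda>s. det (matrix (\<lambda>h. h + (r * s) *\<^sub>R B h))) has_real_derivative
  det (matrix M) * (r * trace (matrix (\<lambda>v. B (G v))))) (at s)"
proof -
 have lM: "linear M" unfolding M using B by (intro linearI) (auto simp: linear_add linear_scale algebra_simps)
 define C where "C v = r *\<^sub>R B (G v)" for v
 have lC: "linear C" unfolding C_def using linear_compose[OF G(1) B] by (auto simp: o_def intro: linear_compose_scale_right)
 have GM: "G (M h) = h" for h
  using d det_nz_iff_inj[OF lM] G(2)[of "M h"] by (simp add: inj_def)
 have comp: "(\<lambda>h. h + (r * (t + s)) *\<^sub>R B h) = (\<lambda>v. v + t *\<^sub>R C v) \<circ> M" for t
  by (rule ext) (simp add: C_def GM, simp add: M algebra_simps)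
 have l1: "linear (\<lambda>v. v + t *\<^sub>R C v)" for t using lC by (intro linearI) (auto simp: linear_add linear_scale algebra_simps)
 have "det (matrix (\<lambda>h. h + (r * (t + s)) *\<^sub>R B h)) = det (matrix (\<lambda>v. v + t *\<^sub>R C v)) * det (matrix M)" for t
  unfolding comp matrix_compose[OF lM l1] by (rule det_mul)
 moreover have "((\<lambda>t. det (matrix (\<lambda>v. v + t *\<^sub>R C v)) * det (matrix M)) has_real_derivative trace (matrix C) * det (matrix M)) (at 0)"
  by (rule DERIV_cmult_right[OF det_derivative[OF lC]])
 ultimately have "((\<lambda>t. det (matrix (\<lambda>h. h + (r * (t + s)) *\<^sub>R B h))) has_real_derivative trace (matrix C) * det (matrix M)) (at 0)"
  by simp
 then have "((\<lambda>s. det (matrix (\<lambda>h. h + (r * s) *\<^sub>R B h))) has_real_derivative trace (matrix C) * det (matrix M)) (at (0 + s))"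
  unfolding DERIV_shift .
 moreover have "trace (matrix C) = r * trace (matrix (\<lambda>v. B (G v)))"
  by (simp add: C_def trace_def matrix_def sum_distrib_left)
 ultimately show ?thesis by (simp add: mult.commute)
qed

lemma has_integral_quad_avg:
 assumes W: "finite W" and g: "\<And>x. (g x has_integral G x) I"
 shows "((\<lambda>\<theta>. quad_avg W (\<lambda>x. g x \<theta>)) has_integral quad_avg W G) I"
 unfolding quad_avg_def
 by (intro has_integral_divide has_integral_sum W has_integral_mult_right has_integral_diff g)

end

lemma P1_vector:
 fixes w :: "real^'n \<Rightarrow> real^'n"
 assumes "\<And>i. P1_on S (\<lambda>x. w x $ i)"
 obtains B b where "linear B" "\<And>x. x \<in> S \<Longrightarrow> w x = B x + b"
proof -
 have "\<exists>c g. \<forall>x\<in>S. w x $ i = c + g \<bullet> x" for i using assms[of i] unfolding P1_on_def .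
 then obtain c g where wi: "\<And>i x. x \<in> S \<Longrightarrow> w x $ i = c i + g i \<bullet> x" by metis
 show ?thesis
 proof
  show "linear (\<lambda>x. \<chi> i. g i \<bullet> x)" by (intro linearI) (auto simp: vec_eq_iff inner_add_right)
  show "w x = (\<chi> i. g i \<bullet> x) + (\<chi> i. c i)" if "x \<in> S" for x using wi[OF that] by (simp add: vec_eq_iff)
 qed
qed

abbreviation move_deriv :: "('a::euclidean_space \<Rightarrow> 'a) \<Rightarrow> real \<Rightarrow> 'a set \<Rightarrow> 'a \<Rightarrow> 'a \<Rightarrow> 'a" where
 "move_deriv w s S x \<equiv> frechet_derivative (\<lambda>y. y + s *\<^sub>R w y) (at x within S)"

lemma frechet_derivative_motion:
 assumes T: "cell T" and B: "linear B" and w: "\<And>x. x \<in> T \<Longrightarrow> w x = B x + b" and x: "x \<in> T"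
 shows "move_deriv w s T x = (\<lambda>h. h + s *\<^sub>R B h)"
proof -
 note V = full_verts[OF T] and TV = simplexD(4)[OF T]
 have B': "(B has_derivative B) (at x within T)" using B by (simp add: linear_imp_has_derivative)
 have "((\<lambda>y. y + s *\<^sub>R (B y + b)) has_derivative (\<lambda>h. h + s *\<^sub>R B h)) (at x within T)"
  by (rule derivative_eq_intros B' refl | simp)+
 then have D: "((\<lambda>y. y + s *\<^sub>R w y) has_derivative (\<lambda>h. h + s *\<^sub>R B h)) (at x within T)"
  by (rule has_derivative_transform[OF x, rotated]) (use w in auto)
 show ?thesis
  using frechet_derivative_within_convex[OF _ x D] span_full[OF V, of _ x] convex_convex_hull[of "verts T"]
  unfolding TV by blast
qed

lemma sum_bgrad_linear:
 fixes L :: "'a::euclidean_space \<Rightarrow> 'b::real_vector"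
 assumes V: "full V" and L: "linear L"
 shows "(\<Sum>P\<in>V. (bgrad V P \<bullet> h) *\<^sub>R L P) = L h"
 using arg_cong[OF sum_bgrad_vertex[OF V, of h], of L] by (simp add: linear_sum[OF L] linear_scale[OF L])

text \<open>The derivative of determinant times nodal sum, in the form of a sum over facets. The vector \<open>N P\<close> is
the normal of the moved facet opposite to \<open>P\<close>, and the two terms on the right come from the motion of
the density and from the change of volume.\<close>

lemma transport_algebra:
 fixes V :: "(real^'n) set" and B G M :: "real^'n \<Rightarrow> real^'n"
 assumes V: "full V" and lin: "linear B" "linear G" "linear M" and MG: "\<And>v. M (G v) = v"
  and N: "\<And>P h. P \<in> V \<Longrightarrow> N P \<bullet> M h = - (c * (bgrad V P \<bullet> h))"
  and f: "\<And>P. f P = a + \<beta> \<bullet> M P" and w: "\<And>P. w P = B P + b"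
 shows "(\<Sum>P\<in>V. (\<Sum>Q\<in>V - {P}. f Q) * (\<Sum>Q\<in>V - {P}. w Q \<bullet> N P) + (\<Sum>Q\<in>V - {P}. f Q * (w Q \<bullet> N P)))
  = c * (\<beta> \<bullet> (\<Sum>Q\<in>V. w Q)) + c * (\<Sum>Q\<in>V. f Q) * trace (matrix (\<lambda>v. B (G v)))"
proof -
 note fin = full_finite[OF V]
 have Nv: "N P \<bullet> v = - (c * (bgrad V P \<bullet> G v))" if "P \<in> V" for P v
  using N[OF that, of "G v"] by (simp add: MG)
 have s0: "(\<Sum>P\<in>V. v \<bullet> N P) = 0" for v
 proof -
  have "(\<Sum>P\<in>V. v \<bullet> N P) = (\<Sum>P\<in>V. - c * (bgrad V P \<bullet> G v))"
   by (intro sum.cong refl) (simp add: inner_commute[of v] Nv)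
  also have "\<dots> = - c * ((\<Sum>P\<in>V. bgrad V P) \<bullet> G v)" by (simp only: sum_distrib_left inner_sum_left)
  finally show ?thesis by (simp add: sum_bgrad[OF V])
 qed
 have s1: "(\<Sum>P\<in>V. l P * (v \<bullet> N P)) = - (c * l (G v))" if l: "linear l" for l :: "real^'n \<Rightarrow> real" and v
 proof -
  have "(\<Sum>P\<in>V. l P * (v \<bullet> N P)) = (\<Sum>P\<in>V. - c * ((bgrad V P \<bullet> G v) *\<^sub>R l P))"
   by (intro sum.cong refl) (simp add: inner_commute[of v] Nv)
  also have "\<dots> = - c * l (G v)" by (simp only: sum_distrib_left[symmetric] sum_bgrad_linear[OF V l])
  finally show ?thesis by simp
 qed
 have lf: "linear (\<lambda>P. \<beta> \<bullet> M P)" using lin(3) by (intro linearI) (auto simp: linear_add linear_scale inner_add_right)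
 have s2: "(\<Sum>P\<in>V. f P * (v \<bullet> N P)) = - (c * (\<beta> \<bullet> v))" for v
 proof -
  have "(\<Sum>P\<in>V. f P * (v \<bullet> N P)) = a * (\<Sum>P\<in>V. v \<bullet> N P) + (\<Sum>P\<in>V. (\<beta> \<bullet> M P) * (v \<bullet> N P))"
   by (simp add: f distrib_right sum.distrib sum_distrib_left)
  then show ?thesis by (simp only: s0 s1[OF lf] MG mult_zero_right add_0_left)
 qed
 have s3: "(\<Sum>P\<in>V. w P \<bullet> N P) = - (c * trace (matrix (\<lambda>v. B (G v))))"
 proof -
  have "(\<Sum>P\<in>V. w P \<bullet> N P) = (\<Sum>P\<in>V. B P \<bullet> N P)"
   using s0[of b] by (simp add: w inner_add_left sum.distrib)
  also have "\<dots> = (\<Sum>P\<in>V. \<Sum>i\<in>UNIV. (B P $ i) * (axis i 1 \<bullet> N P))"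
   by (intro sum.cong refl) (simp add: inner_axis', simp add: inner_vec_def)
  also have "\<dots> = (\<Sum>i\<in>UNIV. \<Sum>P\<in>V. (B P $ i) * (axis i 1 \<bullet> N P))" by (rule sum.swap)
  also have "\<dots> = (\<Sum>i\<in>UNIV. - (c * (B (G (axis i 1)) $ i)))"
  proof (rule sum.cong[OF refl])
   fix i :: 'n
   have "linear (\<lambda>P. B P $ i)" using lin(1) by (intro linearI) (auto simp: linear_add linear_scale)
   from s1[OF this] show "(\<Sum>P\<in>V. (B P $ i) * (axis i 1 \<bullet> N P)) = - (c * (B (G (axis i 1)) $ i))" .
  qed
  also have "\<dots> = - (c * trace (matrix (\<lambda>v. B (G v))))"
   by (simp add: trace_def matrix_def sum_negf sum_distrib_left)
  finally show ?thesis .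
 qed
 define F where "F = (\<Sum>Q\<in>V. f Q)"
 define W where "W = (\<Sum>Q\<in>V. w Q)"
 define R where "R = (\<Sum>Q\<in>V. f Q *\<^sub>R w Q)"
 have "(\<Sum>Q\<in>V - {P}. f Q) * (\<Sum>Q\<in>V - {P}. w Q \<bullet> N P) + (\<Sum>Q\<in>V - {P}. f Q * (w Q \<bullet> N P))
  = F * (W \<bullet> N P) - F * (w P \<bullet> N P) - f P * (W \<bullet> N P) + R \<bullet> N P" if P: "P \<in> V" for P
 proof -
  have 1: "(\<Sum>Q\<in>V - {P}. f Q) = F - f P" using sum.remove[OF fin P, of f] by (simp add: F_def)
  have 2: "(\<Sum>Q\<in>V - {P}. w Q \<bullet> N P) = W \<bullet> N P - w P \<bullet> N P"
   using sum.remove[OF fin P, of "\<lambda>Q. w Q \<bullet> N P"] by (simp add: W_def inner_sum_left)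
  have 3: "(\<Sum>Q\<in>V - {P}. f Q * (w Q \<bullet> N P)) = R \<bullet> N P - f P * (w P \<bullet> N P)"
   using sum.remove[OF fin P, of "\<lambda>Q. f Q * (w Q \<bullet> N P)"] by (simp add: R_def inner_sum_left)
  show ?thesis unfolding 1 2 3 by (simp add: algebra_simps)
 qed
 then have "(\<Sum>P\<in>V. (\<Sum>Q\<in>V - {P}. f Q) * (\<Sum>Q\<in>V - {P}. w Q \<bullet> N P) + (\<Sum>Q\<in>V - {P}. f Q * (w Q \<bullet> N P)))
  = (\<Sum>P\<in>V. F * (W \<bullet> N P) - F * (w P \<bullet> N P) - f P * (W \<bullet> N P) + R \<bullet> N P)" by (rule sum.cong[OF refl])
 also have "\<dots> = F * (\<Sum>P\<in>V. W \<bullet> N P) - F * (\<Sum>P\<in>V. w P \<bullet> N P) - (\<Sum>P\<in>V. f P * (W \<bullet> N P)) + (\<Sum>P\<in>V. R \<bullet> N P)"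
  by (simp only: sum.distrib sum_subtractf sum_distrib_left)
 also have "\<dots> = c * (\<beta> \<bullet> W) + c * F * trace (matrix (\<lambda>v. B (G v)))"
  unfolding s0 s2 s3 by simp
 finally show ?thesis unfolding F_def W_def .
qed

context face_geometry
begin

text \<open>For the density one this is the time average of the scaled normal of a moving face, and for the
height it is the gravity vector of the schemes.\<close>

definition swept :: "(real^'n \<Rightarrow> real) \<Rightarrow> real \<Rightarrow> (real^'n \<Rightarrow> real^'n) \<Rightarrow> (real^'n) set \<Rightarrow> real^'n \<Rightarrow> real^'n \<Rightarrow> real^'n" where
 "swept f r w \<sigma> n x = integral {0..1} (\<lambda>\<theta>. f (x + (r * \<theta>) *\<^sub>R w x) *\<^sub>R
   cof (move_deriv w (r * \<theta>) \<sigma> x) n)"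

abbreviation sweep :: "real \<Rightarrow> real^'n \<Rightarrow> real \<Rightarrow> (real^'n \<Rightarrow> real^'n) \<Rightarrow> (real^'n) set \<Rightarrow> real^'n \<Rightarrow> real^'n \<Rightarrow> real" where
 "sweep a \<beta> r w \<sigma> n x \<equiv> swept (\<lambda>y. a + \<beta> \<bullet> y) r w \<sigma> n x \<bullet> w x"

lemma motion_derivative_face:
 fixes T :: "(real^'n) set"
 assumes T: "cell T" and P: "P \<in> verts T" and B: "linear B" and w: "\<And>x. x \<in> T \<Longrightarrow> w x = B x + b"
  and x: "x \<in> facet (verts T) P"
 shows "((\<lambda>y. y + s *\<^sub>R w y) has_derivative (\<lambda>h. h + s *\<^sub>R B h)) (at x within facet (verts T) P)"
  and "linear (move_deriv w s (facet (verts T) P) x)"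
  and "bgrad (verts T) P \<bullet> h = 0 \<Longrightarrow>
   move_deriv w s (facet (verts T) P) x h = h + s *\<^sub>R B h"
proof -
 let ?\<sigma> = "facet (verts T) P"
 have V: "full (verts T)" by (rule full_verts[OF T])
 have sub: "?\<sigma> \<subseteq> T" using facet_of_imp_subset[OF cell_facetD(1)[OF T P]] .
 have B': "(B has_derivative B) (at x within ?\<sigma>)" using B by (simp add: linear_imp_has_derivative)
 have "((\<lambda>y. y + s *\<^sub>R (B y + b)) has_derivative (\<lambda>h. h + s *\<^sub>R B h)) (at x within ?\<sigma>)"
  by (rule derivative_eq_intros B' refl | simp)+
 then show D: "((\<lambda>y. y + s *\<^sub>R w y) has_derivative (\<lambda>h. h + s *\<^sub>R B h)) (at x within ?\<sigma>)"
  by (rule has_derivative_transform[OF x, rotated]) (use sub w in auto)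
 then have "((\<lambda>y. y + s *\<^sub>R w y) has_derivative move_deriv w s ?\<sigma> x) (at x within ?\<sigma>)"
  using frechet_derivative_works differentiable_def by blast
 then show "linear (move_deriv w s ?\<sigma> x)" by (rule has_derivative_linear)
 show "move_deriv w s ?\<sigma> x h = h + s *\<^sub>R B h" if "bgrad (verts T) P \<bullet> h = 0"
  by (rule frechet_derivative_within_convex[OF convex_convex_hull x D span_facet[OF V P that]])
qed

lemma linear_motion: "linear B \<Longrightarrow> linear (\<lambda>h. h + s *\<^sub>R B h)"
 by (intro linearI) (auto simp: linear_add linear_scale algebra_simps)

text \<open>Only tangential derivatives enter, so the derivative within the face may be replaced by that of the cell.\<close>

lemma cof_motion_face:
 fixes T :: "(real^'n) set"
 assumes T: "cell T" and P: "P \<in> verts T" and B: "linear B" and w: "\<And>x. x \<in> T \<Longrightarrow> w x = B x + b"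
  and x: "x \<in> facet (verts T) P"
 shows "cof (move_deriv w s (facet (verts T) P) x) (outn T (facet (verts T) P))
  = cof (\<lambda>h. h + s *\<^sub>R B h) (outn T (facet (verts T) P))"
proof (rule cof_tangent[OF outn_props(1)[OF T cell_facetD(1)[OF T P]] motion_derivative_face(2)[OF assms] linear_motion[OF B]])
 fix h assume h: "outn T (facet (verts T) P) \<bullet> h = 0"
 have "bgrad (verts T) P \<noteq> 0" by (rule bgrad_nonzero[OF full_verts[OF T] P])
 then have "bgrad (verts T) P \<bullet> h = 0" using h unfolding cell_facetD(6)[OF T P] by simp
 then show "move_deriv w s (facet (verts T) P) x h = h + s *\<^sub>R B h"
  using motion_derivative_face(3)[OF T P B w x, where s=s and h=h] by simp
qed

lemma moving_cell_derivative:
 fixes T :: "(real^'n) set" and r s a :: real and b \<beta> :: "real^'n"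
 assumes T: "cell T" and B: "linear B" and d: "det (matrix (\<lambda>h. h + (r * s) *\<^sub>R B h)) \<noteq> 0"
 defines "\<omega> \<equiv> \<lambda>x. B x + b"
 shows "((\<lambda>s. measure lborel T * det (matrix (\<lambda>h. h + (r * s) *\<^sub>R B h)) *
    (\<Sum>P\<in>verts T. a + \<beta> \<bullet> (P + (r * s) *\<^sub>R \<omega> P)) / (real CARD('n) + 1)) has_real_derivative
   r * (\<Sum>P\<in>verts T. real CARD('n) * measure lborel T * norm (bgrad (verts T) P) *
    quad_avg (verts T - {P}) (\<lambda>x. (a + \<beta> \<bullet> (x + (r * s) *\<^sub>R \<omega> x)) *
     (\<omega> x \<bullet> cof (\<lambda>h. h + (r * s) *\<^sub>R B h) (outn T (facet (verts T) P)))))) (at s)"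
proof -
 let ?V = "verts T" and ?n = "real CARD('n)" and ?m = "measure lborel T"
 note V = full_verts[OF T] and TV = simplexD(4)[OF T]
 have n0: "0 < ?n" by simp
 define M where "M h = h + (r * s) *\<^sub>R B h" for h
 have lM: "linear M" unfolding M_def by (rule linear_motion[OF B])
 define D where "D = det (matrix M)"
 have D0: "D \<noteq> 0" using d by (simp add: D_def M_def[abs_def])
 have "inj M" using D0 det_nz_iff_inj[OF lM] by (simp add: D_def)
 then obtain G where G: "linear G" "\<And>v. M (G v) = v"
  using linear_injective_isomorphism[OF lM] by blast
 define tr where "tr = trace (matrix (\<lambda>v. B (G v)))"
 define \<nu> where "\<nu> P = outn T (facet ?V P)" for P
 define N where "N P = (?n * ?m * norm (bgrad ?V P)) *\<^sub>R cof M (\<nu> P)" for P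
 define f where "f x = a + \<beta> \<bullet> (x + (r * s) *\<^sub>R \<omega> x)" for x
 have fM: "f x = (a + \<beta> \<bullet> ((r * s) *\<^sub>R b)) + \<beta> \<bullet> M x" for x
  by (simp add: f_def M_def \<omega>_def inner_add_right algebra_simps)
 have N: "N P \<bullet> M h = - ((?n * ?m * D) * (bgrad ?V P \<bullet> h))" if P: "P \<in> ?V" for P h
 proof -
  have g0: "norm (bgrad ?V P) \<noteq> 0" using bgrad_nonzero[OF V P] by simp
  have "cof M (\<nu> P) \<bullet> M h = D * (\<nu> P \<bullet> h)"
   unfolding D_def \<nu>_def by (rule cof_det[OF outn_props(1)[OF T cell_facetD(1)[OF T P]] lM])
  then show ?thesis using g0 unfolding N_def \<nu>_def cell_facetD(6)[OF T P] by simp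
 qed
 have alg: "(\<Sum>P\<in>?V. (\<Sum>Q\<in>?V - {P}. f Q) * (\<Sum>Q\<in>?V - {P}. \<omega> Q \<bullet> N P) + (\<Sum>Q\<in>?V - {P}. f Q * (\<omega> Q \<bullet> N P)))
  = (?n * ?m * D) * (\<beta> \<bullet> (\<Sum>Q\<in>?V. \<omega> Q)) + (?n * ?m * D) * (\<Sum>Q\<in>?V. f Q) * tr"
  unfolding tr_def by (rule transport_algebra[OF V B G(1) lM G(2) N fM]) (auto simp: \<omega>_def)
 have quad: "?n * ?m * norm (bgrad ?V P) * quad_avg (?V - {P}) (\<lambda>x. f x * (\<omega> x \<bullet> cof M (\<nu> P)))
  = ((\<Sum>Q\<in>?V - {P}. f Q) * (\<Sum>Q\<in>?V - {P}. \<omega> Q \<bullet> N P) + (\<Sum>Q\<in>?V - {P}. f Q * (\<omega> Q \<bullet> N P))) / (?n * (?n + 1))"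
  if P: "P \<in> ?V" for P
 proof -
  have card: "card (?V - {P}) = CARD('n)" using card_facet[OF V P] by simp
  have "?n * ?m * norm (bgrad ?V P) * quad_avg (?V - {P}) (\<lambda>x. f x * (\<omega> x \<bullet> cof M (\<nu> P)))
   = quad_avg (?V - {P}) (\<lambda>x. (?n * ?m * norm (bgrad ?V P)) * (f x * (\<omega> x \<bullet> cof M (\<nu> P))))"
   by (rule quad_avg_cmult[symmetric])
  also have "(\<lambda>x. (?n * ?m * norm (bgrad ?V P)) * (f x * (\<omega> x \<bullet> cof M (\<nu> P)))) = (\<lambda>x. f x * (\<omega> x \<bullet> N P))"
   by (simp add: N_def fun_eq_iff)
  also have "quad_avg (?V - {P}) (\<lambda>x. f x * (\<omega> x \<bullet> N P))
   = ((\<Sum>Q\<in>?V - {P}. f Q) * (\<Sum>Q\<in>?V - {P}. \<omega> Q \<bullet> N P) + (\<Sum>Q\<in>?V - {P}. f Q * (\<omega> Q \<bullet> N P))) / (?n * (?n + 1))"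
   unfolding card[symmetric]
  proof (rule quad_avg_product[OF cell_facetD(5)[OF T P] cell_facetD(4)[OF T P]])
   fix Q R
   show "f ((1/2) *\<^sub>R (Q + R)) = (f Q + f R) / 2"
    unfolding fM linear_scale[OF lM] linear_add[OF lM] by (simp add: inner_add_right field_simps)
   have "\<omega> ((1/2) *\<^sub>R (Q + R)) = (1/2) *\<^sub>R (\<omega> Q + \<omega> R)"
   proof -
    have bb: "b = (1/2) *\<^sub>R b + (1/2) *\<^sub>R b" by (simp flip: scaleR_add_left)
    have "B ((1/2) *\<^sub>R (Q + R)) + ((1/2) *\<^sub>R b + (1/2) *\<^sub>R b) = (1/2) *\<^sub>R (B Q + b + (B R + b))"
     unfolding linear_scale[OF B] linear_add[OF B] by (simp only: scaleR_add_right ac_simps)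
    then show ?thesis unfolding \<omega>_def using bb by simp
   qed
   then show "\<omega> ((1/2) *\<^sub>R (Q + R)) \<bullet> N P = (\<omega> Q \<bullet> N P + \<omega> R \<bullet> N P) / 2"
    by (simp add: inner_add_left)
  qed
  finally show ?thesis .
 qed
 have sum: "r * (\<Sum>P\<in>?V. ?n * ?m * norm (bgrad ?V P) * quad_avg (?V - {P}) (\<lambda>x. f x * (\<omega> x \<bullet> cof M (\<nu> P))))
  = r * (?m * D * (\<beta> \<bullet> (\<Sum>Q\<in>?V. \<omega> Q)) + ?m * D * (\<Sum>Q\<in>?V. f Q) * tr) / (?n + 1)"
 proof -
  have "(\<Sum>P\<in>?V. ?n * ?m * norm (bgrad ?V P) * quad_avg (?V - {P}) (\<lambda>x. f x * (\<omega> x \<bullet> cof M (\<nu> P))))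
   = (\<Sum>P\<in>?V. (\<Sum>Q\<in>?V - {P}. f Q) * (\<Sum>Q\<in>?V - {P}. \<omega> Q \<bullet> N P) + (\<Sum>Q\<in>?V - {P}. f Q * (\<omega> Q \<bullet> N P))) / (?n * (?n + 1))"
   unfolding sum_divide_distrib by (rule sum.cong[OF refl quad])
  also have "\<dots> = (?n * (?m * D * (\<beta> \<bullet> (\<Sum>Q\<in>?V. \<omega> Q)) + ?m * D * (\<Sum>Q\<in>?V. f Q) * tr)) / (?n * (?n + 1))"
   unfolding alg by (simp add: algebra_simps)
  also have "\<dots> = (?m * D * (\<beta> \<bullet> (\<Sum>Q\<in>?V. \<omega> Q)) + ?m * D * (\<Sum>Q\<in>?V. f Q) * tr) / (?n + 1)"
   using n0 by simp
  finally show ?thesis by simp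
 qed
 have d1: "((\<lambda>s. det (matrix (\<lambda>h. h + (r * s) *\<^sub>R B h))) has_real_derivative D * (r * tr)) (at s)"
  unfolding D_def tr_def by (rule det_motion_derivative[OF B M_def _ G]) (use D0 in \<open>simp add: D_def\<close>)
 have d2: "((\<lambda>s. \<Sum>P\<in>?V. a + \<beta> \<bullet> (P + (r * s) *\<^sub>R \<omega> P)) has_real_derivative (\<Sum>P\<in>?V. r * (\<beta> \<bullet> \<omega> P))) (at s)"
 proof (rule DERIV_sum)
  fix P
  have "((\<lambda>s. (a + \<beta> \<bullet> P) + s * (r * (\<beta> \<bullet> \<omega> P))) has_real_derivative (r * (\<beta> \<bullet> \<omega> P))) (at s)"
   by (auto intro!: derivative_eq_intros)
  then show "((\<lambda>s. a + \<beta> \<bullet> (P + (r * s) *\<^sub>R \<omega> P)) has_real_derivative r * (\<beta> \<bullet> \<omega> P)) (at s)"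
   by (simp add: inner_add_right algebra_simps)
 qed
 have Deq: "det (matrix (\<lambda>h. h + (r * s) *\<^sub>R B h)) = D" by (simp add: D_def M_def[abs_def])
 have Feq: "(\<Sum>P\<in>?V. a + \<beta> \<bullet> (P + (r * s) *\<^sub>R \<omega> P)) = (\<Sum>Q\<in>?V. f Q)" by (simp add: f_def)
 have Weq: "(\<Sum>P\<in>?V. r * (\<beta> \<bullet> \<omega> P)) = r * (\<beta> \<bullet> (\<Sum>Q\<in>?V. \<omega> Q))" by (simp add: inner_sum_right sum_distrib_left)
 from DERIV_cdivide[OF DERIV_mult[OF DERIV_cmult[OF d1, of ?m] d2], of "?n + 1"]
 have "((\<lambda>s. ?m * det (matrix (\<lambda>h. h + (r * s) *\<^sub>R B h)) *
    (\<Sum>P\<in>?V. a + \<beta> \<bullet> (P + (r * s) *\<^sub>R \<omega> P)) / (?n + 1)) has_real_derivative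
   (?m * (D * (r * tr)) * (\<Sum>Q\<in>?V. f Q) + r * (\<beta> \<bullet> (\<Sum>Q\<in>?V. \<omega> Q)) * (?m * D)) / (?n + 1)) (at s)"
  unfolding Deq Feq Weq .
 moreover have "(?m * (D * (r * tr)) * (\<Sum>Q\<in>?V. f Q) + r * (\<beta> \<bullet> (\<Sum>Q\<in>?V. \<omega> Q)) * (?m * D)) / (?n + 1)
   = r * (?m * D * (\<beta> \<bullet> (\<Sum>Q\<in>?V. \<omega> Q)) + ?m * D * (\<Sum>Q\<in>?V. f Q) * tr) / (?n + 1)"
  by (simp add: algebra_simps)
 ultimately have "((\<lambda>s. ?m * det (matrix (\<lambda>h. h + (r * s) *\<^sub>R B h)) *
    (\<Sum>P\<in>?V. a + \<beta> \<bullet> (P + (r * s) *\<^sub>R \<omega> P)) / (?n + 1)) has_real_derivative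
   r * (\<Sum>P\<in>?V. ?n * ?m * norm (bgrad ?V P) * quad_avg (?V - {P}) (\<lambda>x. f x * (\<omega> x \<bullet> cof M (\<nu> P))))) (at s)"
  unfolding sum by simp
 then show ?thesis unfolding f_def \<nu>_def M_def[abs_def] .
qed

end

context face_geometry
begin

lemma moving_cell:
 fixes T :: "(real^'n) set" and r a :: real and b \<beta> :: "real^'n"
 assumes T: "cell T" and B: "linear B" and w: "\<And>x. x \<in> T \<Longrightarrow> w x = B x + b"
  and d: "\<And>\<theta>. \<theta> \<in> {0..1} \<Longrightarrow> det (matrix (\<lambda>h. h + (r * \<theta>) *\<^sub>R B h)) \<noteq> 0"
 defines "F \<equiv> \<lambda>\<theta>. measure lborel T * det (matrix (\<lambda>h. h + (r * \<theta>) *\<^sub>R B h)) *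
  (\<Sum>P\<in>verts T. a + \<beta> \<bullet> (P + (r * \<theta>) *\<^sub>R w P)) / (real CARD('n) + 1)"
 shows "F 1 - F 0 = r * (\<Sum>\<sigma> | \<sigma> facet_of T.
  LINT x:\<sigma>|hausdorff k. sweep a \<beta> r w \<sigma> (outn T \<sigma>) x)"
proof -
 let ?V = "verts T" and ?n = "real CARD('n)" and ?m = "measure lborel T"
 note V = full_verts[OF T] and TV = simplexD(4)[OF T]
 define \<omega> where "\<omega> x = B x + b" for x
 define M where "M \<theta> h = h + (r * \<theta>) *\<^sub>R B h" for \<theta> h
 define \<nu> where "\<nu> P = outn T (facet ?V P)" for P
 define f where "f \<theta> x = a + \<beta> \<bullet> (x + (r * \<theta>) *\<^sub>R \<omega> x)" for \<theta> x
 define J where "J P x = integral {0..1} (\<lambda>\<theta>. f \<theta> x *\<^sub>R cof (M \<theta>) (\<nu> P))" for P x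
 have wV: "w P = \<omega> P" if "P \<in> ?V" for P
 proof -
  have "P \<in> T" using hull_inc[OF that, of convex] unfolding TV .
  then show ?thesis using w by (simp add: \<omega>_def)
 qed
 have F_alt: "F = (\<lambda>\<theta>. ?m * det (matrix (\<lambda>h. h + (r * \<theta>) *\<^sub>R B h)) *
  (\<Sum>P\<in>?V. a + \<beta> \<bullet> (P + (r * \<theta>) *\<^sub>R (B P + b))) / (?n + 1))"
  unfolding F_def using wV by (simp add: \<omega>_def cong: sum.cong)
 have \<nu>1: "norm (\<nu> P) = 1" if "P \<in> ?V" for P
  unfolding \<nu>_def by (rule outn_props(1)[OF T cell_facetD(1)[OF T that]])
 define F' where "F' \<theta> = r * (\<Sum>P\<in>?V. ?n * ?m * norm (bgrad ?V P) *
    quad_avg (?V - {P}) (\<lambda>x. f \<theta> x * (\<omega> x \<bullet> cof (M \<theta>) (\<nu> P))))" for \<theta>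
 have "(F has_vector_derivative F' \<theta>) (at \<theta> within {0..1})" if "\<theta> \<in> {0..1}" for \<theta>
 proof -
  have "(F has_real_derivative F' \<theta>) (at \<theta>)"
   unfolding F_alt F'_def f_def \<omega>_def M_def[abs_def] \<nu>_def
   by (rule moving_cell_derivative[OF T B d[OF that]])
  then show ?thesis
   unfolding has_real_derivative_iff_has_vector_derivative by (rule has_vector_derivative_at_within)
 qed
 then have ftc: "(F' has_integral (F 1 - F 0)) {0..1}"
  by (intro fundamental_theorem_of_calculus) auto
 have cc: "continuous_on {0..1} (\<lambda>\<theta>. cof (M \<theta>) (\<nu> P))" if "P \<in> ?V" for P
  unfolding M_def[abs_def] by (rule cof_continuous[OF \<nu>1[OF that] B])
 have Ji: "((\<lambda>\<theta>. f \<theta> x *\<^sub>R cof (M \<theta>) (\<nu> P)) has_integral J P x) {0..1}" if P: "P \<in> ?V" for P x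
  unfolding J_def f_def
  by (intro integrable_integral integrable_continuous_real continuous_intros cc P)
 have Jw: "((\<lambda>\<theta>. f \<theta> x * (\<omega> x \<bullet> cof (M \<theta>) (\<nu> P))) has_integral (J P x \<bullet> \<omega> x)) {0..1}" if P: "P \<in> ?V" for P x
  using has_integral_linear[OF Ji[OF P] bounded_linear_inner_left[of "\<omega> x"]]
  by (simp add: o_def inner_commute)
 have "(F' has_integral r * (\<Sum>P\<in>?V. ?n * ?m * norm (bgrad ?V P) * quad_avg (?V - {P}) (\<lambda>x. J P x \<bullet> \<omega> x))) {0..1}"
  unfolding F'_def[abs_def]
  by (intro has_integral_mult_right has_integral_sum full_finite[OF V] has_integral_quad_avg cell_facetD(5)[OF T] Jw)
 then have "F 1 - F 0 = r * (\<Sum>P\<in>?V. ?n * ?m * norm (bgrad ?V P) * quad_avg (?V - {P}) (\<lambda>x. J P x \<bullet> \<omega> x))"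
  using has_integral_unique ftc by blast
 also have "(\<Sum>P\<in>?V. ?n * ?m * norm (bgrad ?V P) * quad_avg (?V - {P}) (\<lambda>x. J P x \<bullet> \<omega> x))
  = (\<Sum>P\<in>?V. LINT x:facet ?V P|hausdorff k.
    sweep a \<beta> r w (facet ?V P) (outn T (facet ?V P)) x)"
 proof (rule sum.cong[OF refl])
  fix P assume P: "P \<in> ?V"
  let ?\<sigma> = "facet ?V P"
  have sub: "?\<sigma> \<subseteq> T" using facet_of_imp_subset[OF cell_facetD(1)[OF T P]] .
  have w1: "P1_on ?\<sigma> (\<lambda>x. \<omega> x \<bullet> v)" for v
  proof (rule P1_onI[of _ _ "b \<bullet> v" "adjoint B v"])
   fix x show "\<omega> x \<bullet> v = b \<bullet> v + adjoint B v \<bullet> x"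
    by (simp add: \<omega>_def inner_add_left adjoint_works[OF B] inner_commute[of "adjoint B v"])
  qed
  define j0 where "j0 = integral {0..1} (\<lambda>\<theta>. cof (M \<theta>) (\<nu> P))"
  define j1 where "j1 = integral {0..1} (\<lambda>\<theta>. \<theta> *\<^sub>R cof (M \<theta>) (\<nu> P))"
  have i0: "((\<lambda>\<theta>. cof (M \<theta>) (\<nu> P)) has_integral j0) {0..1}"
   unfolding j0_def by (intro integrable_integral integrable_continuous_real cc P)
  have i1: "((\<lambda>\<theta>. \<theta> *\<^sub>R cof (M \<theta>) (\<nu> P)) has_integral j1) {0..1}"
   unfolding j1_def by (intro integrable_integral integrable_continuous_real continuous_intros cc P)
  have J: "J P x = (a + \<beta> \<bullet> x) *\<^sub>R j0 + (r * (\<beta> \<bullet> \<omega> x)) *\<^sub>R j1" for x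
  proof -
   have i01: "((\<lambda>\<theta>. (a + \<beta> \<bullet> x) *\<^sub>R cof (M \<theta>) (\<nu> P) + (r * (\<beta> \<bullet> \<omega> x)) *\<^sub>R (\<theta> *\<^sub>R cof (M \<theta>) (\<nu> P))) has_integral
    (a + \<beta> \<bullet> x) *\<^sub>R j0 + (r * (\<beta> \<bullet> \<omega> x)) *\<^sub>R j1) {0..1}"
    by (intro has_integral_add has_integral_cmul i0 i1)
   have feq: "(\<lambda>\<theta>. (a + \<beta> \<bullet> x) *\<^sub>R cof (M \<theta>) (\<nu> P) + (r * (\<beta> \<bullet> \<omega> x)) *\<^sub>R (\<theta> *\<^sub>R cof (M \<theta>) (\<nu> P)))
    = (\<lambda>\<theta>. f \<theta> x *\<^sub>R cof (M \<theta>) (\<nu> P))"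
    by (rule ext) (simp add: f_def inner_add_right scaleR_add_left[symmetric] mult_ac)
   show ?thesis by (rule has_integral_unique[OF Ji[OF P, of x] i01[unfolded feq]])
  qed
  have p2: "P2_on ?\<sigma> (\<lambda>x. J P x \<bullet> \<omega> x)"
  proof -
   have eq: "J P x \<bullet> \<omega> x = (a + \<beta> \<bullet> x) * (\<omega> x \<bullet> j0) + r * ((\<omega> x \<bullet> \<beta>) * (\<omega> x \<bullet> j1))" for x
    unfolding J by (simp add: inner_add_left inner_add_right inner_commute[of _ "\<omega> x"] mult.assoc)
   have "P1_on ?\<sigma> (\<lambda>x. a + \<beta> \<bullet> x)" by (rule P1_onI[of _ _ a \<beta>]) simp
   then show ?thesis unfolding eq by (intro P2_on_add P2_on_cmult P2_on_mult w1)
  qed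
  have "?n * ?m * norm (bgrad ?V P) * quad_avg (?V - {P}) (\<lambda>x. J P x \<bullet> \<omega> x) = (LINT x:?\<sigma>|hausdorff k. J P x \<bullet> \<omega> x)"
   by (rule facet_quadrature[OF T P p2, symmetric])
  also have "\<dots> = (LINT x:?\<sigma>|hausdorff k. sweep a \<beta> r w ?\<sigma> (outn T ?\<sigma>) x)"
  proof (rule set_lebesgue_integral_cong)
   show "?\<sigma> \<in> sets (hausdorff k)"
    using finite_imp_compact_convex_hull[OF cell_facetD(5)[OF T P]] by (simp add: borel_closed compact_imp_closed)
   show "\<forall>x. x \<in> ?\<sigma> \<longrightarrow> J P x \<bullet> \<omega> x = sweep a \<beta> r w ?\<sigma> (outn T ?\<sigma>) x"
   proof (intro allI impI)
    fix x assume x: "x \<in> ?\<sigma>"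
    then have wx: "w x = \<omega> x" using sub w by (auto simp: \<omega>_def)
    have cm: "cof (move_deriv w s ?\<sigma> x) (outn T ?\<sigma>)
     = cof (\<lambda>h. h + s *\<^sub>R B h) (outn T ?\<sigma>)" for s
     by (rule cof_motion_face[OF T P B w x])
    have "swept (\<lambda>y. a + \<beta> \<bullet> y) r w ?\<sigma> (outn T ?\<sigma>) x = J P x"
     unfolding swept_def J_def f_def M_def[abs_def] \<nu>_def wx cm ..
    then show "J P x \<bullet> \<omega> x = sweep a \<beta> r w ?\<sigma> (outn T ?\<sigma>) x" by (simp add: wx)
   qed
  qed
  finally show "?n * ?m * norm (bgrad ?V P) * quad_avg (?V - {P}) (\<lambda>x. J P x \<bullet> \<omega> x)
   = (LINT x:?\<sigma>|hausdorff k. sweep a \<beta> r w ?\<sigma> (outn T ?\<sigma>) x)" .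
 qed
 also have "\<dots> = (\<Sum>\<sigma> | \<sigma> facet_of T. LINT x:\<sigma>|hausdorff k. sweep a \<beta> r w \<sigma> (outn T \<sigma>) x)"
  by (rule sum_facets_of_cell[OF T, symmetric])
 finally show ?thesis .
qed

text \<open>Change of variables for the affine map of a cell.\<close>

lemma integral_affine_moved:
 fixes T :: "(real^'n) set" and M :: "real^'n \<Rightarrow> real^'n"
 assumes T: "cell T" and M: "linear M" "det (matrix M) \<noteq> 0"
 shows "(LINT x:(\<lambda>y. p + M y) ` T|lborel. a + \<beta> \<bullet> x)
  = measure lborel T * \<bar>det (matrix M)\<bar> * (\<Sum>P\<in>verts T. a + \<beta> \<bullet> (p + M P)) / (real CARD('n) + 1)"
proof -
 note V = full_verts[OF T] and TV = simplexD(4)[OF T]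
 have comp: "compact T" using compact_full[OF V] unfolding TV .
 have Tb: "T \<in> sets borel" using compact_imp_closed[OF comp] by (rule borel_closed)
 have inj: "inj M" using M det_nz_iff_inj[OF M(1)] by simp
 have cM: "continuous_on S M" for S using M(1) by (simp add: linear_continuous_on linear_conv_bounded_linear)
 have J: "jacobian M = \<bar>det (matrix M)\<bar>" by (rule jacobian_det[OF M(1)])
 have aff: "a + \<beta> \<bullet> (p + M y) = (a + \<beta> \<bullet> p) + adjoint M \<beta> \<bullet> y" for y
  by (simp add: inner_add_right inner_commute[of "adjoint M \<beta>"] adjoint_works[OF M(1)] inner_commute[of \<beta> "M y"])
 have "(LINT x:(\<lambda>y. p + M y) ` T|hausdorff DIM(real^'n). a + \<beta> \<bullet> x) = jacobian M * (LINT y:T|lborel. a + \<beta> \<bullet> (p + M y))"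
 proof (rule integral_affine_image[OF M(1) inj Tb])
  show "(\<lambda>y. indicator T y *\<^sub>R (a + \<beta> \<bullet> (p + M y))) \<in> borel_measurable borel"
   by (intro borel_measurable_continuous_on_indicator[OF Tb] continuous_intros cM)
 qed
 also have "(LINT y:T|lborel. a + \<beta> \<bullet> (p + M y)) = measure lborel T * (\<Sum>P\<in>verts T. a + \<beta> \<bullet> (p + M P)) / (real CARD('n) + 1)"
  using integral_affine_full[OF V, of "a + \<beta> \<bullet> p" "adjoint M \<beta>"] unfolding TV aff by (simp add: add.commute)
 finally show ?thesis unfolding hausdorff_full_dim J by (simp add: mult_ac)
qed

text \<open>The fluxes through an inner facet cancel, since the cofactor vector is odd in the normal and depends on tangential derivatives only.\<close>

theorem transport_complex:
 fixes K :: "(real^'n) set set" and r a :: real and \<beta> :: "real^'n"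
 assumes K: "cell_complex K" and w: "\<And>T i. T \<in> K \<Longrightarrow> P1_on T (\<lambda>x. w x $ i)"
  and d: "\<And>\<theta> T x. \<theta> \<in> {0..1} \<Longrightarrow> T \<in> K \<Longrightarrow> x \<in> T \<Longrightarrow> det (jac T (\<lambda>y. y + (\<theta> * r) *\<^sub>R w y) x) > 0"
 shows "(\<Sum>T\<in>K. LINT x:(\<lambda>y. y + r *\<^sub>R w y) ` T|lborel. a + \<beta> \<bullet> x) - (\<Sum>T\<in>K. LINT x:T|lborel. a + \<beta> \<bullet> x)
  = r * (\<Sum>\<sigma>\<in>boundary_faces K. LINT x:\<sigma>|hausdorff k.
    sweep a \<beta> r w \<sigma> (outward_normal K \<sigma>) x)"
proof -
 interpret cell_complex K by fact
 let ?\<Psi> = "\<lambda>T \<sigma>. LINT x:\<sigma>|hausdorff k. sweep a \<beta> r w \<sigma> (outn T \<sigma>) x"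
 have cell_eq: "(LINT x:(\<lambda>y. y + r *\<^sub>R w y) ` T|lborel. a + \<beta> \<bullet> x) - (LINT x:T|lborel. a + \<beta> \<bullet> x)
  = r * (\<Sum>\<sigma> | \<sigma> facet_of T. ?\<Psi> T \<sigma>)" if TK: "T \<in> K" for T
 proof -
  have T: "cell T" by (rule cells[OF TK])
  note V = full_verts[OF T] and TV = simplexD(4)[OF T]
  obtain B b where B: "linear B" and wB: "\<And>x. x \<in> T \<Longrightarrow> w x = B x + b"
   using P1_vector[OF w[OF TK]] by blast
  define M where "M \<theta> h = h + (r * \<theta>) *\<^sub>R B h" for \<theta> h
  have lM: "linear (M \<theta>)" for \<theta> unfolding M_def by (rule linear_motion[OF B])
  have dM: "det (matrix (M \<theta>)) > 0" if \<theta>: "\<theta> \<in> {0..1}" for \<theta>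
  proof -
   obtain x where x: "x \<in> T" using cell_interior_nonempty[OF T] interior_subset by blast
   have "move_deriv w (\<theta> * r) T x = (\<lambda>h. h + (\<theta> * r) *\<^sub>R B h)"
    by (rule frechet_derivative_motion[OF T B wB x])
   then have "move_deriv w (\<theta> * r) T x = M \<theta>" unfolding M_def[abs_def] by (simp add: mult.commute)
   then show ?thesis using d[OF \<theta> TK x] by (simp add: jac_def)
  qed
  define F where "F \<theta> = measure lborel T * det (matrix (\<lambda>h. h + (r * \<theta>) *\<^sub>R B h)) *
   (\<Sum>P\<in>verts T. a + \<beta> \<bullet> (P + (r * \<theta>) *\<^sub>R w P)) / (real CARD('n) + 1)" for \<theta>
  have main: "F 1 - F 0 = r * (\<Sum>\<sigma> | \<sigma> facet_of T. ?\<Psi> T \<sigma>)"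
   unfolding F_def using dM unfolding M_def[abs_def] by (intro moving_cell[OF T B wB]) (auto simp: less_imp_neq[symmetric])
  have F_eq: "(LINT x:(\<lambda>y. y + (r * \<theta>) *\<^sub>R w y) ` T|lborel. a + \<beta> \<bullet> x) = F \<theta>" if \<theta>: "\<theta> \<in> {0..1}" for \<theta>
  proof -
   have img: "(\<lambda>y. y + (r * \<theta>) *\<^sub>R w y) ` T = (\<lambda>y. (r * \<theta>) *\<^sub>R b + M \<theta> y) ` T"
    by (intro image_cong refl) (simp add: wB M_def algebra_simps)
   have vV: "(r * \<theta>) *\<^sub>R b + M \<theta> P = P + (r * \<theta>) *\<^sub>R w P" if "P \<in> verts T" for P
   proof -
    have "P \<in> T" using hull_inc[OF that, of convex] unfolding TV .
    then show ?thesis by (simp add: wB M_def algebra_simps)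
   qed
   have "(LINT x:(\<lambda>y. (r * \<theta>) *\<^sub>R b + M \<theta> y) ` T|lborel. a + \<beta> \<bullet> x)
    = measure lborel T * \<bar>det (matrix (M \<theta>))\<bar> * (\<Sum>P\<in>verts T. a + \<beta> \<bullet> ((r * \<theta>) *\<^sub>R b + M \<theta> P)) / (real CARD('n) + 1)"
    using dM[OF \<theta>] by (intro integral_affine_moved[OF T lM]) simp
   also have "\<dots> = F \<theta>"
   proof -
    have "(\<Sum>P\<in>verts T. a + \<beta> \<bullet> ((r * \<theta>) *\<^sub>R b + M \<theta> P)) = (\<Sum>P\<in>verts T. a + \<beta> \<bullet> (P + (r * \<theta>) *\<^sub>R w P))"
     by (rule sum.cong[OF refl]) (simp only: vV)
    then show ?thesis unfolding F_def using dM[OF \<theta>] by (simp add: M_def[abs_def])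
   qed
   finally show ?thesis unfolding img .
  qed
  have "(LINT x:(\<lambda>y. y + r *\<^sub>R w y) ` T|lborel. a + \<beta> \<bullet> x) = F 1" using F_eq[of 1] by simp
  moreover have "(LINT x:T|lborel. a + \<beta> \<bullet> x) = F 0" using F_eq[of 0] by simp
  ultimately show ?thesis using main by simp
 qed
 have anti: "?\<Psi> T' \<sigma> = - ?\<Psi> T \<sigma>"
  if *: "T \<in> K" "T' \<in> K" "\<sigma> facet_of T" "\<sigma> facet_of T'" "T \<noteq> T'" for T T' \<sigma>
 proof -
  have eq: "outn T' \<sigma> = - outn T \<sigma>" by (rule outn_opposite[OF *(1,3) *(2,4) *(5)])
  have T: "cell T" by (rule cells[OF *(1)])
  have TV: "convex hull (verts T) = T" by (rule simplexD(4)[OF T])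
  obtain P where P: "P \<in> verts T" "\<sigma> = facet (verts T) P" using facet_of_cellE[OF T *(3)] by metis
  obtain B b where B: "linear B" and wB: "\<And>x. x \<in> T \<Longrightarrow> w x = B x + b"
   using P1_vector[OF w[OF *(1)]] by blast
  have "sweep a \<beta> r w \<sigma> (outn T' \<sigma>) x = - (sweep a \<beta> r w \<sigma> (outn T \<sigma>) x)"
   if x: "x \<in> \<sigma>" for x
  proof -
   have lin: "linear (move_deriv w (r * \<theta>) \<sigma> x)" for \<theta>
    using motion_derivative_face(2)[OF T P(1) B wB, of x "r * \<theta>"] x unfolding P(2) by blast
   have m: "cof (move_deriv w (r * \<theta>) \<sigma> x) (outn T' \<sigma>)
    = - cof (move_deriv w (r * \<theta>) \<sigma> x) (outn T \<sigma>)" for \<theta>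
    unfolding eq by (rule cof_minus[OF outn_props(1)[OF T *(3)] lin])
   have "swept (\<lambda>y. a + \<beta> \<bullet> y) r w \<sigma> (outn T' \<sigma>) x = - swept (\<lambda>y. a + \<beta> \<bullet> y) r w \<sigma> (outn T \<sigma>) x"
    unfolding swept_def m by simp
   then show ?thesis by simp
  qed
  moreover have "\<sigma> \<in> sets (hausdorff k)"
   unfolding P(2) using finite_imp_compact_convex_hull[OF cell_facetD(5)[OF T P(1)]] by (simp add: borel_closed compact_imp_closed)
  ultimately have "?\<Psi> T' \<sigma> = (LINT x:\<sigma>|hausdorff k. - (sweep a \<beta> r w \<sigma> (outn T \<sigma>) x))"
   by (intro set_lebesgue_integral_cong) auto
  then show ?thesis by (simp add: set_lebesgue_integral_def)
 qed
 have "(\<Sum>T\<in>K. LINT x:(\<lambda>y. y + r *\<^sub>R w y) ` T|lborel. a + \<beta> \<bullet> x) - (\<Sum>T\<in>K. LINT x:T|lborel. a + \<beta> \<bullet> x)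
  = (\<Sum>T\<in>K. r * (\<Sum>\<sigma> | \<sigma> facet_of T. ?\<Psi> T \<sigma>))"
  unfolding sum_subtractf[symmetric] by (rule sum.cong[OF refl cell_eq])
 also have "\<dots> = r * (\<Sum>T\<in>K. \<Sum>\<sigma> | \<sigma> facet_of T. ?\<Psi> T \<sigma>)" by (rule sum_distrib_left[symmetric])
 also have "(\<Sum>T\<in>K. \<Sum>\<sigma> | \<sigma> facet_of T. ?\<Psi> T \<sigma>) = (\<Sum>\<sigma>\<in>boundary_faces K. ?\<Psi> (cell_of \<sigma>) \<sigma>)"
  by (rule sum_facets_boundary[OF anti])
 also have "\<dots> = (\<Sum>\<sigma>\<in>boundary_faces K. LINT x:\<sigma>|hausdorff k.
    sweep a \<beta> r w \<sigma> (outward_normal K \<sigma>) x)"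
  by (intro sum.cong refl) (simp only: outward_normal_boundary)
 finally show ?thesis .
qed

end

section \<open>Cofactor vectors in two and three dimensions\<close>

definition cof2 :: "(real^2 \<Rightarrow> real^2) \<Rightarrow> real^2 \<Rightarrow> real^2" where
 "cof2 D n = rot90 (D (- rot90 n))"

definition cof3 :: "(real^3 \<Rightarrow> real^3) \<Rightarrow> real^3 \<Rightarrow> real^3" where
 "cof3 D n = (let (t1, t2) = (SOME (t1, t2). norm t1 = 1 \<and> norm t2 = 1 \<and> t1 \<bullet> t2 = 0 \<and> cross3 t1 t2 = n)
   in cross3 (D t1) (D t2))"

lemma rot90_nth [simp]: "rot90 x $ 1 = - x $ 2" "rot90 x $ 2 = x $ 1"
 by (simp_all add: rot90_def)

lemma linear_rot90: "linear rot90"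
 by (intro linearI) (auto simp: vec_eq_iff forall_2)

lemma inner_rot90: "x \<bullet> rot90 x = 0" "norm (rot90 x) = norm x" "rot90 (rot90 x) = - x"
 "rot90 x \<bullet> rot90 y = x \<bullet> y"
 by (simp_all add: inner_vec_def sum_2 norm_vec_def L2_set_def vec_eq_iff forall_2 add.commute)

lemma tangents_exist:
 fixes n :: "real^3"
 assumes n: "norm n = 1"
 shows "\<exists>t1 t2. norm t1 = 1 \<and> norm t2 = 1 \<and> t1 \<bullet> t2 = 0 \<and> cross3 t1 t2 = n"
proof -
 have "2 \<le> DIM(real^3)" by simp
 then obtain y where "y \<noteq> 0" "orthogonal n y" using orthogonal_to_vector_exists[of n] by blast
 then have y: "y \<noteq> 0" "n \<bullet> y = 0" by (simp_all add: orthogonal_def)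
 define t where "t = y /\<^sub>R norm y"
 have t: "norm t = 1" "n \<bullet> t = 0" using y by (auto simp: t_def)
 have "(norm (cross3 n t))\<^sup>2 = 1" using norm_cross_dot[of n t] n t by simp
 then have "norm (cross3 n t) = 1" using abs_square_eq_1[of "norm (cross3 n t)"] by simp
 moreover have "t \<bullet> cross3 n t = 0" by (simp add: dot_cross_self)
 moreover have "cross3 t (cross3 n t) = n"
  using t n by (simp add: Lagrange inner_commute[of t n] norm_eq_1)
 ultimately show ?thesis using t(1) by blast
qed

text \<open>The pair \<open>t1, t2\<close> completes \<open>n\<close> to a positively oriented orthonormal basis.\<close>

lemma tangent_expansion:
 fixes t1 t2 n :: "real^3"
 assumes t: "norm t1 = 1" "norm t2 = 1" "t1 \<bullet> t2 = 0" "cross3 t1 t2 = n"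
 shows "s = (s \<bullet> t1) *\<^sub>R t1 + (s \<bullet> t2) *\<^sub>R t2 + (s \<bullet> n) *\<^sub>R n" "norm n = 1" "n \<bullet> t1 = 0" "n \<bullet> t2 = 0"
  "cross3 n t1 = t2" "cross3 t2 n = t1"
proof -
 have n: "n \<bullet> t1 = 0" "n \<bullet> t2 = 0" unfolding t(4)[symmetric] by (simp_all add: dot_cross_self)
 have "(norm n)\<^sup>2 = 1" using norm_cross_dot[of t1 t2] t by simp
 then show n1: "norm n = 1" using abs_square_eq_1[of "norm n"] by simp
 show n12: "cross3 n t1 = t2" "cross3 t2 n = t1"
  using t unfolding t(4)[symmetric] cross_skew[of "cross3 t1 t2" t1] by (simp_all add: Lagrange norm_eq_1 inner_commute[of t2 t1])
 have "cross3 n s = - cross3 s n" by (rule cross_skew)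
 also have "cross3 s n = (s \<bullet> t2) *\<^sub>R t1 - (s \<bullet> t1) *\<^sub>R t2" unfolding t(4)[symmetric] by (rule Lagrange)
 finally have "cross3 n (cross3 n s) = cross3 n (- ((s \<bullet> t2) *\<^sub>R t1 - (s \<bullet> t1) *\<^sub>R t2))" by simp
 also have "\<dots> = (s \<bullet> t1) *\<^sub>R cross3 n t2 - (s \<bullet> t2) *\<^sub>R cross3 n t1"
  by (simp add: cross_mult_right Cross3.right_diff_distrib)
 also have "cross3 n t2 = - t1" using n12(2) cross_skew[of t2 n] by (metis minus_minus)
 finally have "cross3 n (cross3 n s) = - ((s \<bullet> t1) *\<^sub>R t1 + (s \<bullet> t2) *\<^sub>R t2)" by (simp add: n12)
 moreover have "cross3 n (cross3 n s) = (n \<bullet> s) *\<^sub>R n - s" using n1 by (simp add: Lagrange norm_eq_1)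
 ultimately show "s = (s \<bullet> t1) *\<^sub>R t1 + (s \<bullet> t2) *\<^sub>R t2 + (s \<bullet> n) *\<^sub>R n"
  by (simp add: inner_commute[of s n] algebra_simps)
 show "n \<bullet> t1 = 0" "n \<bullet> t2 = 0" by (rule n)+
qed

lemma cof3_tangents:
 assumes n: "norm n = 1"
 obtains t1 t2 where "norm t1 = 1" "norm t2 = 1" "t1 \<bullet> t2 = 0" "cross3 t1 t2 = n"
  "\<And>D. cof3 D n = cross3 (D t1) (D t2)"
proof -
 let ?P = "\<lambda>(t1, t2). norm t1 = 1 \<and> norm t2 = 1 \<and> t1 \<bullet> t2 = 0 \<and> cross3 t1 t2 = n"
 obtain t1 t2 where e: "(SOME x. ?P x) = (t1, t2)" by (cases "SOME x. ?P x")
 have "\<exists>x. ?P x" using tangents_exist[OF n] by auto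
 then have "?P (SOME x. ?P x)" by (rule someI_ex)
 then have "norm t1 = 1 \<and> norm t2 = 1 \<and> t1 \<bullet> t2 = 0 \<and> cross3 t1 t2 = n" unfolding e by simp
 then show ?thesis using e by (intro that[of t1 t2]) (auto simp: cof3_def)
qed

text \<open>The cross product of two tangential images depends on the tangents only through their own cross product, so the choice of the basis is immaterial.\<close>

lemma cof3_eq:
 assumes n: "norm n = 1" and D: "linear D" and s: "n \<bullet> s1 = 0" "n \<bullet> s2 = 0"
 shows "cross3 (D s1) (D s2) = (n \<bullet> cross3 s1 s2) *\<^sub>R cof3 D n"
proof -
 obtain t1 t2 where t: "norm t1 = 1" "norm t2 = 1" "t1 \<bullet> t2 = 0" "cross3 t1 t2 = n"
  and c: "\<And>D. cof3 D n = cross3 (D t1) (D t2)" using cof3_tangents[OF n] by blast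
 have e: "s = (s \<bullet> t1) *\<^sub>R t1 + (s \<bullet> t2) *\<^sub>R t2" if "n \<bullet> s = 0" for s
  using tangent_expansion(1)[OF t, of s] that by (simp add: inner_commute[of s n])
 have *: "cross3 (L s1) (L s2) = ((s1 \<bullet> t1) * (s2 \<bullet> t2) - (s1 \<bullet> t2) * (s2 \<bullet> t1)) *\<^sub>R cross3 (L t1) (L t2)"
  if L: "linear L" for L :: "real^3 \<Rightarrow> real^3"
 proof -
  have Ls: "L s = (s \<bullet> t1) *\<^sub>R L t1 + (s \<bullet> t2) *\<^sub>R L t2" if "n \<bullet> s = 0" for s
   using arg_cong[OF e[OF that], of L] by (simp only: linear_add[OF L] linear_scale[OF L])
  show ?thesis unfolding Ls[OF s(1)] Ls[OF s(2)]
   by (simp add: cross_add_left cross_add_right cross_mult_left cross_mult_right cross_skew[of "L t2" "L t1"] algebra_simps)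
 qed
 have "n \<bullet> cross3 s1 s2 = (s1 \<bullet> t1) * (s2 \<bullet> t2) - (s1 \<bullet> t2) * (s2 \<bullet> t1)"
  using *[OF linear_id] n t(4) by (simp add: norm_eq_1)
 then show ?thesis unfolding c *[OF D] by simp
qed

lemma jacobian_abs_det:
 fixes M :: "real^'n::{finite,wellorder} \<Rightarrow> real^'n::_"
 assumes M: "linear M" shows "jacobian M = \<bar>det (matrix M)\<bar>"
proof -
 have comp: "compact (M ` cbox 0 One)"
  by (intro compact_continuous_image linear_continuous_on) (use M in \<open>auto simp: linear_conv_bounded_linear\<close>)
 have "measure lborel (M ` cbox 0 One) = measure lebesgue (M ` cbox 0 One)"
  using compact_imp_closed[OF comp] by simp
 also have "\<dots> = \<bar>det (matrix M)\<bar> * measure lebesgue (cbox (0 :: real^'n::_) One)"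
  by (rule measure_linear_image[OF M]) simp
 finally show ?thesis unfolding jacobian_def hausdorff_full_dim by simp
qed

lemma linear_eq_matrix: "linear D \<Longrightarrow> D = (\<lambda>x. matrix D *v x)" for D :: "real^'n \<Rightarrow> real^'m"
 by (simp add: matrix_works fun_eq_iff)

lemma face_geometry_2: "face_geometry cof2 1"
proof
 show "CARD(2) = Suc 1" by simp
 show "(1::nat) = 1 \<or> (1::nat) = 2" by simp
 show "measure (hausdorff 1) (facet V P) = real CARD(2) * measure lborel (convex hull V) * norm (bgrad V P)"
  if "full V" "P \<in> V" for V :: "(real^2) set" and P
  using facet_measure_2[OF that] by simp
 show "cof2 D n = cof2 D' n" if "\<And>h. n \<bullet> h = 0 \<Longrightarrow> D h = D' h" for D D' n
  using that[of "- rot90 n"] by (simp add: cof2_def inner_rot90)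
 show "cof2 D (- n) = - cof2 D n" if "linear D" for D n
  by (simp add: cof2_def linear_neg[OF linear_rot90] linear_neg[OF that])
 show "cof2 D n \<bullet> D h = det (matrix D) * (n \<bullet> h)" if "linear D" for D n h
 proof -
  define A where "A = matrix D"
  have D: "D = (\<lambda>x. A *v x)" unfolding A_def by (rule linear_eq_matrix[OF that])
  show ?thesis unfolding A_def[symmetric] unfolding D
   by (simp add: cof2_def matrix_vector_mult_def inner_vec_def sum_2 det_2 algebra_simps)
 qed
 show "continuous_on {0..1} (\<lambda>\<theta>. cof2 (\<lambda>h. h + (r * \<theta>) *\<^sub>R B h) n)" if "linear B" for B n r
  unfolding cof2_def linear_add[OF linear_rot90] linear_scale[OF linear_rot90] by (intro continuous_intros)
 show "jacobian M = \<bar>det (matrix M)\<bar>" if "linear M" for M :: "real^2 \<Rightarrow> real^2"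
  using that by (rule jacobian_abs_det)
 show "((\<lambda>t. det (matrix (\<lambda>h :: real^2. h + t *\<^sub>R C h))) has_real_derivative trace (matrix C)) (at 0)"
  for C :: "real^2 \<Rightarrow> real^2"
  unfolding det_2 trace_def sum_2 matrix_def
  by (auto intro!: derivative_eq_intros simp: axis_def)
qed

lemma face_geometry_3: "face_geometry cof3 2"
proof
 show "CARD(3) = Suc 2" by simp
 show "(2::nat) = 1 \<or> (2::nat) = 2" by simp
 show "measure (hausdorff 2) (facet V P) = real CARD(3) * measure lborel (convex hull V) * norm (bgrad V P)"
  if "full V" "P \<in> V" for V :: "(real^3) set" and P
  using facet_measure_3[OF that] by simp
 show "cof3 D n = cof3 D' n" if n: "norm n = 1" and *: "\<And>h. n \<bullet> h = 0 \<Longrightarrow> D h = D' h" for D D' n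
 proof -
  obtain t1 t2 where t: "norm t1 = 1" "norm t2 = 1" "t1 \<bullet> t2 = 0" "cross3 t1 t2 = n"
   and c: "\<And>D. cof3 D n = cross3 (D t1) (D t2)" using cof3_tangents[OF n] by blast
  show ?thesis unfolding c using *[of t1] *[of t2] tangent_expansion(3,4)[OF t] by simp
 qed
 show "cof3 D (- n) = - cof3 D n" if n: "norm n = 1" and D: "linear D" for D n
 proof -
  have n': "norm (- n) = 1" using n by simp
  obtain t1 t2 where t: "norm t1 = 1" "norm t2 = 1" "t1 \<bullet> t2 = 0" "cross3 t1 t2 = - n"
   and c: "\<And>D. cof3 D (- n) = cross3 (D t1) (D t2)" using cof3_tangents[OF n'] by blast
  have "n \<bullet> t1 = 0" "n \<bullet> t2 = 0" using tangent_expansion(3,4)[OF t] by simp_all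
  from cof3_eq[OF n D this] t(4) n show ?thesis unfolding c by (simp add: norm_eq_1)
 qed
 show "cof3 D n \<bullet> D h = det (matrix D) * (n \<bullet> h)" if n: "norm n = 1" and D: "linear D" for D n h
 proof -
  obtain t1 t2 where t: "norm t1 = 1" "norm t2 = 1" "t1 \<bullet> t2 = 0" "cross3 t1 t2 = n"
   and c: "\<And>D. cof3 D n = cross3 (D t1) (D t2)" using cof3_tangents[OF n] by blast
  define A where "A = matrix D"
  have DA: "D = (\<lambda>x. A *v x)" unfolding A_def by (rule linear_eq_matrix[OF D])
  have "(A *v h) \<bullet> cross3 (A *v t1) (A *v t2) = h \<bullet> (transpose A *v cross3 (A *v t1) (A *v t2))"
   by (metis dot_lmul_matrix inner_commute transpose_matrix_vector)
  also have "\<dots> = det A * (h \<bullet> n)" unfolding cross_matrix_mult t(4) by simp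
  finally show ?thesis unfolding c A_def[symmetric] by (simp add: DA inner_commute)
 qed
 show "continuous_on {0..1} (\<lambda>\<theta>. cof3 (\<lambda>h. h + (r * \<theta>) *\<^sub>R B h) n)" if n: "norm n = 1" for B n r
 proof -
  obtain t1 t2 where c: "\<And>D. cof3 D n = cross3 (D t1) (D t2)" using cof3_tangents[OF n] by blast
  show ?thesis unfolding c by (intro continuous_on_cross continuous_intros)
 qed
 show "jacobian M = \<bar>det (matrix M)\<bar>" if "linear M" for M :: "real^3 \<Rightarrow> real^3"
  using that by (rule jacobian_abs_det)
 show "((\<lambda>t. det (matrix (\<lambda>h :: real^3. h + t *\<^sub>R C h))) has_real_derivative trace (matrix C)) (at 0)"
  for C :: "real^3 \<Rightarrow> real^3"
  unfolding det_3 trace_def sum_3 matrix_def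
  by (auto intro!: derivative_eq_intros simp: axis_def)
qed

interpretation two: face_geometry cof2 1 by (rule face_geometry_2)
interpretation three: face_geometry cof3 2 by (rule face_geometry_3)

lemma nhat2_cof: "nhat2 p M wt \<sigma> \<theta> x = cof2 (frechet_derivative (interp_pos p wt \<theta>) (at x within \<sigma>)) (face_nrm M \<sigma>)"
 by (simp add: nhat2_def cof2_def)

lemma nhat3_cof: "nhat3 p M wt \<sigma> \<theta> x = cof3 (frechet_derivative (interp_pos p wt \<theta>) (at x within \<sigma>)) (face_nrm M \<sigma>)"
 by (simp add: nhat3_def cof3_def Let_def)

section \<open>One step of the mesh motion\<close>

lemma frechet_derivative_cong_on:
 assumes "x \<in> S" "\<And>y. y \<in> S \<Longrightarrow> f y = g y"
 shows "frechet_derivative f (at x within S) = frechet_derivative g (at x within S)"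
proof -
 have "(f has_derivative D) (at x within S) \<longleftrightarrow> (g has_derivative D) (at x within S)" for D
  using has_derivative_transform[OF assms(1), of f g D] has_derivative_transform[OF assms(1), of g f D] assms(2) by auto
 then show ?thesis by (simp add: frechet_derivative_def)
qed

lemma S1v_component:
 fixes f :: "real^'n \<Rightarrow> real^'n"
 assumes "f \<in> S1v F" shows "(\<lambda>x. f x $ i) \<in> S1 F"
proof -
 have "(\<lambda>x. f x \<bullet> axis i 1) \<in> S1 F" using assms axis_in_Basis_iff[of i "1::real"] unfolding S1v_def by auto
 then show ?thesis by (simp add: inner_axis)
qed

lemma S2v_component:
 fixes f :: "real^'n \<Rightarrow> real^'n"
 assumes "f \<in> S2v F" shows "(\<lambda>x. f x $ i) \<in> S2 F"
proof -
 have "(\<lambda>x. f x \<bullet> axis i 1) \<in> S2 F" using assms axis_in_Basis_iff[of i "1::real"] unfolding S2v_def by auto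
 then show ?thesis by (simp add: inner_axis)
qed

lemma S1D: "f \<in> S1 F \<Longrightarrow> \<sigma> \<in> F \<Longrightarrow> P1_on \<sigma> f" "f \<in> S1 F \<Longrightarrow> continuous_on (\<Union>F) f"
 by (auto simp: S1_def)

lemma S2D: "f \<in> S2 F \<Longrightarrow> \<sigma> \<in> F \<Longrightarrow> P2_on \<sigma> f" "f \<in> S2 F \<Longrightarrow> continuous_on (\<Union>F) f"
 by (auto simp: S2_def)

lemma P1_on_inner:
 fixes w :: "real^'n \<Rightarrow> real^'n"
 assumes "\<And>i. P1_on S (\<lambda>x. w x $ i)" shows "P1_on S (\<lambda>x. w x \<bullet> v)"
proof -
 have "(\<lambda>x. w x \<bullet> v) = (\<lambda>x. \<Sum>i\<in>UNIV. v $ i * w x $ i)" by (simp add: inner_vec_def mult.commute)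
 then show ?thesis by (simp only:) (intro P1_on_sum P1_on_cmult assms)
qed

lemma P2_on_inner:
 fixes w :: "real^'n \<Rightarrow> real^'n"
 assumes "\<And>i. P2_on S (\<lambda>x. w x $ i)" shows "P2_on S (\<lambda>x. w x \<bullet> v)"
proof -
 have "(\<lambda>x. w x \<bullet> v) = (\<lambda>x. \<Sum>i\<in>UNIV. v $ i * w x $ i)" by (simp add: inner_vec_def mult.commute)
 then show ?thesis by (simp only:) (intro P2_on_sum P2_on_cmult assms)
qed

text \<open>The level sets of an affine function are convex.\<close>

lemma P1_on_hull_eq:
 assumes f: "P1_on (convex hull V) f" and V: "\<And>P. P \<in> V \<Longrightarrow> f P = c" and x: "x \<in> convex hull V"
 shows "f x = c"
proof -
 obtain d a where f: "\<And>y. y \<in> convex hull V \<Longrightarrow> f y = d + a \<bullet> y" using f unfolding P1_on_def by blast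
 have "convex {y. a \<bullet> y = c - d}" by (rule convex_hyperplane)
 moreover have "V \<subseteq> {y. a \<bullet> y = c - d}"
 proof
  fix P assume P: "P \<in> V"
  show "P \<in> {y. a \<bullet> y = c - d}" using f[OF hull_inc[OF P]] V[OF P] by simp
 qed
 ultimately have "convex hull V \<subseteq> {y. a \<bullet> y = c - d}" by (rule hull_minimal[rotated])
 then show ?thesis using x f[OF x] by auto
qed

lemma continuous_on_components:
 fixes f :: "'a::topological_space \<Rightarrow> real^'n"
 assumes "\<And>i. continuous_on S (\<lambda>x. f x $ i)" shows "continuous_on S f"
 using assms continuous_on_vec_lambda[of S "\<lambda>i x. f x $ i"] by simp

text \<open>The area of the image of a face, and its bound by half the squared tangential gradient.\<close>

locale face_area = face_geometry cof k for cof :: "(real^'n \<Rightarrow> real^'n) \<Rightarrow> real^'n \<Rightarrow> real^'n" and k +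
 assumes cof_norm: "\<And>D n. norm n = 1 \<Longrightarrow> linear D \<Longrightarrow> 2 * (norm (cof D n) - 1) \<le>
   matrix (\<lambda>h. D (tproj n h)) \<bullet> matrix (\<lambda>h. D (tproj n h)) - matrix (tproj n) \<bullet> matrix (tproj n)"
  and cof_image: "\<And>V D b n. \<not> affine_dependent V \<Longrightarrow> card V = Suc k \<Longrightarrow> linear D \<Longrightarrow> inj D \<Longrightarrow> norm n = 1 \<Longrightarrow>
   (\<And>x y. x \<in> V \<Longrightarrow> y \<in> V \<Longrightarrow> n \<bullet> (y - x) = 0) \<Longrightarrow>
   measure (hausdorff k) (convex hull ((\<lambda>x. D x + b) ` V)) = measure (hausdorff k) (convex hull V) * norm (cof D n)"

text \<open>One step of either scheme: \<open>wt\<close> is the velocity of the free surface and \<open>w\<close> its bulk extension. The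
new mesh is required to be valid, so its boundary facets are the images of the old ones.\<close>

locale mesh_step = face_area cof k for cof :: "(real^'n \<Rightarrow> real^'n) \<Rightarrow> real^'n \<Rightarrow> real^'n" and k +
 fixes p :: "(real^'n) params" and M :: "(real^'n) mesh" and wt w :: "real^'n \<Rightarrow> real^'n"
 assumes ok: "params_ok p" and valid: "valid_mesh p M"
  and valid': "valid_mesh p (map_mesh (\<lambda>x. x + tau p *\<^sub>R w x) M)"
  and ext: "bulk_extension p M wt w" and nondeg: "nondegenerate p M w"
begin

abbreviation "bdry \<equiv> boundary_faces (cells M)"
abbreviation "nrm \<equiv> outward_normal (cells M)"
abbreviation "area \<equiv> measure (hausdorff k)"
abbreviation "\<psi> \<equiv> \<lambda>x. x + tau p *\<^sub>R w x"
abbreviation "M' \<equiv> map_mesh \<psi> M"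

sublocale cell_complex "cells M"
proof
 show "triangulation (cells M)" using valid by (simp add: valid_mesh_def)
 show "cell T" if "T \<in> cells M" for T using valid that by (simp add: valid_mesh_def)
qed

lemma complex: "cell_complex (cells M)"
 by (rule cell_complex_axioms)

lemma complex': "cell_complex (cells M')"
proof
 show "triangulation (cells M')" using valid' by (simp add: valid_mesh_def)
 show "cell T" if "T \<in> cells M'" for T using valid' that by (simp add: valid_mesh_def)
qed

lemma k_eq: "CARD('n) - 1 = k" "DIM(real^'n) = Suc k"
 using card_n by simp_all

lemma tau_pos: "0 < tau p" and We_pos: "0 < Web p" and nrm_s_unit: "norm (nrm_s p) = 1"
 using ok by (simp_all add: params_ok_def)

lemma faces: "free_faces M \<union> solid_faces M = bdry" "free_faces M \<inter> solid_faces M = {}"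
 using valid by (simp_all add: valid_mesh_def)

lemma free_boundary: "\<sigma> \<in> free_faces M \<Longrightarrow> \<sigma> \<in> bdry"
 and solid_boundary: "\<sigma> \<in> solid_faces M \<Longrightarrow> \<sigma> \<in> bdry"
 using faces(1) by blast+

lemma finite_boundary: "finite (bdry)"
 by (rule finite_subset[OF boundary_subset_all_facets finite_all_facets])

lemma finite_faces: "finite (free_faces M)" "finite (solid_faces M)"
 using finite_boundary unfolding faces(1)[symmetric] by simp_all

lemma sum_boundary: "(\<Sum>\<sigma>\<in>bdry. f \<sigma>) = (\<Sum>\<sigma>\<in>free_faces M. f \<sigma>) + (\<Sum>\<sigma>\<in>solid_faces M. f \<sigma>)"
 for f :: "_ \<Rightarrow> real"
 unfolding faces(1)[symmetric] by (rule sum.union_disjoint[OF finite_faces faces(2)])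

lemma solid_normal: "\<rho> \<in> solid_faces M \<Longrightarrow> nrm \<rho> = nrm_s p"
 using valid by (simp add: valid_mesh_def)

lemma face_in_cell: "\<sigma> \<in> bdry \<Longrightarrow> \<sigma> \<subseteq> cell_of \<sigma>"
 using facet_of_imp_subset[OF cell_of(2)] .

lemma face_nrm_unit: "\<sigma> \<in> bdry \<Longrightarrow> norm (nrm \<sigma>) = 1"
 unfolding outward_normal_boundary using outn_props(1)[OF cells cell_of(2)] cell_of(1) outward_normal_boundary by metis

lemma face_nrm_orthogonal:
 assumes "\<sigma> \<in> bdry" "x \<in> \<sigma>" "y \<in> \<sigma>" shows "nrm \<sigma> \<bullet> (y - x) = 0"
 unfolding outward_normal_boundary[OF assms(1)]
 by (rule outn_props(2)[OF cells[OF cell_of(1)[OF assms(1)]] cell_of(2)[OF assms(1)] assms(2,3)])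

lemma face_measure_pos: "\<sigma> \<in> bdry \<Longrightarrow> 0 < area \<sigma>"
 and face_integral: "\<sigma> \<in> bdry \<Longrightarrow> P2_on \<sigma> g \<Longrightarrow>
  (LINT x:\<sigma>|hausdorff k. g x) = area \<sigma> * quad_avg (verts \<sigma>) g"
 using hausdorff_boundary_face[OF _ k_eq(2) k12] by blast+

lemma face_nonempty: "\<sigma> \<in> bdry \<Longrightarrow> verts \<sigma> \<noteq> {}"
 using boundary_face_simplex(2)[of \<sigma>] by force

lemma verts_in_face: "\<sigma> \<in> bdry \<Longrightarrow> P \<in> verts \<sigma> \<Longrightarrow> P \<in> \<sigma>"
 using boundary_face_simplex(3)[of \<sigma>] hull_inc[of P "verts \<sigma>" convex] by simp

lemma face_integral_P1:
 assumes \<sigma>: "\<sigma> \<in> bdry" and g: "P1_on \<sigma> g"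
 shows "(LINT x:\<sigma>|hausdorff k. g x) = area \<sigma> / real (k + 1) * (\<Sum>P\<in>verts \<sigma>. g P)"
proof -
 have "P1_on (convex hull (verts \<sigma>)) g" using g boundary_face_simplex(3)[OF \<sigma>] by simp
 from quad_avg_P1[OF boundary_face_simplex(4)[OF \<sigma>] face_nonempty[OF \<sigma>] this] face_integral[OF \<sigma> P2_on_P1[OF g]]
 show ?thesis using boundary_face_simplex(2)[OF \<sigma>] k_eq(2) by simp
qed

lemma face_sets: "\<sigma> \<in> bdry \<Longrightarrow> \<sigma> \<in> sets (hausdorff k)"
 using boundary_face_simplex(5)[of \<sigma>] by (simp add: compact_imp_closed borel_closed)

lemma w_space: "w \<in> S1v (cells M)" and w_free: "x \<in> free_surface M \<Longrightarrow> w x = wt x"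
 using ext by (simp_all add: bulk_extension_def mesh_velocity_space_def)

lemma w_free_face: "\<sigma> \<in> free_faces M \<Longrightarrow> x \<in> \<sigma> \<Longrightarrow> w x = wt x"
 by (rule w_free) (auto simp: free_surface_def)

lemma w_P1: "T \<in> cells M \<Longrightarrow> P1_on T (\<lambda>x. w x $ i)"
 using S1D(1)[OF S1v_component[OF w_space]] .

lemma w_face_P1: "\<sigma> \<in> bdry \<Longrightarrow> P1_on \<sigma> (\<lambda>x. w x $ i)"
 using P1_on_subset[OF w_P1 face_in_cell] cell_of(1) by blast

lemma continuous_w: "continuous_on (domain M) w"
 by (rule continuous_on_components) (use S1D(2)[OF S1v_component[OF w_space]] in \<open>simp add: domain_def\<close>)

lemma det_pos: "\<theta> \<in> {0..1} \<Longrightarrow> T \<in> cells M \<Longrightarrow> x \<in> T \<Longrightarrow> det (jac T (\<lambda>y. y + (\<theta> * tau p) *\<^sub>R w y) x) > 0"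
 using nondeg unfolding nondegenerate_def by blast

text \<open>The gradient of the mesh velocity on a cell.\<close>

definition dw :: "(real^'n) set \<Rightarrow> real^'n \<Rightarrow> real^'n" where
 "dw T = (SOME B. linear B \<and> (\<exists>b. \<forall>x\<in>T. w x = B x + b))"

lemma dw:
 assumes T: "T \<in> cells M"
 shows linear_dw: "linear (dw T)" and w_affine: "\<exists>b. \<forall>x\<in>T. w x = dw T x + b"
proof -
 obtain B b where B: "linear B" and wB: "\<And>x. x \<in> T \<Longrightarrow> w x = B x + b"
  using P1_vector[OF w_P1[OF T]] by blast
 then have "\<exists>B. linear B \<and> (\<exists>b. \<forall>x\<in>T. w x = B x + b)" by blast
 then have "linear (dw T) \<and> (\<exists>b. \<forall>x\<in>T. w x = dw T x + b)" unfolding dw_def by (rule someI_ex)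
 then show "linear (dw T)" "\<exists>b. \<forall>x\<in>T. w x = dw T x + b" by blast+
qed

lemma dw_diff: "T \<in> cells M \<Longrightarrow> x \<in> T \<Longrightarrow> y \<in> T \<Longrightarrow> dw T (y - x) = w y - w x"
 using w_affine[of T] by (auto simp: linear_diff[OF linear_dw])

lemma det_dw_pos:
 assumes T: "T \<in> cells M" and \<theta>: "\<theta> \<in> {0..1}"
 shows "det (matrix (\<lambda>h. h + (tau p * \<theta>) *\<^sub>R dw T h)) > 0"
proof -
 note B = linear_dw[OF T]
 obtain b where wB: "\<And>x. x \<in> T \<Longrightarrow> w x = dw T x + b" using w_affine[OF T] by blast
 obtain x where x: "x \<in> T" using cell_interior_nonempty[OF cells[OF T]] interior_subset by blast
 have "move_deriv w (\<theta> * tau p) T x = (\<lambda>h. h + (\<theta> * tau p) *\<^sub>R dw T h)"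
  by (rule frechet_derivative_motion[OF cells[OF T] B wB x])
 then show ?thesis using det_pos[OF \<theta> T x] by (simp add: jac_def mult.commute)
qed

abbreviation "grad_w \<sigma> \<equiv> dw (cell_of \<sigma>)"

lemma face_motion:
 assumes \<sigma>: "\<sigma> \<in> bdry" and x: "x \<in> \<sigma>"
 shows "cof (move_deriv w s \<sigma> x) (nrm \<sigma>)
   = cof (\<lambda>h. h + s *\<^sub>R grad_w \<sigma> h) (nrm \<sigma>)"
  and "nrm \<sigma> \<bullet> h = 0 \<Longrightarrow> frechet_derivative w (at x within \<sigma>) h = grad_w \<sigma> h"
  and "nrm \<sigma> \<bullet> h = 0 \<Longrightarrow>
   move_deriv w s \<sigma> x h = h + s *\<^sub>R grad_w \<sigma> h"
  and "nrm \<sigma> \<bullet> h = 0 \<Longrightarrow> h \<in> span ((\<lambda>y. y - x) ` \<sigma>)"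
proof -
 define T where "T = cell_of \<sigma>"
 have TK: "T \<in> cells M" and fT: "\<sigma> facet_of T" using cell_of(1,2)[OF \<sigma>] by (simp_all add: T_def)
 note B = linear_dw[OF TK]
 obtain b where wB: "\<And>x. x \<in> T \<Longrightarrow> w x = dw T x + b" using w_affine[OF TK] by blast
 have T: "cell T" by (rule cells[OF TK])
 obtain P where P: "P \<in> verts T" "\<sigma> = facet (verts T) P"
   "outn T \<sigma> = - (bgrad (verts T) P /\<^sub>R norm (bgrad (verts T) P))"
  using facet_of_cellE[OF T fT] by metis
 have n: "nrm \<sigma> = outn T \<sigma>" unfolding T_def by (rule outward_normal_boundary[OF \<sigma>])
 have g0: "bgrad (verts T) P \<noteq> 0" by (rule bgrad_nonzero[OF full_verts[OF T] P(1)])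
 have x': "x \<in> facet (verts T) P" using x unfolding P(2) .
 show "cof (move_deriv w s \<sigma> x) (nrm \<sigma>)
   = cof (\<lambda>h. h + s *\<^sub>R grad_w \<sigma> h) (nrm \<sigma>)"
  using cof_motion_face[OF T P(1) B wB x', of s] unfolding n P(2)[symmetric] unfolding T_def .
 assume "nrm \<sigma> \<bullet> h = 0"
 then have tang: "bgrad (verts T) P \<bullet> h = 0" using g0 unfolding n P(3) by simp
 show sp: "h \<in> span ((\<lambda>y. y - x) ` \<sigma>)"
  using span_facet[OF full_verts[OF T] P(1) tang, of x] unfolding P(2)[symmetric] .
 show "move_deriv w s \<sigma> x h = h + s *\<^sub>R grad_w \<sigma> h"
  using motion_derivative_face(3)[OF T P(1) B wB x' tang, of s] unfolding P(2)[symmetric] unfolding T_def .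
 have B': "(dw T has_derivative dw T) (at x within \<sigma>)" using B by (simp add: linear_imp_has_derivative)
 have "((\<lambda>y. dw T y + b) has_derivative dw T) (at x within \<sigma>)" by (rule derivative_eq_intros B' refl | simp)+
 then have D: "(w has_derivative dw T) (at x within \<sigma>)"
  by (rule has_derivative_transform[OF x, rotated]) (use wB facet_of_imp_subset[OF fT] in auto)
 have "convex (facet (verts T) P)" by (rule convex_convex_hull)
 then have cv: "convex \<sigma>" unfolding P(2)[symmetric] .
 show "frechet_derivative w (at x within \<sigma>) h = grad_w \<sigma> h"
  using frechet_derivative_within_convex[OF cv x D sp] unfolding T_def .
qed

text \<open>Mass lumping tests the normal component of the mesh velocity at the vertices against itself.\<close>

lemma solid_tangential:
 assumes \<rho>: "\<rho> \<in> solid_faces M" and x: "x \<in> \<rho>"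
 shows "w x \<bullet> nrm_s p = 0"
proof -
 let ?\<phi> = "\<lambda>x. w x \<bullet> nrm_s p"
 have p1: "P1_on \<sigma> ?\<phi>" if "\<sigma> \<in> solid_faces M" for \<sigma>
  by (rule P1_on_inner[OF w_face_P1[OF solid_boundary[OF that]]])
 have sub: "\<Union>(solid_faces M) \<subseteq> domain M"
  using face_in_cell cell_of(1) solid_boundary unfolding domain_def by blast
 have tst: "\<forall>\<phi>s\<in>S1 (solid_faces M). lump k (solid_faces M) (\<lambda>\<rho> x. (w x \<bullet> nrm_s p) * \<phi>s x) = 0"
  using ext unfolding bulk_extension_def k_eq(1) by blast
 have "?\<phi> \<in> S1 (solid_faces M)"
  unfolding S1_def using p1 continuous_on_subset[OF continuous_w sub] by (auto intro!: continuous_intros)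
 from bspec[OF tst this] have "lump k (solid_faces M) (\<lambda>\<rho> x. ?\<phi> x * ?\<phi> x) = 0" .
 then have "(\<Sum>\<sigma>\<in>solid_faces M. area \<sigma> / real (k + 1) * (\<Sum>P\<in>verts \<sigma>. ?\<phi> P * ?\<phi> P)) = 0"
  by (simp add: lump_def)
 moreover have "0 \<le> area \<sigma> / real (k + 1) * (\<Sum>P\<in>verts \<sigma>. ?\<phi> P * ?\<phi> P)" for \<sigma>
  by (simp add: sum_nonneg)
 ultimately have "area \<rho> / real (k + 1) * (\<Sum>P\<in>verts \<rho>. ?\<phi> P * ?\<phi> P) = 0"
  using sum_nonneg_eq_0_iff[OF finite_faces(2), of "\<lambda>\<sigma>. area \<sigma> / real (k + 1) * (\<Sum>P\<in>verts \<sigma>. ?\<phi> P * ?\<phi> P)"] \<rho>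
  by blast
 then have "(\<Sum>P\<in>verts \<rho>. ?\<phi> P * ?\<phi> P) = 0" using face_measure_pos[OF solid_boundary[OF \<rho>]] by simp
 then have z: "?\<phi> P = 0" if "P \<in> verts \<rho>" for P
  using sum_nonneg_eq_0_iff[OF boundary_face_simplex(4)[OF solid_boundary[OF \<rho>]], of "\<lambda>P. ?\<phi> P * ?\<phi> P"] that by simp
 note hull = boundary_face_simplex(3)[OF solid_boundary[OF \<rho>]]
 show ?thesis
  by (rule P1_on_hull_eq[of "verts \<rho>" ?\<phi>]) (use p1[OF \<rho>] z x hull in auto)
qed

text \<open>The motion of a cell at the substrate maps the plane of the substrate onto itself.\<close>

lemma solid_motion:
 assumes \<rho>: "\<rho> \<in> solid_faces M" and \<theta>: "\<theta> \<in> {0..1}"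
 shows "nrm_s p \<bullet> h = 0 \<Longrightarrow> nrm_s p \<bullet> (h + (tau p * \<theta>) *\<^sub>R grad_w \<rho> h) = 0"
  and "nrm_s p \<bullet> v = 0 \<Longrightarrow> \<exists>h. nrm_s p \<bullet> h = 0 \<and> v = h + (tau p * \<theta>) *\<^sub>R grad_w \<rho> h"
proof -
 note \<rho>' = solid_boundary[OF \<rho>]
 let ?n = "nrm_s p"
 have n: "nrm \<rho> = ?n" by (rule solid_normal[OF \<rho>])
 obtain x where x: "x \<in> \<rho>" using face_nonempty[OF \<rho>'] verts_in_face[OF \<rho>'] by blast
 define B where "B = grad_w \<rho>"
 have B: "linear B" unfolding B_def by (rule linear_dw[OF cell_of(1)[OF \<rho>']])
 have Bt: "?n \<bullet> B h = 0" if h: "?n \<bullet> h = 0" for h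
 proof -
  have "h \<in> span ((\<lambda>y. y - x) ` \<rho>)" by (rule face_motion(4)[OF \<rho>' x]) (simp add: n h)
  moreover have "subspace {h. ?n \<bullet> B h = 0}"
   using B by (auto simp: subspace_def linear_add linear_scale linear_0 inner_add_right)
  moreover have "(\<lambda>y. y - x) ` \<rho> \<subseteq> {h. ?n \<bullet> B h = 0}"
  proof clarify
   fix y assume y: "y \<in> \<rho>"
   have "B (y - x) = w y - w x"
    unfolding B_def using y x face_in_cell[OF \<rho>'] by (intro dw_diff[OF cell_of(1)[OF \<rho>']]) auto
   then show "?n \<bullet> B (y - x) = 0"
    using solid_tangential[OF \<rho> y] solid_tangential[OF \<rho> x] by (simp add: inner_diff_right inner_commute)
  qed
  ultimately have "h \<in> {h. ?n \<bullet> B h = 0}" using span_minimal by blast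
  then show ?thesis by simp
 qed
 define D where "D h = h + (tau p * \<theta>) *\<^sub>R B h" for h
 have D: "linear D" unfolding D_def by (rule linear_motion[OF B])
 have "det (matrix D) \<noteq> 0" using det_dw_pos[OF cell_of(1)[OF \<rho>'] \<theta>] by (simp add: D_def[abs_def] B_def)
 then have "inj D" using det_nz_iff_inj[OF D] by simp
 then have surj: "surj D" using linear_injective_imp_surjective[OF D] by simp
 have nn: "?n \<bullet> ?n = 1" using nrm_s_unit by (simp add: norm_eq_1)
 have Dt: "?n \<bullet> D v = 0" if "?n \<bullet> v = 0" for v using that Bt by (simp add: D_def inner_add_right)
 then show "?n \<bullet> (h + (tau p * \<theta>) *\<^sub>R grad_w \<rho> h) = 0" if "?n \<bullet> h = 0" using that by (simp add: D_def B_def)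
 have split: "?n \<bullet> D v = (?n \<bullet> v) * (?n \<bullet> D ?n)" for v
 proof -
  have "?n \<bullet> D (v - (?n \<bullet> v) *\<^sub>R ?n) = 0" by (rule Dt) (simp add: inner_diff_right nn)
  then show ?thesis by (simp add: linear_diff[OF D] linear_scale[OF D] inner_diff_right)
 qed
 have nD: "?n \<bullet> D ?n \<noteq> 0"
 proof
  assume 0: "?n \<bullet> D ?n = 0"
  obtain v where "?n = D v" using surj by (metis surjD)
  then show False using split[of v] nn 0 by simp
 qed
 assume v: "?n \<bullet> v = 0"
 obtain h where h: "v = D h" using surj by (metis surjD)
 then have "?n \<bullet> h = 0" using split[of h] v nD by simp
 then show "\<exists>h. ?n \<bullet> h = 0 \<and> v = h + (tau p * \<theta>) *\<^sub>R grad_w \<rho> h" using h by (auto simp: D_def B_def)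
qed

lemma cof_solid_tangent:
 assumes \<rho>: "\<rho> \<in> solid_faces M" and \<theta>: "\<theta> \<in> {0..1}" and v: "nrm_s p \<bullet> v = 0"
 shows "cof (\<lambda>h. h + (tau p * \<theta>) *\<^sub>R grad_w \<rho> h) (nrm_s p) \<bullet> v = 0"
proof -
 obtain h where h: "nrm_s p \<bullet> h = 0" "v = h + (tau p * \<theta>) *\<^sub>R grad_w \<rho> h" using solid_motion(2)[OF \<rho> \<theta> v] by blast
 have "linear (\<lambda>h. h + (tau p * \<theta>) *\<^sub>R grad_w \<rho> h)"
  by (rule linear_motion[OF linear_dw[OF cell_of(1)[OF solid_boundary[OF \<rho>]]]])
 from cof_det[OF nrm_s_unit this, of h] show ?thesis unfolding h(2) by (simp add: h(1))
qed

text \<open>A motion within the plane of the substrate sweeps no volume through it.\<close>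

lemma swept_solid:
 assumes \<rho>: "\<rho> \<in> solid_faces M" and x: "x \<in> \<rho>"
 shows "swept f (tau p) w \<rho> (nrm \<rho>) x \<bullet> w x = 0"
proof -
 let ?n = "nrm \<rho>"
 have n: "?n = nrm_s p" by (rule solid_normal[OF \<rho>])
 have wn: "nrm_s p \<bullet> w x = 0" using solid_tangential[OF \<rho> x] by (simp add: inner_commute)
 have z: "cof (move_deriv w (tau p * \<theta>) \<rho> x) ?n \<bullet> w x = 0" if "\<theta> \<in> {0..1}" for \<theta>
  unfolding face_motion(1)[OF solid_boundary[OF \<rho>] x] unfolding n by (rule cof_solid_tangent[OF \<rho> that wn])
 let ?F = "\<lambda>\<theta>. f (x + (tau p * \<theta>) *\<^sub>R w x) *\<^sub>R cof (move_deriv w (tau p * \<theta>) \<rho> x) ?n"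
 show ?thesis
 proof (cases "?F integrable_on {0..1}")
  case True
  then have "(?F has_integral integral {0..1} ?F) {0..1}" by (rule integrable_integral)
  from has_integral_linear[OF this bounded_linear_inner_left[of "w x"]]
  have "((\<lambda>\<theta>. ?F \<theta> \<bullet> w x) has_integral integral {0..1} ?F \<bullet> w x) {0..1}" by (simp add: o_def)
  moreover have "((\<lambda>\<theta>. ?F \<theta> \<bullet> w x) has_integral 0) {0..1}"
   by (rule has_integral_is_0) (simp add: z)
  ultimately have "integral {0..1} ?F \<bullet> w x = 0" by (rule has_integral_unique)
  then show ?thesis by (simp add: swept_def)
 next
  case False
  then show ?thesis by (simp add: swept_def not_integrable_integral)
 qed
qed

lemma swept_cong_free:
 assumes \<sigma>: "\<sigma> \<in> free_faces M" and x: "x \<in> \<sigma>"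
 shows "swept f r w \<sigma> n x = swept f r wt \<sigma> n x"
proof -
 note w = w_free_face[OF \<sigma>]
 have "move_deriv w s \<sigma> x = move_deriv wt s \<sigma> x" for s
  by (rule frechet_derivative_cong_on[OF x]) (simp add: w)
 then show ?thesis unfolding swept_def w[OF x] by simp
qed

lemma integral_domain':
 fixes f :: "real^'n \<Rightarrow> real"
 assumes f: "continuous_on UNIV f"
 shows "(LINT x:domain M'|lborel. f x) = (\<Sum>T\<in>cells M. LINT x:\<psi> ` T|lborel. f x)"
proof -
 have inj: "inj_on \<psi> (domain M)" using nondeg unfolding nondegenerate_def by (metis atLeastAtMost_iff mult_1 zero_le_one order_refl)
 have "inj_on ((`) \<psi>) (cells M)"
 proof (rule inj_onI)
  fix S T assume "S \<in> cells M" "T \<in> cells M" "\<psi> ` S = \<psi> ` T"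
  then show "S = T" using inj_on_image_eq_iff[OF inj, of S T] by (auto simp: domain_def)
 qed
 then have "(\<Sum>T\<in>cells M'. LINT x:T|lborel. f x) = (\<Sum>T\<in>cells M. LINT x:\<psi> ` T|lborel. f x)"
  by (simp add: map_mesh_def sum.reindex)
 then show ?thesis
  using cell_complex.integral_cells[OF complex' continuous_on_subset[OF f subset_UNIV]] by (simp add: domain_def)
qed

text \<open>Only the free surface contributes to the change of the moment of an affine density.\<close>

lemma transport_free:
 shows "(LINT x:domain M'|lborel. a + \<beta> \<bullet> x) - (LINT x:domain M|lborel. a + \<beta> \<bullet> x)
  = tau p * surf_int k (free_faces M)
    (\<lambda>\<sigma> x. sweep a \<beta> (tau p) wt \<sigma> (face_nrm M \<sigma>) x)"
proof -
 let ?s = "\<lambda>\<sigma> x. sweep a \<beta> (tau p) w \<sigma> (nrm \<sigma>) x"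
 have cont: "continuous_on S (\<lambda>x. a + \<beta> \<bullet> x)" for S by (intro continuous_intros)
 have "(LINT x:domain M'|lborel. a + \<beta> \<bullet> x) - (LINT x:domain M|lborel. a + \<beta> \<bullet> x)
  = tau p * (\<Sum>\<sigma>\<in>bdry. LINT x:\<sigma>|hausdorff k. ?s \<sigma> x)"
  using transport_complex[OF complex w_P1 det_pos, of a \<beta>] integral_domain'[OF cont] integral_cells[OF cont]
  by (simp add: domain_def)
 also have "(\<Sum>\<sigma>\<in>bdry. LINT x:\<sigma>|hausdorff k. ?s \<sigma> x) = (\<Sum>\<sigma>\<in>free_faces M. LINT x:\<sigma>|hausdorff k. ?s \<sigma> x)"
 proof -
  have "(LINT x:\<sigma>|hausdorff k. ?s \<sigma> x) = 0" if "\<sigma> \<in> solid_faces M" for \<sigma>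
  proof -
   have "(LINT x:\<sigma>|hausdorff k. ?s \<sigma> x) = (LINT x:\<sigma>|hausdorff k. 0)"
    using face_sets[OF solid_boundary[OF that]] swept_solid[OF that] by (intro set_lebesgue_integral_cong) auto
   then show ?thesis by simp
  qed
  then show ?thesis unfolding sum_boundary by simp
 qed
 also have "\<dots> = surf_int k (free_faces M) (\<lambda>\<sigma> x. sweep a \<beta> (tau p) wt \<sigma> (face_nrm M \<sigma>) x)"
  unfolding surf_int_def
 proof (rule sum.cong[OF refl], rule set_lebesgue_integral_cong)
  fix \<sigma> assume \<sigma>: "\<sigma> \<in> free_faces M"
  show "\<sigma> \<in> sets (hausdorff k)" by (rule face_sets[OF free_boundary[OF \<sigma>]])
  show "\<forall>x. x \<in> \<sigma> \<longrightarrow> ?s \<sigma> x = sweep a \<beta> (tau p) wt \<sigma> (face_nrm M \<sigma>) x"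
  proof (intro allI impI)
   fix x assume x: "x \<in> \<sigma>"
   then have "w x = wt x" by (rule w_free_face[OF \<sigma>])
   then show "?s \<sigma> x = sweep a \<beta> (tau p) wt \<sigma> (face_nrm M \<sigma>) x"
    unfolding swept_cong_free[OF \<sigma> x] face_nrm_def by simp
  qed
 qed
 finally show ?thesis .
qed

end

section \<open>Growth of the free surface\<close>

lemma matrix_inner:
 fixes L L' :: "real^'n \<Rightarrow> real^'m"
 shows "matrix L \<bullet> matrix L' = (\<Sum>j\<in>UNIV. L (axis j 1) \<bullet> L' (axis j 1))"
proof -
 have "matrix L \<bullet> matrix L' = (\<Sum>i\<in>UNIV. \<Sum>j\<in>UNIV. L (axis j 1) $ i * L' (axis j 1) $ i)"
  by (simp add: inner_vec_def matrix_def)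
 also have "\<dots> = (\<Sum>j\<in>UNIV. \<Sum>i\<in>UNIV. L (axis j 1) $ i * L' (axis j 1) $ i)" by (rule sum.swap)
 finally show ?thesis by (simp add: inner_vec_def)
qed

lemma mean_bound:
 fixes a b c i :: real
 assumes "2 * (c - 1) \<le> a - i" "2 * b \<le> a + i" shows "c - 1 \<le> a - b"
 using assms by argo

lemma tangent2:
 fixes n h :: "real^2"
 assumes n: "norm n = 1"
 shows "tproj n h = (h \<bullet> - rot90 n) *\<^sub>R - rot90 n"
proof -
 have "n $ 1 * n $ 1 + n $ 2 * n $ 2 = 1" using n by (simp add: norm_eq_1 inner_vec_def sum_2)
 then have 1: "n $ 1 * n $ 1 = 1 - n $ 2 * n $ 2" by simp
 have "h $ 1 - (h $ 1 * n $ 1 + h $ 2 * n $ 2) * n $ 1 = (h $ 1 * n $ 2 - h $ 2 * n $ 1) * n $ 2"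
  using arg_cong[OF 1, of "\<lambda>s. h $ 1 * s"] by (simp add: algebra_simps)
 moreover have "h $ 2 - (h $ 1 * n $ 1 + h $ 2 * n $ 2) * n $ 2 = - ((h $ 1 * n $ 2 - h $ 2 * n $ 1) * n $ 1)"
  using arg_cong[OF 1, of "\<lambda>s. h $ 2 * s"] by (simp add: algebra_simps)
 ultimately show ?thesis
  by (simp add: tproj_def vec_eq_iff forall_2 inner_vec_def sum_2)
qed

lemma face_area_2: "face_area cof2 1"
proof (intro face_area.intro face_geometry_2 face_area_axioms.intro)
 fix D :: "real^2 \<Rightarrow> real^2" and n :: "real^2" assume n: "norm n = 1" and D: "linear D"
 let ?t = "- rot90 n"
 have t1: "?t \<bullet> ?t = 1" using n by (simp add: inner_rot90 norm_eq_1)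
 have *: "matrix (\<lambda>h. L (tproj n h)) \<bullet> matrix (\<lambda>h. L (tproj n h)) = (norm (L ?t))\<^sup>2" if L: "linear L" for L :: "real^2 \<Rightarrow> real^2"
 proof -
  have "L (tproj n h) = (h \<bullet> ?t) *\<^sub>R L ?t" for h unfolding tangent2[OF n] by (rule linear_scale[OF L])
  then have "matrix (\<lambda>h. L (tproj n h)) \<bullet> matrix (\<lambda>h. L (tproj n h)) = (\<Sum>j\<in>UNIV. (?t $ j)\<^sup>2 * (L ?t \<bullet> L ?t))"
   unfolding matrix_inner by (simp add: inner_axis' power2_eq_square mult.assoc)
  also have "\<dots> = (?t \<bullet> ?t) * (L ?t \<bullet> L ?t)"
   unfolding sum_distrib_right[symmetric] inner_vec_def[of ?t ?t] by (simp add: power2_eq_square)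
  finally show ?thesis using t1 by (simp add: power2_norm_eq_inner)
 qed
 have t: "norm ?t = 1" using t1 by (simp add: norm_eq_1)
 have "norm (cof2 D n) = norm (D ?t)" by (simp add: cof2_def inner_rot90)
 moreover have "0 \<le> (norm (D ?t) - 1)\<^sup>2" by simp
 ultimately show "2 * (norm (cof2 D n) - 1) \<le>
   matrix (\<lambda>h. D (tproj n h)) \<bullet> matrix (\<lambda>h. D (tproj n h)) - matrix (tproj n) \<bullet> matrix (tproj n)"
  unfolding *[OF D] using *[OF linear_id] t by (simp add: power2_diff)
next
 fix V :: "(real^2) set" and D :: "real^2 \<Rightarrow> real^2" and b n :: "real^2"
 assume card: "card V = Suc 1" and D: "linear D" "inj D" and n: "norm n = 1"
  and V: "\<And>x y. x \<in> V \<Longrightarrow> y \<in> V \<Longrightarrow> n \<bullet> (y - x) = 0"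
 obtain P Q where PQ: "V = {P, Q}" "P \<noteq> Q" using card by (auto simp: card_2_iff numeral_2_eq_2[symmetric])
 have ne: "D P + b \<noteq> D Q + b" using D(2) PQ(2) by (auto dest: injD)
 have "tproj n (Q - P) = Q - P" using V[of P Q] PQ by (simp add: tproj_def inner_commute)
 then have e: "Q - P = ((Q - P) \<bullet> - rot90 n) *\<^sub>R - rot90 n" unfolding tangent2[OF n] by simp
 define c where "c = (Q - P) \<bullet> - rot90 n"
 have QP: "Q - P = c *\<^sub>R - rot90 n" unfolding c_def by (rule e)
 have "dist (D P + b) (D Q + b) = norm (D (Q - P))" by (simp add: dist_norm norm_minus_commute linear_diff[OF D(1)])
 also have "\<dots> = \<bar>c\<bar> * norm (D (- rot90 n))" unfolding QP linear_scale[OF D(1)] by simp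
 also have "\<bar>c\<bar> = dist P Q"
  using arg_cong[OF QP, of norm] n by (simp add: dist_norm norm_minus_commute inner_rot90)
 finally show "measure (hausdorff 1) (convex hull ((\<lambda>x. D x + b) ` V)) = measure (hausdorff 1) (convex hull V) * norm (cof2 D n)"
  using hausdorff_segment(1)[OF PQ(2)] hausdorff_segment(1)[OF ne] PQ(1)
  by (simp add: segment_convex_hull cof2_def inner_rot90)
qed

lemma face_area_3: "face_area cof3 2"
proof (intro face_area.intro face_geometry_3 face_area_axioms.intro)
 fix D :: "real^3 \<Rightarrow> real^3" and n :: "real^3" assume n: "norm n = 1" and D: "linear D"
 obtain t1 t2 where t: "norm t1 = 1" "norm t2 = 1" "t1 \<bullet> t2 = 0" "cross3 t1 t2 = n"
  and c: "\<And>D. cof3 D n = cross3 (D t1) (D t2)" using cof3_tangents[OF n] by blast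
 have *: "matrix (\<lambda>h. L (tproj n h)) \<bullet> matrix (\<lambda>h. L (tproj n h)) = (norm (L t1))\<^sup>2 + (norm (L t2))\<^sup>2"
  if L: "linear L" for L :: "real^3 \<Rightarrow> real^3"
 proof -
  have "tproj n h = (h \<bullet> t1) *\<^sub>R t1 + (h \<bullet> t2) *\<^sub>R t2" for h
   using tangent_expansion(1)[OF t, of h] unfolding tproj_def by (metis add_diff_cancel_right')
  then have "L (tproj n h) = (h \<bullet> t1) *\<^sub>R L t1 + (h \<bullet> t2) *\<^sub>R L t2" for h
   by (simp add: linear_add[OF L] linear_scale[OF L])
  then have "matrix (\<lambda>h. L (tproj n h)) \<bullet> matrix (\<lambda>h. L (tproj n h))
   = (\<Sum>j\<in>UNIV. (t1 $ j * t1 $ j) * (L t1 \<bullet> L t1) + (t2 $ j * t2 $ j) * (L t2 \<bullet> L t2) + 2 * (t1 $ j * t2 $ j) * (L t1 \<bullet> L t2))"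
   unfolding matrix_inner by (simp add: inner_axis' inner_add_left inner_add_right inner_commute[of "L t2" "L t1"] algebra_simps)
  also have "\<dots> = (t1 \<bullet> t1) * (L t1 \<bullet> L t1) + (t2 \<bullet> t2) * (L t2 \<bullet> L t2) + 2 * (t1 \<bullet> t2) * (L t1 \<bullet> L t2)"
   by (simp add: sum.distrib inner_vec_def[of t1] inner_vec_def[of t2] sum_distrib_left sum_distrib_right)
  finally show ?thesis using t by (simp add: norm_eq_1 power2_norm_eq_inner)
 qed
 have "(norm (cross3 (D t1) (D t2)))\<^sup>2 \<le> (norm (D t1) * norm (D t2))\<^sup>2" using norm_cross_dot[of "D t1" "D t2"] zero_le_power2[of "D t1 \<bullet> D t2"] by linarith
 then have "norm (cof3 D n) \<le> norm (D t1) * norm (D t2)" unfolding c by (rule power2_le_imp_le) simp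
 moreover have "0 \<le> (norm (D t1) - norm (D t2))\<^sup>2" by simp
 ultimately show "2 * (norm (cof3 D n) - 1) \<le>
   matrix (\<lambda>h. D (tproj n h)) \<bullet> matrix (\<lambda>h. D (tproj n h)) - matrix (tproj n) \<bullet> matrix (tproj n)"
  unfolding *[OF D] using *[OF linear_id] t by (simp add: power2_diff)
next
 fix V :: "(real^3) set" and D :: "real^3 \<Rightarrow> real^3" and b n :: "real^3"
 assume ind: "\<not> affine_dependent V" and card: "card V = Suc 2" and D: "linear D" "inj D" and n: "norm n = 1"
  and V: "\<And>x y. x \<in> V \<Longrightarrow> y \<in> V \<Longrightarrow> n \<bullet> (y - x) = 0"
 have "card V = 3" using card by simp
 then obtain P Q R where PQR: "V = {P, Q, R}" "P \<noteq> Q" "P \<noteq> R" "Q \<noteq> R" by (auto simp: card_3_iff)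
 have i: "s = 0 \<and> t = 0" if "s *\<^sub>R (Q - P) + t *\<^sub>R (R - P) = 0" for s t
  by (rule affine_independent3[OF _ PQR(2-4) that]) (use ind PQR(1) in simp)
 have i': "s = 0 \<and> t = 0" if "s *\<^sub>R ((D Q + b) - (D P + b)) + t *\<^sub>R ((D R + b) - (D P + b)) = 0" for s t
 proof (rule i)
  have "D (s *\<^sub>R (Q - P) + t *\<^sub>R (R - P)) = 0"
   using that by (simp add: linear_add[OF D(1)] linear_scale[OF D(1)] linear_diff[OF D(1)])
  then show "s *\<^sub>R (Q - P) + t *\<^sub>R (R - P) = 0"
   using D linear_injective_0[OF D(1)] by blast
 qed
 have s: "n \<bullet> (Q - P) = 0" "n \<bullet> (R - P) = 0" using V[of P Q] V[of P R] PQR(1) by auto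
 let ?c = "cross3 (Q - P) (R - P)"
 obtain t1 t2 where t: "cross3 t1 t2 = n" and c: "\<And>D. cof3 D n = cross3 (D t1) (D t2)" using cof3_tangents[OF n] by blast
 have id: "?c = (n \<bullet> ?c) *\<^sub>R n" using cof3_eq[OF n linear_id s] unfolding c by (simp add: t)
 have "norm ?c = \<bar>n \<bullet> ?c\<bar>" using arg_cong[OF id, of norm] n by simp
 moreover have "norm (cross3 (D (Q - P)) (D (R - P))) = \<bar>n \<bullet> ?c\<bar> * norm (cof3 D n)"
  unfolding cof3_eq[OF n D(1) s] by simp
 ultimately have m: "measure (hausdorff 2) (convex hull {P, Q, R}) = \<bar>n \<bullet> ?c\<bar> / 2"
   "measure (hausdorff 2) (convex hull {D P + b, D Q + b, D R + b}) = \<bar>n \<bullet> ?c\<bar> * norm (cof3 D n) / 2"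
  using hausdorff_triangle(1)[of Q P R, OF i] hausdorff_triangle(1)[of "D Q + b" "D P + b" "D R + b", OF i']
  by (simp_all add: gram_cross3 linear_diff[OF D(1)])
 show "measure (hausdorff 2) (convex hull ((\<lambda>x. D x + b) ` V)) = measure (hausdorff 2) (convex hull V) * norm (cof3 D n)"
  unfolding PQR(1) image_insert image_empty m by simp
qed

context mesh_step
begin

lemma face_integral_const:
 assumes \<sigma>: "\<sigma> \<in> bdry"
 shows "(LINT x:\<sigma>|hausdorff k. c) = area \<sigma> * c"
 using face_integral_P1[OF \<sigma> P1_on_const, of c] boundary_face_simplex(2)[OF \<sigma>] k_eq(2) by simp

lemma inj_psi: "inj_on \<psi> (domain M)"
proof -
 have "inj_on (\<lambda>x. x + (1 * tau p) *\<^sub>R w x) (domain M)" using nondeg unfolding nondegenerate_def by (metis atLeastAtMost_iff zero_le_one order_refl)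
 then show ?thesis by simp
qed

lemma inj_psi_faces: "inj_on ((`) \<psi>) (bdry)"
proof (rule inj_onI)
 fix S T assume "S \<in> bdry" "T \<in> bdry" "\<psi> ` S = \<psi> ` T"
 then show "S = T" using inj_on_image_eq_iff[OF inj_psi, of S T] face_in_cell cell_of(1) unfolding domain_def by blast
qed

text \<open>On a face the motion is the affine map with linear part \<open>motion \<sigma>\<close>.\<close>

definition motion :: "(real^'n) set \<Rightarrow> real^'n \<Rightarrow> real^'n" where
 "motion \<sigma> h = h + tau p *\<^sub>R grad_w \<sigma> h"

lemma motion:
 assumes \<sigma>: "\<sigma> \<in> bdry"
 shows linear_motion_face: "linear (motion \<sigma>)" and det_motion_pos: "0 < det (matrix (motion \<sigma>))"
  and inj_motion: "inj (motion \<sigma>)"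
  and psi_affine: "\<exists>c. \<forall>x\<in>cell_of \<sigma>. \<psi> x = motion \<sigma> x + c"
proof -
 note K = cell_of(1)[OF \<sigma>]
 show l: "linear (motion \<sigma>)" unfolding motion_def[abs_def] by (rule linear_motion[OF linear_dw[OF K]])
 show d: "0 < det (matrix (motion \<sigma>))" using det_dw_pos[OF K, of 1] unfolding motion_def[abs_def] by simp
 show "inj (motion \<sigma>)" using det_nz_iff_inj[OF l] d by simp
 obtain b where b: "\<And>x. x \<in> cell_of \<sigma> \<Longrightarrow> w x = grad_w \<sigma> x + b" using w_affine[OF K] by blast
 have "\<psi> x = motion \<sigma> x + tau p *\<^sub>R b" if "x \<in> cell_of \<sigma>" for x
  unfolding motion_def b[OF that] by (simp add: scaleR_add_right)
 then show "\<exists>c. \<forall>x\<in>cell_of \<sigma>. \<psi> x = motion \<sigma> x + c" by blast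
qed

lemma psi_face_hull:
 assumes \<sigma>: "\<sigma> \<in> bdry"
 shows "\<psi> ` \<sigma> = convex hull (\<psi> ` verts \<sigma>)"
proof -
 obtain c where c: "\<And>x. x \<in> cell_of \<sigma> \<Longrightarrow> \<psi> x = motion \<sigma> x + c" using psi_affine[OF \<sigma>] by blast
 have "\<psi> ` \<sigma> = (\<lambda>x. motion \<sigma> x + c) ` \<sigma>" using c face_in_cell[OF \<sigma>] by (intro image_cong) auto
 also have "\<dots> = (\<lambda>x. c + x) ` motion \<sigma> ` (convex hull (verts \<sigma>))"
  unfolding boundary_face_simplex(3)[OF \<sigma>] by (simp add: image_image add.commute)
 also have "\<dots> = convex hull ((\<lambda>x. c + x) ` motion \<sigma> ` verts \<sigma>)"
  by (simp only: convex_hull_linear_image[OF linear_motion_face[OF \<sigma>]] convex_hull_translation)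
 also have "(\<lambda>x. c + x) ` motion \<sigma> ` verts \<sigma> = \<psi> ` verts \<sigma>"
  unfolding image_image
 proof (rule image_cong[OF refl])
  fix x assume "x \<in> verts \<sigma>"
  then have "x \<in> cell_of \<sigma>" using face_in_cell[OF \<sigma>] verts_in_face[OF \<sigma>] by blast
  then show "c + motion \<sigma> x = \<psi> x" unfolding add.commute[of c] by (rule c[symmetric])
 qed
 finally show ?thesis .
qed

lemma measure_psi_face:
 assumes \<sigma>: "\<sigma> \<in> bdry"
 shows "area (\<psi> ` \<sigma>) = area \<sigma> * norm (cof (motion \<sigma>) (nrm \<sigma>))"
proof -
 obtain c where c: "\<And>x. x \<in> cell_of \<sigma> \<Longrightarrow> \<psi> x = motion \<sigma> x + c" using psi_affine[OF \<sigma>] by blast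
 have "\<psi> ` verts \<sigma> = (\<lambda>x. motion \<sigma> x + c) ` verts \<sigma>"
  using c face_in_cell[OF \<sigma>] verts_in_face[OF \<sigma>] by (intro image_cong) auto
 moreover have "area (convex hull ((\<lambda>x. motion \<sigma> x + c) ` verts \<sigma>))
  = area (convex hull (verts \<sigma>)) * norm (cof (motion \<sigma>) (nrm \<sigma>))"
  using boundary_face_simplex(2)[OF \<sigma>] k_eq(2)
  by (intro cof_image boundary_face_simplex(1)[OF \<sigma>] linear_motion_face[OF \<sigma>] inj_motion[OF \<sigma>] face_nrm_unit[OF \<sigma>]
    face_nrm_orthogonal[OF \<sigma>] verts_in_face[OF \<sigma>]) simp_all
 ultimately show ?thesis unfolding psi_face_hull[OF \<sigma>] boundary_face_simplex(3)[OF \<sigma>] by simp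
qed

lemma measure_faces:
 assumes "F \<subseteq> bdry" "(`) \<psi> ` F \<subseteq> boundary_faces (cells M')"
 shows "area (\<Union>((`) \<psi> ` F)) - area (\<Union>F)
  = (\<Sum>\<sigma>\<in>F. area (\<psi> ` \<sigma>) - area \<sigma>)"
proof -
 have "area (\<Union>((`) \<psi> ` F)) = (\<Sum>\<sigma>\<in>(`) \<psi> ` F. area \<sigma>)"
  by (rule cell_complex.measure_Union_boundary_faces[OF complex' assms(2) k_eq(2) k12])
 also have "\<dots> = (\<Sum>\<sigma>\<in>F. area (\<psi> ` \<sigma>))"
  by (simp add: sum.reindex[OF inj_on_subset[OF inj_psi_faces assms(1)]])
 finally show ?thesis
  using measure_Union_boundary_faces[OF assms(1) k_eq(2) k12] by (simp add: sum_subtractf)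
qed

lemma faces': "(`) \<psi> ` free_faces M \<subseteq> boundary_faces (cells M')" "(`) \<psi> ` solid_faces M \<subseteq> boundary_faces (cells M')"
 "\<rho> \<in> solid_faces M \<Longrightarrow> outward_normal (cells M') (\<psi> ` \<rho>) = nrm_s p"
 using valid' unfolding valid_mesh_def by (auto simp: map_mesh_def)

text \<open>With \<open>A = I + tau p *\<^sub>R G\<close> the stiffness is \<open>A \<bullet> A - A \<bullet> I\<close>, which is at least half of
\<open>A \<bullet> A - I \<bullet> I\<close> and hence at least the relative growth of area.\<close>

lemma free_area_growth:
 "area (free_surface M') - area (free_surface M) \<le> tau p * surface_stiffness p M wt wt"
proof -
 have "area (\<psi> ` \<sigma>) - area \<sigma> \<le> tau p * (LINT x:\<sigma>|hausdorff k.
   sgrad \<sigma> (face_nrm M \<sigma>) (\<lambda>y. y + tau p *\<^sub>R wt y) x \<bullet> sgrad \<sigma> (face_nrm M \<sigma>) wt x)" if \<sigma>: "\<sigma> \<in> free_faces M" for \<sigma>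
 proof -
  note \<sigma>' = free_boundary[OF \<sigma>]
  let ?n = "nrm \<sigma>"
  have n: "norm ?n = 1" by (rule face_nrm_unit[OF \<sigma>'])
  have tang: "?n \<bullet> tproj ?n h = 0" for h using n by (simp add: tproj_def inner_diff_right norm_eq_1 inner_commute[of h])
  note w = w_free_face[OF \<sigma>]
  define A where "A = matrix (\<lambda>h. motion \<sigma> (tproj ?n h))"
  define G where "G = matrix (\<lambda>h. grad_w \<sigma> (tproj ?n h))"
  define I where "I = matrix (tproj ?n)"
  have AIG: "A = I + tau p *\<^sub>R G" by (simp add: A_def I_def G_def motion_def matrix_def vec_eq_iff)
  have g: "sgrad \<sigma> (face_nrm M \<sigma>) (\<lambda>y. y + tau p *\<^sub>R wt y) x \<bullet> sgrad \<sigma> (face_nrm M \<sigma>) wt x = A \<bullet> G" if x: "x \<in> \<sigma>" for x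
  proof -
   have 1: "move_deriv wt (tau p) \<sigma> x = move_deriv w (tau p) \<sigma> x"
    by (rule frechet_derivative_cong_on[OF x]) (simp add: w)
   have 2: "frechet_derivative wt (at x within \<sigma>) = frechet_derivative w (at x within \<sigma>)"
    by (rule frechet_derivative_cong_on[OF x]) (simp add: w)
   show ?thesis unfolding sgrad_def face_nrm_def 1 2 face_motion(3)[OF \<sigma>' x tang] face_motion(2)[OF \<sigma>' x tang] A_def G_def motion_def ..
  qed
  have "(LINT x:\<sigma>|hausdorff k. sgrad \<sigma> (face_nrm M \<sigma>) (\<lambda>y. y + tau p *\<^sub>R wt y) x \<bullet> sgrad \<sigma> (face_nrm M \<sigma>) wt x)
   = (LINT x:\<sigma>|hausdorff k. A \<bullet> G)"
   using face_sets[OF \<sigma>'] g by (intro set_lebesgue_integral_cong) auto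
  also have "\<dots> = area \<sigma> * (A \<bullet> G)" by (rule face_integral_const[OF \<sigma>'])
  finally have S: "tau p * (LINT x:\<sigma>|hausdorff k. sgrad \<sigma> (face_nrm M \<sigma>) (\<lambda>y. y + tau p *\<^sub>R wt y) x \<bullet> sgrad \<sigma> (face_nrm M \<sigma>) wt x)
   = area \<sigma> * (A \<bullet> A - A \<bullet> I)" by (simp add: AIG inner_add_right algebra_simps)
  have "2 * (norm (cof (motion \<sigma>) ?n) - 1) \<le> A \<bullet> A - I \<bullet> I"
   unfolding A_def I_def by (rule cof_norm[OF n linear_motion_face[OF \<sigma>']])
  moreover have "0 \<le> (A - I) \<bullet> (A - I)" by (rule inner_ge_zero)
  then have "2 * (A \<bullet> I) \<le> A \<bullet> A + I \<bullet> I" by (simp add: inner_diff_left inner_diff_right inner_commute[of I A])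
  ultimately have "norm (cof (motion \<sigma>) ?n) - 1 \<le> A \<bullet> A - A \<bullet> I" by (rule mean_bound)
  then have "area \<sigma> * (norm (cof (motion \<sigma>) ?n) - 1) \<le> area \<sigma> * (A \<bullet> A - A \<bullet> I)"
   by (rule mult_left_mono) simp
  then show ?thesis unfolding S measure_psi_face[OF \<sigma>'] by (simp add: algebra_simps)
 qed
 then have "(\<Sum>\<sigma>\<in>free_faces M. area (\<psi> ` \<sigma>) - area \<sigma>) \<le> tau p * surface_stiffness p M wt wt"
  unfolding surface_stiffness_def surf_int_def k_eq(1) sum_distrib_left by (rule sum_mono)
 moreover have "free_faces M \<subseteq> bdry" using free_boundary by blast
 from measure_faces[OF this faces'(1)]
 have "area (free_surface M') - area (free_surface M)
  = (\<Sum>\<sigma>\<in>free_faces M. area (\<psi> ` \<sigma>) - area \<sigma>)"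
  by (simp add: free_surface_def map_mesh_def)
 ultimately show ?thesis by simp
qed

end

section \<open>Volume conservation and energy balance\<close>

lemma finite_nodes2: "finite (verts \<sigma>) \<Longrightarrow> finite (nodes2 \<sigma>)"
proof -
 assume "finite (verts \<sigma>)"
 moreover have "nodes2 \<sigma> = (\<lambda>(P, Q). midpoint P Q) ` (verts \<sigma> \<times> verts \<sigma>)" by (auto simp: nodes2_def)
 ultimately show ?thesis by simp
qed

lemma nodes2_midpoint: "P \<in> verts \<sigma> \<Longrightarrow> Q \<in> verts \<sigma> \<Longrightarrow> (1/2) *\<^sub>R (P + Q) \<in> nodes2 \<sigma>"
 unfolding nodes2_def midpoint_def by (auto simp: inverse_eq_divide)

lemma set_integral_nonneg_on:
 fixes f :: "'a \<Rightarrow> real"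
 shows "(\<And>x. 0 \<le> f x) \<Longrightarrow> 0 \<le> (LINT x:A|M. f x)"
 unfolding set_lebesgue_integral_def by (rule Bochner_Integration.integral_nonneg) simp

lemma bulk_dissipation_nonneg:
 assumes "params_ok p" shows "0 \<le> bulk_dissipation p E m"
proof -
 have "0 \<le> strain_form M u u" for M u
  unfolding strain_form_def cell_sum_def by (intro sum_nonneg set_integral_nonneg_on inner_ge_zero)
 moreover have "0 \<le> surf_int k F (\<lambda>\<rho> x. (norm (f x))\<^sup>2)" for k F and f :: "real^'a \<Rightarrow> real^'a"
  unfolding surf_int_def by (intro sum_nonneg set_integral_nonneg_on) simp
 ultimately show ?thesis using assms unfolding bulk_dissipation_def params_ok_def
  by (intro add_nonneg_nonneg mult_nonneg_nonneg set_integral_nonneg_on divide_nonneg_nonneg) auto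
qed

text \<open>Polarization, the discrete counterpart of the time derivative of the kinetic energy.\<close>

lemma l2_polarization:
 fixes f g :: "'a::euclidean_space \<Rightarrow> 'b::euclidean_space"
 assumes S: "compact S" and f: "continuous_on S f" and g: "continuous_on S g"
 shows "2 * l2 S f g = l2 S g g + (LINT x:S|lborel. (norm (f x))\<^sup>2) - (LINT x:S|lborel. (norm (g x - f x))\<^sup>2)"
proof -
 have i: "set_integrable lborel S (\<lambda>x. h x \<bullet> h' x)" if "continuous_on S h" "continuous_on S h'" for h h' :: "'a \<Rightarrow> 'b"
  by (rule set_integrable_compact_lborel[OF S]) (intro continuous_intros that)
 have "(LINT x:S|lborel. (norm (g x - f x))\<^sup>2) = (LINT x:S|lborel. (g x \<bullet> g x + f x \<bullet> f x) - 2 * (f x \<bullet> g x))"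
  by (intro arg_cong[where f="set_lebesgue_integral lborel S"])
   (simp add: power2_norm_eq_inner inner_diff_left inner_diff_right inner_commute fun_eq_iff)
 also have "\<dots> = (LINT x:S|lborel. g x \<bullet> g x + f x \<bullet> f x) - (LINT x:S|lborel. 2 * (f x \<bullet> g x))"
  by (intro set_integral_diff set_integral_add set_integrable_mult_right i f g)
 also have "(LINT x:S|lborel. g x \<bullet> g x + f x \<bullet> f x) = (LINT x:S|lborel. g x \<bullet> g x) + (LINT x:S|lborel. f x \<bullet> f x)"
  by (intro set_integral_add i f g)
 also have "(LINT x:S|lborel. 2 * (f x \<bullet> g x)) = 2 * (LINT x:S|lborel. f x \<bullet> g x)" by simp
 finally show ?thesis by (simp add: l2_def power2_norm_eq_inner)
qed

context mesh_step
begin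

text \<open>Impermeability of the substrate holds at the nodes and hence, by the quadrature formula, in the mean.\<close>

lemma solid_flux:
 assumes u: "u \<in> velocity_space M"
  and lam: "\<And>ls. ls \<in> S2 (solid_faces M) \<Longrightarrow> lump2 k (solid_faces M) (\<lambda>x. (ls x *\<^sub>R nrm_s p) \<bullet> u x) = 0"
  and \<rho>: "\<rho> \<in> solid_faces M"
 shows "(LINT x:\<rho>|hausdorff k. u x \<bullet> nrm_s p) = 0"
proof -
 let ?\<phi> = "\<lambda>x. u x \<bullet> nrm_s p"
 have comp: "(\<lambda>x. u x $ i) \<in> S2 (cells M)" for i using S2v_component u unfolding velocity_space_def by blast
 have p2c: "P2_on T (\<lambda>x. u x $ i)" if "T \<in> cells M" for T i by (rule S2D(1)[OF comp that])
 have p2: "P2_on \<sigma> ?\<phi>" if \<sigma>: "\<sigma> \<in> solid_faces M" for \<sigma>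
  by (rule P2_on_inner) (rule P2_on_subset[OF p2c[OF cell_of(1)[OF solid_boundary[OF \<sigma>]]] face_in_cell[OF solid_boundary[OF \<sigma>]]])
 have sub: "\<Union>(solid_faces M) \<subseteq> domain M"
  using face_in_cell cell_of(1) solid_boundary unfolding domain_def by blast
 have "continuous_on (domain M) u"
  by (rule continuous_on_components) (use S2D(2)[OF comp] in \<open>simp add: domain_def\<close>)
 then have "?\<phi> \<in> S2 (solid_faces M)"
  unfolding S2_def using p2 continuous_on_subset[OF _ sub] by (auto intro!: continuous_intros)
 from lam[OF this] have "(\<Sum>\<sigma>\<in>solid_faces M. area \<sigma> / real ((k + 2) choose 2) * (\<Sum>P\<in>nodes2 \<sigma>. ?\<phi> P * ?\<phi> P)) = 0"
  by (simp add: lump2_def inner_commute)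
 moreover have "0 \<le> area \<sigma> / real ((k + 2) choose 2) * (\<Sum>P\<in>nodes2 \<sigma>. ?\<phi> P * ?\<phi> P)" for \<sigma>
  by (simp add: sum_nonneg)
 ultimately have "area \<rho> / real ((k + 2) choose 2) * (\<Sum>P\<in>nodes2 \<rho>. ?\<phi> P * ?\<phi> P) = 0"
  using sum_nonneg_eq_0_iff[OF finite_faces(2), of "\<lambda>\<sigma>. area \<sigma> / real ((k + 2) choose 2) * (\<Sum>P\<in>nodes2 \<sigma>. ?\<phi> P * ?\<phi> P)"] \<rho>
  by blast
 then have "(\<Sum>P\<in>nodes2 \<rho>. ?\<phi> P * ?\<phi> P) = 0" using face_measure_pos[OF solid_boundary[OF \<rho>]] k12 by (auto simp: choose_two)
 then have z: "?\<phi> P = 0" if "P \<in> nodes2 \<rho>" for P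
  using sum_nonneg_eq_0_iff[OF finite_nodes2[OF boundary_face_simplex(4)[OF solid_boundary[OF \<rho>]]], of "\<lambda>P. ?\<phi> P * ?\<phi> P"] that by simp
 have zv: "?\<phi> P = 0" if "P \<in> verts \<rho>" for P
 proof -
  have "(1/2) *\<^sub>R (P + P) = P" by (simp flip: scaleR_2)
  then show ?thesis using z[OF nodes2_midpoint[OF that that]] by simp
 qed
 have "quad_avg (verts \<rho>) ?\<phi> = 0"
  unfolding quad_avg_def using z[OF nodes2_midpoint] zv by simp
 then show ?thesis using face_integral[OF solid_boundary[OF \<rho>] p2[OF \<rho>]] by simp
qed

lemma free_flux:
 assumes u: "u \<in> velocity_space M"
  and lam: "\<And>ls. ls \<in> S2 (solid_faces M) \<Longrightarrow> lump2 k (solid_faces M) (\<lambda>x. (ls x *\<^sub>R nrm_s p) \<bullet> u x) = 0"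
  and div: "\<And>q. q \<in> pressure_space M \<Longrightarrow> div_form M q u = 0"
 shows "surf_int k (free_faces M) (\<lambda>\<sigma> x. u x \<bullet> face_nrm M \<sigma>) = 0"
proof -
 have "(\<lambda>x. 1) \<in> pressure_space M" by (simp add: pressure_space_def S1_def P1_on_const)
 from div[OF this] have "(\<Sum>T\<in>cells M. LINT x:T|lborel. divg T u x) = 0" by (simp add: div_form_def cell_sum_def)
 moreover have "P2_on T (\<lambda>x. u x $ i)" if "T \<in> cells M" for T i
  using S2D(1)[OF S2v_component that] u unfolding velocity_space_def by blast
 ultimately have "(\<Sum>\<sigma>\<in>bdry. LINT x:\<sigma>|hausdorff k. u x \<bullet> nrm \<sigma>) = 0"
  using divergence_complex[OF complex, of u] by simp
 moreover have "(\<Sum>\<rho>\<in>solid_faces M. LINT x:\<rho>|hausdorff k. u x \<bullet> nrm \<rho>) = 0"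
  using solid_flux[OF u lam] by (intro sum.neutral ballI) (simp add: solid_normal)
 ultimately show ?thesis unfolding sum_boundary by (simp add: surf_int_def face_nrm_def)
qed

text \<open>The time averaged normal of a moving face does not depend on the point.\<close>

lemma swept_one_const:
 assumes \<sigma>: "\<sigma> \<in> free_faces M"
 shows "\<exists>c. \<forall>x\<in>\<sigma>. swept (\<lambda>y. 1) (tau p) wt \<sigma> (face_nrm M \<sigma>) x = c"
proof -
 have "swept (\<lambda>y. 1) (tau p) wt \<sigma> (face_nrm M \<sigma>) x
  = integral {0..1} (\<lambda>\<theta>. cof (\<lambda>h. h + (tau p * \<theta>) *\<^sub>R grad_w \<sigma> h) (face_nrm M \<sigma>))" if x: "x \<in> \<sigma>" for x
  unfolding swept_cong_free[OF \<sigma> x, symmetric] unfolding swept_def face_nrm_def face_motion(1)[OF free_boundary[OF \<sigma>] x] by simp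
 then show ?thesis by blast
qed

text \<open>The integrand of the swept volume is affine on each face, so mass lumping integrates it exactly, and
the kinematic equation tested with one turns it into the flux of the fluid velocity.\<close>

lemma volume_conservation:
 assumes u: "u \<in> velocity_space M"
  and lam: "\<And>ls. ls \<in> S2 (solid_faces M) \<Longrightarrow> lump2 k (solid_faces M) (\<lambda>x. (ls x *\<^sub>R nrm_s p) \<bullet> u x) = 0"
  and div: "\<And>q. q \<in> pressure_space M \<Longrightarrow> div_form M q u = 0"
  and N: "\<And>\<sigma> x. \<sigma> \<in> free_faces M \<Longrightarrow> x \<in> \<sigma> \<Longrightarrow> N \<sigma> x = swept (\<lambda>y. 1) (tau p) wt \<sigma> (face_nrm M \<sigma>) x"
  and kin: "\<And>\<phi>F. \<phi>F \<in> S1 (free_faces M) \<Longrightarrow> lump k (free_faces M) (\<lambda>\<sigma> x. (wt x \<bullet> N \<sigma> x) * \<phi>F x)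
   = surf_int k (free_faces M) (\<lambda>\<sigma> x. (u x \<bullet> face_nrm M \<sigma>) * \<phi>F x)"
 shows "mesh_volume M' = mesh_volume M"
proof -
 have vol: "mesh_volume A = (LINT x:domain A|lborel. 1 + 0 \<bullet> x)" if "cell_complex (cells A)" for A :: "(real^'n) mesh"
 proof -
  have "closed (domain A)" unfolding domain_def
   using cell_complex.finite_K[OF that] cell_complex.closed_cell[OF that] by (intro closed_Union) auto
  then show ?thesis by (simp add: mesh_volume_def set_lebesgue_integral_def)
 qed
 have "(\<lambda>x. 1) \<in> S1 (free_faces M)" by (simp add: S1_def P1_on_const)
 from kin[OF this] free_flux[OF u lam div] have L: "lump k (free_faces M) (\<lambda>\<sigma> x. wt x \<bullet> N \<sigma> x) = 0" by simp
 have "(LINT x:\<sigma>|hausdorff k. swept (\<lambda>y. 1) (tau p) wt \<sigma> (face_nrm M \<sigma>) x \<bullet> wt x)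
  = area \<sigma> / real (k + 1) * (\<Sum>P\<in>verts \<sigma>. wt P \<bullet> N \<sigma> P)" if \<sigma>: "\<sigma> \<in> free_faces M" for \<sigma>
 proof -
  note \<sigma>' = free_boundary[OF \<sigma>]
  obtain c where c: "\<And>x. x \<in> \<sigma> \<Longrightarrow> swept (\<lambda>y. 1) (tau p) wt \<sigma> (face_nrm M \<sigma>) x = c"
   using swept_one_const[OF \<sigma>] by blast
  note w = w_free_face[OF \<sigma>]
  have "(LINT x:\<sigma>|hausdorff k. swept (\<lambda>y. 1) (tau p) wt \<sigma> (face_nrm M \<sigma>) x \<bullet> wt x) = (LINT x:\<sigma>|hausdorff k. w x \<bullet> c)"
   using face_sets[OF \<sigma>'] by (intro set_lebesgue_integral_cong) (auto simp: c w inner_commute)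
  also have "\<dots> = area \<sigma> / real (k + 1) * (\<Sum>P\<in>verts \<sigma>. w P \<bullet> c)"
   by (rule face_integral_P1[OF \<sigma>' P1_on_inner[OF w_face_P1[OF \<sigma>']]])
  also have "(\<Sum>P\<in>verts \<sigma>. w P \<bullet> c) = (\<Sum>P\<in>verts \<sigma>. wt P \<bullet> N \<sigma> P)"
   using verts_in_face[OF \<sigma>'] by (intro sum.cong refl) (simp add: w N[OF \<sigma>] c)
  finally show ?thesis .
 qed
 then have "surf_int k (free_faces M) (\<lambda>\<sigma> x. swept (\<lambda>y. 1) (tau p) wt \<sigma> (face_nrm M \<sigma>) x \<bullet> wt x) = 0"
  using L by (simp add: surf_int_def lump_def)
 then show ?thesis using transport_free[of 1 0] vol[OF complex] vol[OF complex'] by simp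
qed

abbreviation "nhat \<sigma> \<theta> x \<equiv> cof (frechet_derivative (interp_pos p wt \<theta>) (at x within \<sigma>)) (face_nrm M \<sigma>)"

lemma gravity_growth:
 "(LINT x:domain M'|lborel. x \<bullet> e_vert p) - (LINT x:domain M|lborel. x \<bullet> e_vert p)
  = tau p * surf_int k (free_faces M) (\<lambda>\<sigma> x. gravity_vec p wt (nhat \<sigma>) x \<bullet> wt x)"
proof -
 have "gravity_vec p wt (nhat \<sigma>) x = swept (\<lambda>y. 0 + e_vert p \<bullet> y) (tau p) wt \<sigma> (face_nrm M \<sigma>) x" for \<sigma> x
  unfolding gravity_vec_def swept_def interp_pos_def[abs_def] by (simp add: inner_commute)
 then show ?thesis using transport_free[of 0 "e_vert p"] by (simp add: inner_commute)
qed

text \<open>The contact terms enter through their sum \<open>Cc\<close> only; what remains to be shown in each dimension is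
that they amount to the growth of the wetted area and the friction \<open>Q\<close>.\<close>

theorem energy_step:
 fixes E :: "(real^'n, 'z) evolution_scheme" and m :: nat and Cc Q :: real
 assumes E: "msh E m = M" "msh E (Suc m) = M'"
  and u: "vel E (Suc m) \<in> velocity_space M" and pr: "pres E (Suc m) \<in> pressure_space M"
  and ka: "kappa_s E (Suc m) \<in> S2 (solid_faces M)" and H: "curv E (Suc m) \<in> S1 (free_faces M)"
  and momentum: "\<And>q ls. q \<in> pressure_space M \<Longrightarrow> ls \<in> S2 (solid_faces M) \<Longrightarrow>
   momentum_lhs p E m (vel E (Suc m)) q ls = momentum_rhs p E m (vel E (Suc m))"
  and old: "compact (domain (msh E (m - 1)))" "continuous_on (domain (msh E (m - 1))) (vel E m)"
   "continuous_on (domain (msh E (m - 1))) (vel E (Suc m) \<circ> psi p E m)"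
  and N: "\<And>\<sigma> x. \<sigma> \<in> free_faces M \<Longrightarrow> x \<in> \<sigma> \<Longrightarrow> N \<sigma> x = swept (\<lambda>y. 1) (tau p) wt \<sigma> (face_nrm M \<sigma>) x"
  and curvature: "- lump k (free_faces M) (\<lambda>\<sigma> x. (curv E (Suc m) x *\<^sub>R N \<sigma> x) \<bullet> wt x)
   = - 1 / Web p * surface_stiffness p M wt wt + 1 / Web p * Cc
    - grav p * surf_int k (free_faces M) (\<lambda>\<sigma> x. gravity_vec p wt (nhat \<sigma>) x \<bullet> wt x)"
  and kin: "\<And>\<phi>F. \<phi>F \<in> S1 (free_faces M) \<Longrightarrow> lump k (free_faces M) (\<lambda>\<sigma> x. (wt x \<bullet> N \<sigma> x) * \<phi>F x)
   = surf_int k (free_faces M) (\<lambda>\<sigma> x. (vel E (Suc m) x \<bullet> face_nrm M \<sigma>) * \<phi>F x)"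
  and contact: "tau p * Cc = cos (theta_Y p) *
    (area (solid_surface M') - area (solid_surface M)) - Web p * (tau p * beta_c p * Q)"
 shows "mesh_volume M' = mesh_volume M"
  and "energy p E (Suc m) - energy p E m \<le> - bulk_dissipation p E m - tau p * beta_c p * Q"
proof -
 let ?u = "vel E (Suc m)" and ?S = "domain (msh E (m - 1))"
 have z: "(\<lambda>x. 0) \<in> pressure_space M" "(\<lambda>x. 0) \<in> S2 (solid_faces M)"
  by (simp_all add: pressure_space_def S1_def S2_def P1_on_const P2_on_P1)
 have z0: "div_form M (\<lambda>x. 0) ?u = 0" "lump2 k (solid_faces M) (\<lambda>x. (0 *\<^sub>R nrm_s p) \<bullet> ?u x) = 0"
  by (simp_all add: div_form_def cell_sum_def lump2_def)
 have c0: "conv_form A y v v = 0" for A y v by (simp add: conv_form_def)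
 have tz: "tau p \<noteq> 0" using tau_pos by simp
 have mom: "1 / (2 * tau p) * l2 (domain M) ?u ?u + 1 / (2 * tau p) * l2 ?S (?u \<circ> psi p E m) (?u \<circ> psi p E m)
   + 2 / Rey p * strain_form M ?u ?u - div_form M (pres E (Suc m)) ?u + div_form M q ?u
   + surf_int k (free_faces M) (\<lambda>\<sigma> x. (curv E (Suc m) x *\<^sub>R face_nrm M \<sigma>) \<bullet> ?u x)
   - lump2 k (solid_faces M) (\<lambda>x. (kappa_s E (Suc m) x *\<^sub>R nrm_s p) \<bullet> ?u x)
   + lump2 k (solid_faces M) (\<lambda>x. (ls x *\<^sub>R nrm_s p) \<bullet> ?u x)
   + beta_s p * surf_int k (solid_faces M) (\<lambda>\<rho> x. tproj (nrm_s p) (?u x) \<bullet> tproj (nrm_s p) (?u x))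
   = 1 / tau p * l2 ?S (vel E m) (?u \<circ> psi p E m)" if "q \<in> pressure_space M" "ls \<in> S2 (solid_faces M)" for q ls
  using momentum[OF that] unfolding momentum_lhs_def momentum_rhs_def Let_def E(1) c0 k_eq(1) by simp
 \<comment> \<open>The momentum equation is linear in \<open>q\<close> and \<open>ls\<close>; comparison with zero isolates the constraints.\<close>
 have div: "div_form M q ?u = 0" if "q \<in> pressure_space M" for q
  using mom[OF that z(2)] mom[OF z] z0 by linarith
 have lam: "lump2 k (solid_faces M) (\<lambda>x. (ls x *\<^sub>R nrm_s p) \<bullet> ?u x) = 0" if "ls \<in> S2 (solid_faces M)" for ls
  using mom[OF z(1) that] mom[OF z] z0 by linarith
 show "mesh_volume M' = mesh_volume M" by (rule volume_conservation[OF u lam div N kin])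
 define a where "a = l2 (domain M) ?u ?u"
 define b where "b = l2 ?S (?u \<circ> psi p E m) (?u \<circ> psi p E m)"
 define c where "c = l2 ?S (vel E m) (?u \<circ> psi p E m)"
 define e where "e = (LINT x:?S|lborel. (norm (vel E m x))\<^sup>2)"
 define d where "d = (LINT x:?S|lborel. (norm (?u (psi p E m x) - vel E m x))\<^sup>2)"
 define D where "D = 2 / Rey p * strain_form M ?u ?u"
 define B where "B = beta_s p * surf_int k (solid_faces M) (\<lambda>\<rho> x. (norm (tproj (nrm_s p) (?u x)))\<^sup>2)"
 define h where "h = surf_int k (free_faces M) (\<lambda>\<sigma> x. (curv E (Suc m) x *\<^sub>R face_nrm M \<sigma>) \<bullet> ?u x)"
 define s where "s = surface_stiffness p M wt wt"
 define G where "G = surf_int k (free_faces M) (\<lambda>\<sigma> x. gravity_vec p wt (nhat \<sigma>) x \<bullet> wt x)"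
 have pol: "2 * c = b + e - d"
  using l2_polarization[OF old] by (simp add: b_def c_def d_def e_def)
 have "1 / (2 * tau p) * a + 1 / (2 * tau p) * b + D + h + B = 1 / tau p * c"
  using mom[OF pr ka] div[OF pr] lam[OF ka]
  unfolding a_def b_def c_def D_def B_def h_def by (simp add: power2_norm_eq_inner)
 from arg_cong[OF this, of "\<lambda>y. 2 * tau p * y"] have m1: "a + b + 2 * tau p * (D + h + B) = 2 * c"
  using tz by (simp add: algebra_simps)
 have hh: "h = - (- 1 / Web p * s + 1 / Web p * Cc - grav p * G)"
 proof -
  have "h = surf_int k (free_faces M) (\<lambda>\<sigma> x. (?u x \<bullet> face_nrm M \<sigma>) * curv E (Suc m) x)"
   unfolding h_def by (simp add: inner_commute[of "face_nrm M _"] mult.commute)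
  also have "\<dots> = lump k (free_faces M) (\<lambda>\<sigma> x. (wt x \<bullet> N \<sigma> x) * curv E (Suc m) x)" by (rule kin[OF H, symmetric])
  also have "\<dots> = lump k (free_faces M) (\<lambda>\<sigma> x. (curv E (Suc m) x *\<^sub>R N \<sigma> x) \<bullet> wt x)"
   by (simp add: inner_commute[of "wt _"] mult.commute)
  finally show ?thesis using curvature unfolding s_def G_def by simp
 qed
 define F where "F = area (free_surface M') - area (free_surface M)"
 define L where "L = area (solid_surface M') - area (solid_surface M)"
 have area: "1 / Web p * F \<le> 1 / Web p * (tau p * s)"
  using free_area_growth We_pos unfolding F_def s_def by (intro mult_left_mono) auto
 have con: "1 / Web p * (tau p * Cc) = 1 / Web p * (cos (theta_Y p) * L) - tau p * beta_c p * Q"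
  unfolding contact L_def using We_pos by (simp add: field_simps)
 have gr: "(LINT x:domain M'|lborel. x \<bullet> e_vert p) - (LINT x:domain M|lborel. x \<bullet> e_vert p) = tau p * G"
  unfolding G_def by (rule gravity_growth)
 have "energy p E (Suc m) - energy p E m
  = 1/2 * (a - e) + 1 / Web p * F - 1 / Web p * (cos (theta_Y p) * L) + grav p * (tau p * G)"
  unfolding energy_def a_def e_def F_def L_def k_eq(1) gr[symmetric] l2_def
  by (simp add: E power2_norm_eq_inner algebra_simps diff_divide_distrib)
 also have "1/2 * (a - e) = - (1/2) * d - tau p * (D + h + B)"
 proof -
  define t where "t = tau p * (D + h + B)"
  have "a + b + 2 * t = 2 * c" using m1 by (simp add: t_def)
  then show ?thesis unfolding t_def[symmetric] using pol by argo
 qed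
 also have "tau p * (D + h + B) = tau p * D + tau p * B + 1 / Web p * (tau p * s) - 1 / Web p * (tau p * Cc) + grav p * (tau p * G)"
  unfolding hh by (simp add: algebra_simps)
 finally have "energy p E (Suc m) - energy p E m
  \<le> - (1/2 * d + tau p * D + tau p * B) - tau p * beta_c p * Q"
  using area con by simp
 also have "1/2 * d + tau p * D + tau p * B = bulk_dissipation p E m"
  unfolding bulk_dissipation_def d_def D_def B_def k_eq(1) E by simp
 finally show "energy p E (Suc m) - energy p E m \<le> - bulk_dissipation p E m - tau p * beta_c p * Q" .
qed

end

section \<open>Motion of the substrate\<close>

context mesh_step
begin

lemma cof_id: "norm n = 1 \<Longrightarrow> cof (\<lambda>h. h) n = n"
proof -
 assume n: "norm n = 1"
 have "cof (\<lambda>h. h) n \<bullet> h = n \<bullet> h" for h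
  using cof_det[OF n, of "\<lambda>h. h" h] by (simp add: linear_ident matrix_id[unfolded id_def])
 then have "(cof (\<lambda>h. h) n - n) \<bullet> (cof (\<lambda>h. h) n - n) = 0" by (simp add: inner_diff_left)
 then show "cof (\<lambda>h. h) n = n" by simp
qed

text \<open>
 Along the motion the cofactor vector of a face on the substrate stays parallel to the normal
 of the substrate and never vanishes, so it keeps its direction.
\<close>

lemma cof_solid:
 assumes \<rho>: "\<rho> \<in> solid_faces M"
 shows "cof (motion \<rho>) (nrm_s p) = (cof (motion \<rho>) (nrm_s p) \<bullet> nrm_s p) *\<^sub>R nrm_s p"
  and "0 < cof (motion \<rho>) (nrm_s p) \<bullet> nrm_s p"
proof -
 let ?n = "nrm_s p"
 define D where "D \<theta> h = h + (tau p * \<theta>) *\<^sub>R grad_w \<rho> h" for \<theta> h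
 note K = cell_of(1)[OF solid_boundary[OF \<rho>]]
 have nn: "?n \<bullet> ?n = 1" using nrm_s_unit by (simp add: norm_eq_1)
 have par: "cof (D \<theta>) ?n = (cof (D \<theta>) ?n \<bullet> ?n) *\<^sub>R ?n" if \<theta>: "\<theta> \<in> {0..1}" for \<theta>
 proof -
  let ?z = "cof (D \<theta>) ?n" and ?v = "cof (D \<theta>) ?n - (cof (D \<theta>) ?n \<bullet> ?n) *\<^sub>R ?n"
  have v: "?n \<bullet> ?v = 0" by (simp add: inner_diff_right nn inner_commute[of ?n ?z])
  have "?z \<bullet> ?v = 0" unfolding D_def[abs_def] by (rule cof_solid_tangent[OF \<rho> \<theta> v[unfolded D_def[abs_def]]])
  then have "?v \<bullet> ?v = 0" using v by (simp add: inner_diff_left)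
  then show ?thesis by simp
 qed
 have nz: "cof (D \<theta>) ?n \<bullet> ?n \<noteq> 0" if \<theta>: "\<theta> \<in> {0..1}" for \<theta>
 proof
  assume "cof (D \<theta>) ?n \<bullet> ?n = 0"
  then have "cof (D \<theta>) ?n = 0" using par[OF \<theta>] by simp
  moreover have "linear (D \<theta>)" unfolding D_def[abs_def] by (rule linear_motion[OF linear_dw[OF K]])
  ultimately have "det (matrix (D \<theta>)) = 0" using cof_det[OF nrm_s_unit, of "D \<theta>" ?n] nn by simp
  then show False using det_dw_pos[OF K \<theta>] by (simp add: D_def[abs_def])
 qed
 have D1: "D 1 = motion \<rho>" by (simp add: D_def[abs_def] motion_def[abs_def])
 show "cof (motion \<rho>) ?n = (cof (motion \<rho>) ?n \<bullet> ?n) *\<^sub>R ?n" using par[of 1] unfolding D1 by simp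
 have cont: "continuous_on {0..1} (\<lambda>\<theta>. cof (D \<theta>) ?n \<bullet> ?n)"
  unfolding D_def[abs_def] by (intro continuous_intros cof_continuous nrm_s_unit linear_dw[OF K])
 have D0: "cof (D 0) ?n \<bullet> ?n = 1" using cof_id[OF nrm_s_unit] nn by (simp add: D_def[abs_def])
 show "0 < cof (motion \<rho>) ?n \<bullet> ?n"
 proof (rule ccontr)
  assume "\<not> ?thesis"
  then have "cof (D 1) ?n \<bullet> ?n \<le> 0" unfolding D1 by simp
  then have "\<exists>\<theta>. 0 \<le> \<theta> \<and> \<theta> \<le> 1 \<and> cof (D \<theta>) ?n \<bullet> ?n = 0"
   using IVT2'[of "\<lambda>\<theta>. cof (D \<theta>) ?n \<bullet> ?n" 1 0 0] cont D0 by simp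
  then show False using nz by auto
 qed
qed

lemma measure_psi_solid:
 assumes \<rho>: "\<rho> \<in> solid_faces M"
 shows "area (\<psi> ` \<rho>) = area \<rho> * (cof (motion \<rho>) (nrm_s p) \<bullet> nrm_s p)"
proof -
 have "norm (cof (motion \<rho>) (nrm_s p)) = cof (motion \<rho>) (nrm_s p) \<bullet> nrm_s p"
  using arg_cong[OF cof_solid(1)[OF \<rho>], of norm] cof_solid(2)[OF \<rho>] nrm_s_unit by simp
 then show ?thesis using measure_psi_face[OF solid_boundary[OF \<rho>]] by (simp add: solid_normal[OF \<rho>])
qed

lemma solid_area_growth:
 "area (solid_surface M') - area (solid_surface M)
  = (\<Sum>\<rho>\<in>solid_faces M. area (\<psi> ` \<rho>) - area \<rho>)"
proof -
 have "solid_faces M \<subseteq> bdry" using solid_boundary by blast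
 from measure_faces[OF this faces'(2)] show ?thesis by (simp add: solid_surface_def map_mesh_def)
qed

lemma contact_point:
 assumes "x \<in> \<sigma>" "\<sigma> \<in> free_faces M" "x \<in> \<rho>" "\<rho> \<in> solid_faces M"
 shows "w x = wt x" "wt x \<bullet> nrm_s p = 0" "x \<in> contact_set M"
proof -
 show "w x = wt x" by (rule w_free_face[OF assms(2,1)])
 then show "wt x \<bullet> nrm_s p = 0" using solid_tangential[OF assms(4,3)] by simp
 show "x \<in> contact_set M" using assms by (auto simp: contact_set_def free_surface_def solid_surface_def)
qed

end

section \<open>Contact points\<close>

locale mesh_step2 = mesh_step cof2 1 p M wt w for p M wt w +
 assumes horizontal: "nrm_s p = vector [0, 1] \<or> nrm_s p = - vector [0, 1]"
  and card_contact: "card (contact_set M) = 2"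
begin

lemma solid_horizontal: "nrm_s p \<bullet> h = 0 \<Longrightarrow> h = (h $ 1) *\<^sub>R axis 1 1"
 using horizontal by (auto simp: inner_vec_def sum_2 vec_eq_iff forall_2 axis_def)

text \<open>The end points of a wetted segment, from left to right.\<close>

definition is_ends :: "(real^2) set \<Rightarrow> (real^2) \<times> (real^2) \<Rightarrow> bool" where
 "is_ends \<rho> c \<longleftrightarrow> verts \<rho> = {fst c, snd c} \<and> fst c $ 1 < snd c $ 1 \<and>
  \<rho> = closed_segment (fst c) (snd c) \<and> fst c $ 2 = snd c $ 2 \<and>
  area (\<psi> ` \<rho>) - area \<rho> = tau p * (w (snd c) $ 1 - w (fst c) $ 1)"

lemma solid_segment:
 assumes \<rho>: "\<rho> \<in> solid_faces M"
 shows "\<exists>c. is_ends \<rho> c"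
proof -
 note \<rho>' = solid_boundary[OF \<rho>]
 have "card (verts \<rho>) = 2" using boundary_face_simplex(2)[OF \<rho>'] by simp
 then obtain P Q where PQ: "verts \<rho> = {P, Q}" "P \<noteq> Q" by (auto simp: card_2_iff)
 have hor: "y - x = ((y - x) $ 1) *\<^sub>R axis 1 1" if "x \<in> verts \<rho>" "y \<in> verts \<rho>" for x y
  using face_nrm_orthogonal[OF \<rho>' verts_in_face[OF \<rho>' that(1)] verts_in_face[OF \<rho>' that(2)]]
  by (intro solid_horizontal) (simp add: solid_normal[OF \<rho>])
 have "P $ 1 \<noteq> Q $ 1" using hor[of P Q] PQ by auto
 then obtain a b where ab: "verts \<rho> = {a, b}" "a $ 1 < b $ 1"
  using PQ(1) by (metis insert_commute linorder_neqE_linordered_idom)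
 have e: "b - a = (b $ 1 - a $ 1) *\<^sub>R axis 1 1" using hor[of a b] ab(1) by simp
 have seg: "\<rho> = closed_segment a b"
  using boundary_face_simplex(3)[OF \<rho>'] ab(1) by (simp add: segment_convex_hull)
 have "norm (b - a) = \<bar>b $ 1 - a $ 1\<bar> * norm (axis 1 1 :: real^2)" using arg_cong[OF e, of norm] by simp
 then have "dist a b = b $ 1 - a $ 1" using ab(2) by (simp add: dist_norm norm_minus_commute)
 then have m: "area \<rho> = b $ 1 - a $ 1"
  using hausdorff_segment(1)[of a b] ab(2) unfolding seg by auto
 have K: "cell_of \<rho> \<in> cells M" by (rule cell_of(1)[OF \<rho>'])
 have in_cell: "a \<in> cell_of \<rho>" "b \<in> cell_of \<rho>"
  using ab(1) verts_in_face[OF \<rho>'] face_in_cell[OF \<rho>'] by auto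
 have "cof2 (motion \<rho>) (nrm_s p) \<bullet> nrm_s p = motion \<rho> (axis 1 1) $ 1"
 proof -
  have "rot90 (vector [0, 1]) = - axis 1 1" by (simp add: vec_eq_iff forall_2 axis_def)
  then show ?thesis
   using horizontal linear_neg[OF linear_motion_face[OF \<rho>']] linear_neg[OF linear_rot90]
   by (auto simp: cof2_def inner_vec_def sum_2)
 qed
 also have "\<dots> = 1 + tau p * (grad_w \<rho> (axis 1 1) $ 1)" by (simp add: motion_def axis_def)
 finally have "area (\<psi> ` \<rho>) - area \<rho> = tau p * ((b $ 1 - a $ 1) * (grad_w \<rho> (axis 1 1) $ 1))"
  unfolding measure_psi_solid[OF \<rho>] m by (simp add: algebra_simps)
 also have "(b $ 1 - a $ 1) * (grad_w \<rho> (axis 1 1) $ 1) = grad_w \<rho> (b - a) $ 1"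
  unfolding e linear_scale[OF linear_dw[OF K]] by simp
 also have "\<dots> = w b $ 1 - w a $ 1" unfolding dw_diff[OF K in_cell] by simp
 finally have "area (\<psi> ` \<rho>) - area \<rho> = tau p * (w b $ 1 - w a $ 1)" .
 moreover have "a $ 2 = b $ 2" using arg_cong[OF e, of "\<lambda>v. v $ 2"] by (simp add: axis_def)
 ultimately have "is_ends \<rho> (a, b)" unfolding is_ends_def fst_conv snd_conv using ab seg by blast
 then show ?thesis by blast
qed

lemma vertex_facet:
 assumes \<sigma>: "\<sigma> \<in> bdry"
 shows "{P} facet_of \<sigma> \<longleftrightarrow> P \<in> verts \<sigma>"
proof -
 have "card (verts \<sigma>) = 2" using boundary_face_simplex(2)[OF \<sigma>] by simp
 then obtain A B where AB: "verts \<sigma> = {A, B}" "A \<noteq> B" by (auto simp: card_2_iff)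
 have "{P} facet_of (convex hull (verts \<sigma>)) \<longleftrightarrow> (\<exists>u\<in>verts \<sigma>. {P} = convex hull (verts \<sigma> - {u}))"
  using facet_of_convex_hull_affine_independent[OF boundary_face_simplex(1)[OF \<sigma>], of "{P}"] by blast
 moreover have "(\<exists>u\<in>verts \<sigma>. {P} = convex hull (verts \<sigma> - {u}))
   \<longleftrightarrow> {P} = convex hull (verts \<sigma> - {A}) \<or> {P} = convex hull (verts \<sigma> - {B})"
  unfolding AB(1) by simp
 moreover have "verts \<sigma> - {A} = {B}" "verts \<sigma> - {B} = {A}" using AB(2) unfolding AB(1) by auto
 ultimately have "{P} facet_of \<sigma> \<longleftrightarrow> {P} = {B} \<or> {P} = {A}"
  unfolding boundary_face_simplex(3)[OF \<sigma>] by simp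
 then show ?thesis unfolding AB(1) by auto
qed

text \<open>
 The lengths of the wetted segments telescope.  At a vertex that is not a contact point the
 number of wetted segments is even, so a segment ending there is followed by one starting there;
 hence the leftmost and the rightmost vertex are contact points, and there are no others.
\<close>

lemma solid_length_growth:
 "area (solid_surface M') - area (solid_surface M)
  = tau p * (\<Sum>P\<in>contact_set M. mu2 M P \<bullet> wt P)"
proof -
 let ?S = "solid_faces M"
 define a where "a \<rho> = fst (SOME c. is_ends \<rho> c)" for \<rho>
 define b where "b \<rho> = snd (SOME c. is_ends \<rho> c)" for \<rho>
 have "is_ends \<rho> (SOME c. is_ends \<rho> c)" if \<rho>: "\<rho> \<in> ?S" for \<rho>
  by (rule someI_ex[OF solid_segment[OF \<rho>]])
 note ends = this[unfolded is_ends_def[of _ "SOME c. is_ends _ c"], folded a_def b_def]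
 have vab: "\<And>\<rho>. \<rho> \<in> ?S \<Longrightarrow> verts \<rho> = {a \<rho>, b \<rho>}" and lt: "\<And>\<rho>. \<rho> \<in> ?S \<Longrightarrow> a \<rho> $ 1 < b \<rho> $ 1"
  and seg: "\<And>\<rho>. \<rho> \<in> ?S \<Longrightarrow> \<rho> = closed_segment (a \<rho>) (b \<rho>)" and lev: "\<And>\<rho>. \<rho> \<in> ?S \<Longrightarrow> a \<rho> $ 2 = b \<rho> $ 2"
  and gr: "\<And>\<rho>. \<rho> \<in> ?S \<Longrightarrow> area (\<psi> ` \<rho>) - area \<rho> = tau p * (w (b \<rho>) $ 1 - w (a \<rho>) $ 1)"
  by (drule ends, elim conjE, assumption)+
 define V where "V = a ` ?S \<union> b ` ?S"
 have finV: "finite V" using finite_faces(2) by (simp add: V_def)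
 \<comment> \<open>The numbers of wetted segments starting and ending at \<open>P\<close>.\<close>
 define l where "l P = card {\<rho>\<in>?S. a \<rho> = P}" for P
 define r where "r P = card {\<rho>\<in>?S. b \<rho> = P}" for P
 have tele: "(\<Sum>\<rho>\<in>?S. w (b \<rho>) $ 1 - w (a \<rho>) $ 1) = (\<Sum>P\<in>V. (real (r P) - real (l P)) * w P $ 1)"
 proof -
  have "(\<Sum>\<rho>\<in>?S. f (c \<rho>)) = (\<Sum>P\<in>V. real (card {\<rho>\<in>?S. c \<rho> = P}) * f P)" if c: "c ` ?S \<subseteq> V" for c and f :: "real^2 \<Rightarrow> real"
  proof -
   have "(\<Sum>\<rho>\<in>?S. f (c \<rho>)) = (\<Sum>P\<in>V. \<Sum>\<rho>\<in>{\<rho>\<in>?S. c \<rho> = P}. f (c \<rho>))"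
    by (rule sum.group[OF finite_faces(2) finV c, symmetric])
   also have "\<dots> = (\<Sum>P\<in>V. \<Sum>\<rho>\<in>{\<rho>\<in>?S. c \<rho> = P}. f P)" by (intro sum.cong refl) simp
   finally show ?thesis by simp
  qed
  note count = this
  show ?thesis
   unfolding sum_subtractf r_def l_def left_diff_distrib
   using count[of b "\<lambda>P. w P $ 1"] count[of a "\<lambda>P. w P $ 1"] by (simp add: V_def)
 qed
 have sub: "\<rho> \<subseteq> \<rho>'" if "\<rho> \<in> ?S" "\<rho>' \<in> ?S" "a \<rho> $ 2 = a \<rho>' $ 2" "a \<rho>' $ 1 \<le> a \<rho> $ 1" "b \<rho> $ 1 \<le> b \<rho>' $ 1" for \<rho> \<rho>'
 proof -
  have on: "x \<in> closed_segment (a \<rho>') (b \<rho>')" if x: "x $ 2 = a \<rho>' $ 2" "a \<rho>' $ 1 \<le> x $ 1" "x $ 1 \<le> b \<rho>' $ 1" for x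
  proof -
   define u where "u = (x $ 1 - a \<rho>' $ 1) / (b \<rho>' $ 1 - a \<rho>' $ 1)"
   have d: "0 < b \<rho>' $ 1 - a \<rho>' $ 1" using lt[OF \<open>\<rho>' \<in> ?S\<close>] by simp
   have "0 \<le> u" "u \<le> 1" using x(2,3) d by (auto simp: u_def divide_simps)
   moreover have "u * (b \<rho>' $ 1 - a \<rho>' $ 1) = x $ 1 - a \<rho>' $ 1" using d by (simp add: u_def)
   then have "x = (1 - u) *\<^sub>R a \<rho>' + u *\<^sub>R b \<rho>'"
    using x(1) lev[OF \<open>\<rho>' \<in> ?S\<close>] by (simp add: vec_eq_iff forall_2 algebra_simps)
   ultimately show ?thesis unfolding closed_segment_def by blast
  qed
  have ab: "a \<rho> $ 1 < b \<rho> $ 1" "a \<rho> $ 2 = b \<rho> $ 2" using lt lev \<open>\<rho> \<in> ?S\<close> by auto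
  have "a \<rho> \<in> closed_segment (a \<rho>') (b \<rho>')" "b \<rho> \<in> closed_segment (a \<rho>') (b \<rho>')"
   by (rule on; use that(3-5) ab in linarith)+
  then have "closed_segment (a \<rho>) (b \<rho>) \<subseteq> closed_segment (a \<rho>') (b \<rho>')" by (simp add: subset_closed_segment)
  then show ?thesis using seg[OF that(1)] seg[OF that(2)] by blast
 qed
 have eqI: "\<rho> = \<rho>'" if "\<rho> \<in> ?S" "\<rho>' \<in> ?S" "\<rho> \<subseteq> \<rho>'" for \<rho> \<rho>'
  by (rule boundary_face_subset_eq[OF solid_boundary[OF that(1)] solid_boundary[OF that(2)] that(3)])
 have la: "\<rho> = \<rho>'" if "\<rho> \<in> ?S" "\<rho>' \<in> ?S" "a \<rho> = a \<rho>'" for \<rho> \<rho>'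
 proof (cases "b \<rho> $ 1 \<le> b \<rho>' $ 1")
  case True
  then show ?thesis by (intro eqI[OF that(1,2)] sub[OF that(1,2)]) (simp_all add: that(3))
 next
  case False
  then show ?thesis by (intro eqI[OF that(2,1), symmetric] sub[OF that(2,1)]) (simp_all add: that(3))
 qed
 have rb: "\<rho> = \<rho>'" if "\<rho> \<in> ?S" "\<rho>' \<in> ?S" "b \<rho> = b \<rho>'" for \<rho> \<rho>'
 proof -
  have 2: "a \<rho> $ 2 = a \<rho>' $ 2" using lev[OF that(1)] lev[OF that(2)] that(3) by simp
  show ?thesis
  proof (cases "a \<rho>' $ 1 \<le> a \<rho> $ 1")
   case True
   then show ?thesis by (intro eqI[OF that(1,2)] sub[OF that(1,2)]) (simp_all add: that(3) 2)
  next
   case False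
   then show ?thesis by (intro eqI[OF that(2,1), symmetric] sub[OF that(2,1)]) (simp_all add: that(3) 2)
  qed
 qed
 have le1: "l P \<le> 1" "r P \<le> 1" for P
 proof -
  have "card {\<rho>\<in>?S. c \<rho> = P} \<le> Suc 0" if "\<And>\<rho> \<rho>'. \<rho> \<in> ?S \<Longrightarrow> \<rho>' \<in> ?S \<Longrightarrow> c \<rho> = c \<rho>' \<Longrightarrow> \<rho> = \<rho>'" for c :: "(real^2) set \<Rightarrow> real^2"
  proof (rule card_le_Suc0_iff_eq[THEN iffD2])
   show "finite {\<rho>\<in>?S. c \<rho> = P}" using finite_faces(2) by simp
   show "\<forall>\<rho>\<in>{\<rho>\<in>?S. c \<rho> = P}. \<forall>\<rho>'\<in>{\<rho>\<in>?S. c \<rho> = P}. \<rho> = \<rho>'"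
    by (intro ballI, rule that) simp_all
  qed
  from this[OF la] this[OF rb] show "l P \<le> 1" "r P \<le> 1" unfolding l_def r_def One_nat_def by blast+
 qed
 have balance: "l P = r P" if P: "P \<in> V" "P \<notin> contact_set M" for P
 proof -
  obtain \<rho>0 where \<rho>0: "\<rho>0 \<in> ?S" "P = a \<rho>0 \<or> P = b \<rho>0" using P(1) unfolding V_def by blast
  then have "P \<in> verts \<rho>0" unfolding vab[OF \<rho>0(1)] by blast
  then have P0: "P \<in> \<rho>0" by (rule verts_in_face[OF solid_boundary[OF \<rho>0(1)]])
  have free: "P \<notin> \<sigma>" if "\<sigma> \<in> free_faces M" for \<sigma> using contact_point(3)[OF _ that P0 \<rho>0(1)] P(2) by blast
  have "{\<sigma>\<in>bdry. {P} facet_of \<sigma>} = {\<rho>\<in>?S. a \<rho> = P} \<union> {\<rho>\<in>?S. b \<rho> = P}"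
  proof (intro set_eqI iffI)
   fix \<sigma> assume \<sigma>: "\<sigma> \<in> {\<sigma>\<in>bdry. {P} facet_of \<sigma>}"
   then have v: "P \<in> verts \<sigma>" using vertex_facet[of \<sigma> P] by blast
   then have "P \<in> \<sigma>" using verts_in_face[of \<sigma> P] \<sigma> by blast
   then have "\<sigma> \<in> ?S" using \<sigma> free faces(1) by blast
   then show "\<sigma> \<in> {\<rho>\<in>?S. a \<rho> = P} \<union> {\<rho>\<in>?S. b \<rho> = P}" using v unfolding vab[OF \<open>\<sigma> \<in> ?S\<close>] by blast
  next
   fix \<sigma> assume "\<sigma> \<in> {\<rho>\<in>?S. a \<rho> = P} \<union> {\<rho>\<in>?S. b \<rho> = P}"
   then have \<sigma>: "\<sigma> \<in> ?S" and "P = a \<sigma> \<or> P = b \<sigma>" by auto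
   then have "P \<in> verts \<sigma>" unfolding vab[OF \<sigma>] by blast
   then show "\<sigma> \<in> {\<sigma>\<in>bdry. {P} facet_of \<sigma>}"
    using vertex_facet[OF solid_boundary[OF \<sigma>]] solid_boundary[OF \<sigma>] by blast
  qed
  moreover have "card ({\<rho>\<in>?S. a \<rho> = P} \<union> {\<rho>\<in>?S. b \<rho> = P}) = l P + r P"
  proof -
   have "{\<rho>\<in>?S. a \<rho> = P} \<inter> {\<rho>\<in>?S. b \<rho> = P} = {}" using lt by force
   then show ?thesis unfolding l_def r_def using finite_faces(2) by (intro card_Un_disjoint) simp_all
  qed
  ultimately have "even (l P + r P)" using even_boundary_faces_at_ridge[of "{P}"] by simp
  then show ?thesis using le1[of P] by (cases "l P"; cases "r P") auto
 qed
 have "contact_set M \<noteq> {}" using card_contact by auto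
 then have "?S \<noteq> {}" by (auto simp: contact_set_def solid_surface_def)
 then have V0: "V \<noteq> {}" by (simp add: V_def)
 obtain L where L: "L \<in> V" "\<And>P. P \<in> V \<Longrightarrow> L $ 1 \<le> P $ 1"
  using ex_min_if_finite[of "(\<lambda>P. P $ 1) ` V"] finV V0 by (metis (no_types, lifting) arg_min_if_finite(1,2) linorder_not_less)
 obtain R where R: "R \<in> V" "\<And>P. P \<in> V \<Longrightarrow> P $ 1 \<le> R $ 1"
  using arg_min_if_finite[OF finV V0, of "\<lambda>P. - P $ 1"] by (metis linorder_not_less neg_less_iff_less)
 have rL: "r L = 0"
 proof -
  have e: "{\<rho>\<in>?S. b \<rho> = L} = {}" using L(2) lt by (auto simp: V_def) force
  show ?thesis unfolding r_def e by simp
 qed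
 have lR: "l R = 0"
 proof -
  have e: "{\<rho>\<in>?S. a \<rho> = R} = {}" using R(2) lt by (auto simp: V_def) force
  show ?thesis unfolding l_def e by simp
 qed
 have pos: "l P + r P \<noteq> 0" if "P \<in> V" for P
  using that finite_faces(2) by (auto simp: V_def l_def r_def)
 have lL: "l L = 1" and rR: "r R = 1" using pos[OF L(1)] pos[OF R(1)] rL lR le1[of L] le1[of R] by auto
 have LC: "L \<in> contact_set M" and RC: "R \<in> contact_set M"
  using balance[OF L(1)] balance[OF R(1)] rL lL lR rR by auto
 obtain \<rho> where \<rho>: "\<rho> \<in> ?S" using \<open>?S \<noteq> {}\<close> by blast
 have LR: "L $ 1 < R $ 1" using L(2)[of "a \<rho>"] R(2)[of "b \<rho>"] lt[OF \<rho>] \<rho> by (auto simp: V_def)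
 have "finite (contact_set M)" using card_contact card.infinite by fastforce
 moreover have LRne: "L \<noteq> R" using LR by blast
 moreover have "{L, R} \<subseteq> contact_set M" "card {L, R} = card (contact_set M)"
 proof -
  show "{L, R} \<subseteq> contact_set M" "card {L, R} = card (contact_set M)" using LC RC card_contact LRne by simp_all
 qed
 ultimately have C: "contact_set M = {L, R}" using card_subset_eq by metis
 have "(\<Sum>P\<in>V. (real (r P) - real (l P)) * w P $ 1) = (\<Sum>P\<in>{L, R}. (real (r P) - real (l P)) * w P $ 1)"
 proof (rule sum.mono_neutral_right[OF finV])
  show "{L, R} \<subseteq> V" using L R by simp
  show "\<forall>P\<in>V - {L, R}. (real (r P) - real (l P)) * w P $ 1 = 0" using balance C by simp
 qed
 also have "\<dots> = w R $ 1 - w L $ 1" using LRne rL lL lR rR by simp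
 also have "\<dots> = (\<Sum>P\<in>contact_set M. mu2 M P \<bullet> w P)"
 proof -
  have "mu2 M L = vector [-1, 0]" "mu2 M R = vector [1, 0]" using LR by (simp_all add: mu2_def C)
  then have "mu2 M L \<bullet> w L = - w L $ 1" "mu2 M R \<bullet> w R = w R $ 1" by (simp_all add: inner_vec_def sum_2)
  then show ?thesis unfolding C using LRne by simp
 qed
 also have "\<dots> = (\<Sum>P\<in>contact_set M. mu2 M P \<bullet> wt P)"
  by (intro sum.cong refl) (auto simp: contact_set_def free_surface_def w_free)
 finally have "(\<Sum>\<rho>\<in>?S. w (b \<rho>) $ 1 - w (a \<rho>) $ 1) = (\<Sum>P\<in>contact_set M. mu2 M P \<bullet> wt P)" using tele by simp
 then show ?thesis unfolding solid_area_growth using gr by (simp add: sum_distrib_left[symmetric])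
qed

end

section \<open>The contact line\<close>

lemma plane_coordinates:
 fixes n x z v :: "real^3"
 assumes "n \<bullet> v = 0" "cross3 x z = (n \<bullet> cross3 x z) *\<^sub>R n"
 shows "(n \<bullet> cross3 x z) *\<^sub>R v = (n \<bullet> cross3 v z) *\<^sub>R x + (n \<bullet> cross3 x v) *\<^sub>R z"
proof -
 have "(n \<bullet> cross3 x z) *\<^sub>R v = (v \<bullet> cross3 x z) *\<^sub>R n + (n \<bullet> cross3 v z) *\<^sub>R x + (n \<bullet> cross3 x v) *\<^sub>R z"
  by (simp add: vec_eq_iff forall_3 cross3_simps)
 moreover have "v \<bullet> cross3 x z = (n \<bullet> cross3 x z) * (v \<bullet> n)"
  by (subst assms(2)) simp
 ultimately show ?thesis using assms(1) by (simp add: inner_commute[of v n])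
qed

lemma cross3_plane:
 fixes n :: "real^3"
 assumes n: "norm n = 1" and s: "n \<bullet> s1 = 0" "n \<bullet> s2 = 0"
 shows "cross3 s1 s2 = (n \<bullet> cross3 s1 s2) *\<^sub>R n"
proof -
 obtain t1 t2 where t: "cross3 t1 t2 = n" and c: "\<And>D. cof3 D n = cross3 (D t1) (D t2)" using cof3_tangents[OF n] by blast
 show ?thesis using cof3_eq[OF n linear_ident s] unfolding c by (simp add: t)
qed

locale mesh_step3 = mesh_step cof3 2 p M wt w for p M wt w +
 assumes unique_solid: "\<And>e. e \<in> contact_edges M \<Longrightarrow> \<exists>!\<rho>. \<rho> \<in> solid_faces M \<and> e facet_of \<rho>"
begin

lemma edge_of_face:
 assumes \<sigma>: "\<sigma> \<in> bdry" and e: "e facet_of \<sigma>"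
 obtains c where "verts \<sigma> = insert c (verts e)" "c \<notin> verts e" "card (verts e) = 2" "e = convex hull (verts e)"
proof -
 note s = boundary_face_simplex[OF \<sigma>]
 have "e facet_of convex hull (verts \<sigma>)" using e s(3) by simp
 then obtain c where c: "c \<in> verts \<sigma>" "e = convex hull (verts \<sigma> - {c})"
  using facet_of_convex_hull_affine_independent[OF s(1), of e] by blast
 have ind: "\<not> affine_dependent (verts \<sigma> - {c})" using s(1) affine_independent_subset by blast
 have v: "verts e = verts \<sigma> - {c}" unfolding c(2) by (rule verts_convex_hull[OF ind])
 have "card (verts \<sigma>) = 3" using s(2) by simp
 then have "card (verts e) = 2" unfolding v using c(1) s(4) by (simp add: card_Diff_singleton)
 moreover have "verts \<sigma> = insert c (verts e)" "c \<notin> verts e" using v c(1) by auto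
 moreover have "e = convex hull (verts e)" unfolding v by (rule c(2))
 ultimately show ?thesis using that by blast
qed

lemma sum_edges_of_face:
 assumes \<sigma>: "\<sigma> \<in> bdry" and v: "verts \<sigma> = {a, b, c}" "a \<noteq> b" "a \<noteq> c" "b \<noteq> c"
 shows "{e. e facet_of \<sigma>} = {convex hull {a, b}, convex hull {b, c}, convex hull {c, a}}"
  and "verts (convex hull {a, b}) = {a, b}" "verts (convex hull {b, c}) = {b, c}" "verts (convex hull {c, a}) = {c, a}"
proof -
 note s = boundary_face_simplex[OF \<sigma>]
 have "{e. e facet_of convex hull (verts \<sigma>)} = {e. e \<noteq> {} \<and> (\<exists>u\<in>verts \<sigma>. e = convex hull (verts \<sigma> - {u}))}"
  using facet_of_convex_hull_affine_independent[OF s(1)] by blast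
 also have "\<dots> = {e. e \<noteq> {} \<and> (e = convex hull (verts \<sigma> - {c}) \<or> e = convex hull (verts \<sigma> - {a}) \<or> e = convex hull (verts \<sigma> - {b}))}"
  unfolding v(1) by auto
 also have "\<dots> = {e. e \<noteq> {} \<and> (e = convex hull {a, b} \<or> e = convex hull {b, c} \<or> e = convex hull {c, a})}"
 proof -
  have "verts \<sigma> - {c} = {a, b}" "verts \<sigma> - {a} = {b, c}" "verts \<sigma> - {b} = {c, a}" using v(2-4) unfolding v(1) by auto
  then show ?thesis by simp
 qed
 also have "\<dots> = {convex hull {a, b}, convex hull {b, c}, convex hull {c, a}}" by auto
 finally show "{e. e facet_of \<sigma>} = {convex hull {a, b}, convex hull {b, c}, convex hull {c, a}}" unfolding s(3) .
 have sub: "verts (convex hull V) = V" if "V \<subseteq> verts \<sigma>" for V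
  using affine_independent_subset[OF s(1) that] by (rule verts_convex_hull)
 show "verts (convex hull {a, b}) = {a, b}" "verts (convex hull {b, c}) = {b, c}" "verts (convex hull {c, a}) = {c, a}"
  by (rule sub; simp add: v(1))+
qed

text \<open>Twice the signed area of a triangle in the plane of the substrate.\<close>

definition sarea :: "real^3 \<Rightarrow> real^3 \<Rightarrow> real^3 \<Rightarrow> real" where
 "sarea a b c = nrm_s p \<bullet> cross3 (b - a) (c - a)"

text \<open>The signed area of the quadrilateral swept by a moving edge.\<close>

definition swept_edge :: "real^3 \<Rightarrow> real^3 \<Rightarrow> real" where
 "swept_edge a b = (nrm_s p \<bullet> cross3 ((\<psi> a + \<psi> b) - (a + b)) ((b + \<psi> b) - (a + \<psi> a))) / 4"

text \<open>The sign is that of the orientation of the triangle, so both orders of the end points of \<open>e\<close> contribute the same.\<close>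

definition edge_growth :: "(real^3) set \<Rightarrow> (real^3) set \<Rightarrow> real" where
 "edge_growth \<rho> e = (\<Sum>c\<in>verts \<rho> - verts e. \<Sum>a\<in>verts e. \<Sum>b\<in>verts e. sgn (sarea a b c) * swept_edge a b) / 2"

abbreviation line_growth :: "(real^3) set \<Rightarrow> real" where
 "line_growth e \<equiv> \<Sum>\<rho> | \<rho> \<in> solid_faces M \<and> e facet_of \<rho>. edge_growth \<rho> e"

lemma sarea_swap: "sarea b a c = - sarea a b c" and sarea_rotate: "sarea b c a = sarea a b c"
 by (simp_all add: sarea_def cross3_simps)

lemma swept_edge_swap: "swept_edge b a = - swept_edge a b"
 unfolding swept_edge_def by (simp add: cross3_def inner_vec_def sum_3 field_simps)

lemma swept_edge_same: "swept_edge a a = 0"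
 by (simp add: swept_edge_def)

lemma edge_growth_eq:
 assumes "verts e = {a, b}" "a \<noteq> b" "verts \<rho> = insert c (verts e)" "c \<notin> verts e"
 shows "edge_growth \<rho> e = sgn (sarea a b c) * swept_edge a b"
proof -
 have "verts \<rho> - verts e = {c}" using assms(3,4) by auto
 then show ?thesis unfolding edge_growth_def assms(1) using assms(2)
  by (simp add: swept_edge_same swept_edge_swap[of b a] sarea_swap[of b a] sgn_minus)
qed

text \<open>Summed around a triangle, the terms at the vertices cancel and the change of its signed area remains.\<close>

lemma swept_edges_triangle:
 "swept_edge a b + swept_edge b c + swept_edge c a = (nrm_s p \<bullet> cross3 (\<psi> b - \<psi> a) (\<psi> c - \<psi> a) - sarea a b c) / 2"
proof -
 have "n \<bullet> cross3 ((a' + b') - (a + b)) ((b + b') - (a + a')) + n \<bullet> cross3 ((b' + c') - (b + c)) ((c + c') - (b + b'))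
   + n \<bullet> cross3 ((c' + a') - (c + a)) ((a + a') - (c + c'))
  = 2 * (n \<bullet> cross3 (b' - a') (c' - a')) - 2 * (n \<bullet> cross3 (b - a) (c - a))" for n a' b' c' :: "real^3"
  by (simp add: cross3_def inner_vec_def sum_3 algebra_simps)
 from this[of "nrm_s p" "\<psi> a" "\<psi> b" "\<psi> c"] show ?thesis unfolding swept_edge_def sarea_def by argo
qed

lemma solid_triangle:
 assumes \<rho>: "\<rho> \<in> solid_faces M" and v: "verts \<rho> = {a, b, c}" "a \<noteq> b" "a \<noteq> c" "b \<noteq> c"
 shows "area \<rho> = \<bar>sarea a b c\<bar> / 2" "sarea a b c \<noteq> 0"
  "nrm_s p \<bullet> cross3 (\<psi> b - \<psi> a) (\<psi> c - \<psi> a) = sarea a b c * (cof3 (motion \<rho>) (nrm_s p) \<bullet> nrm_s p)"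
  "nrm_s p \<bullet> (b - a) = 0" "nrm_s p \<bullet> (c - a) = 0"
proof -
 note \<rho>' = solid_boundary[OF \<rho>]
 have orth: "nrm_s p \<bullet> (y - x) = 0" if "x \<in> verts \<rho>" "y \<in> verts \<rho>" for x y
  using face_nrm_orthogonal[OF \<rho>' verts_in_face[OF \<rho>' that(1)] verts_in_face[OF \<rho>' that(2)]] by (simp add: solid_normal[OF \<rho>])
 show o: "nrm_s p \<bullet> (b - a) = 0" "nrm_s p \<bullet> (c - a) = 0" using orth v(1) by auto
 have "norm (cross3 (b - a) (c - a)) = \<bar>sarea a b c\<bar>"
  using arg_cong[OF cross3_plane[OF nrm_s_unit o], of norm] nrm_s_unit by (simp add: sarea_def)
 then show m: "area \<rho> = \<bar>sarea a b c\<bar> / 2"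
  using measure_triangle_cross3[OF _ v(2-4)] boundary_face_simplex(1,3)[OF \<rho>'] v(1) by metis
 then show "sarea a b c \<noteq> 0" using face_measure_pos[OF \<rho>'] by auto
 obtain d where d: "\<And>x. x \<in> cell_of \<rho> \<Longrightarrow> \<psi> x = motion \<rho> x + d" using psi_affine[OF \<rho>'] by blast
 have cellv: "x \<in> cell_of \<rho>" if "x \<in> verts \<rho>" for x using face_in_cell[OF \<rho>'] verts_in_face[OF \<rho>' that] by blast
 have "\<psi> b - \<psi> a = motion \<rho> (b - a)" "\<psi> c - \<psi> a = motion \<rho> (c - a)"
  using d[OF cellv[of a]] d[OF cellv[of b]] d[OF cellv[of c]] v(1)
  by (simp_all add: linear_diff[OF linear_motion_face[OF \<rho>']])
 then show "nrm_s p \<bullet> cross3 (\<psi> b - \<psi> a) (\<psi> c - \<psi> a) = sarea a b c * (cof3 (motion \<rho>) (nrm_s p) \<bullet> nrm_s p)"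
  using cof3_eq[OF nrm_s_unit linear_motion_face[OF \<rho>'] o] by (simp add: sarea_def inner_commute)
qed

lemma solid_face_growth:
 assumes \<rho>: "\<rho> \<in> solid_faces M"
 shows "area (\<psi> ` \<rho>) - area \<rho> = (\<Sum>e | e facet_of \<rho>. edge_growth \<rho> e)"
proof -
 note \<rho>' = solid_boundary[OF \<rho>]
 have "card (verts \<rho>) = 3" using boundary_face_simplex(2)[OF \<rho>'] by simp
 then obtain a b c where v: "verts \<rho> = {a, b, c}" "a \<noteq> b" "a \<noteq> c" "b \<noteq> c" by (auto simp: card_3_iff)
 note t = solid_triangle[OF \<rho> v]
 note ed = sum_edges_of_face[OF \<rho>' v]
 let ?s = "sgn (sarea a b c)"
 have "convex hull {a, b} \<noteq> convex hull {b, c}" "convex hull {a, b} \<noteq> convex hull {c, a}" "convex hull {b, c} \<noteq> convex hull {c, a}"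
  using ed(2-4) v(2-4) by (metis doubleton_eq_iff)+
 then have "(\<Sum>e | e facet_of \<rho>. edge_growth \<rho> e)
  = edge_growth \<rho> (convex hull {a, b}) + (edge_growth \<rho> (convex hull {b, c}) + edge_growth \<rho> (convex hull {c, a}))"
  unfolding ed(1) by simp
 also have "edge_growth \<rho> (convex hull {a, b}) = ?s * swept_edge a b"
  by (rule edge_growth_eq[OF ed(2) v(2)]) (use v in \<open>auto simp: ed(2)\<close>)
 also have "edge_growth \<rho> (convex hull {b, c}) = sgn (sarea b c a) * swept_edge b c"
  by (rule edge_growth_eq[OF ed(3) v(4)]) (use v in \<open>auto simp: ed(3)\<close>)
 also have "edge_growth \<rho> (convex hull {c, a}) = sgn (sarea c a b) * swept_edge c a"
  by (rule edge_growth_eq[OF ed(4) v(3)[symmetric]]) (use v in \<open>auto simp: ed(4)\<close>)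
 also have "sarea c a b = sarea a b c" by (metis sarea_rotate)
 also have "sarea b c a = sarea a b c" by (rule sarea_rotate)
 also have "?s * swept_edge a b + (?s * swept_edge b c + ?s * swept_edge c a) = ?s * (swept_edge a b + swept_edge b c + swept_edge c a)"
  by (simp add: algebra_simps)
 also have "\<dots> = (?s * sarea a b c) * (cof3 (motion \<rho>) (nrm_s p) \<bullet> nrm_s p - 1) / 2"
  unfolding swept_edges_triangle t(3) by (simp add: algebra_simps)
 also have "?s * sarea a b c = \<bar>sarea a b c\<bar>" by (simp add: sgn_if)
 finally show ?thesis unfolding measure_psi_solid[OF \<rho>] t(1) by (simp add: algebra_simps)
qed

text \<open>Two wetted triangles sharing an edge lie on different sides of it.\<close>

lemma opposite_sides:
 assumes \<rho>: "\<rho> \<in> solid_faces M" "\<rho>' \<in> solid_faces M" "\<rho> \<noteq> \<rho>'"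
  and v: "verts \<rho> = {a, b, c}" "a \<noteq> b" "a \<noteq> c" "b \<noteq> c" and v': "verts \<rho>' = {a, b, c'}" "a \<noteq> c'" "b \<noteq> c'"
 shows "sgn (sarea a b c') = - sgn (sarea a b c)"
proof (rule ccontr)
 assume ns: "\<not> ?thesis"
 note B = solid_boundary[OF \<rho>(1)] and B' = solid_boundary[OF \<rho>(2)]
 note t = solid_triangle[OF \<rho>(1) v] and t' = solid_triangle[OF \<rho>(2) v'(1) v(2) v'(2,3)]
 define \<alpha> where "\<alpha> = (nrm_s p \<bullet> cross3 (c' - a) (c - a)) / sarea a b c"
 define \<beta> where "\<beta> = sarea a b c' / sarea a b c"
 have \<beta>: "0 < \<beta>"
 proof -
  have "sgn (sarea a b c') = sgn (sarea a b c)" using ns t(2) t'(2) by (auto simp: sgn_if split: if_splits)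
  then show ?thesis using t(2) t'(2) unfolding \<beta>_def by (auto simp: sgn_if divide_pos_pos divide_neg_neg split: if_splits)
 qed
 have rep: "c' - a = \<alpha> *\<^sub>R (b - a) + \<beta> *\<^sub>R (c - a)"
 proof -
  have "sarea a b c *\<^sub>R (c' - a) = (nrm_s p \<bullet> cross3 (c' - a) (c - a)) *\<^sub>R (b - a) + sarea a b c' *\<^sub>R (c - a)"
   unfolding sarea_def by (rule plane_coordinates[OF t'(5) cross3_plane[OF nrm_s_unit t(4,5)]])
  from arg_cong[OF this, of "\<lambda>y. (1 / sarea a b c) *\<^sub>R y"] show ?thesis
   using t(2) by (simp add: \<alpha>_def \<beta>_def scaleR_add_right)
 qed
 \<comment> \<open>A step \<open>\<epsilon>\<close> from the midpoint towards \<open>c'\<close> small enough to keep all coordinates nonnegative.\<close>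
 define s where "s = 1 + \<bar>\<alpha>\<bar> + \<bar>\<beta>\<bar>"
 define \<epsilon> where "\<epsilon> = 1 / (2 * s)"
 have s0: "0 < s" by (simp add: s_def add_pos_nonneg)
 have \<epsilon>: "0 < \<epsilon>" "\<epsilon> * s = 1/2" using s0 by (simp_all add: \<epsilon>_def)
 have \<epsilon>s: "\<epsilon> + \<epsilon> * \<bar>\<alpha>\<bar> + \<epsilon> * \<bar>\<beta>\<bar> = 1/2" using \<epsilon>(2) by (simp add: s_def algebra_simps)
 have nn: "0 \<le> \<epsilon> * \<bar>\<alpha>\<bar>" "0 \<le> \<epsilon> * \<bar>\<beta>\<bar>" using \<epsilon>(1) by simp_all
 have ab: "- (\<epsilon> * \<bar>\<alpha>\<bar>) \<le> \<epsilon> * \<alpha>" "\<epsilon> * \<alpha> \<le> \<epsilon> * \<bar>\<alpha>\<bar>" "\<epsilon> * \<beta> \<le> \<epsilon> * \<bar>\<beta>\<bar>"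
  using mult_left_mono[of "- \<bar>\<alpha>\<bar>" \<alpha> \<epsilon>] mult_left_mono[of \<alpha> "\<bar>\<alpha>\<bar>" \<epsilon>] mult_left_mono[of \<beta> "\<bar>\<beta>\<bar>" \<epsilon>] \<epsilon>(1) by simp_all
 define y where "y = ((1 - \<epsilon>) / 2) *\<^sub>R a + ((1 - \<epsilon>) / 2) *\<^sub>R b + \<epsilon> *\<^sub>R c'"
 have "\<epsilon> \<le> 1" using \<epsilon>s nn by linarith
 have y': "y \<in> \<rho>'"
 proof -
  have "0 \<le> (1 - \<epsilon>) / 2" "(1 - \<epsilon>) / 2 + (1 - \<epsilon>) / 2 + \<epsilon> = 1" using \<open>\<epsilon> \<le> 1\<close> by simp_all
  then have "y \<in> convex hull {a, b, c'}"
   unfolding convex_hull_3 y_def using \<epsilon>(1) less_imp_le[OF \<epsilon>(1)] by blast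
  then show ?thesis using boundary_face_simplex(3)[OF B'] v'(1) by simp
 qed
 \<comment> \<open>The point \<open>y\<close>, close to the midpoint of the edge, has these coordinates in the first triangle.\<close>
 define wb where "wb = (1 - \<epsilon>) / 2 + \<epsilon> * \<alpha>"
 define wc where "wc = \<epsilon> * \<beta>"
 have y_rep: "y - a = wb *\<^sub>R (b - a) + wc *\<^sub>R (c - a)"
 proof -
  have "y - a = ((1 - \<epsilon>) / 2) *\<^sub>R (b - a) + \<epsilon> *\<^sub>R (c' - a)"
   by (simp add: y_def vec_eq_iff field_simps)
  then show ?thesis unfolding rep wb_def wc_def by (simp add: algebra_simps)
 qed
 have wc: "0 < wc" using \<epsilon>(1) \<beta> by (simp add: wc_def)
 have wb: "0 \<le> wb" and wa: "0 \<le> 1 - wb - wc"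
  using ab nn \<epsilon>s \<epsilon>(1) unfolding wb_def wc_def by argo+
 have "y = (1 - wb - wc) *\<^sub>R a + wb *\<^sub>R b + wc *\<^sub>R c" using y_rep by (simp add: algebra_simps)
 moreover have "1 - wb - wc + wb + wc = 1" by simp
 ultimately have "y \<in> convex hull {a, b, c}"
  unfolding convex_hull_3 using wa wb less_imp_le[OF wc] by blast
 then have y: "y \<in> \<rho>" using boundary_face_simplex(3)[OF B] v(1) by simp
 have "\<rho> \<inter> \<rho>' face_of convex hull {a, b, c}"
  using boundary_faces_Int(1)[OF B B'] boundary_face_simplex(3)[OF B] v(1) by simp
 then obtain S where S: "S \<subseteq> {a, b, c}" "\<rho> \<inter> \<rho>' = convex hull S"
  using face_of_convex_hull_affine_independent[of "{a, b, c}" "\<rho> \<inter> \<rho>'"] boundary_face_simplex(1)[OF B] v(1) by auto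
 have "c \<in> S"
 proof (rule ccontr)
  assume "c \<notin> S"
  then have "convex hull S \<subseteq> convex hull {a, b}" using S(1) by (intro hull_mono) auto
  then have "y \<in> closed_segment a b" using y y' S(2) by (auto simp: segment_convex_hull)
  then obtain u where "y = (1 - u) *\<^sub>R a + u *\<^sub>R b" unfolding closed_segment_def by blast
  then have "y - a = u *\<^sub>R (b - a)" by (simp add: algebra_simps)
  then have "nrm_s p \<bullet> cross3 (b - a) (y - a) = 0" by (simp add: cross_mult_right)
  moreover have "nrm_s p \<bullet> cross3 (b - a) (y - a) = wc * sarea a b c"
   unfolding y_rep by (simp add: cross_add_right cross_mult_right sarea_def)
  ultimately show False using wc t(2) by simp
 qed
 then have "c \<in> \<rho>'" using S(2) hull_inc[of c S convex] by auto
 then have "{a, b, c} \<subseteq> \<rho>'" using verts_in_face[OF B', of a] verts_in_face[OF B', of b] v'(1) by auto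
 moreover have "convex \<rho>'" using convex_convex_hull[of "verts \<rho>'"] unfolding boundary_face_simplex(3)[OF B'] .
 ultimately have "\<rho> \<subseteq> \<rho>'" using hull_minimal[of "{a, b, c}" \<rho>' convex] boundary_face_simplex(3)[OF B] v(1) by simp
 then show False using boundary_face_subset_eq[OF B B'] \<rho>(3) by blast
qed


lemma contact_edge:
 assumes e: "e \<in> contact_edges M"
 obtains \<rho> \<sigma> a b c where "\<rho> \<in> solid_faces M" "e facet_of \<rho>" "\<sigma> \<in> free_faces M" "e facet_of \<sigma>"
  "verts e = {a, b}" "a \<noteq> b" "a \<noteq> c" "b \<noteq> c" "verts \<rho> = {a, b, c}" "0 < sarea a b c" "e = closed_segment a b"
  "{\<rho>. \<rho> \<in> solid_faces M \<and> e facet_of \<rho>} = {\<rho>}"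
proof -
 obtain \<sigma> \<rho> where \<sigma>: "\<sigma> \<in> free_faces M" "e facet_of \<sigma>" and \<rho>: "\<rho> \<in> solid_faces M" "e facet_of \<rho>"
  using e unfolding contact_edges_def by blast
 obtain c where c: "verts \<rho> = insert c (verts e)" "c \<notin> verts e" "card (verts e) = 2" "e = convex hull (verts e)"
  using edge_of_face[OF solid_boundary[OF \<rho>(1)] \<rho>(2)] by blast
 obtain a b where ab: "verts e = {a, b}" "a \<noteq> b" using c(3) by (auto simp: card_2_iff)
 have v: "verts \<rho> = {a, b, c}" "a \<noteq> c" "b \<noteq> c" using c(1,2) ab(1) by auto
 have u: "{\<rho>. \<rho> \<in> solid_faces M \<and> e facet_of \<rho>} = {\<rho>}" using unique_solid[OF e] \<rho> by blast
 have seg: "e = closed_segment a b" using c(4) ab(1) by (simp add: segment_convex_hull)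
 show ?thesis
 proof (cases "0 < sarea a b c")
  case True
  show ?thesis by (rule that[OF \<rho> \<sigma> ab v(2,3,1) True seg u])
 next
  case False
  then have "0 < sarea b a c" using solid_triangle(2)[OF \<rho>(1) v(1) ab(2) v(2,3)] sarea_swap[of b a c] by simp
  moreover have "verts e = {b, a}" "verts \<rho> = {b, a, c}" "e = closed_segment b a" using ab(1) v(1) seg by (auto simp: closed_segment_commute)
  ultimately show ?thesis using that[OF \<rho> \<sigma> _ ab(2)[symmetric] v(3,2) _ _ _ u] by blast
 qed
qed

text \<open>Without a free face at \<open>e\<close> the number of wetted triangles at \<open>e\<close> is even, and there cannot be three
of them since any two lie on opposite sides.\<close>

lemma solid_faces_at_inner_edge:
 assumes e: "e \<notin> contact_edges M" and \<rho>: "\<rho> \<in> solid_faces M" "e facet_of \<rho>"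
 shows "line_growth e = 0"
proof -
 let ?F = "{\<rho>. \<rho> \<in> solid_faces M \<and> e facet_of \<rho>}"
 have finF: "finite ?F" using finite_faces(2) by simp
 have "{\<sigma> \<in> bdry. e facet_of \<sigma>} = ?F"
  using e \<rho> unfolding contact_edges_def faces(1)[symmetric] by blast
 then have ev: "even (card ?F)" using even_boundary_faces_at_ridge[of e] by simp
 obtain c0 where c0: "verts \<rho> = insert c0 (verts e)" "c0 \<notin> verts e" "card (verts e) = 2" "e = convex hull (verts e)"
  by (rule edge_of_face[OF solid_boundary[OF \<rho>(1)] \<rho>(2)])
 obtain a b where ab: "verts e = {a, b}" "a \<noteq> b" using c0(3) by (auto simp: card_2_iff)
 \<comment> \<open>The vertex opposite to the edge.\<close>
 define third where "third \<rho> = (THE c. c \<in> verts \<rho> - verts e)" for \<rho>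
 have third: "verts \<rho> = {a, b, third \<rho>}" "a \<noteq> third \<rho>" "b \<noteq> third \<rho>"
   "edge_growth \<rho> e = sgn (sarea a b (third \<rho>)) * swept_edge a b" "sarea a b (third \<rho>) \<noteq> 0"
  if \<rho>: "\<rho> \<in> ?F" for \<rho>
 proof -
  have \<rho>': "\<rho> \<in> solid_faces M" "e facet_of \<rho>" using \<rho> by simp_all
  obtain c where c: "verts \<rho> = insert c (verts e)" "c \<notin> verts e" "card (verts e) = 2" "e = convex hull (verts e)"
   by (rule edge_of_face[OF solid_boundary[OF \<rho>'(1)] \<rho>'(2)])
  have "verts \<rho> - verts e = {c}" using c(1,2) by blast
  then have tc: "third \<rho> = c" by (simp add: third_def)
  then show 1: "verts \<rho> = {a, b, third \<rho>}" "a \<noteq> third \<rho>" "b \<noteq> third \<rho>" using c(1,2) ab unfolding tc by auto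
  show "edge_growth \<rho> e = sgn (sarea a b (third \<rho>)) * swept_edge a b"
   unfolding tc by (rule edge_growth_eq[OF ab c(1,2)])
  show "sarea a b (third \<rho>) \<noteq> 0" by (rule solid_triangle(2)[OF \<rho>'(1) 1(1) ab(2) 1(2,3)])
 qed
 have anti: "sgn (sarea a b (third \<rho>2)) = - sgn (sarea a b (third \<rho>1))" if "\<rho>1 \<in> ?F" "\<rho>2 \<in> ?F" "\<rho>1 \<noteq> \<rho>2" for \<rho>1 \<rho>2
  using opposite_sides[OF _ _ that(3) third(1)[OF that(1)] ab(2) third(2,3)[OF that(1)] third(1)[OF that(2)] third(2,3)[OF that(2)]] that
  by blast
 have le2: "card ?F \<le> 2"
 proof (rule ccontr)
  assume "\<not> card ?F \<le> 2"
  then have "3 \<le> card ?F" by simp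
  then obtain G where G: "G \<subseteq> ?F" "card G = 3" "finite G" by (rule obtain_subset_with_card_n)
  obtain x y z where xyz: "G = {x, y, z}" and ne: "x \<noteq> y" "x \<noteq> z" "y \<noteq> z" using G(2) unfolding card_3_iff by blast
  have "x \<in> ?F" "y \<in> ?F" "z \<in> ?F" using G(1) unfolding xyz by blast+
  with ne have "sgn (sarea a b (third x)) = 0" using anti[of x y] anti[of x z] anti[of y z] by simp
  then show False using third(5)[OF \<open>x \<in> ?F\<close>] by (simp add: sgn_0_0)
 qed
 have "card ?F \<noteq> 0" using \<rho> finF by auto
 then have "card ?F = 2" using le2 ev by (cases "card ?F = 1") auto
 then obtain x y where xy: "?F = {x, y}" "x \<noteq> y" by (auto simp: card_2_iff)
 then have "x \<in> ?F" "y \<in> ?F" by auto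
 then have "edge_growth x e + edge_growth y e = 0" using third(4)[of x] third(4)[of y] anti[of x y] xy(2) by simp
 then show ?thesis unfolding xy(1) using xy(2) by simp
qed

lemma solid_area_growth_edges:
 "area (solid_surface M') - area (solid_surface M)
  = (\<Sum>e\<in>contact_edges M. line_growth e)"
proof -
 define Ed where "Ed = (\<Union>\<rho>\<in>solid_faces M. {e. e facet_of \<rho>})"
 have fin: "finite {e. e facet_of \<rho>}" if "\<rho> \<in> solid_faces M" for \<rho>
  using finite_polyhedron_facets polytope_imp_polyhedron polytope_convex_hull
   boundary_face_simplex(3,4)[OF solid_boundary[OF that]] by metis
 then have finE: "finite Ed" using finite_faces(2) by (simp add: Ed_def)
 have "area (solid_surface M') - area (solid_surface M)
  = (\<Sum>\<rho>\<in>solid_faces M. \<Sum>e | e facet_of \<rho>. edge_growth \<rho> e)"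
  unfolding solid_area_growth by (rule sum.cong[OF refl solid_face_growth])
 also have "\<dots> = (\<Sum>\<rho>\<in>solid_faces M. \<Sum>e | e \<in> Ed \<and> e facet_of \<rho>. edge_growth \<rho> e)"
  by (intro sum.cong refl) (auto simp: Ed_def)
 also have "\<dots> = (\<Sum>e\<in>Ed. line_growth e)"
  by (rule sum.swap_restrict[OF finite_faces(2) finE])
 also have "\<dots> = (\<Sum>e\<in>contact_edges M. line_growth e)"
 proof (rule sum.mono_neutral_right[OF finE])
  show "contact_edges M \<subseteq> Ed" by (auto simp: contact_edges_def Ed_def)
  show "\<forall>e\<in>Ed - contact_edges M. line_growth e = 0"
   using solid_faces_at_inner_edge unfolding Ed_def by blast
 qed
 finally show ?thesis .
qed

text \<open>
 The averaged conormal of a contact edge, integrated against the velocity, is exactly the area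
 swept by the edge: both are the same quadratic expression in the end points.
\<close>

lemma contact_edge_integral:
 assumes e: "e \<in> contact_edges M"
 shows "(LINT x:e|hausdorff 1. (\<gamma> *\<^sub>R mu3_half p M wt e x - (\<delta> * (wt x \<bullet> mu3 p M e)) *\<^sub>R mu3 p M e + s *\<^sub>R nrm_s p) \<bullet> wt x) * tau p
  = \<gamma> * line_growth e
   - tau p * \<delta> * (LINT x:e|hausdorff 1. (wt x \<bullet> mu3 p M e)\<^sup>2)"
proof -
 obtain \<rho> \<sigma> a b c where \<rho>: "\<rho> \<in> solid_faces M" "e facet_of \<rho>" and \<sigma>: "\<sigma> \<in> free_faces M" "e facet_of \<sigma>"
  and v: "verts e = {a, b}" "a \<noteq> b" "a \<noteq> c" "b \<noteq> c" "verts \<rho> = {a, b, c}" and pos: "0 < sarea a b c"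
  and seg: "e = closed_segment a b" and F: "{\<rho>. \<rho> \<in> solid_faces M \<and> e facet_of \<rho>} = {\<rho>}"
  by (rule contact_edge[OF e])
 note B = solid_boundary[OF \<rho>(1)]
 let ?n = "nrm_s p"
 have es: "e \<subseteq> \<sigma>" "e \<subseteq> \<rho>" using facet_of_imp_subset \<sigma>(2) \<rho>(2) by blast+
 have wn: "w x = wt x" "wt x \<bullet> ?n = 0" if x: "x \<in> e" for x
 proof -
  have "x \<in> \<sigma>" "x \<in> \<rho>" using x es by blast+
  note * = contact_point[OF this(1) \<sigma>(1) this(2) \<rho>(1)]
  show "w x = wt x" "wt x \<bullet> ?n = 0" by (rule *(1), rule *(2))
 qed
 have abe: "a \<in> e" "b \<in> e" unfolding seg by simp_all
 define l where "l = norm (b - a)"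
 have l: "0 < l" using v(2) by (simp add: l_def)
 define t where "t = (1 / l) *\<^sub>R (b - a)"
 have lt: "l *\<^sub>R t = b - a" using l by (simp add: t_def)
 have on_e: "y - x = (v - u) *\<^sub>R (b - a)" if "x = (1 - u) *\<^sub>R a + u *\<^sub>R b" "y = (1 - v) *\<^sub>R a + v *\<^sub>R b" for x y u v
  unfolding that by (simp add: algebra_simps)
 have par: "\<exists>c. y - x = c *\<^sub>R (b - a)" if "x \<in> e" "y \<in> e" for x y
  using that on_e unfolding seg closed_segment_def by blast
 have outw: "cross3 t ?n \<bullet> (y - x) \<le> 0" if x: "x \<in> e" and y: "y \<in> \<rho>" for x y
 proof -
  have "y \<in> convex hull {a, b, c}" using y boundary_face_simplex(3)[OF B] v(5) by simp
  then obtain r1 r2 r3 where r: "0 \<le> r3" "r1 + r2 + r3 = 1" "y = r1 *\<^sub>R a + r2 *\<^sub>R b + r3 *\<^sub>R c"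
   unfolding convex_hull_3 by blast
  have ya: "y - a = r2 *\<^sub>R (b - a) + r3 *\<^sub>R (c - a)"
  proof -
   have r1: "r1 = 1 - r2 - r3" using r(2) by simp
   show ?thesis unfolding r(3) r1 by (simp add: algebra_simps)
  qed
  obtain q where ax: "a - x = q *\<^sub>R (b - a)" using par[OF x abe(1)] by blast
  have "y - x = (y - a) + (a - x)" by simp
  then have yx: "y - x = (r2 + q) *\<^sub>R (b - a) + r3 *\<^sub>R (c - a)"
   unfolding ya ax by (simp add: scaleR_add_left)
  have "cross3 t ?n \<bullet> (y - x) = - (?n \<bullet> cross3 t (y - x))" by (simp add: cross3_simps)
  also have "?n \<bullet> cross3 t (y - x) = (r3 / l) * sarea a b c"
   unfolding yx t_def sarea_def by (simp add: cross_add_right cross_mult_left cross_mult_right)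
  finally show ?thesis using r(1) l pos by simp
 qed
 have tang: "tangent3 p M e = t"
  unfolding tangent3_def
 proof (rule the_equality)
  have "norm t = 1" using l by (simp add: t_def l_def)
  moreover have "\<exists>c. y - x = c *\<^sub>R t" if "x \<in> e" "y \<in> e" for x y
  proof -
   obtain c where "y - x = c *\<^sub>R (b - a)" using par[OF \<open>x \<in> e\<close> \<open>y \<in> e\<close>] by blast
   then have "y - x = (c * l) *\<^sub>R t" unfolding lt[symmetric] by simp
   then show ?thesis by blast
  qed
  moreover have "cross3 t ?n \<bullet> (y - x) \<le> 0" if "\<rho>' \<in> solid_faces M" "e facet_of \<rho>'" "x \<in> e" "y \<in> \<rho>'" for \<rho>' x y
   proof -
   have "\<rho>' \<in> {\<rho>}" unfolding F[symmetric] using that(1,2) by simp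
   then show ?thesis using outw[OF that(3)] that(4) by simp
  qed
  ultimately show "norm t = 1 \<and> (\<forall>x\<in>e. \<forall>y\<in>e. \<exists>c. y - x = c *\<^sub>R t) \<and>
   (\<forall>\<rho>\<in>solid_faces M. e facet_of \<rho> \<longrightarrow> (\<forall>x\<in>e. \<forall>y\<in>\<rho>. cross3 t ?n \<bullet> (y - x) \<le> 0))" by blast
 next
  fix t' assume t': "norm t' = 1 \<and> (\<forall>x\<in>e. \<forall>y\<in>e. \<exists>c. y - x = c *\<^sub>R t') \<and>
   (\<forall>\<rho>\<in>solid_faces M. e facet_of \<rho> \<longrightarrow> (\<forall>x\<in>e. \<forall>y\<in>\<rho>. cross3 t' ?n \<bullet> (y - x) \<le> 0))"
  then obtain q where q: "b - a = q *\<^sub>R t'" using abe by blast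
  have "l = \<bar>q\<bar>" using arg_cong[OF q, of norm] t' by (simp add: l_def)
  then consider "q = l" | "q = - l" by linarith
  then show "t' = t"
  proof cases
   case 1
   then show ?thesis using q l by (simp add: t_def)
  next
   case 2
   then have t'': "t' = - t" using q l by (simp add: t_def)
   have "c \<in> \<rho>" using verts_in_face[OF B, of c] v(5) by simp
   then have "cross3 t' ?n \<bullet> (c - a) \<le> 0" using t' \<rho> abe(1) by blast
   moreover have "cross3 (- t) ?n \<bullet> y = ?n \<bullet> cross3 t y" for y by (simp add: cross3_simps)
   then have "cross3 t' ?n \<bullet> (c - a) = sarea a b c / l"
    unfolding t'' by (simp add: t_def sarea_def cross_mult_left)
   ultimately show ?thesis using pos l by (simp add: divide_le_0_iff)
  qed
 qed
 have K: "cell_of \<rho> \<in> cells M" by (rule cell_of(1)[OF B])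
 have eT: "e \<subseteq> cell_of \<rho>" using es(2) face_in_cell[OF B] by blast
 obtain d where d: "\<And>x. x \<in> cell_of \<rho> \<Longrightarrow> \<psi> x = motion \<rho> x + d" using psi_affine[OF B] by blast
 have cv: "convex e" unfolding seg by simp
 define \<nu> where "\<nu> = cross3 ((1/2) *\<^sub>R (t + motion \<rho> t)) ?n"
 have \<nu>: "mu3_half p M wt e x = \<nu>" if x: "x \<in> e" for x
 proof -
  have "(motion \<rho> has_derivative motion \<rho>) (at x within e)"
   using linear_motion_face[OF B] by (simp add: linear_imp_has_derivative)
  then have "((\<lambda>y. motion \<rho> y + d) has_derivative motion \<rho>) (at x within e)"
   by (auto intro!: derivative_eq_intros)
  then have D: "((\<lambda>y. y + tau p *\<^sub>R wt y) has_derivative motion \<rho>) (at x within e)"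
  proof (rule has_derivative_transform[OF x, rotated])
   fix y assume y: "y \<in> e"
   show "y + tau p *\<^sub>R wt y = motion \<rho> y + d" using d[of y] eT y wn(1)[OF y] by auto
  qed
  have "b - x \<in> span ((\<lambda>y. y - x) ` e)" "a - x \<in> span ((\<lambda>y. y - x) ` e)" using abe by (auto intro: span_base)
  then have "t \<in> span ((\<lambda>y. y - x) ` e)" unfolding t_def using span_diff[of "b - x" _ "a - x"] by (intro span_scale) simp
  then have "move_deriv wt (tau p) e x t = motion \<rho> t"
   by (rule frechet_derivative_within_convex[OF cv x D])
  then show ?thesis unfolding mu3_half_def tang \<nu>_def by simp
 qed
 let ?\<mu> = "mu3 p M e"
 have w1: "P1_on e (\<lambda>x. w x \<bullet> z)" for z
  by (rule P1_on_inner, rule P1_on_subset[OF w_P1[OF K] eT])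
 have es': "e \<in> sets (hausdorff 1)" unfolding seg by simp
 have q: "(LINT x:e|hausdorff 1. g x) = l * quad_avg {a, b} g" if "P2_on e g" for g
  using hausdorff_segment(2)[OF v(2), of g] hausdorff_segment(1)[OF v(2)] that unfolding seg l_def by (simp add: dist_norm norm_minus_commute)
 have I2: "(LINT x:e|hausdorff 1. (wt x \<bullet> ?\<mu>)\<^sup>2) = l * quad_avg {a, b} (\<lambda>x. (w x \<bullet> ?\<mu>) * (w x \<bullet> ?\<mu>))"
 proof -
  have "(LINT x:e|hausdorff 1. (wt x \<bullet> ?\<mu>)\<^sup>2) = (LINT x:e|hausdorff 1. (w x \<bullet> ?\<mu>) * (w x \<bullet> ?\<mu>))"
   using es' wn(1) by (intro set_lebesgue_integral_cong) (auto simp: power2_eq_square)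
  then show ?thesis using q[OF P2_on_mult[OF w1 w1]] by simp
 qed
 have "(LINT x:e|hausdorff 1. (\<gamma> *\<^sub>R mu3_half p M wt e x - (\<delta> * (wt x \<bullet> ?\<mu>)) *\<^sub>R ?\<mu> + s *\<^sub>R ?n) \<bullet> wt x)
  = (LINT x:e|hausdorff 1. \<gamma> * (w x \<bullet> \<nu>) + (- \<delta>) * ((w x \<bullet> ?\<mu>) * (w x \<bullet> ?\<mu>)))"
 proof (rule set_lebesgue_integral_cong[OF es'], intro allI impI)
  fix x assume x: "x \<in> e"
  show "(\<gamma> *\<^sub>R mu3_half p M wt e x - (\<delta> * (wt x \<bullet> ?\<mu>)) *\<^sub>R ?\<mu> + s *\<^sub>R ?n) \<bullet> wt x
   = \<gamma> * (w x \<bullet> \<nu>) + (- \<delta>) * ((w x \<bullet> ?\<mu>) * (w x \<bullet> ?\<mu>))"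
   unfolding \<nu>[OF x] wn(1)[OF x] using wn(2)[OF x]
   by (simp add: inner_add_left inner_diff_left inner_add_right inner_diff_right inner_commute[of _ "wt x"])
 qed
 also have "\<dots> = l * quad_avg {a, b} (\<lambda>x. \<gamma> * (w x \<bullet> \<nu>) + (- \<delta>) * ((w x \<bullet> ?\<mu>) * (w x \<bullet> ?\<mu>)))"
  by (rule q, intro P2_on_add P2_on_cmult P2_on_mult w1 P2_on_P1)
 also have "\<dots> = l * (\<gamma> * quad_avg {a, b} (\<lambda>x. w x \<bullet> \<nu>) - \<delta> * quad_avg {a, b} (\<lambda>x. (w x \<bullet> ?\<mu>) * (w x \<bullet> ?\<mu>)))"
  unfolding quad_avg_add quad_avg_cmult by simp
 also have "quad_avg {a, b} (\<lambda>x. w x \<bullet> \<nu>) = (w a \<bullet> \<nu> + w b \<bullet> \<nu>) / 2"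
 proof -
  have "P1_on (convex hull {a, b}) (\<lambda>x. w x \<bullet> \<nu>)" using w1[of \<nu>] unfolding seg segment_convex_hull .
  from quad_avg_P1[OF _ _ this] show ?thesis using v(2) by simp
 qed
 finally have I: "(LINT x:e|hausdorff 1. (\<gamma> *\<^sub>R mu3_half p M wt e x - (\<delta> * (wt x \<bullet> ?\<mu>)) *\<^sub>R ?\<mu> + s *\<^sub>R ?n) \<bullet> wt x)
  = l * (\<gamma> * ((w a \<bullet> \<nu> + w b \<bullet> \<nu>) / 2) - \<delta> * quad_avg {a, b} (\<lambda>x. (w x \<bullet> ?\<mu>) * (w x \<bullet> ?\<mu>)))" .
 have geo: "tau p * l * ((w a \<bullet> \<nu> + w b \<bullet> \<nu>) / 2) = swept_edge a b"
 proof -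
  have ab: "a \<in> cell_of \<rho>" "b \<in> cell_of \<rho>" using eT abe by blast+
  have "\<psi> b - \<psi> a = motion \<rho> (b - a)"
   unfolding d[OF ab(1)] d[OF ab(2)] linear_diff[OF linear_motion_face[OF B]] by simp
  also have "\<dots> = l *\<^sub>R motion \<rho> t" unfolding lt[symmetric] by (rule linear_scale[OF linear_motion_face[OF B]])
  finally have "(b + \<psi> b) - (a + \<psi> a) = l *\<^sub>R (t + motion \<rho> t)" using lt by (simp add: algebra_simps)
  moreover have "(\<psi> a + \<psi> b) - (a + b) = tau p *\<^sub>R (w a + w b)" by (simp add: algebra_simps)
  moreover have "?n \<bullet> cross3 y x = y \<bullet> cross3 x ?n" for x y by (simp add: cross3_simps)
  ultimately have "swept_edge a b = (tau p *\<^sub>R (w a + w b)) \<bullet> cross3 (l *\<^sub>R (t + motion \<rho> t)) ?n / 4"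
   unfolding swept_edge_def by simp
  also have "cross3 (l *\<^sub>R (t + motion \<rho> t)) ?n = (2 * l) *\<^sub>R \<nu>" by (simp add: \<nu>_def cross_mult_left)
  finally show ?thesis by (simp add: inner_add_left algebra_simps)
 qed
 have cv': "verts \<rho> = insert c (verts e)" "c \<notin> verts e" using v by auto
 have "line_growth e = swept_edge a b"
  unfolding F using edge_growth_eq[OF v(1,2) cv'] pos by simp
 then show ?thesis unfolding I I2 geo[symmetric] by (simp add: algebra_simps)
qed

lemma contact_line_growth:
 "tau p * surf_int 1 (contact_edges M) (\<lambda>e x. (\<gamma> *\<^sub>R mu3_half p M wt e x - (\<delta> * (wt x \<bullet> mu3 p M e)) *\<^sub>R mu3 p M e
   + s e *\<^sub>R nrm_s p) \<bullet> wt x)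
  = \<gamma> * (area (solid_surface M') - area (solid_surface M))
   - tau p * \<delta> * contact_norm_sq3 p M wt"
proof -
 let ?I = "\<lambda>e. LINT x:e|hausdorff 1. (\<gamma> *\<^sub>R mu3_half p M wt e x - (\<delta> * (wt x \<bullet> mu3 p M e)) *\<^sub>R mu3 p M e
   + s e *\<^sub>R nrm_s p) \<bullet> wt x"
 let ?G = "\<lambda>e. line_growth e"
 let ?Q = "\<lambda>e. LINT x:e|hausdorff 1. (wt x \<bullet> mu3 p M e)\<^sup>2"
 have "tau p * (\<Sum>e\<in>contact_edges M. ?I e) = (\<Sum>e\<in>contact_edges M. ?I e * tau p)"
  by (simp only: sum_distrib_left mult.commute)
 also have "\<dots> = (\<Sum>e\<in>contact_edges M. \<gamma> * ?G e - tau p * \<delta> * ?Q e)"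
  by (rule sum.cong[OF refl contact_edge_integral])
 also have "\<dots> = \<gamma> * (\<Sum>e\<in>contact_edges M. ?G e) - tau p * \<delta> * (\<Sum>e\<in>contact_edges M. ?Q e)"
  unfolding sum_subtractf sum_distrib_left[of _ ?G] sum_distrib_left[of _ ?Q] ..
 finally show ?thesis
  unfolding solid_area_growth_edges contact_norm_sq3_def surf_int_def .
qed

end

section \<open>The energy law\<close>

lemma valid_mesh_complex: "valid_mesh p M \<Longrightarrow> cell_complex (cells M)"
 by (simp add: valid_mesh_def cell_complex_def)

lemma velocity_continuous:
 fixes u :: "real^'n \<Rightarrow> real^'n"
 assumes "u \<in> velocity_space M" shows "continuous_on (domain M) u"
 by (rule continuous_on_components) (use S2D(2)[OF S2v_component] assms in \<open>auto simp: domain_def velocity_space_def\<close>)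

lemma compact_domain: "valid_mesh p M \<Longrightarrow> compact (domain M)"
 unfolding domain_def using cell_complex.finite_K[OF valid_mesh_complex] cell_complex.compact_cell[OF valid_mesh_complex]
 by (intro compact_Union) auto

lemma psi_continuous:
 assumes "bulk_extension p M wt w" shows "continuous_on (domain M) (\<lambda>x. x + tau p *\<^sub>R w x)"
proof -
 have w: "w \<in> S1v (cells M)" using assms by (simp add: bulk_extension_def mesh_velocity_space_def)
 have "continuous_on (domain M) w"
  by (rule continuous_on_components) (use S1D(2)[OF S1v_component[OF w]] in \<open>simp add: domain_def\<close>)
 then show ?thesis by (intro continuous_intros)
qed

text \<open>The data of the previous level are continuous on a compact domain; for the first step that domain is the initial one.\<close>

lemma previous_level:
 fixes E :: "(real^'n, 'z) evolution_scheme"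
 assumes init: "initial_ok v0 E" and valid: "\<And>j. j \<le> m \<Longrightarrow> valid_mesh p (msh E j)"
  and u: "\<And>j. j \<le> m \<Longrightarrow> vel E (Suc j) \<in> velocity_space (msh E j)"
  and mot: "\<And>j. j < m \<Longrightarrow> mesh_motion p E j"
 shows "compact (domain (msh E (m - 1)))" "continuous_on (domain (msh E (m - 1))) (vel E m)"
  "continuous_on (domain (msh E (m - 1))) (vel E (Suc m) \<circ> psi p E m)"
proof -
 show "compact (domain (msh E (m - 1)))" by (rule compact_domain[OF valid]) simp
 have um: "continuous_on (domain (msh E m)) (vel E (Suc m))" by (rule velocity_continuous[OF u[OF order_refl]])
 show "continuous_on (domain (msh E (m - 1))) (vel E m)"
 proof (cases m)
  case 0
  then show ?thesis using init velocity_continuous[of "vel E 0" "msh E 0"] by (simp add: initial_ok_def)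
 next
  case (Suc j)
  then show ?thesis using velocity_continuous[OF u[of j]] by simp
 qed
 show "continuous_on (domain (msh E (m - 1))) (vel E (Suc m) \<circ> psi p E m)"
 proof (cases m)
  case 0
  then have "vel E (Suc m) \<circ> psi p E m = vel E (Suc m)" using init by (simp add: initial_ok_def psi_def fun_eq_iff)
  then show ?thesis using um 0 by simp
 next
  case (Suc j)
  have mj: "mesh_motion p E j" using mot Suc by simp
  have ps: "psi p E m = (\<lambda>x. x + tau p *\<^sub>R bulk_vel E m x)" by (simp add: psi_def fun_eq_iff)
  have c: "continuous_on (domain (msh E j)) (psi p E m)"
   unfolding ps by (rule psi_continuous) (use mj Suc in \<open>auto simp: mesh_motion_def\<close>)
  have "msh E m = map_mesh (psi p E m) (msh E j)" using mj Suc by (simp add: mesh_motion_def)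
  then have im: "psi p E m ` domain (msh E j) = domain (msh E m)" by (auto simp: map_mesh_def domain_def)
  have j: "m - 1 = j" using Suc by simp
  show ?thesis unfolding j by (rule continuous_on_compose[OF c]) (simp only: im um)
 qed
qed

lemma mesh_motion_step:
 assumes "params_ok p" "mesh_motion p E m" "valid_mesh p (msh E m)" "valid_mesh p (msh E (Suc m))"
 shows "mesh_step_axioms p (msh E m) (free_vel E (Suc m)) (bulk_vel E (Suc m))"
  and "msh E (Suc m) = map_mesh (\<lambda>x. x + tau p *\<^sub>R bulk_vel E (Suc m) x) (msh E m)"
proof -
 have "psi p E (Suc m) = (\<lambda>x. x + tau p *\<^sub>R bulk_vel E (Suc m) x)" by (simp add: psi_def fun_eq_iff)
 then show *: "msh E (Suc m) = map_mesh (\<lambda>x. x + tau p *\<^sub>R bulk_vel E (Suc m) x) (msh E m)"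
  using assms(2) by (simp add: mesh_motion_def)
 show "mesh_step_axioms p (msh E m) (free_vel E (Suc m)) (bulk_vel E (Suc m))"
  using assms unfolding * by (intro mesh_step_axioms.intro) (auto simp: mesh_motion_def)
qed

text \<open>In the plane the scaled normal is affine in time, so its mean is its value at the midpoint.\<close>

lemma (in mesh_step2) nhat2_mean:
 assumes \<sigma>: "\<sigma> \<in> free_faces M" and x: "x \<in> \<sigma>"
 shows "nhat2 p M wt \<sigma> (1/2) x = swept (\<lambda>y. 1) (tau p) wt \<sigma> (face_nrm M \<sigma>) x"
proof -
 let ?n = "face_nrm M \<sigma>"
 note \<sigma>' = free_boundary[OF \<sigma>]
 define A where "A = rot90 (- rot90 ?n)"
 define B where "B = rot90 (grad_w \<sigma> (- rot90 ?n))"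
 note w = w_free_face[OF \<sigma>]
 have D: "move_deriv wt s \<sigma> x = move_deriv w s \<sigma> x" for s
  by (rule frechet_derivative_cong_on[OF x]) (simp add: w)
 have c: "cof2 (move_deriv wt s \<sigma> x) ?n = A + s *\<^sub>R B" for s
  unfolding D face_nrm_def face_motion(1)[OF \<sigma>' x] unfolding A_def B_def cof2_def face_nrm_def
  by (simp add: linear_add[OF linear_rot90] linear_neg[OF linear_rot90] linear_diff[OF linear_rot90] linear_scale[OF linear_rot90])
 have "((\<lambda>\<theta>::real. \<theta>) has_integral 1/2) {0..1}" using ident_has_integral[of 0 "1::real"] by simp
 then have "((\<lambda>\<theta>. (tau p * \<theta>) *\<^sub>R B) has_integral (tau p * (1/2)) *\<^sub>R B) {0..1}"
  by (intro has_integral_scaleR_left has_integral_mult_right)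
 moreover have "((\<lambda>\<theta>::real. A) has_integral A) {0..1}" using has_integral_const_real[of A 0 1] by simp
 ultimately have "((\<lambda>\<theta>. A + (tau p * \<theta>) *\<^sub>R B) has_integral A + (tau p * (1/2)) *\<^sub>R B) {0..1}"
  by (intro has_integral_add)
 then have "swept (\<lambda>y. 1) (tau p) wt \<sigma> ?n x = A + (tau p * (1/2)) *\<^sub>R B"
  unfolding swept_def c by (simp add: integral_unique)
 then show ?thesis unfolding nhat2_cof interp_pos_def[abs_def] c by simp
qed

lemma (in mesh_step3) ntilde3_mean: "ntilde3 p M wt \<sigma> x = swept (\<lambda>y. 1) (tau p) wt \<sigma> (face_nrm M \<sigma>) x"
 unfolding ntilde3_def swept_def nhat3_cof interp_pos_def[abs_def] by simp

theorem energy_law_2: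
 assumes sol: "solution2 p v0 E N" and m: "m < N"
 shows "mesh_volume (msh E (Suc m)) = mesh_volume (msh E m)"
  and "energy p E (Suc m) - energy p E m
   \<le> - bulk_dissipation p E m - tau p * beta_c p * contact_norm_sq2 (msh E m) (free_vel E (Suc m))"
proof -
 define M where "M = msh E m"
 define wt where "wt = free_vel E (Suc m)"
 define w where "w = bulk_vel E (Suc m)"
 have ok: "params_ok p" and ev: "e_vert p = vector [0, 1]" "nrm_s p \<in> {e_vert p, - e_vert p}" and init: "initial_ok v0 E"
  and val: "\<And>j. j \<le> N \<Longrightarrow> valid_mesh2 p (msh E j)" and sch: "\<And>j. j < N \<Longrightarrow> scheme2 p E j" and mot: "\<And>j. j < N \<Longrightarrow> mesh_motion p E j"
  using sol unfolding solution2_def by blast+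
 have vm: "valid_mesh p (msh E j)" if "j \<le> N" for j using val[OF that] by (simp add: valid_mesh2_def)
 have "m \<le> N" "Suc m \<le> N" using m by simp_all
 note step_m = mesh_motion_step[OF ok mot[OF m] vm[OF this(1)] vm[OF this(2)], folded M_def wt_def w_def]
 note M' = step_m(2)
 interpret mesh_step2 p M wt w
 proof (intro mesh_step2.intro mesh_step.intro face_area_2 step_m(1) mesh_step2_axioms.intro)
  show "nrm_s p = vector [0, 1] \<or> nrm_s p = - vector [0, 1]" using ev by auto
  show "card (contact_set M) = 2" using val[of m] m by (simp add: valid_mesh2_def M_def)
 qed
 note S = sch[OF m, unfolded scheme2_def Let_def, folded M_def wt_def]
 note eqs = S[THEN conjunct2, THEN conjunct2, THEN conjunct2, THEN conjunct2, THEN conjunct2]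
 note eq_a = eqs[THEN conjunct1, rule_format] and eq_b = eqs[THEN conjunct2, THEN conjunct1, rule_format]
  and eq_c = eqs[THEN conjunct2, THEN conjunct2, rule_format]
 have u: "vel E (Suc m) \<in> velocity_space M" and pr: "pres E (Suc m) \<in> pressure_space M"
  and ka: "kappa_s E (Suc m) \<in> S2 (solid_faces M)" and H: "curv E (Suc m) \<in> S1 (free_faces M)" and wS: "wt \<in> S1v (free_faces M)"
  using S by blast+
 have uj: "vel E (Suc j) \<in> velocity_space (msh E j)" if "j \<le> m" for j
  using sch[of j] that m unfolding scheme2_def Let_def by simp
 have vj: "valid_mesh p (msh E j)" if "j \<le> m" for j using vm[of j] that m by simp
 have mj: "mesh_motion p E j" if "j < m" for j using mot[of j] that m by simp
 note old = previous_level[OF init vj uj mj]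
 define C1 where "C1 = (\<Sum>P\<in>contact_set M. (phi_c E (Suc m) P *\<^sub>R nrm_s p) \<bullet> wt P)"
 define C2 where "C2 = (\<Sum>P\<in>contact_set M.
        (cos (theta_Y p) *\<^sub>R mu2 M P - (Web p * beta_c p * (wt P \<bullet> mu2 M P)) *\<^sub>R mu2 M P
        + sin (theta2 p E m P) *\<^sub>R nrm_s p) \<bullet> wt P)"
 have cp: "wt P \<bullet> nrm_s p = 0" if "P \<in> contact_set M" for P
  using that contact_point(2) unfolding contact_set_def free_surface_def solid_surface_def by blast
 have C1: "C1 = 0" unfolding C1_def by (intro sum.neutral ballI) (simp add: inner_commute[of "nrm_s p"] cp)
 have C2: "C2 = cos (theta_Y p) * (\<Sum>P\<in>contact_set M. mu2 M P \<bullet> wt P) - Web p * beta_c p * contact_norm_sq2 M wt"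
  unfolding C2_def contact_norm_sq2_def sum_distrib_left sum_subtractf[symmetric]
  by (rule sum.cong[OF refl])
   (simp add: inner_add_left inner_diff_left inner_commute[of "nrm_s p"] inner_commute[of "mu2 M _"] cp power2_eq_square mult.assoc)
 have mom: "momentum_lhs p E m (vel E (Suc m)) q ls = momentum_rhs p E m (vel E (Suc m))"
  if "q \<in> pressure_space M" "ls \<in> S2 (solid_faces M)" for q ls
  using eq_a[OF u that, of "\<lambda>_. 0"] by simp
 have "- lump 1 (free_faces M) (\<lambda>\<sigma> x. (curv E (Suc m) x *\<^sub>R nhat2 p M wt \<sigma> (1/2) x) \<bullet> wt x)
  = - 1 / Web p * surface_stiffness p M wt wt + 1 / Web p * C1 + 1 / Web p * C2
   - grav p * surf_int 1 (free_faces M) (\<lambda>\<sigma> x. gravity_vec p wt (nhat2 p M wt \<sigma>) x \<bullet> wt x)"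
  unfolding C1_def C2_def by (rule eq_b[OF wS])
 moreover have "nhat2 p M wt \<sigma> = (\<lambda>\<theta> x. nhat \<sigma> \<theta> x)" for \<sigma> by (simp add: fun_eq_iff nhat2_cof)
 ultimately have curvature: "- lump 1 (free_faces M) (\<lambda>\<sigma> x. (curv E (Suc m) x *\<^sub>R nhat2 p M wt \<sigma> (1/2) x) \<bullet> wt x)
  = - 1 / Web p * surface_stiffness p M wt wt + 1 / Web p * (C1 + C2)
   - grav p * surf_int 1 (free_faces M) (\<lambda>\<sigma> x. gravity_vec p wt (nhat \<sigma>) x \<bullet> wt x)"
  by (simp add: distrib_left add_divide_distrib)
 have kin: "lump 1 (free_faces M) (\<lambda>\<sigma> x. (wt x \<bullet> nhat2 p M wt \<sigma> (1/2) x) * \<phi>F x)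
   = surf_int 1 (free_faces M) (\<lambda>\<sigma> x. (vel E (Suc m) x \<bullet> face_nrm M \<sigma>) * \<phi>F x)" if "\<phi>F \<in> S1 (free_faces M)" for \<phi>F
  by (rule eq_c[OF that])
 have contact: "tau p * (C1 + C2) = cos (theta_Y p) *
    (measure (hausdorff 1) (solid_surface M') - measure (hausdorff 1) (solid_surface M))
   - Web p * (tau p * beta_c p * contact_norm_sq2 M wt)"
  unfolding C1 C2 solid_length_growth by (simp add: algebra_simps)
 note step = energy_step[OF M_def[symmetric] M' u pr ka H mom old nhat2_mean curvature kin contact]
 show "mesh_volume (msh E (Suc m)) = mesh_volume (msh E m)" using step(1) unfolding M' M_def .
 show "energy p E (Suc m) - energy p E m
   \<le> - bulk_dissipation p E m - tau p * beta_c p * contact_norm_sq2 (msh E m) (free_vel E (Suc m))"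
  using step(2) unfolding M_def wt_def .
qed

theorem energy_law_3:
 assumes sol: "solution3 p v0 E N" and m: "m < N"
 shows "mesh_volume (msh E (Suc m)) = mesh_volume (msh E m)"
  and "energy p E (Suc m) - energy p E m
   \<le> - bulk_dissipation p E m - tau p * beta_c p * contact_norm_sq3 p (msh E m) (free_vel E (Suc m))"
proof -
 define M where "M = msh E m"
 define wt where "wt = free_vel E (Suc m)"
 define w where "w = bulk_vel E (Suc m)"
 let ?u = "vel E (Suc m)" and ?CE = "contact_edges (msh E m)"
 have ok: "params_ok p" and init: "initial_ok v0 E"
  and val: "\<And>j. j \<le> N \<Longrightarrow> valid_mesh3 p (msh E j)" and sch: "\<And>j. j < N \<Longrightarrow> scheme3 p E j" and mot: "\<And>j. j < N \<Longrightarrow> mesh_motion p E j"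
  using sol unfolding solution3_def by blast+
 have vm: "valid_mesh p (msh E j)" if "j \<le> N" for j using val[OF that] by (simp add: valid_mesh3_def)
 have "m \<le> N" "Suc m \<le> N" using m by simp_all
 note step_m = mesh_motion_step[OF ok mot[OF m] vm[OF this(1)] vm[OF this(2)], folded M_def wt_def w_def]
 note M' = step_m(2)
 interpret mesh_step3 p M wt w
 proof (intro mesh_step3.intro mesh_step.intro face_area_3 step_m(1) mesh_step3_axioms.intro)
  have "valid_mesh3 p M" unfolding M_def using val m by simp
  then have "\<forall>e\<in>contact_edges M. \<exists>!\<rho>. \<rho> \<in> solid_faces M \<and> e facet_of \<rho>"
   unfolding valid_mesh3_def by (elim conjE) assumption
  then show "\<exists>!\<rho>. \<rho> \<in> solid_faces M \<and> e facet_of \<rho>" if "e \<in> contact_edges M" for e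
   using that by (rule bspec)
 qed
 note S = sch[OF m, unfolded scheme3_def Let_def, folded M_def wt_def]
 note eqs = S[THEN conjunct2, THEN conjunct2, THEN conjunct2, THEN conjunct2, THEN conjunct2, THEN conjunct2, THEN conjunct2]
 note eq_a = eqs[THEN conjunct1, rule_format] and eq_b = eqs[THEN conjunct2, THEN conjunct1, rule_format]
  and eq_c = eqs[THEN conjunct2, THEN conjunct2, rule_format]
 have u: "?u \<in> velocity_space M" and pr: "pres E (Suc m) \<in> pressure_space M"
  and ka: "kappa_s E (Suc m) \<in> S2 (solid_faces M)" and H: "curv E (Suc m) \<in> S1 (free_faces M)" and wS: "wt \<in> S1v (free_faces M)"
  and psi: "psi_c E (Suc m) \<in> S1 (contact_edges M)"
  using S by blast+
 have uj: "vel E (Suc j) \<in> velocity_space (msh E j)" if "j \<le> m" for j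
  using sch[of j] that m unfolding scheme3_def Let_def by simp
 have vj: "valid_mesh p (msh E j)" if "j \<le> m" for j using vm[of j] that m by simp
 have mj: "mesh_motion p E j" if "j < m" for j using mot[of j] that m by simp
 note old = previous_level[OF init vj uj mj]
 define C1 where "C1 = lump 1 (contact_edges M) (\<lambda>e x. (phi_c E (Suc m) x *\<^sub>R nrm_s p) \<bullet> wt x)"
 define C2 where "C2 = surf_int 1 (contact_edges M) (\<lambda>e x.
        (cos (theta_Y p) *\<^sub>R mu3_half p M wt e x
        - (Web p * beta_c p * (wt x \<bullet> mu3 p M e)) *\<^sub>R mu3 p M e
        + sin (theta3 p E m e) *\<^sub>R nrm_s p) \<bullet> wt x)"
 define C3 where "C3 = lump 1 (contact_edges M) (\<lambda>e x. (psi_c E (Suc m) x *\<^sub>R tangent3 p M e) \<bullet> wt x)"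
 have cp: "wt P \<bullet> nrm_s p = 0" if e: "e \<in> contact_edges M" and P: "P \<in> verts e" for e P
 proof -
  obtain \<sigma> \<rho> where \<sigma>: "\<sigma> \<in> free_faces M" "e facet_of \<sigma>" and \<rho>: "\<rho> \<in> solid_faces M" "e facet_of \<rho>"
   using e unfolding contact_edges_def by blast
  have "P \<in> e" using P unfolding verts_def extreme_point_of_def by blast
  then have "P \<in> \<sigma>" "P \<in> \<rho>" using facet_of_imp_subset \<sigma>(2) \<rho>(2) by blast+
  then show ?thesis using contact_point(2) \<sigma>(1) \<rho>(1) by blast
 qed
 have C1: "C1 = 0" unfolding C1_def lump_def
  by (intro sum.neutral ballI mult_zero_right[THEN trans[rotated]] arg_cong[where f="\<lambda>y. _ * y"])
   (simp add: inner_commute[of "nrm_s p"] cp)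
 have z: "(\<lambda>x. 0) \<in> S1 (contact_edges M)" by (simp add: S1_def P1_on_const)
 have z0: "lump 1 (contact_edges M) (\<lambda>e x. wt x \<bullet> (0 *\<^sub>R f e x)) = 0" for f by (simp add: lump_def)
 have mom: "momentum_lhs p E m ?u q ls + 1 / Web p * lump 1 (contact_edges M) (\<lambda>e x. wt x \<bullet> (xc x *\<^sub>R tangent3 p M e))
   = momentum_rhs p E m ?u"
  if "q \<in> pressure_space M" "ls \<in> S2 (solid_faces M)" "xc \<in> S1 (contact_edges M)" for q ls xc
 proof -
  show ?thesis using eq_a[OF u that(1,2) z that(3)] unfolding z0 by simp
 qed
 have mom0: "momentum_lhs p E m ?u q ls = momentum_rhs p E m ?u" if "q \<in> pressure_space M" "ls \<in> S2 (solid_faces M)" for q ls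
  using mom[OF that z] unfolding z0 by simp
 have C3: "C3 = 0"
 proof -
  have "1 / Web p * lump 1 (contact_edges M) (\<lambda>e x. wt x \<bullet> (psi_c E (Suc m) x *\<^sub>R tangent3 p M e)) = 0"
   using mom[OF pr ka psi] mom0[OF pr ka] by simp
  then have "lump 1 (contact_edges M) (\<lambda>e x. wt x \<bullet> (psi_c E (Suc m) x *\<^sub>R tangent3 p M e)) = 0" using We_pos by simp
  then show ?thesis unfolding C3_def by (simp only: inner_commute)
 qed
 have "- lump 2 (free_faces M) (\<lambda>\<sigma> x. (curv E (Suc m) x *\<^sub>R ntilde3 p M wt \<sigma> x) \<bullet> wt x)
  = - 1 / Web p * surface_stiffness p M wt wt + 1 / Web p * C1 + 1 / Web p * C2 + 1 / Web p * C3
   - grav p * surf_int 2 (free_faces M) (\<lambda>\<sigma> x. gravity_vec p wt (nhat3 p M wt \<sigma>) x \<bullet> wt x)"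
  unfolding C1_def C2_def C3_def by (rule eq_b[OF wS])
 moreover have "nhat3 p M wt \<sigma> = (\<lambda>\<theta> x. nhat \<sigma> \<theta> x)" for \<sigma> by (simp add: fun_eq_iff nhat3_cof)
 ultimately have curvature: "- lump 2 (free_faces M) (\<lambda>\<sigma> x. (curv E (Suc m) x *\<^sub>R ntilde3 p M wt \<sigma> x) \<bullet> wt x)
  = - 1 / Web p * surface_stiffness p M wt wt + 1 / Web p * C2
   - grav p * surf_int 2 (free_faces M) (\<lambda>\<sigma> x. gravity_vec p wt (nhat \<sigma>) x \<bullet> wt x)"
  by (simp add: C1 C3)
 have kin: "lump 2 (free_faces M) (\<lambda>\<sigma> x. (wt x \<bullet> ntilde3 p M wt \<sigma> x) * \<phi>F x)
   = surf_int 2 (free_faces M) (\<lambda>\<sigma> x. (?u x \<bullet> face_nrm M \<sigma>) * \<phi>F x)" if "\<phi>F \<in> S1 (free_faces M)" for \<phi>F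
  by (rule eq_c[OF that])
 have contact: "tau p * C2 = cos (theta_Y p) *
    (measure (hausdorff 2) (solid_surface M') - measure (hausdorff 2) (solid_surface M))
   - Web p * (tau p * beta_c p * contact_norm_sq3 p M wt)"
  unfolding C2_def contact_line_growth by (simp add: algebra_simps)
 note step = energy_step[OF M_def[symmetric] M' u pr ka H mom0 old ntilde3_mean curvature kin contact]
 show "mesh_volume (msh E (Suc m)) = mesh_volume (msh E m)" using step(1) unfolding M' M_def .
 show "energy p E (Suc m) - energy p E m
   \<le> - bulk_dissipation p E m - tau p * beta_c p * contact_norm_sq3 p (msh E m) (free_vel E (Suc m))"
  using step(2) unfolding M_def wt_def .
qed

theorem theorem4p1:
 fixes p2 :: "(real^2) params" and v2 :: "real^2 \<Rightarrow> real^2" and E2 :: "(real^2) evolution"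
  and p3 :: "(real^3) params" and v3 :: "real^3 \<Rightarrow> real^3" and E3 :: "(real^3) evolution3"
  and N :: nat
 shows
  "(solution2 p2 v2 E2 N \<longrightarrow>
    (\<forall>m<N.
      mesh_volume (msh E2 (Suc m)) = mesh_volume (msh E2 m) \<and>
      energy p2 E2 (Suc m) - energy p2 E2 m
       \<le> - bulk_dissipation p2 E2 m
        - tau p2 * beta_c p2 * contact_norm_sq2 (msh E2 m) (free_vel E2 (Suc m)) \<and>
      - bulk_dissipation p2 E2 m
       - tau p2 * beta_c p2 * contact_norm_sq2 (msh E2 m) (free_vel E2 (Suc m)) \<le> 0)) \<and>
   (solution3 p3 v3 E3 N \<longrightarrow>
    (\<forall>m<N.
      mesh_volume (msh E3 (Suc m)) = mesh_volume (msh E3 m) \<and>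
      energy p3 E3 (Suc m) - energy p3 E3 m
       \<le> - bulk_dissipation p3 E3 m
        - tau p3 * beta_c p3 * contact_norm_sq3 p3 (msh E3 m) (free_vel E3 (Suc m)) \<and>
      - bulk_dissipation p3 E3 m
       - tau p3 * beta_c p3 * contact_norm_sq3 p3 (msh E3 m) (free_vel E3 (Suc m)) \<le> 0))"
proof (intro conjI impI allI)
 fix m assume sol: "solution2 p2 v2 E2 N" and m: "m < N"
 have ok: "params_ok p2" using sol by (simp add: solution2_def)
 show "mesh_volume (msh E2 (Suc m)) = mesh_volume (msh E2 m)"
  and "energy p2 E2 (Suc m) - energy p2 E2 m \<le> - bulk_dissipation p2 E2 m
   - tau p2 * beta_c p2 * contact_norm_sq2 (msh E2 m) (free_vel E2 (Suc m))"
  by (rule energy_law_2[OF sol m])+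
 have "0 \<le> contact_norm_sq2 M wt" for M wt unfolding contact_norm_sq2_def by (intro sum_nonneg) simp
 then have "0 \<le> tau p2 * beta_c p2 * contact_norm_sq2 (msh E2 m) (free_vel E2 (Suc m))"
  using ok unfolding params_ok_def by simp
 then show "- bulk_dissipation p2 E2 m - tau p2 * beta_c p2 * contact_norm_sq2 (msh E2 m) (free_vel E2 (Suc m)) \<le> 0"
  using bulk_dissipation_nonneg[OF ok, of E2 m] by linarith
next
 fix m assume sol: "solution3 p3 v3 E3 N" and m: "m < N"
 have ok: "params_ok p3" using sol by (simp add: solution3_def)
 show "mesh_volume (msh E3 (Suc m)) = mesh_volume (msh E3 m)"
  and "energy p3 E3 (Suc m) - energy p3 E3 m \<le> - bulk_dissipation p3 E3 m
   - tau p3 * beta_c p3 * contact_norm_sq3 p3 (msh E3 m) (free_vel E3 (Suc m))"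
  by (rule energy_law_3[OF sol m])+
 have "0 \<le> contact_norm_sq3 p M wt" for p M wt
  unfolding contact_norm_sq3_def surf_int_def by (intro sum_nonneg set_integral_nonneg_on) simp
 then have "0 \<le> tau p3 * beta_c p3 * contact_norm_sq3 p3 (msh E3 m) (free_vel E3 (Suc m))"
  using ok unfolding params_ok_def by simp
 then show "- bulk_dissipation p3 E3 m - tau p3 * beta_c p3 * contact_norm_sq3 p3 (msh E3 m) (free_vel E3 (Suc m)) \<le> 0"
  using bulk_dissipation_nonneg[OF ok, of E3 m] by linarith
qed

end
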